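(* Let $\Omega\subset\mathbb C^n$ be a bounded domain and $\Gamma$ a discontinuous, fixed point free subgroup of $\mathrm{Iso}(\Omega)$ such that $X=\Omega/\Gamma$ is compact, with universal covering mapping $\pi:\Omega\to X$. Let $\rho$ be the distance function of the Bergman metric $\omega=i\partial\overline\partial\log K_\Omega$. If for every fixed $x\in\Omega$ the function $\log\rho(x,\cdot)$ is plurisubharmonic on $\Omega$, then $$\varepsilon(K_X,\pi(x))\ge\frac{\rho_x^2}{2}\qquad\text{for all } x\in\Omega,$$ where $\rho_x:=\frac12\inf_{\gamma\in\Gamma\setminus\{1\}}\rho(x,\gamma x)$.
   Context: $\mathrm{Iso}(\Omega)$ is the group of biholomorphic mappings of $\Omega$ onto itself. $\Gamma$ is discontinuous if every orbit $\{\gamma(a):\gamma\in\Gamma\}$, $a\in\Omega$, is a discrete sequence in $\Omega$; it is fixed point free if $\gamma z=z$ for some $z\in\Omega$ implies $\gamma=1$. $K_\Omega(z,z)$ is the Bergman kernel of $\Omega$ on the diagonal. The distance $\rho$ associated to $\omega$ is that of the Riemannian metric $g$ with $g(u,v)=\omega(u,Jv)$ ($J$ the complex structure), so that $|d\rho|_\omega^2=2|\overline\partial\rho|^2_\omega\le1$ (for instance $\omega=i\,dz\wedge d\bar z$ corresponds to $g=2(dx^2+dy^2)$). Seshadri number: $K_X$ is the canonical line bundle (it is ample), with smooth Hermitian metric $h$, e.g. the one induced by the Bergman kernel, for which $\pi^*(i\Theta(K_X,h))=i\partial\overline\partial\log K_\Omega$. For $p\in X$ let $H(t,p)$ be the set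 of quasi-plurisubharmonic functions $\phi\in C(X\setminus\{p\})$ such that $\liminf_{z\to p}\frac{\phi(z)}{\log|z-p|^2}=t$ (in local coordinates) and $i\partial\overline\partial\phi+i\Theta(K_X,h)\ge0$ in the sense of currents. Then $\varepsilon(K_X,p)=\sup\{t>0:H(t,p)\ne\emptyset\}$. *)

theory Defs
  imports "HOL-Analysis.Analysis" "HOL-Algebra.Group_Action"
begin

section \<open>Several complex variables\<close>

fun Ck_on :: "nat \<Rightarrow> 'a::euclidean_space set \<Rightarrow> ('a \<Rightarrow> real) \<Rightarrow> bool" where
  "Ck_on 0 S f \<longleftrightarrow> continuous_on S f"
| "Ck_on (Suc k) S f \<longleftrightarrow>
     (\<forall>x\<in>S. f differentiable (at x)) \<and>
     (\<forall>b\<in>Basis. Ck_on k S (\<lambda>x. frechet_derivative f (at x) b))"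

text \<open>Meant for open sets \<open>S\<close>, like the other notions of this section.\<close>

definition smooth_on :: "'a::euclidean_space set \<Rightarrow> ('a \<Rightarrow> real) \<Rightarrow> bool" where
  "smooth_on S f \<longleftrightarrow> (\<forall>k. Ck_on k S f)"

definition holo_fun :: "(complex^'n) set \<Rightarrow> (complex^'n \<Rightarrow> complex) \<Rightarrow> bool" where
  "holo_fun S f \<longleftrightarrow>
     (\<forall>z\<in>S. \<exists>f'. (f has_derivative f') (at z) \<and> (\<forall>c v. f' (c *s v) = c * f' v))"

definition holo_map :: "(complex^'n) set \<Rightarrow> (complex^'n \<Rightarrow> complex^'m) \<Rightarrow> bool" where
  "holo_map S f \<longleftrightarrow> (\<forall>i. holo_fun S (\<lambda>z. f z $ i))"

definition complex_jacobian :: "(complex^'n \<Rightarrow> complex^'n) \<Rightarrow> complex^'n \<Rightarrow> complex" where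
  "complex_jacobian f z = det (\<chi> i j. frechet_derivative f (at z) (axis j 1) $ i)"

text \<open>The Wirtinger derivatives \<open>\<partial>/\<partial>z\<^sub>j\<close> and \<open>\<partial>/\<partial>\<close> of the conjugate of \<open>z\<^sub>j\<close>.\<close>

definition wirt :: "'n \<Rightarrow> (complex^'n \<Rightarrow> complex) \<Rightarrow> complex^'n \<Rightarrow> complex" where
  "wirt j f z =
     (frechet_derivative f (at z) (axis j 1) - \<i> * frechet_derivative f (at z) (axis j \<i>)) / 2"

definition wirt_bar :: "'n \<Rightarrow> (complex^'n \<Rightarrow> complex) \<Rightarrow> complex^'n \<Rightarrow> complex" where
  "wirt_bar j f z =
     (frechet_derivative f (at z) (axis j 1) + \<i> * frechet_derivative f (at z) (axis j \<i>)) / 2"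

text \<open>The \<open>(1,1)\<close>-form \<open>i \<partial>\<close>-\<open>\<partial>\<close>-bar \<open>f\<close> evaluated on a pair of real tangent vectors, with the
  convention \<open>(\<alpha> \<and> \<beta>)(u,v) = \<alpha> u * \<beta> v - \<alpha> v * \<beta> u\<close>. The complex structure \<open>J\<close> is
  multiplication by \<open>\<i>\<close>.\<close>

definition i_ddbar ::
    "(complex^'n \<Rightarrow> real) \<Rightarrow> complex^'n \<Rightarrow> complex^'n \<Rightarrow> complex^'n \<Rightarrow> real" where
  "i_ddbar f z u v =
     Re (\<i> * (\<Sum>j\<in>UNIV. \<Sum>k\<in>UNIV. wirt j (wirt_bar k (\<lambda>w. complex_of_real (f w))) z
                 * (u $ j * cnj (v $ k) - v $ j * cnj (u $ k))))"

text \<open>The logarithm of a nonnegative number with \<open>log 0 = -\<infinity>\<close> (HOL's \<open>ln 0\<close> is \<open>0\<close>).\<close>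

definition log0 :: "real \<Rightarrow> ereal" where
  "log0 r = (if r \<le> 0 then -\<infinity> else ereal (ln r))"

text \<open>Integral over \<open>[0,2\<pi>]\<close> of a function bounded above, possibly equal to \<open>-\<infinity>\<close>;
  \<^const>\<open>e2ennreal\<close> sends negative numbers to \<open>0\<close>, so the two integrals are those of the
  positive and of the negative part.\<close>

definition circle_mean :: "(real \<Rightarrow> ereal) \<Rightarrow> ereal" where
  "circle_mean f =
     (enn2ereal (\<integral>\<^sup>+\<theta>\<in>{0..2*pi}. e2ennreal (f \<theta>) \<partial>lborel)
      - enn2ereal (\<integral>\<^sup>+\<theta>\<in>{0..2*pi}. e2ennreal (- f \<theta>) \<partial>lborel)) / ereal (2*pi)"

definition psh_on :: "(complex^'n) set \<Rightarrow> (complex^'n \<Rightarrow> ereal) \<Rightarrow> bool" where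
  "psh_on S u \<longleftrightarrow>
     (\<forall>z\<in>S. u z \<noteq> \<infinity>) \<and>
     (\<forall>c. openin (top_of_set S) {z\<in>S. u z < c}) \<and>
     (\<forall>a\<in>S. \<forall>b. (\<forall>\<zeta>. cmod \<zeta> \<le> 1 \<longrightarrow> a + \<zeta> *s b \<in> S) \<longrightarrow>
        u a \<le> circle_mean (\<lambda>\<theta>. u (a + cis \<theta> *s b)))"

definition quasi_psh_on :: "(complex^'n) set \<Rightarrow> (complex^'n \<Rightarrow> ereal) \<Rightarrow> bool" where
  "quasi_psh_on S u \<longleftrightarrow>
     (\<forall>a\<in>S. \<exists>V v f. open V \<and> a \<in> V \<and> V \<subseteq> S \<and> psh_on V v \<and> smooth_on V f \<and>
        (\<forall>z\<in>V. u z = v z + ereal (f z)))"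

definition test_fun :: "(complex^'n) set \<Rightarrow> (complex^'n \<Rightarrow> real) \<Rightarrow> bool" where
  "test_fun S \<eta> \<longleftrightarrow> smooth_on UNIV \<eta> \<and> (\<exists>C. compact C \<and> C \<subseteq> S \<and> (\<forall>z. z \<notin> C \<longrightarrow> \<eta> z = 0))"

text \<open>Positivity on \<open>S\<close> of the \<open>(1,1)\<close>-current \<open>i \<partial>\<close>-\<open>\<partial>\<close>-bar \<open>u + \<theta>\<close>, where \<open>u\<close> is locally
  integrable and \<open>\<theta>\<close> is a smooth form: a \<open>(1,1)\<close>-current \<open>T\<close> is positive iff for every constant
  vector \<open>v\<close> the distribution \<open>T(v,Jv)\<close> is nonnegative on nonnegative test functions.\<close>

definition i_ddbar_plus_form_nonneg ::
    "(complex^'n) set \<Rightarrow> (complex^'n \<Rightarrow> ereal)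
      \<Rightarrow> (complex^'n \<Rightarrow> complex^'n \<Rightarrow> complex^'n \<Rightarrow> real) \<Rightarrow> bool" where
  "i_ddbar_plus_form_nonneg S u \<theta> \<longleftrightarrow>
     (\<forall>\<eta> v. test_fun S \<eta> \<longrightarrow> (\<forall>z. 0 \<le> \<eta> z) \<longrightarrow>
        0 \<le> (LINT z:S|lborel. real_of_ereal (u z) * i_ddbar \<eta> z v (\<i> *s v))
          + (LINT z:S|lborel. \<eta> z * \<theta> z v (\<i> *s v)))"

section \<open>Bergman kernel, metric and distance\<close>

definition bergman_space :: "(complex^'n) set \<Rightarrow> (complex^'n \<Rightarrow> complex) set" where
  "bergman_space \<Omega> =
     {f \<in> extensional \<Omega>. holo_fun \<Omega> f \<and> set_integrable lborel \<Omega> (\<lambda>z. (cmod (f z))\<^sup>2)}"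

definition bergman_kernel :: "(complex^'n) set \<Rightarrow> complex^'n \<Rightarrow> complex^'n \<Rightarrow> complex" where
  "bergman_kernel \<Omega> z w =
     (THE k. k \<in> bergman_space \<Omega> \<and>
        (\<forall>f\<in>bergman_space \<Omega>. f w = (LINT \<zeta>:\<Omega>|lborel. f \<zeta> * cnj (k \<zeta>)))) z"

definition bergman_form ::
    "(complex^'n) set \<Rightarrow> complex^'n \<Rightarrow> complex^'n \<Rightarrow> complex^'n \<Rightarrow> real" where
  "bergman_form \<Omega> = i_ddbar (\<lambda>z. ln (Re (bergman_kernel \<Omega> z z)))"

definition bergman_riemannian ::
    "(complex^'n) set \<Rightarrow> complex^'n \<Rightarrow> complex^'n \<Rightarrow> complex^'n \<Rightarrow> real" where
  "bergman_riemannian \<Omega> z u v = bergman_form \<Omega> z u (\<i> *s v)"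

definition bergman_speed ::
    "(complex^'n) set \<Rightarrow> (real \<Rightarrow> complex^'n) \<Rightarrow> real \<Rightarrow> real" where
  "bergman_speed \<Omega> \<gamma> t =
     sqrt (bergman_riemannian \<Omega> (\<gamma> t) (vector_derivative \<gamma> (at t)) (vector_derivative \<gamma> (at t)))"

text \<open>A \<^const>\<open>valid_path\<close> may have an unbounded derivative near its break points, and then
  its length can be infinite; the HOL integral would be \<open>0\<close>. Hence the integrability condition.\<close>

definition bergman_dist :: "(complex^'n) set \<Rightarrow> complex^'n \<Rightarrow> complex^'n \<Rightarrow> real" where
  "bergman_dist \<Omega> x y =
     Inf {integral {0..1} (bergman_speed \<Omega> \<gamma>) | \<gamma>.
            valid_path \<gamma> \<and> path_image \<gamma> \<subseteq> \<Omega> \<and> pathstart \<gamma> = x \<and> pathfinish \<gamma> = y \<and>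
            bergman_speed \<Omega> \<gamma> integrable_on {0..1}}"

section \<open>Quotients by discontinuous groups\<close>

definition Iso :: "(complex^'n) set \<Rightarrow> (complex^'n \<Rightarrow> complex^'n) monoid" where
  "Iso \<Omega> = BijGroup \<Omega> \<lparr>carrier := {f \<in> Bij \<Omega>. holo_map \<Omega> f \<and> holo_map \<Omega> (inv_into \<Omega> f)}\<rparr>"

definition discontinuous :: "(complex^'n) set \<Rightarrow> (complex^'n \<Rightarrow> complex^'n) set \<Rightarrow> bool" where
  "discontinuous \<Omega> \<Gamma> \<longleftrightarrow> (\<forall>a\<in>\<Omega>. \<forall>b\<in>\<Omega>. \<not> b islimpt {\<gamma> a | \<gamma>. \<gamma> \<in> \<Gamma>})"

definition fixed_point_free :: "(complex^'n) set \<Rightarrow> (complex^'n \<Rightarrow> complex^'n) set \<Rightarrow> bool" where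
  "fixed_point_free \<Omega> \<Gamma> \<longleftrightarrow> (\<forall>\<gamma>\<in>\<Gamma>. (\<exists>z\<in>\<Omega>. \<gamma> z = z) \<longrightarrow> \<gamma> = \<one>\<^bsub>Iso \<Omega>\<^esub>)"

definition covering_proj ::
    "(complex^'n) set \<Rightarrow> (complex^'n \<Rightarrow> complex^'n) set \<Rightarrow> complex^'n \<Rightarrow> (complex^'n) set" where
  "covering_proj \<Omega> \<Gamma> z = orbit (Iso \<Omega> \<lparr>carrier := \<Gamma>\<rparr>) (\<lambda>\<gamma>. \<gamma>) z"

definition quotient_space :: "(complex^'n) set \<Rightarrow> (complex^'n \<Rightarrow> complex^'n) set \<Rightarrow> (complex^'n) set set" where
  "quotient_space \<Omega> \<Gamma> = orbits (Iso \<Omega> \<lparr>carrier := \<Gamma>\<rparr>) \<Omega> (\<lambda>\<gamma>. \<gamma>)"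

definition quot_topology ::
    "(complex^'n) set \<Rightarrow> (complex^'n \<Rightarrow> complex^'n) set \<Rightarrow> (complex^'n) set topology" where
  "quot_topology \<Omega> \<Gamma> =
     topology (\<lambda>U. U \<subseteq> quotient_space \<Omega> \<Gamma> \<and> openin (top_of_set \<Omega>) {z\<in>\<Omega>. covering_proj \<Omega> \<Gamma> z \<in> U})"

lemma openin_quot_topology:
  "openin (quot_topology \<Omega> \<Gamma>) U \<longleftrightarrow>
     U \<subseteq> quotient_space \<Omega> \<Gamma> \<and> openin (top_of_set \<Omega>) {z\<in>\<Omega>. covering_proj \<Omega> \<Gamma> z \<in> U}"
proof -
  let ?P = "\<lambda>U. U \<subseteq> quotient_space \<Omega> \<Gamma> \<and> openin (top_of_set \<Omega>) {z\<in>\<Omega>. covering_proj \<Omega> \<Gamma> z \<in> U}"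
  have "istopology ?P"
    unfolding istopology_def
  proof (intro conjI allI impI)
    fix A B assume "?P A" "?P B"
    moreover have "{z\<in>\<Omega>. covering_proj \<Omega> \<Gamma> z \<in> A \<inter> B}
        = {z\<in>\<Omega>. covering_proj \<Omega> \<Gamma> z \<in> A} \<inter> {z\<in>\<Omega>. covering_proj \<Omega> \<Gamma> z \<in> B}" by blast
    ultimately show "A \<inter> B \<subseteq> quotient_space \<Omega> \<Gamma>"
      "openin (top_of_set \<Omega>) {z\<in>\<Omega>. covering_proj \<Omega> \<Gamma> z \<in> A \<inter> B}"
      by (auto intro: openin_Int)
  next
    fix \<K> assume "\<forall>K\<in>\<K>. ?P K"
    moreover have "{z\<in>\<Omega>. covering_proj \<Omega> \<Gamma> z \<in> \<Union>\<K>} = (\<Union>K\<in>\<K>. {z\<in>\<Omega>. covering_proj \<Omega> \<Gamma> z \<in> K})" by blast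
    ultimately show "\<Union>\<K> \<subseteq> quotient_space \<Omega> \<Gamma>" "openin (top_of_set \<Omega>) {z\<in>\<Omega>. covering_proj \<Omega> \<Gamma> z \<in> \<Union>\<K>}"
      by auto
  qed
  then show ?thesis
    by (simp add: quot_topology_def)
qed

lemma quotient_map_covering_proj:
  "quotient_map (top_of_set \<Omega>) (quot_topology \<Omega> \<Gamma>) (covering_proj \<Omega> \<Gamma>)"
proof -
  have im: "covering_proj \<Omega> \<Gamma> ` \<Omega> = quotient_space \<Omega> \<Gamma>"
    by (auto simp: covering_proj_def quotient_space_def orbits_def)
  then have "{z\<in>\<Omega>. covering_proj \<Omega> \<Gamma> z \<in> quotient_space \<Omega> \<Gamma>} = \<Omega>" by blast
  then have "openin (quot_topology \<Omega> \<Gamma>) (quotient_space \<Omega> \<Gamma>)"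
    by (simp add: openin_quot_topology)
  then have "topspace (quot_topology \<Omega> \<Gamma>) = quotient_space \<Omega> \<Gamma>"
    by (meson openin_quot_topology openin_subset openin_topspace subset_antisym)
  with im show ?thesis
    by (simp add: quotient_map_def openin_quot_topology)
qed

text \<open>The infimum runs over a nonempty set as soon as the quotient is compact: otherwise
  \<open>\<Gamma> = {1}\<close> and \<open>\<Omega>\<close> would be compact.\<close>

definition half_displacement ::
    "(complex^'n) set \<Rightarrow> (complex^'n \<Rightarrow> complex^'n) set \<Rightarrow> complex^'n \<Rightarrow> real" where
  "half_displacement \<Omega> \<Gamma> x =
     (1/2) * (INF \<gamma>\<in>\<Gamma> - {\<one>\<^bsub>Iso \<Omega>\<^esub>}. bergman_dist \<Omega> x (\<gamma> x))"

section \<open>The canonical bundle of the quotient and its Seshadri numbers\<close>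

text \<open>The complex structure of the quotient \<open>X\<close> is the one for which the projection \<open>\<pi>\<close> is
  locally biholomorphic, so the local inverses of \<open>\<pi>\<close> are charts and local notions on \<open>X\<close> are
  tested on the pull-back to \<open>\<Omega>\<close>.

  The canonical bundle of \<open>X\<close> is the quotient of the bundle of \<open>(n,0)\<close>-forms on \<open>\<Omega>\<close>:
  \<open>canonical_pt \<Gamma> z c\<close> is the point over \<open>\<pi> z\<close> represented by the covector
  \<open>c dz\<^sub>1 \<and> \<dots> \<and> dz\<^sub>n\<close> at \<open>z\<close>, which is the pull-back under \<open>\<gamma>\<close> of
  \<open>(c / J\<^sub>\<gamma> z) dz\<^sub>1 \<and> \<dots> \<and> dz\<^sub>n\<close> at \<open>\<gamma> z\<close>.\<close>

definition canonical_pt ::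
    "(complex^'n \<Rightarrow> complex^'n) set \<Rightarrow> complex^'n \<Rightarrow> complex \<Rightarrow> ((complex^'n) \<times> complex) set" where
  "canonical_pt \<Gamma> z c = {(\<gamma> z, c / complex_jacobian \<gamma> z) | \<gamma>. \<gamma> \<in> \<Gamma>}"

text \<open>A Hermitian metric is given by its length function \<open>h\<close> on the total space; its weight
  with respect to the local frame \<open>dz\<^sub>1 \<and> \<dots> \<and> dz\<^sub>n\<close> is \<open>-log |dz\<^sub>1 \<and> \<dots> \<and> dz\<^sub>n|\<^sup>2\<close>. The
  metric induced by the Bergman kernel is \<open>|c dz\<^sub>1 \<and> \<dots> \<and> dz\<^sub>n|\<^sup>2 = |c|\<^sup>2 / K(z,z)\<close>, of
  weight \<open>log K(z,z)\<close>.\<close>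

definition metric_weight ::
    "(complex^'n \<Rightarrow> complex^'n) set \<Rightarrow> (((complex^'n) \<times> complex) set \<Rightarrow> real)
      \<Rightarrow> complex^'n \<Rightarrow> real" where
  "metric_weight \<Gamma> h z = - ln ((h (canonical_pt \<Gamma> z 1))\<^sup>2)"

definition smooth_hermitian_metric ::
    "(complex^'n) set \<Rightarrow> (complex^'n \<Rightarrow> complex^'n) set
      \<Rightarrow> (((complex^'n) \<times> complex) set \<Rightarrow> real) \<Rightarrow> bool" where
  "smooth_hermitian_metric \<Omega> \<Gamma> h \<longleftrightarrow>
     (\<forall>z\<in>\<Omega>. 0 < h (canonical_pt \<Gamma> z 1)) \<and>
     (\<forall>z\<in>\<Omega>. \<forall>c. h (canonical_pt \<Gamma> z c) = cmod c * h (canonical_pt \<Gamma> z 1)) \<and>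
     smooth_on \<Omega> (metric_weight \<Gamma> h)"

text \<open>The pull-back to \<open>\<Omega>\<close> of the curvature form \<open>i\<Theta>(K\<^sub>X,h)\<close>.\<close>

definition i_curvature ::
    "(complex^'n \<Rightarrow> complex^'n) set \<Rightarrow> (((complex^'n) \<times> complex) set \<Rightarrow> real)
      \<Rightarrow> complex^'n \<Rightarrow> complex^'n \<Rightarrow> complex^'n \<Rightarrow> real" where
  "i_curvature \<Gamma> h = i_ddbar (metric_weight \<Gamma> h)"

text \<open>Elements of \<open>p\<close> are the points of \<open>\<Omega>\<close> over \<open>p\<close>; the coordinates of \<open>\<Omega>\<close> near any of
  them serve as local coordinates at \<open>p\<close>.\<close>

definition seshadri_functions ::
    "(complex^'n) set \<Rightarrow> (complex^'n \<Rightarrow> complex^'n) set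
      \<Rightarrow> (((complex^'n) \<times> complex) set \<Rightarrow> real)
      \<Rightarrow> real \<Rightarrow> (complex^'n) set \<Rightarrow> ((complex^'n) set \<Rightarrow> ereal) set" where
  "seshadri_functions \<Omega> \<Gamma> h t p =
     {\<phi>. quasi_psh_on \<Omega> (\<lambda>z. \<phi> (covering_proj \<Omega> \<Gamma> z)) \<and>
         (\<forall>q\<in>quotient_space \<Omega> \<Gamma> - {p}. \<bar>\<phi> q\<bar> \<noteq> \<infinity>) \<and>
         continuous_map (subtopology (quot_topology \<Omega> \<Gamma>) (quotient_space \<Omega> \<Gamma> - {p})) euclidean \<phi> \<and>
         (\<forall>a\<in>p. Liminf (at a) (\<lambda>z. \<phi> (covering_proj \<Omega> \<Gamma> z) / ereal (ln ((norm (z - a))\<^sup>2))) = ereal t) \<and>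
         i_ddbar_plus_form_nonneg \<Omega> (\<lambda>z. \<phi> (covering_proj \<Omega> \<Gamma> z)) (i_curvature \<Gamma> h)}"

definition seshadri_number ::
    "(complex^'n) set \<Rightarrow> (complex^'n \<Rightarrow> complex^'n) set
      \<Rightarrow> (((complex^'n) \<times> complex) set \<Rightarrow> real) \<Rightarrow> (complex^'n) set \<Rightarrow> ereal" where
  "seshadri_number \<Omega> \<Gamma> h p = (SUP t\<in>{t. 0 < t \<and> seshadri_functions \<Omega> \<Gamma> h t p \<noteq> {}}. ereal t)"

end

theory Submission
  imports Defs "HOL-Complex_Analysis.Complex_Analysis" "HOL-Library.Numeral_Type"
begin

text \<open>
  Let \<open>d\<close> be the Bergman distance to the orbit of \<open>x\<close>. For \<open>R < \<rho>\<^sub>x\<close> the potential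
  \<open>(R\<^sup>2/2) \<chi>(d/R) + log K\<close> with \<open>\<chi>(b) = 2 log b + 1 - b\<^sup>2\<close> for \<open>b < 1\<close> and \<open>\<chi>(b) = 0\<close> otherwise is
  plurisubharmonic: \<open>\<chi>\<close> is increasing and log d is plurisubharmonic where \<open>\<chi>\<close> does not vanish, while the
  negative contribution of \<open>- d\<^sup>2\<close> is controlled by \<open>|\<partial>d|\<^sup>2 \<le> 1/2\<close>, that is, by the Bergman form itself.
  It has a logarithmic pole with coefficient \<open>R\<^sup>2/2\<close> at the orbit and differs from the weight of an
  arbitrary metric of the canonical bundle by a function which is invariant under the group.

  Since \<open>d\<close> is only Lipschitz, positivity of the current is derived from circle means
  \<open>\<integral> u(z + r e\<^sup>i\<^sup>\<theta> v) d\<theta> - 2 \<pi> u(z)\<close> tested against \<open>\<eta>\<close>, divided by \<open>r\<^sup>2\<close>; the quadratic term in the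
  increments of \<open>d\<close> is bounded by the energy inequality for Lipschitz functions, obtained by mollification.
\<close>

text \<open>The constant comes from balancing one loss against one gain. In s = log b the cut-off is
  2s + 1 - exp(2s), with first derivative 2(1 - b^2), which vanishes at b = 1, and second derivative
  -4b^2. So the negative part of the Levi form of t cutlog(d/R) is at most 4t/R^2 times i del d
  wedge delbar d; with t = R^2/2 the factor is 2, and |del d|^2 <= 1/2 bounds this by the Bergman
  form with nothing to spare.

  The obstacle is to keep that constant when d has no derivatives. A Lipschitz bound for each
  increment along a circle loses a factor two, because the mean of (A cos \<theta> + B sin
  \<theta>)^2 is only half of A^2 + B^2. The factor returns after integration, when the energies in
  the directions v and iv are added. The second obstacle is the pole: the expansion of the logarithm
  is not uniform there, the error on a circle of radius r is merely O(r^2), and it disappears only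
  through dominated convergence.

  R stays strictly below the half displacement so that small circles about points with d < R remain
  where d is the distance to a single orbit point.\<close>

no_notation fps_nth (infixl \<open>$\<close> 75)

section \<open>Holomorphy with respect to a complex structure\<close>

abbreviation fd :: "('a::real_normed_vector => 'b::real_normed_vector) => 'a => 'a => 'b" where
 "fd f z \<equiv> frechet_derivative f (at z)"

text \<open>Cauchy estimates deliver remainders of second order, and such bounds survive pointwise
  limits; this is how differentiability of J-holomorphic limits is recovered.\<close>

lemma has_derivative_quadratic:
 fixes f :: "'a::euclidean_space => 'b::real_normed_vector"
 assumes A: "linear A" and d: "\<delta> > 0"
  and q: "!!h. norm h < \<delta> ==> norm (f (z + h) - f z - A h) <= C * (norm h)\<^sup>2"
 shows "(f has_derivative A) (at z)"
 unfolding has_derivative_at_alt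
proof (intro conjI allI impI)
 show "bounded_linear A" using A by (simp add: linear_conv_bounded_linear)
 fix e :: real assume e: "e > 0"
 define d where "d = min \<delta> (e / (\<bar>C\<bar> + 1))"
 have d0: "d > 0" using d e by (simp add: d_def)
 have "norm (f y - f z - A (y - z)) <= e * norm (y - z)" if y: "norm (y - z) < d" for y
 proof -
  have "norm (f (z + (y - z)) - f z - A (y - z)) <= C * (norm (y - z))\<^sup>2"
   using y by (intro q) (simp add: d_def)
  also have "... <= (\<bar>C\<bar> + 1) * (norm (y - z))\<^sup>2" by (intro mult_right_mono) auto
  also have "... = ((\<bar>C\<bar> + 1) * norm (y - z)) * norm (y - z)" by (simp add: power2_eq_square)
  also have "... <= e * norm (y - z)"
  proof (intro mult_right_mono)
   have "norm (y - z) <= e / (\<bar>C\<bar> + 1)" using y by (simp add: d_def)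
   then show "(\<bar>C\<bar> + 1) * norm (y - z) <= e" by (simp add: pos_le_divide_eq mult.commute)
  qed auto
  finally show ?thesis by simp
 qed
 then show "\<exists>d>0. \<forall>y. norm (y - z) < d \<longrightarrow> norm (f y - f z - A (y - z)) <= e * norm (y - z)"
  using d0 by blast
qed

text \<open>The complex structure is a parameter because the Bergman kernel K(z,w) is holomorphic in
  z and antiholomorphic in w: it becomes holomorphic for the product of multiplication by i and by
  -i. One theory then serves functions on the domain, their conjugates and the kernel.\<close>

definition jholo :: "('a::euclidean_space => 'a) => 'a set => ('a => complex) => bool" where
 "jholo J S f \<longleftrightarrow> (\<forall>z\<in>S. f differentiable (at z) \<and> (\<forall>v. fd f z (J v) = \<i> * fd f z v))"

lemma jholoI:
 assumes "!!z. z \<in> S ==> \<exists>A. (f has_derivative A) (at z) \<and> (\<forall>v. A (J v) = \<i> * A v)"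
 shows "jholo J S f"
 unfolding jholo_def
proof
 fix z assume "z \<in> S"
 then obtain A where A: "(f has_derivative A) (at z)" "\<forall>v. A (J v) = \<i> * A v" using assms by blast
 then have "A = fd f z" by (rule_tac frechet_derivative_at)
 then show "f differentiable (at z) \<and> (\<forall>v. fd f z (J v) = \<i> * fd f z v)"
  using A by (auto simp: differentiable_def)
qed

lemma jholo_has_derivative: "jholo J S f ==> z \<in> S ==> (f has_derivative fd f z) (at z)"
 by (simp add: jholo_def frechet_derivative_works)

lemma jholo_subset: "jholo J S f ==> T \<subseteq> S ==> jholo J T f"
 by (auto simp: jholo_def)

lemma jholo_continuous: "jholo J S f ==> continuous_on S f"
 by (meson continuous_at_imp_continuous_on differentiable_imp_continuous_within jholo_def)

lemma fd_scaleR: "f differentiable (at z) ==> fd f z (c *\<^sub>R v) = c *\<^sub>R fd f z v"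
 by (simp add: linear_cmul linear_frechet_derivative)

lemma fd_add: "f differentiable (at z) ==> fd f z (v + w) = fd f z v + fd f z w"
 by (simp add: linear_add linear_frechet_derivative)

lemma fd_minus: "f differentiable (at z) ==> fd f z (- v) = - fd f z v"
 by (simp add: linear_neg linear_frechet_derivative)

lemma fd_zero: "f differentiable (at z) ==> fd f z 0 = 0"
 by (simp add: linear_0 linear_frechet_derivative)

lemma fd_cong_open:
 assumes "open S" "z \<in> S" "!!w. w \<in> S ==> f w = g w"
 shows "fd f z = fd g z"
proof -
 have "(f has_derivative A) (at z) \<longleftrightarrow> (g has_derivative A) (at z)" for A
  using assms by (auto intro: has_derivative_transform_within_open)
 then show ?thesis unfolding frechet_derivative_def by simp
qed

locale complex_structure =
 fixes J :: "'a::euclidean_space => 'a"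
 assumes linJ: "linear J" and JJ: "J (J v) = - v" and normJ: "norm (J v) = norm v"
begin

text \<open>The J-complex line through \<open>z\<close> in the direction \<open>v\<close>,
  parametrised by the complex plane. It reduces the estimates to functions of one complex
  variable.\<close>

definition slice :: "'a => 'a => complex => 'a" where
 "slice z v \<zeta> = z + Re \<zeta> *\<^sub>R v + Im \<zeta> *\<^sub>R J v"

lemma slice_dist: "dist z (slice z v \<zeta>) <= 2 * norm \<zeta> * norm v"
proof -
 have "dist z (slice z v \<zeta>) = norm (Re \<zeta> *\<^sub>R v + Im \<zeta> *\<^sub>R J v)"
  by (metis (no_types, lifting) add.assoc add_diff_cancel_left' dist_norm dist_commute slice_def)
 also have "... <= \<bar>Re \<zeta>\<bar> * norm v + \<bar>Im \<zeta>\<bar> * norm v"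
  by (rule norm_triangle_le) (simp add: normJ)
 also have "... <= norm \<zeta> * norm v + norm \<zeta> * norm v"
  by (intro add_mono mult_right_mono abs_Re_le_cmod abs_Im_le_cmod norm_ge_zero)
 finally show ?thesis by (simp add: mult_ac)
qed

lemma slice_derivative:
 assumes f: "jholo J S f" and z: "slice z v \<zeta> \<in> S"
 shows "((%\<zeta>. f (slice z v \<zeta>)) has_field_derivative fd f (slice z v \<zeta>) v) (at \<zeta>)"
proof -
 let ?A = "fd f (slice z v \<zeta>)"
 have d: "f differentiable (at (slice z v \<zeta>))" and j: "!!v. ?A (J v) = \<i> * ?A v"
  using f z by (auto simp: jholo_def)
 have "(slice z v has_derivative (%h. Re h *\<^sub>R v + Im h *\<^sub>R J v)) (at \<zeta>)"
  unfolding slice_def by (auto intro!: derivative_eq_intros)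
 from has_derivative_compose[OF this jholo_has_derivative[OF f z]]
 have "((%\<zeta>. f (slice z v \<zeta>)) has_derivative (%h. ?A (Re h *\<^sub>R v + Im h *\<^sub>R J v))) (at \<zeta>)" .
 moreover have "?A (Re h *\<^sub>R v + Im h *\<^sub>R J v) = ?A v * h" for h
  by (simp add: fd_add[OF d] fd_scaleR[OF d] j scaleR_conv_of_real)
    (metis (no_types) complex_eq distrib_left mult.assoc mult.commute)
 ultimately show ?thesis by (simp add: has_field_derivative_def)
qed

lemma slice_holomorphic:
 assumes f: "jholo J (ball z r) f" and R: "2 * R * norm v <= r" and v: "v \<noteq> 0"
 shows "(%\<zeta>. f (slice z v \<zeta>)) holomorphic_on ball 0 R"
  and "!!\<zeta>. \<zeta> \<in> ball 0 R ==> slice z v \<zeta> \<in> ball z r"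
proof -
 show *: "slice z v \<zeta> \<in> ball z r" if "\<zeta> \<in> ball 0 R" for \<zeta>
 proof -
  have "2 * norm \<zeta> * norm v < 2 * R * norm v" using that v by simp
  then show ?thesis using slice_dist[of z v \<zeta>] R by simp
 qed
 show "(%\<zeta>. f (slice z v \<zeta>)) holomorphic_on ball 0 R"
  unfolding holomorphic_on_def
  using slice_derivative[OF f *] field_differentiable_def field_differentiable_at_within by blast
qed

lemma slice_0 [simp]: "slice z v 0 = z" and slice_1 [simp]: "slice z v 1 = z + v"
 by (simp_all add: slice_def)

text \<open>Cauchy's inequality on a slice. By \<open>slice_dist\<close> the parameter disc of
  radius r/(2|v|) stays in the ball; half of that radius is used, so that the closed disc is inside,
  whence the factor 4.\<close>

lemma jholo_deriv_bound:
 assumes f: "jholo J (ball z r) f" and r: "r > 0" and M: "!!w. w \<in> ball z r ==> norm (f w) <= M"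
 shows "norm (fd f z v) <= 4 * M / r * norm v"
proof (cases "v = 0")
 case True
 have "f differentiable (at z)" using f r by (auto simp: jholo_def)
 then show ?thesis by (simp add: fd_zero True)
next
 case False
 define R where "R = r / (2 * norm v)"
 have R: "2 * R * norm v <= r" "R > 0" using False r by (auto simp: R_def)
 note h = slice_holomorphic[OF f R(1) False]
 have "norm ((deriv ^^ 1) (%\<zeta>. f (slice z v \<zeta>)) 0) <= fact 1 * M / (R/2) ^ 1"
 proof (rule Cauchy_inequality)
  show "(%\<zeta>. f (slice z v \<zeta>)) holomorphic_on ball 0 (R/2)"
   by (rule holomorphic_on_subset[OF h(1)]) (use R in auto)
  show "continuous_on (cball 0 (R/2)) (%\<zeta>. f (slice z v \<zeta>))"
   by (rule holomorphic_on_imp_continuous_on, rule holomorphic_on_subset[OF h(1)]) (use R in auto)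
  show "0 < R/2" using R by simp
  show "norm (f (slice z v x)) <= M" if "norm (0 - x) = R/2" for x
   by (rule M, rule h(2)) (use that R in auto)
 qed
 moreover have "((%\<zeta>. f (slice z v \<zeta>)) has_field_derivative fd f z v) (at 0)"
  using slice_derivative[OF f, of z v 0] r by simp
 then have "deriv (%\<zeta>. f (slice z v \<zeta>)) 0 = fd f z v" by (rule DERIV_imp_deriv)
 ultimately show ?thesis by (simp add: R_def field_simps)
qed

text \<open>The condition on \<open>v\<close> makes the slice live on a disc of radius R > 2, so
  discs of radius R/2 about points of the closed unit disc are still inside it. Cauchy's inequality
  there bounds the second derivative, and Taylor's formula is used at the parameter 1.\<close>

lemma jholo_taylor2:
 assumes f: "jholo J (ball z r) f" and r: "r > 0" and M: "!!w. w \<in> ball z r ==> norm (f w) <= M"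
  and v: "4 * norm v < r"
 shows "norm (f (z + v) - f z - fd f z v) <= 32 * M / r\<^sup>2 * (norm v)\<^sup>2"
proof (cases "v = 0")
 case True
 have "f differentiable (at z)" using f r by (auto simp: jholo_def)
 then show ?thesis by (simp add: fd_zero True)
next
 case False
 define R where "R = r / (2 * norm v)"
 have R: "2 * R * norm v <= r" "R > 2" using False r v by (auto simp: R_def field_simps)
 note h = slice_holomorphic[OF f R(1) False]
 define g where "g = (%\<zeta>. f (slice z v \<zeta>))"
 have g: "g holomorphic_on ball 0 R" using h(1) by (simp add: g_def)
 have sub: "cball x (R/2) \<subseteq> ball 0 R" if "x \<in> cball 0 1" for x :: complex
 proof
  fix y assume "y \<in> cball x (R/2)"
  then have "norm y <= norm x + R/2"
   by (metis dist_norm dist_commute add.commute add_left_mono diff_add_cancel mem_cball norm_triangle_ineq order_trans)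
  then show "y \<in> ball 0 R" using that R by simp
 qed
 have der: "((deriv ^^ i) g has_field_derivative (deriv ^^ Suc i) g x) (at x within cball 0 1)"
  if "x \<in> cball 0 1" for i x
 proof -
  have "(deriv ^^ i) g holomorphic_on ball 0 R" by (rule holomorphic_higher_deriv[OF g]) simp
  moreover have "x \<in> ball 0 R" using that R by auto
  ultimately have "((deriv ^^ i) g has_field_derivative deriv ((deriv ^^ i) g) x) (at x)"
   by (meson holomorphic_derivI open_ball)
  then show ?thesis by (simp add: has_field_derivative_at_within)
 qed
 have bd: "norm ((deriv ^^ 2) g x) <= fact 2 * M / (R/2) ^ 2" if x: "x \<in> cball 0 1" for x
 proof (rule Cauchy_inequality)
  show "g holomorphic_on ball x (R/2)"
   by (rule holomorphic_on_subset[OF g]) (use sub[OF x] ball_subset_cball in blast)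
  show "continuous_on (cball x (R/2)) g"
   by (rule holomorphic_on_imp_continuous_on, rule holomorphic_on_subset[OF g]) (use sub[OF x] in blast)
  show "0 < R/2" using R by simp
  show "norm (g y) <= M" if "norm (x - y) = R/2" for y
   unfolding g_def by (rule M, rule h(2)) (use sub[OF x] that in \<open>auto simp: dist_norm\<close>)
 qed
 have "norm ((deriv ^^ 0) g 1 - (\<Sum>i\<le>1. (deriv ^^ i) g 0 * (1 - 0) ^ i / fact i))
    <= (fact 2 * M / (R/2) ^ 2) * norm (1 - 0 :: complex) ^ Suc 1 / fact 1"
  by (rule complex_Taylor[where S = "cball 0 1" and f = "%i. (deriv ^^ i) g"])
    (use der bd in \<open>auto simp: numeral_2_eq_2\<close>)
 moreover have "(g has_field_derivative fd f z v) (at 0)"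
  using slice_derivative[OF f, of z v 0] r by (simp add: g_def)
 then have "deriv g 0 = fd f z v" by (rule DERIV_imp_deriv)
 ultimately have "norm (f (z + v) - (f z + fd f z v)) <= 2 * M / (R/2) ^ 2" by (simp add: g_def)
 also have "... = 32 * M / r\<^sup>2 * (norm v)\<^sup>2" by (simp add: R_def field_simps)
 finally show ?thesis by (simp add: algebra_simps)
qed

lemma jholo_Lipschitz:
 assumes f: "jholo J (ball z r) f" and r: "r > 0" and M: "!!w. w \<in> ball z r ==> norm (f w) <= M"
  and v: "4 * norm v < r"
 shows "norm (f (z + v) - f z) <= 12 * M / r * norm v"
proof -
 have M0: "0 <= M" using M[of z] r norm_ge_zero[of "f z"] by (smt (verit) centre_in_ball)
 have "norm (f (z + v) - f z) <= norm (f (z + v) - f z - fd f z v) + norm (fd f z v)"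
  by (metis diff_add_cancel norm_triangle_ineq)
 also have "... <= 32 * M / r\<^sup>2 * (norm v)\<^sup>2 + 4 * M / r * norm v"
  by (intro add_mono jholo_taylor2 jholo_deriv_bound) (use assms in auto)
 also have "32 * M / r\<^sup>2 * (norm v)\<^sup>2 = (8 * M / r\<^sup>2 * norm v) * (4 * norm v)"
  by (simp add: power2_eq_square)
 also have "... <= (8 * M / r\<^sup>2 * norm v) * r" by (intro mult_left_mono) (use v M0 in auto)
 also have "... = 8 * M / r * norm v" using r by (simp add: power2_eq_square)
 finally show ?thesis by (simp add: field_simps)
qed

text \<open>Weierstrass' theorem at the centre of a ball. The derivatives form Cauchy sequences by
  Cauchy's inequality applied to differences, and the second order remainder bound is uniform in
  \<open>n\<close>, hence holds for the limit.\<close>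

lemma jholo_limit:
 assumes r: "r > 0" and F: "!!n. jholo J (ball z r) (F n)"
  and M: "!!n w. w \<in> ball z r ==> norm (F n w) <= M"
  and C: "uniformly_Cauchy_on (ball z r) F"
  and lim: "!!w. w \<in> ball z r ==> (%n. F n w) \<longlonglongrightarrow> f w"
 shows "\<exists>A. (f has_derivative A) (at z) \<and> (\<forall>v. A (J v) = \<i> * A v)"
proof -
 have z: "z \<in> ball z r" using r by simp
 have dF: "F n differentiable (at z)" and jF: "fd (F n) z (J v) = \<i> * fd (F n) z v" for n v
  using F[of n] z by (auto simp: jholo_def)
 have "convergent (%n. fd (F n) z v)" for v
 proof (rule Cauchy_convergent, rule metric_CauchyI)
  fix e :: real assume e: "e > 0"
  define e' where "e' = e * r / (8 * (norm v + 1))"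
  have e': "e' > 0" using e r by (simp add: e'_def add_nonneg_pos)
  then obtain N where N: "!!m n x. m \<ge> N ==> n \<ge> N ==> x \<in> ball z r ==> dist (F m x) (F n x) < e'"
   using C unfolding uniformly_Cauchy_on_def by meson
  have "dist (fd (F m) z v) (fd (F n) z v) < e" if mn: "m \<ge> N" "n \<ge> N" for m n
  proof -
   have der: "((%w. F m w - F n w) has_derivative (%v. fd (F m) w v - fd (F n) w v)) (at w)"
    if "w \<in> ball z r" for w
    using jholo_has_derivative[OF F that] by (auto intro!: derivative_intros)
   have "jholo J (ball z r) (%w. F m w - F n w)"
   proof (rule jholoI)
    fix w assume w: "w \<in> ball z r"
    have "fd (F m) w (J v) - fd (F n) w (J v) = \<i> * (fd (F m) w v - fd (F n) w v)" for v
     using F w by (simp add: jholo_def right_diff_distrib)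
    then show "\<exists>A. ((%w. F m w - F n w) has_derivative A) (at w) \<and> (\<forall>v. A (J v) = \<i> * A v)"
     using der[OF w] by blast
   qed
   then have "norm (fd (%w. F m w - F n w) z v) <= 4 * e' / r * norm v"
    by (rule jholo_deriv_bound) (use r N mn in \<open>force simp: dist_norm intro: less_imp_le\<close>)+
   moreover have "fd (%w. F m w - F n w) z = (%v. fd (F m) z v - fd (F n) z v)"
    by (rule frechet_derivative_at[symmetric], rule der[OF z])
   ultimately have "dist (fd (F m) z v) (fd (F n) z v) <= 4 * e' / r * norm v"
    by (simp add: dist_norm)
   also have "... = e / 2 * (norm v / (norm v + 1))" using r by (simp add: e'_def divide_simps)
   also have "... <= e / 2 * 1" using e by (intro mult_left_mono) (auto simp: divide_le_eq_1 add_nonneg_pos)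
   also have "... < e" using e by simp
   finally show ?thesis .
  qed
  then show "\<exists>N. \<forall>m\<ge>N. \<forall>n\<ge>N. dist (fd (F m) z v) (fd (F n) z v) < e" by blast
 qed
 then obtain A where A: "!!v. (%n. fd (F n) z v) \<longlonglongrightarrow> A v"
  unfolding convergent_def by metis
 have "linear A"
 proof (rule linearI)
  fix v w :: 'a and c :: real
  show "A (v + w) = A v + A w"
   using tendsto_add[OF A[of v] A[of w]] A[of "v + w"] by (auto simp: fd_add[OF dF] intro: LIMSEQ_unique)
  show "A (c *\<^sub>R v) = c *\<^sub>R A v"
   using tendsto_scaleR[OF tendsto_const A[of v], of c] A[of "c *\<^sub>R v"]
   by (auto simp: fd_scaleR[OF dF] intro: LIMSEQ_unique)
 qed
 moreover have "A (J v) = \<i> * A v" for v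
  using tendsto_mult[OF tendsto_const A[of v], of \<i>] A[of "J v"] by (auto simp: jF intro: LIMSEQ_unique)
 moreover have "norm (f (z + v) - f z - A v) <= 32 * M / r\<^sup>2 * (norm v)\<^sup>2" if v: "norm v < r / 4" for v
 proof (rule LIMSEQ_le_const2)
  show "(%n. norm (F n (z + v) - F n z - fd (F n) z v)) \<longlonglongrightarrow> norm (f (z + v) - f z - A v)"
   by (intro tendsto_intros lim A) (use v r norm_ge_zero[of v] in \<open>simp_all add: dist_norm del: norm_ge_zero\<close>)
  show "\<exists>N. \<forall>n\<ge>N. norm (F n (z + v) - F n z - fd (F n) z v) <= 32 * M / r\<^sup>2 * (norm v)\<^sup>2"
   using jholo_taylor2[OF F r M] v by auto
 qed
 then have "(f has_derivative A) (at z)"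
  by (intro has_derivative_quadratic[OF \<open>linear A\<close>, where \<delta> = "r/4" and C = "32 * M / r\<^sup>2"]) (use r in auto)
 ultimately show ?thesis by blast
qed

lemma jholo_locally_bounded:
 assumes "open S" "jholo J S f" "z \<in> S"
 obtains r M where "r > 0" "ball z r \<subseteq> S" "!!w. w \<in> ball z r ==> norm (f w) <= M"
proof -
 obtain r where r: "r > 0" "cball z r \<subseteq> S" using assms open_contains_cball by blast
 have "compact (f ` cball z r)"
  by (intro compact_continuous_image continuous_on_subset[OF jholo_continuous[OF assms(2)]] r) auto
 then obtain M where "!!w. w \<in> cball z r ==> norm (f w) <= M"
  by (meson bounded_iff compact_imp_bounded imageI)
 then show ?thesis using that[of r M] r ball_subset_cball by force
qed

text \<open>Difference quotients in a fixed real direction are J-holomorphic and converge uniformly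
  on a smaller ball by the second order Taylor bound, so the limit theorem applies to them.\<close>

lemma jholo_fd:
 assumes S: "open S" and f: "jholo J S f"
 shows "jholo J S (%z. fd f z v)"
proof (rule jholoI)
 fix z assume "z \<in> S"
 then obtain r M where r: "r > 0" and rS: "ball z r \<subseteq> S" and M: "!!w. w \<in> ball z r ==> norm (f w) <= M"
  using jholo_locally_bounded[OF S f] by blast
 have M0: "0 <= M" using M[of z] r norm_ge_zero[of "f z"] by (smt (verit) centre_in_ball)
 have fr: "jholo J (ball z r) f" using f rS by (rule jholo_subset)
 \<comment> \<open>Steps so short that 16 times the displacement stays below \<open>r\<close>:
   translates of the half ball remain in the ball and the Taylor bound with radius r/2 is available.
   The added 1 admits \<open>v = 0\<close>.\<close>
 define t where "t n = r / (16 * (norm v + 1) * (real n + 1))" for n :: nat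
 have t0: "t n > 0" for n
  using r by (simp add: t_def add_nonneg_pos)
 have tv: "16 * norm (t n *\<^sub>R v) < r" for n
 proof -
  have "16 * norm (t n *\<^sub>R v) = r * (norm v / (norm v + 1)) * (1 / (real n + 1))"
   using t0[of n] r by (simp add: t_def add_nonneg_pos divide_simps)
  also have "... <= r * (norm v / (norm v + 1)) * 1"
   using r by (intro mult_left_mono) auto
  also have "... < r" using r by (simp add: add_nonneg_pos pos_divide_less_eq)
  finally show ?thesis .
 qed
 define F where "F n w = (f (w + t n *\<^sub>R v) - f w) / of_real (t n)" for n w
 have tlim: "t \<longlonglongrightarrow> 0"
 proof -
  have "(%n. r / (16 * (norm v + 1)) * inverse (real (Suc n))) \<longlonglongrightarrow> r / (16 * (norm v + 1)) * 0"
   by (intro tendsto_intros LIMSEQ_inverse_real_of_nat)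
  then show ?thesis by (simp add: t_def[abs_def] field_simps)
 qed
 have bw: "ball w (r/2) \<subseteq> ball z r" if "w \<in> ball z (r/2)" for w
 proof
  fix y assume "y \<in> ball w (r/2)"
  then show "y \<in> ball z r" using that dist_triangle[of z y w] by (simp add: dist_commute)
 qed
 have app: "norm (F n w - fd f w v) <= 128 * M / r\<^sup>2 * (norm v)\<^sup>2 * t n" if w: "w \<in> ball z (r/2)" for n w
 proof -
  have dw: "f differentiable (at w)" using fr bw[OF w] w r by (auto simp: jholo_def)
  have "norm (f (w + t n *\<^sub>R v) - f w - fd f w (t n *\<^sub>R v)) <= 32 * M / (r/2)\<^sup>2 * (norm (t n *\<^sub>R v))\<^sup>2"
   by (rule jholo_taylor2)
     (use r tv[of n] norm_ge_zero[of "t n *\<^sub>R v"] M bw[OF w] jholo_subset[OF fr bw[OF w]] in \<open>auto simp del: norm_scaleR norm_ge_zero\<close>)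
  also have "... = t n * (128 * M / r\<^sup>2 * (norm v)\<^sup>2 * t n)"
   by (simp add: power2_eq_square field_simps)
  finally have "norm (f (w + t n *\<^sub>R v) - f w - fd f w (t n *\<^sub>R v)) / t n <= 128 * M / r\<^sup>2 * (norm v)\<^sup>2 * t n"
   using t0[of n] by (simp add: pos_divide_le_eq mult.commute)
  moreover have "F n w - fd f w v = (f (w + t n *\<^sub>R v) - f w - fd f w (t n *\<^sub>R v)) / of_real (t n)"
   using t0[of n] by (simp add: F_def fd_scaleR[OF dw] field_simps scaleR_conv_of_real)
  ultimately show ?thesis using t0[of n] by (simp add: norm_divide)
 qed
 define K where "K = 128 * M / r\<^sup>2 * (norm v)\<^sup>2"
 have K0: "0 <= K" using M0 by (simp add: K_def)
 have Klim: "(%n. K * t n) \<longlonglongrightarrow> 0" using tendsto_mult[OF tendsto_const tlim, of K] by simp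
 have wsub: "w + t n *\<^sub>R v \<in> ball z r" if "w \<in> ball z (r/2)" for w n
 proof -
  have "norm (t n *\<^sub>R v) < r/2" using tv[of n] norm_ge_zero[of "t n *\<^sub>R v"] by linarith
  then show ?thesis using bw[OF that] by (intro subsetD[OF bw[OF that]]) (simp add: dist_norm)
 qed
 show "\<exists>A. ((%z. fd f z v) has_derivative A) (at z) \<and> (\<forall>v. A (J v) = \<i> * A v)"
 proof (rule jholo_limit[where F = F and r = "r/2"])
  show "r/2 > 0" using r by simp
  show "jholo J (ball z (r/2)) (F n)" for n
  proof (rule jholoI)
   fix w assume w: "w \<in> ball z (r/2)"
   have w': "w \<in> ball z r" using w r by auto
   have "((%w. f (w + t n *\<^sub>R v)) has_derivative (%h. fd f (w + t n *\<^sub>R v) h)) (at w)"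
    by (rule has_derivative_compose[where f = "%w. w + t n *\<^sub>R v" and f' = "%h. h" and g = f,
       OF _ jholo_has_derivative[OF fr wsub[OF w]]])
      (auto intro!: derivative_eq_intros)
   then have "(F n has_derivative (%h. (fd f (w + t n *\<^sub>R v) h - fd f w h) / of_real (t n))) (at w)"
    unfolding F_def using jholo_has_derivative[OF fr w'] t0[of n]
    by (auto intro!: derivative_eq_intros)
   moreover have "(fd f (w + t n *\<^sub>R v) (J h) - fd f w (J h)) / of_real (t n)
      = \<i> * ((fd f (w + t n *\<^sub>R v) h - fd f w h) / of_real (t n))" for h
    using fr w' wsub[OF w] by (simp add: jholo_def right_diff_distrib)
   ultimately show "\<exists>A. (F n has_derivative A) (at w) \<and> (\<forall>v. A (J v) = \<i> * A v)" by blast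
  qed
  show "norm (F n w) <= K * t 0 + 8 * M / r * norm v" if w: "w \<in> ball z (r/2)" for n w
  proof -
   have "norm (F n w) <= norm (F n w - fd f w v) + norm (fd f w v)"
    by (metis diff_add_cancel norm_triangle_ineq)
   also have "... <= K * t n + 4 * M / (r/2) * norm v"
   proof (rule add_mono)
    show "norm (F n w - fd f w v) <= K * t n" using app[OF w, of n] by (simp add: K_def)
    show "norm (fd f w v) <= 4 * M / (r/2) * norm v"
     by (rule jholo_deriv_bound) (use jholo_subset[OF fr bw[OF w]] M bw[OF w] r in auto)
   qed
   also have "K * t n <= K * t 0"
   proof (intro mult_left_mono)
    have "16 * (norm v + 1) * 1 <= 16 * (norm v + 1) * (real n + 1)" by (intro mult_left_mono) auto
    then show "t n <= t 0"
     using r by (auto simp: t_def intro!: divide_left_mono mult_pos_pos add_nonneg_pos)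
   qed (rule K0)
   finally show ?thesis by (simp add: field_simps)
  qed
  show "(%n. F n w) \<longlonglongrightarrow> fd f w v" if w: "w \<in> ball z (r/2)" for w
  proof -
   have "(%n. F n w - fd f w v) \<longlonglongrightarrow> 0"
    by (rule Lim_null_comparison[OF _ Klim]) (use app[OF w] in \<open>simp add: K_def\<close>)
   then show ?thesis by (simp add: LIM_zero_iff)
  qed
  show "uniformly_Cauchy_on (ball z (r/2)) F"
   unfolding uniformly_Cauchy_on_def
  proof (intro allI impI)
   fix e :: real assume "e > 0"
   then obtain N where N: "!!n. n \<ge> N ==> K * t n < e/2"
    using order_tendstoD(2)[OF Klim, of "e/2"] by (auto simp: eventually_sequentially)
   have "dist (F m x) (F n x) < e" if "x \<in> ball z (r/2)" "m \<ge> N" "n \<ge> N" for x m n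
   proof -
    have "dist (F m x) (F n x) <= norm (F m x - fd f x v) + norm (F n x - fd f x v)"
     by (metis dist_norm dist_triangle2)
    also have "... <= K * t m + K * t n"
     by (intro add_mono) (use app that in \<open>auto simp: K_def\<close>)
    also have "... < e" using N that by (smt (verit) field_sum_of_halves)
    finally show ?thesis .
   qed
   then show "\<exists>M. \<forall>x\<in>ball z (r/2). \<forall>m\<ge>M. \<forall>n\<ge>M. dist (F m x) (F n x) < e" by blast
  qed
 qed
qed

end

section \<open>Products of complex structures and Osgood's lemma\<close>

definition prod_map :: "('a => 'a) => ('b => 'b) => 'a \<times> 'b => 'a \<times> 'b" where
 "prod_map J1 J2 p = (J1 (fst p), J2 (snd p))"

lemma complex_structure_prod:
 assumes "complex_structure J1" "complex_structure J2"
 shows "complex_structure (prod_map J1 J2)"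
proof -
 interpret a: complex_structure J1 by fact
 interpret b: complex_structure J2 by fact
 show ?thesis
 proof (rule complex_structure.intro)
  show "linear (prod_map J1 J2)"
   by (rule linearI) (auto simp: prod_map_def linear_add[OF a.linJ] linear_add[OF b.linJ] linear_cmul[OF a.linJ] linear_cmul[OF b.linJ])
 qed (auto simp: prod_map_def a.JJ b.JJ norm_Pair a.normJ b.normJ norm_prod_def)
qed

text \<open>Osgood's lemma with explicit remainders. Moving first in w and then in z gives two
  Taylor remainders in one variable each, plus a mixed term, the z-derivative of the difference
  \<open>G\<close>. As \<open>G\<close> is O(|y|) by the Lipschitz bound in w, Cauchy's inequality
  makes that term O(|x| |y|).\<close>

lemma jholo_Osgood:
 fixes F :: "'a::euclidean_space \<times> 'b::euclidean_space => complex"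
 assumes J1: "complex_structure J1" and J2: "complex_structure J2" and r: "r > 0"
  and M: "!!z w. z \<in> ball z0 r ==> w \<in> ball w0 r ==> norm (F (z, w)) <= M"
  and F1: "!!w. w \<in> ball w0 r ==> jholo J1 (ball z0 r) (%z. F (z, w))"
  and F2: "!!z. z \<in> ball z0 r ==> jholo J2 (ball w0 r) (%w. F (z, w))"
 defines "A \<equiv> %p. fd (%z. F (z, w0)) z0 (fst p) + fd (%w. F (z0, w)) w0 (snd p)"
 shows "(F has_derivative A) (at (z0, w0)) \<and> (\<forall>p. A (prod_map J1 J2 p) = \<i> * A p)"
proof
 interpret a: complex_structure J1 by fact
 interpret b: complex_structure J2 by fact
 have z0: "z0 \<in> ball z0 r" and w0: "w0 \<in> ball w0 r" using r by auto
 have d1: "(%z. F (z, w)) differentiable (at z0)" if "w \<in> ball w0 r" for w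
  using F1[OF that] z0 by (auto simp: jholo_def)
 have d2: "(%w. F (z, w)) differentiable (at w0)" if "z \<in> ball z0 r" for z
  using F2[OF that] w0 by (auto simp: jholo_def)
 show "\<forall>p. A (prod_map J1 J2 p) = \<i> * A p"
  using F1[OF w0] F2[OF z0] z0 w0 by (auto simp: A_def jholo_def prod_map_def distrib_left)
 show "(F has_derivative A) (at (z0, w0))"
 proof (rule has_derivative_quadratic)
  show "linear A"
   unfolding A_def
   by (rule linearI) (auto simp: fd_add[OF d1[OF w0]] fd_add[OF d2[OF z0]] fd_scaleR[OF d1[OF w0]]
     fd_scaleR[OF d2[OF z0]] scaleR_add_right)
  show "r / 4 > 0" using r by simp
  fix h :: "'a \<times> 'b" assume h: "norm h < r / 4"
  obtain x y where xy: "h = (x, y)" by (cases h)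
  have nx: "norm x <= norm h" and ny: "norm y <= norm h"
   using norm_fst_le[of h] norm_snd_le[of h] by (auto simp: xy norm_Pair)
  have M0: "0 <= M" using M[OF z0 w0] norm_ge_zero[of "F (z0, w0)"] by linarith
  have yb: "w0 + y \<in> ball w0 r" using ny h r norm_ge_zero[of h] by (simp add: dist_norm del: norm_ge_zero)
  define G where "G = (%z. F (z, w0 + y) - F (z, w0))"
  have Gder: "(G has_derivative (%v. fd (%z. F (z, w0 + y)) z v - fd (%z. F (z, w0)) z v)) (at z)"
   if "z \<in> ball z0 r" for z
   unfolding G_def using jholo_has_derivative[OF F1[OF yb] that] jholo_has_derivative[OF F1[OF w0] that]
   by (auto intro!: derivative_intros)
  have G: "jholo J1 (ball z0 r) G"
  proof (rule jholoI)
   fix z assume z: "z \<in> ball z0 r"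
   have "\<forall>v. fd (%z. F (z, w0 + y)) z (J1 v) - fd (%z. F (z, w0)) z (J1 v)
     = \<i> * (fd (%z. F (z, w0 + y)) z v - fd (%z. F (z, w0)) z v)"
    using F1[OF yb] F1[OF w0] z by (auto simp: jholo_def right_diff_distrib)
   with Gder[OF z] show "\<exists>A. (G has_derivative A) (at z) \<and> (\<forall>v. A (J1 v) = \<i> * A v)"
    by (intro exI conjI)
  qed
  have "norm (G z) <= 12 * M / r * norm y" if "z \<in> ball z0 r" for z
   unfolding G_def by (rule b.jholo_Lipschitz[OF F2[OF that] r]) (use M that ny h in auto)
  then have "norm (fd G z0 x) <= 4 * (12 * M / r * norm y) / r * norm x"
   by (rule a.jholo_deriv_bound[OF G r])
  also have "... = 48 * M / r\<^sup>2 * (norm y * norm x)" by (simp add: power2_eq_square)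
  also have "... <= 48 * M / r\<^sup>2 * (norm h * norm h)"
   using M0 nx ny by (intro mult_left_mono mult_mono) auto
  finally have e2: "norm (fd G z0 x) <= 48 * M / r\<^sup>2 * (norm h)\<^sup>2" by (simp add: power2_eq_square)
  have "norm (F (z0 + x, w0 + y) - F (z0, w0 + y) - fd (%z. F (z, w0 + y)) z0 x) <= 32 * M / r\<^sup>2 * (norm x)\<^sup>2"
   by (rule a.jholo_taylor2[OF F1[OF yb] r]) (use M yb nx h in auto)
  also have "... <= 32 * M / r\<^sup>2 * (norm h)\<^sup>2" using M0 nx by (intro mult_left_mono power_mono) auto
  finally have e1: "norm (F (z0 + x, w0 + y) - F (z0, w0 + y) - fd (%z. F (z, w0 + y)) z0 x) <= 32 * M / r\<^sup>2 * (norm h)\<^sup>2" .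
  have "norm (F (z0, w0 + y) - F (z0, w0) - fd (%w. F (z0, w)) w0 y) <= 32 * M / r\<^sup>2 * (norm y)\<^sup>2"
   by (rule b.jholo_taylor2[OF F2[OF z0] r]) (use M z0 ny h in auto)
  also have "... <= 32 * M / r\<^sup>2 * (norm h)\<^sup>2" using M0 ny by (intro mult_left_mono power_mono) auto
  finally have e3: "norm (F (z0, w0 + y) - F (z0, w0) - fd (%w. F (z0, w)) w0 y) <= 32 * M / r\<^sup>2 * (norm h)\<^sup>2" .
  have "fd G z0 x = fd (%z. F (z, w0 + y)) z0 x - fd (%z. F (z, w0)) z0 x"
   using frechet_derivative_at[OF Gder[OF z0]] by metis
  then have "F ((z0, w0) + h) - F (z0, w0) - A h =
    (F (z0 + x, w0 + y) - F (z0, w0 + y) - fd (%z. F (z, w0 + y)) z0 x) + fd G z0 x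
    + (F (z0, w0 + y) - F (z0, w0) - fd (%w. F (z0, w)) w0 y)"
   by (simp add: A_def xy)
  then have "norm (F ((z0, w0) + h) - F (z0, w0) - A h) <=
    32 * M / r\<^sup>2 * (norm h)\<^sup>2 + 48 * M / r\<^sup>2 * (norm h)\<^sup>2 + 32 * M / r\<^sup>2 * (norm h)\<^sup>2"
   by (simp only:) (use e1 e2 e3 norm_triangle_ineq[of "F (z0 + x, w0 + y) - F (z0, w0 + y) - fd (%z. F (z, w0 + y)) z0 x" "fd G z0 x"]
    norm_triangle_ineq[of "F (z0 + x, w0 + y) - F (z0, w0 + y) - fd (%z. F (z, w0 + y)) z0 x + fd G z0 x" "F (z0, w0 + y) - F (z0, w0) - fd (%w. F (z0, w)) w0 y"] in linarith)
  then show "norm (F ((z0, w0) + h) - F (z0, w0) - A h) <= 112 * M / r\<^sup>2 * (norm h)\<^sup>2"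
   by (simp add: field_simps)
 qed
qed

section \<open>Change of variables for biholomorphic maps\<close>

text \<open>Carries the change of variables formula from real to complex vectors. A bijection
  between the two standard bases extends to a linear isometry that sends boxes to boxes, hence
  preserves Lebesgue measure.\<close>

lemma euclidean_isometry_lborel:
 assumes "DIM('a::euclidean_space) = DIM('b::euclidean_space)"
 obtains T :: "'a::euclidean_space => 'b::euclidean_space" and T' :: "'b => 'a"
  where "linear T" "linear T'" "!!x. T' (T x) = x" "!!y. T (T' y) = y" "!!x. norm (T x) = norm x"
   "distr lborel borel T = lborel"
proof -
 obtain \<sigma> where \<sigma>: "bij_betw \<sigma> (Basis :: 'a set) (Basis :: 'b set)"
  using finite_same_card_bij[OF finite_Basis finite_Basis assms] by blast
 have inj: "inj_on \<sigma> Basis" and im: "\<sigma> ` Basis = Basis" using \<sigma> by (auto simp: bij_betw_def)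
 have sB: "\<sigma> b \<in> Basis" if "b \<in> Basis" for b using im that by blast
 define T where "T x = (\<Sum>b\<in>Basis. (x \<bullet> b) *\<^sub>R \<sigma> b)" for x :: 'a
 define T' where "T' y = (\<Sum>b\<in>Basis. (y \<bullet> \<sigma> b) *\<^sub>R b)" for y :: 'b
 have Tin: "T x \<bullet> \<sigma> b = x \<bullet> b" if b: "b \<in> Basis" for x b
 proof -
  have "T x \<bullet> \<sigma> b = (\<Sum>c\<in>Basis. (x \<bullet> c) * (\<sigma> c \<bullet> \<sigma> b))" by (simp add: T_def inner_sum_left)
  also have "... = (\<Sum>c\<in>Basis. if c = b then x \<bullet> b else 0)"
   by (intro sum.cong refl) (use inj b sB in \<open>auto simp: inner_Basis inj_on_def\<close>)
  finally show ?thesis using b by simp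
 qed
 have T'in: "T' y \<bullet> b = y \<bullet> \<sigma> b" if "b \<in> Basis" for y b
  using that by (simp add: T'_def inner_sum_left inner_Basis if_distrib if_distribR cong: if_cong)
 have lT: "linear T" by (rule linearI) (simp_all add: T_def inner_add_left scaleR_add_left sum.distrib scaleR_sum_right)
 have lT': "linear T'" by (rule linearI) (simp_all add: T'_def inner_add_left scaleR_add_left sum.distrib scaleR_sum_right)
 have 1: "T' (T x) = x" for x by (rule euclidean_eqI) (simp add: T'in Tin)
 have 2: "T (T' y) = y" for y
 proof (rule euclidean_eqI)
  fix b :: 'b assume "b \<in> Basis"
  then obtain c where "b = \<sigma> c" "c \<in> Basis" using im by blast
  then show "T (T' y) \<bullet> b = y \<bullet> b" by (simp add: T'in Tin)
 qed
 have nT: "norm (T x) = norm x" for x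
 proof -
  have "T x \<bullet> T x = (\<Sum>b\<in>\<sigma> ` Basis. (T x \<bullet> b) * (T x \<bullet> b))"
   by (simp add: im) (metis euclidean_inner)
  also have "... = (\<Sum>b\<in>Basis. (x \<bullet> b) * (x \<bullet> b))"
   by (subst sum.reindex[OF inj]) (simp add: Tin)
  also have "... = x \<bullet> x" by (metis euclidean_inner)
  finally show ?thesis by (simp add: norm_eq_sqrt_inner)
 qed
 have meas: "T \<in> borel_measurable borel"
  by (intro borel_measurable_continuous_onI linear_continuous_on) (simp add: lT linear_conv_bounded_linear[symmetric])
 have "lborel = distr lborel borel T"
 proof (rule lborel_eqI)
  fix l u :: 'b assume lu: "!!b. b \<in> Basis ==> l \<bullet> b <= u \<bullet> b"
  have "T -` box l u = box (T' l) (T' u)"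
  proof (rule Set.set_eqI)
   fix x
   have "T x \<in> box l u \<longleftrightarrow> (\<forall>b\<in>\<sigma> ` Basis. l \<bullet> b < T x \<bullet> b \<and> T x \<bullet> b < u \<bullet> b)" by (simp add: im mem_box)
   then show "x \<in> T -` box l u \<longleftrightarrow> x \<in> box (T' l) (T' u)" by (auto simp: mem_box T'in Tin)
  qed
  then have "emeasure (distr lborel borel T) (box l u) = emeasure lborel (box (T' l) (T' u))"
   using meas by (simp add: emeasure_distr)
  also have "... = (\<Prod>b\<in>Basis. (T' u - T' l) \<bullet> b)"
   by (rule emeasure_lborel_box) (auto simp: T'in lu sB)
  also have "(\<Prod>b\<in>Basis. (T' u - T' l) \<bullet> b) = (\<Prod>b\<in>Basis. (u - l) \<bullet> \<sigma> b)"
   by (intro prod.cong) (auto simp: inner_diff_left T'in)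
  also have "... = (\<Prod>b\<in>\<sigma> ` Basis. (u - l) \<bullet> b)" by (simp add: prod.reindex[OF inj])
  finally show "emeasure (distr lborel borel T) (box l u) = (\<Prod>b\<in>Basis. (u - l) \<bullet> b)" by (simp add: im)
 qed simp
 then show ?thesis using that lT lT' 1 2 nT by metis
qed

text \<open>The matrix of the map replacing the \<open>i\<close>-th coordinate of \<open>x\<close> by \<open>\<Sum>k. w $ k * x $ k\<close>; up to a
  permutation of columns every invertible matrix is a product of such matrices.\<close>

definition row_matrix :: "'n => 'a::field^'n => 'a^'n^'n" where
 "row_matrix i w = (\<chi> r k. if r = i then w $ k else if r = k then 1 else 0)"

lemma mult_row_matrix:
 "(A ** row_matrix i w) $ r $ k = (if k = i then A $ r $ i * w $ i else A $ r $ k + A $ r $ i * w $ k)"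
proof -
 have "(A ** row_matrix i w) $ r $ k = (\<Sum>j\<in>UNIV. A $ r $ j * (if j = i then w $ k else if j = k then 1 else 0))"
  by (simp add: matrix_matrix_mult_def row_matrix_def)
 also have "... = A $ r $ i * w $ k + (\<Sum>j\<in>UNIV - {i}. A $ r $ j * (if j = k then 1 else 0))"
  by (subst sum.remove[of _ i]) auto
 also have "(\<Sum>j\<in>UNIV - {i}. A $ r $ j * (if j = k then 1 else 0)) = (if k = i then 0 else A $ r $ k)"
  by (auto simp: if_distrib[of "(*) _"] sum.delta cong: if_cong)
 finally show ?thesis by auto
qed

lemma row_matrix_mult:
 "row_matrix i w ** row_matrix i w' = row_matrix i (\<chi> k. if k = i then w $ i * w' $ i else w $ k + w $ i * w' $ k)"
 by (subst vec_eq_iff, subst vec_eq_iff) (simp only: mult_row_matrix, auto simp: row_matrix_def)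

lemma row_matrix_axis: "row_matrix i (axis i 1) = mat 1"
 by (auto simp: row_matrix_def mat_def axis_def vec_eq_iff)

text \<open>A nonnegative multiplicative function is 1 on involutions, in particular on
  transpositions. The one-coordinate dilations by \<open>c\<close> are conjugate to each other and
  their product over all coordinates is scalar, so each has value 1. A shear is conjugate to its
  inverse. Elimination then reduces every invertible matrix to these generators.\<close>

lemma invertible_matrix_multiplicative_eq_1:
 fixes \<chi>' :: "'a::field^'n^'n => real"
 assumes mult: "!!A B. \<chi>' (A ** B) = \<chi>' A * \<chi>' B" and nonneg: "!!A. \<chi>' A \<ge> 0"
  and scalar: "!!c. c \<noteq> 0 ==> \<chi>' (mat c) = 1" and A: "invertible A"
 shows "\<chi>' A = 1"
proof -
 have one: "\<chi>' (mat 1) = 1" by (rule scalar) simp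
 have invol: "\<chi>' B = 1" if "B ** B = mat 1" for B
 proof -
  have "\<chi>' B * \<chi>' B = 1" using one that mult[of B B] by simp
  then show ?thesis using nonneg[of B] by (simp add: square_eq_1_iff)
 qed
 define P :: "'n => 'n => 'a^'n^'n" where "P i j = (\<chi> r k. if r = Transposition.transpose i j k then 1 else 0)" for i j
 have mP: "(B ** P i j) $ r $ k = B $ r $ Transposition.transpose i j k" for B :: "'a^'n^'n" and i j r k
  by (simp add: matrix_matrix_mult_def P_def if_distrib[of "(*) _"] cong: if_cong)
 have "P i j ** P i j = mat 1" for i j
  by (subst vec_eq_iff, subst vec_eq_iff) (simp only: mP, simp add: P_def mat_def)
 then have \<chi>P: "\<chi>' (P i j) = 1" for i j by (rule invol)
 have diag: "\<chi>' (row_matrix i (axis i c)) = 1" if c: "c \<noteq> 0" for i :: 'n and c :: 'a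
 proof -
  define D :: "'n set => 'a^'n^'n" where "D S = (\<chi> r k. if r = k then if r \<in> S then c else 1 else 0)" for S
  have D_mult: "D (insert j S) = D S ** row_matrix j (axis j c)" if "j \<notin> S" for j S
   using that by (subst vec_eq_iff, subst vec_eq_iff) (simp only: mult_row_matrix, auto simp: D_def axis_def)
  have conj: "\<chi>' (row_matrix j (axis j c)) = \<chi>' (row_matrix i (axis i c))" for j
  proof -
   have "row_matrix j (axis j c) ** P i j = P i j ** row_matrix i (axis i c)"
    by (subst vec_eq_iff, subst vec_eq_iff)
      (simp only: mP mult_row_matrix, auto simp: P_def row_matrix_def axis_def Transposition.transpose_def)
   then have "\<chi>' (row_matrix j (axis j c)) * \<chi>' (P i j) = \<chi>' (P i j) * \<chi>' (row_matrix i (axis i c))"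
    by (metis mult)
   then show ?thesis by (simp add: \<chi>P)
  qed
  have "\<chi>' (D S) = \<chi>' (row_matrix i (axis i c)) ^ card S" if "finite S" for S
   using that
  proof induction
   case empty
   have "D {} = mat 1" by (auto simp: D_def mat_def vec_eq_iff)
   then show ?case using one by simp
  next
   case (insert j S)
   then show ?case using conj[of j] by (simp add: D_mult mult)
  qed
  from this[of UNIV] have "\<chi>' (row_matrix i (axis i c)) ^ CARD('n) = \<chi>' (D UNIV)" by simp
  also have "D UNIV = mat c" by (auto simp: D_def mat_def vec_eq_iff)
  finally have "\<chi>' (row_matrix i (axis i c)) ^ CARD('n) = 1" using scalar[OF c] by simp
  then show ?thesis using nonneg by (metis power_eq_1_iff zero_less_card_finite order.strict_iff_not real_norm_def abs_of_nonneg)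
 qed
 have shear: "\<chi>' (row_matrix i (\<chi> k. if k = i then 1 else s $ k)) = 1" for i :: 'n and s :: "'a^'n"
 proof -
  let ?E = "%s. row_matrix i (\<chi> k. if k = i then 1 else s $ k)"
  let ?D = "row_matrix i (axis i (- 1)) :: 'a^'n^'n"
  have "?E s ** ?E (- s) = row_matrix i (axis i 1)"
   by (simp only: row_matrix_mult) (rule arg_cong[where f = "row_matrix i"], auto simp: vec_eq_iff axis_def)
  then have "\<chi>' (?E s) * \<chi>' (?E (- s)) = 1" using one by (metis mult row_matrix_axis)
  moreover have "?D ** ?E s ** ?D = ?E (- s)"
   by (simp only: row_matrix_mult) (rule arg_cong[where f = "row_matrix i"], auto simp: vec_eq_iff axis_def)
  then have "\<chi>' (?E (- s)) = \<chi>' (?D ** ?E s ** ?D)" by (rule arg_cong[OF sym])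
  then have "\<chi>' (?E (- s)) = \<chi>' (?E s)" using diag[of "-1" i] by (simp add: mult)
  ultimately have "\<chi>' (?E s) * \<chi>' (?E s) = 1" by simp
  then show ?thesis using nonneg[of "?E s"] by (simp add: square_eq_1_iff)
 qed
 have row: "\<chi>' (row_matrix i w) = 1" if w: "w $ i \<noteq> 0" for i :: 'n and w :: "'a^'n"
 proof -
  have "row_matrix i w = row_matrix i (axis i (w $ i)) ** row_matrix i (\<chi> k. if k = i then 1 else (\<chi> k. w $ k / w $ i) $ k)"
   by (simp only: row_matrix_mult) (rule arg_cong[where f = "row_matrix i"], use w in \<open>auto simp: vec_eq_iff axis_def\<close>)
  then have "\<chi>' (row_matrix i w) = \<chi>' (row_matrix i (axis i (w $ i))) * \<chi>' (row_matrix i (\<chi> k. if k = i then 1 else (\<chi> k. w $ k / w $ i) $ k))"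
   using mult by metis
  then show ?thesis using diag[OF w] shear by simp
 qed
 \<comment> \<open>Induction on the number of rows that are not yet unit rows. One round makes row
   \<open>i\<close> a unit row and leaves the finished rows untouched.\<close>
 define U where "U A = {i. row i A \<noteq> axis i (1::'a)}" for A :: "'a^'n^'n"
 show ?thesis using A
 proof (induction "card (U A)" arbitrary: A rule: less_induct)
  case less
  show ?case
  proof (cases "U A = {}")
   case True
   then have "A = mat 1" by (auto simp: U_def row_def axis_def mat_def vec_eq_iff)
   then show ?thesis using one by simp
  next
   case False
   then obtain i where i: "i \<in> U A" by blast
   \<comment> \<open>If row \<open>i\<close> vanished in all unfinished columns, it would be a
     combination of finished unit rows; \<open>y\<close> records this as a nonzero vector
     annihilated by the matrix from the left.\<close>
   obtain j where j: "j \<in> U A" "A $ i $ j \<noteq> 0"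
   proof (rule ccontr)
    assume neg: "\<not> thesis"
    define y :: "'a^'n" where "y = (\<chi> k. if k = i then 1 else - A $ i $ k)"
    have z: "A $ i $ k = 0" if "k \<in> U A" for k using neg that \<open>!!j. j \<in> U A ==> A $ i $ j \<noteq> 0 ==> thesis\<close> by blast
    have "(y v* A) $ k = 0" for k
    proof -
     have e: "A $ r $ k = (if k = r then 1 else 0)" if "r \<notin> U A" for r
      using that by (auto simp: U_def row_def axis_def vec_eq_iff)
     have "(y v* A) $ k = (\<Sum>r\<in>UNIV. y $ r * A $ r $ k)"
      by (simp add: vector_matrix_mult_def mult.commute)
     also have "... = A $ i $ k + (\<Sum>r\<in>UNIV - {i}. - A $ i $ r * A $ r $ k)"
      by (subst sum.remove[of _ i]) (auto simp: y_def)
     also have "(\<Sum>r\<in>UNIV - {i}. - A $ i $ r * A $ r $ k) = (\<Sum>r\<in>UNIV - {i}. if r = k then - A $ i $ k else 0)"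
     proof (intro sum.cong refl)
      fix r assume "r \<in> UNIV - {i}"
      show "- A $ i $ r * A $ r $ k = (if r = k then - A $ i $ k else 0)"
       by (cases "r \<in> U A") (auto simp: z e)
     qed
     also have "... = (if k = i then 0 else - A $ i $ k)" by (simp add: sum.delta)
     finally show ?thesis using z[OF i] by auto
    qed
    then have "y v* A = 0" by (simp add: vec_eq_iff)
    moreover obtain B where "A ** B = mat 1" using less.prems by (auto simp: invertible_def)
    ultimately have "y = 0" by (metis vector_matrix_mul_assoc vector_matrix_mul_rid vector_matrix_mult_0)
    then have "y $ i = 0" by simp
    then show False by (simp add: y_def)
   qed
   define A1 where "A1 = A ** P i j"
   define w where "w = row i A1"
   have wk: "w $ k = A1 $ i $ k" for k by (simp add: w_def row_def)
   have wi: "w $ i \<noteq> 0" using j by (simp add: wk A1_def mP)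
   define A2 :: "'a^'n^'n" where "A2 = (\<chi> r k. if k = i then A1 $ r $ i / w $ i else A1 $ r $ k - A1 $ r $ i / w $ i * w $ k)"
   have A12: "A1 = A2 ** row_matrix i w"
    by (subst vec_eq_iff, subst vec_eq_iff) (use wi in \<open>simp only: mult_row_matrix, auto simp: A2_def\<close>)
   have "P i j ** P i j = mat 1" by fact
   then have A_eq: "A = A1 ** P i j" by (metis A1_def matrix_mul_assoc matrix_mul_rid)
   have "det A \<noteq> 0" using less.prems by (simp add: invertible_det_nz)
   then have "invertible A2" by (simp add: A_eq A12 det_mul invertible_det_nz)
   moreover have "U A2 \<subset> U A"
   proof
    show "U A2 \<subseteq> U A"
    proof (rule ccontr)
     assume "\<not> U A2 \<subseteq> U A"
     then obtain r where r: "r \<in> U A2" "r \<notin> U A" by blast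
     then have rij: "r \<noteq> i" "r \<noteq> j" using i j by auto
     have "A $ r $ k = (if k = r then 1 else 0)" for k
      using r by (auto simp: U_def row_def axis_def vec_eq_iff)
     then have "A1 $ r $ k = (if k = r then 1 else 0)" for k
      using rij by (auto simp: A1_def mP Transposition.transpose_def)
     then have "row r A2 = axis r 1"
      using rij by (auto simp: A2_def row_def axis_def vec_eq_iff)
     then show False using r by (simp add: U_def)
    qed
    have "row i A2 = axis i 1" using wi by (auto simp: A2_def row_def axis_def vec_eq_iff wk)
    then have "i \<notin> U A2" by (simp add: U_def)
    then show "U A2 \<noteq> U A" using i by blast
   qed
   then have "card (U A2) < card (U A)" by (intro psubset_card_mono) auto
   ultimately have "\<chi>' A2 = 1" using less.hyps by blast
   then show ?thesis by (simp add: A_eq A12 mult row[OF wi] \<chi>P)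
  qed
 qed
qed

lemma norm_cvec_scalar [simp]: "norm (c *s (v :: complex^'n)) = cmod c * norm v"
 by (simp add: norm_vec_def norm_mult L2_set_right_distrib)

lemma scaleR_complex_vec: "r *\<^sub>R (v :: complex^'n) = of_real r *s v"
 by (simp add: vec_eq_iff scaleR_conv_of_real[where 'a = complex])

text \<open>The quotient of the two sides is multiplicative in the matrix, and a scalar
  \<open>c\<close> acts on a space of real dimension 2n as |c| times an isometry, so the quotient is
  1 on scalars and hence on all invertible matrices. For a singular matrix a kernel vector makes
  both sides zero.\<close>

lemma abs_det_real_of_complex_matrix:
 fixes T :: "complex^'n => real^'m" and M :: "complex^'n^'n"
 assumes T: "linear T" "linear T'" "!!x. T' (T x) = x" "!!y. T (T' y) = y" "!!x. norm (T x) = norm x"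
  and card: "CARD('m) = 2 * CARD('n)"
 shows "\<bar>det (matrix (%x. T (M *v T' x)))\<bar> = (cmod (det M))\<^sup>2"
proof -
 define R where "R M = (%x. T (M *v T' x))" for M :: "complex^'n^'n"
 have lR: "linear (R M)" for M
  unfolding R_def by (intro linear_compose[unfolded o_def, OF _ T(1)] linear_compose[unfolded o_def, OF T(2)]) simp
 have Rm: "R (A ** B) = R A \<circ> R B" for A B
  by (auto simp: R_def T matrix_vector_mul_assoc)
 define \<chi>' where "\<chi>' M = \<bar>det (matrix (R M))\<bar> / (cmod (det M))\<^sup>2" for M :: "complex^'n^'n"
 have main: "\<chi>' M = 1" if "invertible M"
 proof (rule invertible_matrix_multiplicative_eq_1[OF _ _ _ that])
  show "\<chi>' (A ** B) = \<chi>' A * \<chi>' B" for A B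
   by (simp add: \<chi>'_def Rm matrix_compose[OF lR lR] det_mul abs_mult norm_mult power_mult_distrib)
  show "\<chi>' A \<ge> 0" for A by (simp add: \<chi>'_def)
  fix c :: complex assume c: "c \<noteq> 0"
  define g where "g = (%x. (1 / cmod c) *\<^sub>R R (mat c) x)"
  have mc: "mat c *v x = c *s x" for x :: "complex^'n"
   by (simp add: vec_eq_iff matrix_vector_mult_def mat_def if_distrib[of "%a. a * _"] cong: if_cong)
  have lg: "linear g" unfolding g_def by (intro linear_compose_scale_right lR)
  have nT': "norm (T' y) = norm y" for y using T(4,5) by metis
  have "orthogonal_transformation g"
   unfolding orthogonal_transformation using lg c by (simp add: g_def R_def mc T nT')
  then have dg: "\<bar>det (matrix g)\<bar> = 1" by simp
  have "R (mat c) = (*\<^sub>R) (cmod c) \<circ> g" using c by (auto simp: g_def)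
  then have "matrix (R (mat c)) = matrix ((*\<^sub>R) (cmod c)) ** matrix g"
   using matrix_compose[OF lg linear_scale_self] by simp
  then have "\<bar>det (matrix (R (mat c)))\<bar> = cmod c ^ CARD('m)"
   using dg by (simp add: det_mul abs_mult)
  moreover have "det (mat c :: complex^'n^'n) = c ^ CARD('n)"
   by (subst det_diagonal) (auto simp: mat_def)
  ultimately show "\<chi>' (mat c) = 1"
   using c by (simp add: \<chi>'_def card norm_power power_mult[symmetric] mult.commute)
 qed
 show ?thesis
 proof (cases "invertible M")
  case True
  then have "det M \<noteq> 0" by (simp add: invertible_det_nz)
  then show ?thesis using main[OF True] by (simp add: \<chi>'_def R_def)
 next
  case False
  then have d: "det M = 0" by (simp add: invertible_det_nz)
  have "\<not> (\<exists>B. B ** M = mat 1)" using False by (metis invertible_left_inverse)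
  then obtain x where x: "x \<noteq> 0" "M *v x = 0" by (auto simp: matrix_left_invertible_ker)
  have "R M (T x) = R M 0" using x T by (simp add: R_def linear_0)
  moreover have "T x \<noteq> 0" using x T(5) by (metis norm_eq_zero)
  ultimately have "\<not> inj (R M)" by (auto simp: inj_def)
  then have "det (matrix (R M)) = 0" using det_nz_iff_inj[OF lR] by blast
  then show ?thesis using d by (simp add: R_def)
 qed
qed

text \<open>The gauge integral belongs to the completed measure, whereas the Bergman space and the
  currents are formulated with \<open>lborel\<close>; on Borel functions the two agree.\<close>

lemma absolutely_integrable_on_lborel_iff:
 fixes f :: "'a::euclidean_space => real"
 assumes "set_borel_measurable lborel S f"
 shows "f absolutely_integrable_on S \<longleftrightarrow> set_integrable lborel S f"
  and "set_integrable lborel S f ==> integral S f = (LINT x:S|lborel. f x)"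
proof -
 show 1: "f absolutely_integrable_on S \<longleftrightarrow> set_integrable lborel S f"
  using assms by (simp add: set_integrable_def set_borel_measurable_def integrable_completion)
 assume "set_integrable lborel S f"
 with 1 have "integral S f = (LINT x:S|lebesgue. f x)" by (simp add: set_lebesgue_integral_eq_integral)
 also have "... = (LINT x:S|lborel. f x)"
  using assms by (simp add: set_lebesgue_integral_def set_borel_measurable_def integral_completion)
 finally show "integral S f = (LINT x:S|lborel. f x)" .
qed

lemma set_borel_measurable_continuous_open:
 fixes f :: "'a::euclidean_space => 'b::{real_normed_vector, second_countable_topology}"
 assumes "open S" "continuous_on S f"
 shows "set_borel_measurable lborel S f"
 using borel_measurable_continuous_on_indicator[of S f] assms by (simp add: set_borel_measurable_def)

text \<open>Differentiability of both \<open>g\<close> and \<open>h\<close> makes the derivatives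
  inverse to each other by the chain rule. The real Jacobian is then the squared modulus of the
  complex determinant.\<close>

lemma change_of_variables_biholomorphic:
 fixes g h :: "complex^'n => complex^'n" and f :: "complex^'n => real"
 assumes S: "open S" "open S'"
  and dg: "!!z. z \<in> S ==> (g has_derivative (*v) (G z)) (at z)"
  and dh: "!!w. w \<in> S' ==> (h has_derivative (*v) (H w)) (at w)"
  and gS: "!!z. z \<in> S ==> g z \<in> S' \<and> h (g z) = z" and hS: "!!w. w \<in> S' ==> h w \<in> S \<and> g (h w) = w"
  and f: "continuous_on S' f" and cG: "continuous_on S (%z. det (G z))"
 shows "set_integrable lborel S (%z. (cmod (det (G z)))\<^sup>2 * f (g z)) \<longleftrightarrow> set_integrable lborel S' f" (is ?A)
  and "set_integrable lborel S' f ==> (LINT z:S|lborel. (cmod (det (G z)))\<^sup>2 * f (g z)) = (LINT w:S'|lborel. f w)"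
proof -
 have dim: "DIM(complex^'n) = DIM(real^('n bit0))" by simp
 obtain T :: "complex^'n => real^('n bit0)" and T' where T: "linear T" "linear T'" "!!x. T' (T x) = x" "!!y. T (T' y) = y"
   "!!x. norm (T x) = norm x" and distr: "distr lborel borel T = lborel"
  using euclidean_isometry_lborel[OF dim] by metis
 have bT: "bounded_linear T" "bounded_linear T'" using T by (auto simp: linear_conv_bounded_linear)
 have cT: "continuous_on X T" "continuous_on Y T'" for X Y using bT by (auto intro: linear_continuous_on)
 have mT: "T \<in> borel_measurable borel" by (intro borel_measurable_continuous_onI cT)
 have TS: "T ` X = T' -` X" for X using T by (auto simp: image_iff) (metis)
 have oT: "open (T ` X)" if "open X" for X unfolding TS using cT(2)[of UNIV] that by (simp add: open_vimage)
 have transfer: "set_integrable lborel (T ` X) (%y. u (T' y)) \<longleftrightarrow> set_integrable lborel X u"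
   "(LINT y:T ` X|lborel. u (T' y)) = (LINT x:X|lborel. u x)"
  if "set_borel_measurable lborel X u" "open X" for X and u :: "complex^'n => real"
 proof -
  have ind: "indicator (T ` X) (T x) = (indicator X x :: real)" for x
   using T by (auto simp: indicator_def) (metis image_eqI)
  have m: "(%y. indicator (T ` X) y *\<^sub>R u (T' y)) \<in> borel_measurable borel"
  proof -
   have "(%x. indicator X x *\<^sub>R u x) \<in> borel_measurable borel" using that by (simp add: set_borel_measurable_def)
   moreover have "T' \<in> borel_measurable borel" by (intro borel_measurable_continuous_onI cT)
   ultimately have "(%y. indicator X (T' y) *\<^sub>R u (T' y)) \<in> borel_measurable borel" by simp
   moreover have "indicator X (T' y) = (indicator (T ` X) y :: real)" for y using ind[of "T' y"] T by simp
   ultimately show ?thesis by simp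
  qed
  have "set_integrable lborel (T ` X) (%y. u (T' y)) \<longleftrightarrow> integrable (distr lborel borel T) (%y. indicator (T ` X) y *\<^sub>R u (T' y))"
   by (simp add: distr set_integrable_def)
  also have "... \<longleftrightarrow> set_integrable lborel X u"
   using mT m by (subst integrable_distr_eq) (auto simp: set_integrable_def T ind)
  finally show "set_integrable lborel (T ` X) (%y. u (T' y)) \<longleftrightarrow> set_integrable lborel X u" .
  have "(LINT y:T ` X|lborel. u (T' y)) = integral\<^sup>L (distr lborel borel T) (%y. indicator (T ` X) y *\<^sub>R u (T' y))"
   by (simp add: distr set_lebesgue_integral_def)
  also have "... = (LINT x:X|lborel. u x)"
   using mT m by (subst integral_distr) (auto simp: set_lebesgue_integral_def T ind)
  finally show "(LINT y:T ` X|lborel. u (T' y)) = (LINT x:X|lborel. u x)" .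
 qed
 have cg: "continuous_on S g"
  by (intro continuous_at_imp_continuous_on ballI has_derivative_continuous[OF dg])
 have m1: "set_borel_measurable lborel S (%z. (cmod (det (G z)))\<^sup>2 * f (g z))"
  by (intro set_borel_measurable_continuous_open S continuous_on_mult continuous_on_power continuous_on_norm cG
     continuous_on_compose2[OF f cg]) (use gS in blast)
 have m2: "set_borel_measurable lborel S' f"
  by (rule set_borel_measurable_continuous_open[OF S(2) f])
 have m1': "set_borel_measurable lborel (T ` S) (%y. (cmod (det (G (T' y))))\<^sup>2 * f (g (T' y)))"
  by (intro set_borel_measurable_continuous_open oT S continuous_on_mult continuous_on_power continuous_on_norm
     continuous_on_compose2[OF cG cT(2)] continuous_on_compose2[OF f continuous_on_compose2[OF cg cT(2)]])
    (use gS T in auto)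
 have m2': "set_borel_measurable lborel (T ` S') (%y. f (T' y))"
  by (intro set_borel_measurable_continuous_open oT S continuous_on_compose2[OF f cT(2)]) (use T in auto)
 define R where "R M = (%x. T (M *v T' x))" for M :: "complex^'n^'n"
 have id: "H w *v (G (h w) *v x) = x" if w: "w \<in> S'" for w x
 proof -
  have hw: "h w \<in> S" and ghw: "g (h w) = w" using hS[OF w] by auto
  have "((%z. h (g z)) has_derivative (%x. H w *v (G (h w) *v x))) (at (h w))"
   using has_derivative_compose[OF dg[OF hw], of h "(*v) (H w)"] dh[OF w] ghw by simp
  moreover have "((%z. h (g z)) has_derivative (%x. x)) (at (h w))"
   by (rule has_derivative_transform_within_open[OF has_derivative_ident S(1) hw]) (use gS in auto)
  ultimately show ?thesis by (metis has_derivative_unique)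
 qed
 have dgT: "((%y. T (g (T' y))) has_derivative R (G (T' y))) (at y within T ` S)" if "y \<in> T ` S" for y
 proof -
  have yS: "T' y \<in> S" using that T by auto
  have "((%y. g (T' y)) has_derivative (%x. G (T' y) *v T' x)) (at y)"
   by (rule has_derivative_compose[OF bounded_linear_imp_has_derivative[OF bT(2)] dg[OF yS]])
  from has_derivative_compose[OF this bounded_linear_imp_has_derivative[OF bT(1)]]
  show ?thesis unfolding R_def by (rule has_derivative_at_withinI)
 qed
 have dhT: "((%y. T (h (T' y))) has_derivative R (H (T' y))) (at y within T ` S')" if "y \<in> T ` S'" for y
 proof -
  have yS: "T' y \<in> S'" using that T by auto
  have "((%y. h (T' y)) has_derivative (%x. H (T' y) *v T' x)) (at y)"
   by (rule has_derivative_compose[OF bounded_linear_imp_has_derivative[OF bT(2)] dh[OF yS]])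
  from has_derivative_compose[OF this bounded_linear_imp_has_derivative[OF bT(1)]]
  show ?thesis unfolding R_def by (rule has_derivative_at_withinI)
 qed
 have detR: "\<bar>det (matrix (R M))\<bar> = (cmod (det M))\<^sup>2" for M
  unfolding R_def by (rule abs_det_real_of_complex_matrix) (use T in auto)
 have cov: "(%y. \<bar>det (matrix (R (G (T' y))))\<bar> * f (T' (T (g (T' y))))) absolutely_integrable_on T ` S \<and>
   integral (T ` S) (%y. \<bar>det (matrix (R (G (T' y))))\<bar> * f (T' (T (g (T' y))))) = b \<longleftrightarrow>
   (%y. f (T' y)) absolutely_integrable_on (T ` S') \<and> integral (T ` S') (%y. f (T' y)) = b" for b
 proof (rule cov_invertible_real[where g' = "%y. R (G (T' y))" and h = "%y. T (h (T' y))" and h' = "%y. R (H (T' y))"])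
  show "T (g (T' x)) \<in> T ` S' \<and> T (h (T' (T (g (T' x))))) = x" if "x \<in> T ` S" for x
   using that T gS by auto
  show "T (h (T' y)) \<in> T ` S \<and> T (g (T' (T (h (T' y))))) = y" if "y \<in> T ` S'" for y
   using that T hS by auto
  show "R (H (T' y)) \<circ> R (G (T' (T (h (T' y))))) = id" if "y \<in> T ` S'" for y
   using that T id by (auto simp: R_def)
 qed (use dgT dhT in auto)
 have cov': "set_integrable lborel S (%z. (cmod (det (G z)))\<^sup>2 * f (g z)) \<and> (LINT z:S|lborel. (cmod (det (G z)))\<^sup>2 * f (g z)) = b
   \<longleftrightarrow> set_integrable lborel S' f \<and> (LINT w:S'|lborel. f w) = b" for b
 proof -
  have L: "(set_integrable lborel S (%z. (cmod (det (G z)))\<^sup>2 * f (g z)) \<and> (LINT z:S|lborel. (cmod (det (G z)))\<^sup>2 * f (g z)) = b) \<longleftrightarrow>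
   ((%y. (cmod (det (G (T' y))))\<^sup>2 * f (g (T' y))) absolutely_integrable_on T ` S \<and>
    integral (T ` S) (%y. (cmod (det (G (T' y))))\<^sup>2 * f (g (T' y))) = b)"
   using absolutely_integrable_on_lborel_iff[OF m1'] transfer[OF m1 S(1)] by auto
  have R: "(set_integrable lborel S' f \<and> (LINT w:S'|lborel. f w) = b) \<longleftrightarrow>
   ((%y. f (T' y)) absolutely_integrable_on (T ` S') \<and> integral (T ` S') (%y. f (T' y)) = b)"
   using absolutely_integrable_on_lborel_iff[OF m2'] transfer[OF m2 S(2)] by auto
  show ?thesis unfolding L R using cov[of b] by (simp add: detR T)
 qed
 show ?A using cov' by blast
 show "set_integrable lborel S' f ==> (LINT z:S|lborel. (cmod (det (G z)))\<^sup>2 * f (g z)) = (LINT w:S'|lborel. f w)"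
  using cov' by blast
qed

section \<open>The Bergman space\<close>

abbreviation cmi :: "complex^'n => complex^'n" where "cmi \<equiv> (*s) \<i>"

lemma complex_structure_cmi: "complex_structure (cmi :: complex^'n => _)"
proof (rule complex_structure.intro)
 show "linear (cmi :: complex^'n => _)"
  by (rule linearI) (auto simp: vec_eq_iff algebra_simps)
qed (auto simp: vec_eq_iff)

interpretation cmi: complex_structure "cmi :: complex^'n => _" by (rule complex_structure_cmi)

lemma cscalar_eq: "c *s (v :: complex^'n) = Re c *\<^sub>R v + Im c *\<^sub>R cmi v"
proof -
 have "c * x = of_real (Re c) * x + of_real (Im c) * (\<i> * x)" for x
  by (subst complex_eq[of c]) (simp add: algebra_simps)
 then show ?thesis by (simp add: vec_eq_iff scaleR_conv_of_real[where 'a = complex])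
qed

lemma slice_cmi: "cmi.slice z v \<zeta> = z + \<zeta> *s v"
 by (simp add: cmi.slice_def cscalar_eq[of \<zeta>] add.assoc)

lemma holo_fun_iff_jholo: "holo_fun S f \<longleftrightarrow> jholo cmi S f"
proof
 assume "holo_fun S f"
 then show "jholo cmi S f" unfolding holo_fun_def by (intro jholoI) blast
next
 assume f: "jholo cmi S f"
 show "holo_fun S f"
  unfolding holo_fun_def
 proof
  fix z assume z: "z \<in> S"
  have d: "f differentiable (at z)" and j: "!!v. fd f z (cmi v) = \<i> * fd f z v"
   using f z by (auto simp: jholo_def)
  have "fd f z (c *s v) = c * fd f z v" for c v
   by (subst cscalar_eq, subst (3) complex_eq[of c])
     (simp add: fd_add[OF d] fd_scaleR[OF d] j scaleR_conv_of_real[where 'a = complex] algebra_simps)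
  then show "\<exists>f'. (f has_derivative f') (at z) \<and> (\<forall>c v. f' (c *s v) = c * f' v)"
   using jholo_has_derivative[OF f z] by blast
 qed
qed

lemma fd_cscalar:
 assumes "holo_fun S f" "z \<in> S"
 shows "fd f z (c *s v) = c * fd f z v"
proof -
 obtain f' where f': "(f has_derivative f') (at z)" "\<forall>c v. f' (c *s v) = c * f' v"
  using assms unfolding holo_fun_def by blast
 then show ?thesis using frechet_derivative_at by metis
qed

lemma holo_fun_has_derivative: "holo_fun S f ==> z \<in> S ==> (f has_derivative fd f z) (at z)"
 by (simp add: holo_fun_iff_jholo jholo_has_derivative)

lemma holo_fun_differentiable: "holo_fun S f ==> z \<in> S ==> f differentiable (at z)"
 by (simp add: holo_fun_iff_jholo jholo_def)

lemma holo_fun_continuous: "holo_fun S f ==> continuous_on S f"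
 by (simp add: holo_fun_iff_jholo jholo_continuous)

lemma holo_fun_subset: "holo_fun S f ==> T \<subseteq> S ==> holo_fun T f"
 by (auto simp: holo_fun_def)

lemma holo_fun_add:
 assumes "holo_fun S f" "holo_fun S g" shows "holo_fun S (%z. f z + g z)"
 unfolding holo_fun_def
proof
 fix z assume z: "z \<in> S"
 have "((%z. f z + g z) has_derivative (%v. fd f z v + fd g z v)) (at z)"
  by (intro has_derivative_add holo_fun_has_derivative[OF _ z] assms)
 then show "\<exists>f'. ((%z. f z + g z) has_derivative f') (at z) \<and> (\<forall>c v. f' (c *s v) = c * f' v)"
  by (intro exI[of _ "%v. fd f z v + fd g z v"])
    (simp add: fd_cscalar[OF assms(1) z] fd_cscalar[OF assms(2) z] algebra_simps)
qed

lemma holo_fun_mult: 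
 assumes "holo_fun S f" "holo_fun S g" shows "holo_fun S (%z. f z * g z)"
 unfolding holo_fun_def
proof
 fix z assume z: "z \<in> S"
 have "((%z. f z * g z) has_derivative (%v. f z * fd g z v + fd f z v * g z)) (at z)"
  by (intro has_derivative_mult holo_fun_has_derivative[OF _ z] assms)
 then show "\<exists>f'. ((%z. f z * g z) has_derivative f') (at z) \<and> (\<forall>c v. f' (c *s v) = c * f' v)"
  by (intro exI[of _ "%v. f z * fd g z v + fd f z v * g z"])
    (simp add: fd_cscalar[OF assms(1) z] fd_cscalar[OF assms(2) z] algebra_simps)
qed

lemma holo_fun_const [simp]: "holo_fun S (%z. c)"
 unfolding holo_fun_def by (intro ballI exI[of _ "%_. 0"]) simp

lemma holo_fun_cmult: "holo_fun S f ==> holo_fun S (%z. c * f z)"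
 using holo_fun_mult[of S "%_. c" f] by simp

lemma holo_fun_diff: "holo_fun S f ==> holo_fun S g ==> holo_fun S (%z. f z - g z)"
 using holo_fun_add[of S f "%z. (-1) * g z"] holo_fun_cmult[of S g "-1"] by simp

lemma holo_fun_cong: "open S ==> (!!z. z \<in> S ==> f z = g z) ==> holo_fun S f ==> holo_fun S g"
 unfolding holo_fun_def by (meson has_derivative_transform_within_open)

lemma holo_fun_component [simp]: "holo_fun S (%z. z $ i)"
 unfolding holo_fun_def
 by (intro ballI exI[of _ "%v. v $ i"]) (auto intro!: bounded_linear_imp_has_derivative bounded_linear_vec_nth)

lemma holo_fun_fd: "open S ==> holo_fun S f ==> holo_fun S (%z. fd f z v)"
 by (simp add: holo_fun_iff_jholo cmi.jholo_fd)

lemma fd_linear_combination: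
 assumes "f differentiable (at z)" "g differentiable (at z)"
 shows "fd (%z. f z + g z) z v = fd f z v + fd g z v"
  and "fd (%z. (c::complex) * f z) z v = c * fd f z v"
  and "fd (%z. f z - g z) z v = fd f z v - fd g z v"
proof -
 note d = assms[unfolded frechet_derivative_works]
 show "fd (%z. f z + g z) z v = fd f z v + fd g z v"
  by (simp add: frechet_derivative_at[OF has_derivative_add[OF d], symmetric])
 show "fd (%z. f z - g z) z v = fd f z v - fd g z v"
  by (simp add: frechet_derivative_at[OF has_derivative_diff[OF d], symmetric])
 show "fd (%z. c * f z) z v = c * fd f z v"
  by (simp add: frechet_derivative_at[OF has_derivative_mult_right[OF d(1)], symmetric])
qed

subsection \<open>Invariance of Lebesgue measure under rotations\<close>

text \<open>Multiplication by \<open>c\<close> has complex determinant \<open>c ^ CARD('n)\<close>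
  of modulus 1, so every box has the same measure as its preimage, and boxes determine Lebesgue
  measure.\<close>

lemma lborel_distr_rotation:
 assumes c: "cmod c = 1"
 shows "distr lborel borel (%\<zeta>. a + c *s \<zeta>) = (lborel :: (complex^'n) measure)"
proof -
 have c0: "c \<noteq> 0" using c by auto
 have mv: "mat b *v x = b *s x" for b and x :: "complex^'n"
  by (simp add: vec_eq_iff matrix_vector_mult_def mat_def if_distrib[of "%a. a * _"] cong: if_cong)
 have det: "det (mat b :: complex^'n^'n) = b ^ CARD('n)" for b
  by (subst det_diagonal) (auto simp: mat_def)
 have lin: "linear ((*s) b :: complex^'n => _)" for b
  by (rule linearI) (auto simp: vec_eq_iff algebra_simps)
 have bl: "bounded_linear ((*s) b :: complex^'n => _)" for b using lin by (simp add: linear_conv_bounded_linear)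
 have cont: "continuous_on X ((*s) b :: complex^'n => _)" for X b by (rule linear_continuous_on[OF bl])
 have meas: "((*s) b :: complex^'n => _) \<in> borel_measurable borel" for b by (intro borel_measurable_continuous_onI cont)
 have "lborel = distr lborel borel ((*s) c :: complex^'n => _)"
 proof (rule lborel_eqI)
  fix l u :: "complex^'n" assume lu: "!!b. b \<in> Basis ==> l \<bullet> b <= u \<bullet> b"
  let ?S' = "box l u" let ?S = "(*s) c -` box l u"
  have oS: "open ?S" using cont[of UNIV] by (intro open_vimage) auto
  have inv: "c *s (inverse c *s x) = x" "inverse c *s (c *s x) = x" for x :: "complex^'n"
   using c0 by (simp_all add: vec_eq_iff)
  note cov = change_of_variables_biholomorphic[where g = "(*s) c" and h = "(*s) (inverse c)" and f = "%_. 1"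
    and G = "%_. mat c" and H = "%_. mat (inverse c)" and S = ?S and S' = ?S']
  have prem: "((*s) b has_derivative (*v) (mat b)) (at x)" for b and x :: "complex^'n"
   using bounded_linear_imp_has_derivative[OF bl] by (simp add: mv[abs_def])
  have bS: "bounded ?S"
  proof -
   obtain B where "!!x. x \<in> box l u ==> norm x <= B" using bounded_box bounded_iff by metis
   then show ?thesis unfolding bounded_iff using c by (intro exI[of _ B]) (metis norm_cvec_scalar mult_1 vimageE)
  qed
  have 1: "set_integrable lborel (box l u) (%_. 1 :: real)"
   using emeasure_bounded_finite[OF bounded_box] by (auto simp: set_integrable_def intro!: integrable_real_indicator)
  have e: "(LINT z:?S|lborel. (cmod (det (mat c :: complex^'n^'n)))\<^sup>2 * 1) = (LINT w:?S'|lborel. 1)"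
   by (rule cov(2)) (use oS prem 1 inv in \<open>auto simp: det\<close>)
  have "measure lborel ?S = measure lborel ?S'"
   using e by (simp add: det norm_power c set_lebesgue_integral_def)
  moreover have "emeasure lborel ?S \<noteq> \<infinity>" using emeasure_bounded_finite[OF bS] by simp
  moreover have "emeasure lborel ?S' \<noteq> \<infinity>" using emeasure_bounded_finite[OF bounded_box, of l u] by simp
  ultimately have "emeasure lborel ?S = emeasure lborel ?S'" by (simp add: emeasure_eq_ennreal_measure)
  then show "emeasure (distr lborel borel ((*s) c)) (box l u) = (\<Prod>b\<in>Basis. (u - l) \<bullet> b)"
   using meas by (simp add: emeasure_distr emeasure_lborel_box lu)
 qed simp
 then have "distr lborel borel (%\<zeta>. a + c *s \<zeta>) = distr (distr lborel borel ((*s) c)) borel ((+) a)"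
  using meas by (subst distr_distr) (auto simp: o_def)
 also have "... = lborel"
  using \<open>lborel = distr lborel borel ((*s) c)\<close> by (simp add: lborel_distr_plus)
 finally show ?thesis .
qed

lemma continuous_cis_scalar [continuous_intros]:
 "continuous_on S f ==> continuous_on S g ==> continuous_on S (%x. f x *s (g x :: complex^'n))"
 unfolding vector_scalar_mult_def
 by (intro continuous_on_vec_lambda continuous_intros) auto

text \<open>A substitute for polar coordinates: by Fubini and rotation invariance, averaging over
  all circles about \<open>a\<close> gives the integral over a ball. It turns circle mean
  inequalities into volume bounds, here for holomorphic functions and later for log d near a
  pole.\<close>

lemma nn_integral_rotation:
 fixes u :: "complex^'n => ennreal"
 assumes u: "u \<in> borel_measurable borel" and \<delta>: "\<delta> > 0"
 shows "(\<integral>\<^sup>+\<zeta>. (\<integral>\<^sup>+\<theta>\<in>{0..2*pi}. u (a + cis \<theta> *s \<zeta>) \<partial>lborel) * indicator (ball 0 \<delta>) \<zeta> \<partial>lborel)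
    = ennreal (2*pi) * (\<integral>\<^sup>+w. u w * indicator (ball a \<delta>) w \<partial>lborel)"
proof -
 have ib: "indicator (ball 0 \<delta>) \<zeta> = (indicator (ball a \<delta>) (a + cis \<theta> *s \<zeta>) :: ennreal)" for \<theta> and \<zeta> :: "complex^'n"
  by (simp add: indicator_def dist_norm)
 have cm: "continuous_on UNIV (%p. a + cis (fst p) *s (snd p :: complex^'n))"
  by (intro continuous_intros)
 have m0: "(%p. a + cis (fst p) *s (snd p :: complex^'n)) \<in> borel_measurable (borel \<Otimes>\<^sub>M borel)"
  unfolding borel_prod by (rule borel_measurable_continuous_onI[OF cm])
 define F where "F = (%\<theta> \<zeta>. u (a + cis \<theta> *s \<zeta>) * indicator (ball a \<delta>) (a + cis \<theta> *s \<zeta>) * indicator {0..2*pi} \<theta>)"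
 have mu: "(%w. u w * indicator (ball a \<delta>) w) \<in> borel_measurable borel"
  using u by (intro borel_measurable_times_ennreal borel_measurable_indicator) auto
 have mF: "case_prod F \<in> borel_measurable (lborel \<Otimes>\<^sub>M lborel)"
 proof -
  have "(%p. (%w. u w * indicator (ball a \<delta>) w) (a + cis (fst p) *s (snd p)) * indicator {0..2*pi} (fst p)) \<in> borel_measurable (borel \<Otimes>\<^sub>M borel)"
   using measurable_compose[OF m0 mu] by simp
  then show ?thesis by (simp add: F_def case_prod_beta')
 qed
 have "(\<integral>\<^sup>+\<zeta>. (\<integral>\<^sup>+\<theta>\<in>{0..2*pi}. u (a + cis \<theta> *s \<zeta>) \<partial>lborel) * indicator (ball 0 \<delta>) \<zeta> \<partial>lborel)
   = (\<integral>\<^sup>+\<zeta>. (\<integral>\<^sup>+\<theta>. F \<theta> \<zeta> \<partial>lborel) \<partial>lborel)"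
 proof (rule nn_integral_cong)
  fix \<zeta> :: "complex^'n"
  have "(%\<theta>. u (a + cis \<theta> *s \<zeta>) * indicator {0..2*pi} \<theta>) \<in> borel_measurable lborel"
  proof -
   have "(%\<theta>. a + cis \<theta> *s \<zeta>) \<in> borel_measurable borel"
    by (intro borel_measurable_continuous_onI continuous_intros)
   from measurable_compose[OF this u] show ?thesis by simp
  qed
  then have "(\<integral>\<^sup>+\<theta>\<in>{0..2*pi}. u (a + cis \<theta> *s \<zeta>) \<partial>lborel) * indicator (ball 0 \<delta>) \<zeta>
   = (\<integral>\<^sup>+\<theta>. u (a + cis \<theta> *s \<zeta>) * indicator {0..2*pi} \<theta> * indicator (ball 0 \<delta>) \<zeta> \<partial>lborel)"
   by (rule nn_integral_multc[symmetric])
  also have "... = (\<integral>\<^sup>+\<theta>. F \<theta> \<zeta> \<partial>lborel)"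
   by (intro nn_integral_cong) (simp add: F_def ib[symmetric] mult_ac)
  finally show "(\<integral>\<^sup>+\<theta>\<in>{0..2*pi}. u (a + cis \<theta> *s \<zeta>) \<partial>lborel) * indicator (ball 0 \<delta>) \<zeta> = (\<integral>\<^sup>+\<theta>. F \<theta> \<zeta> \<partial>lborel)" .
 qed
 also have "... = (\<integral>\<^sup>+\<theta>. (\<integral>\<^sup>+\<zeta>. F \<theta> \<zeta> \<partial>lborel) \<partial>lborel)"
  by (rule lborel_pair.Fubini'[OF mF])
 also have "... = (\<integral>\<^sup>+\<theta>. (\<integral>\<^sup>+w. u w * indicator (ball a \<delta>) w \<partial>lborel) * indicator {0..2*pi} \<theta> \<partial>(lborel :: real measure))"
 proof (rule nn_integral_cong)
  fix \<theta> :: real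
  have m: "(%\<zeta>. a + cis \<theta> *s \<zeta>) \<in> borel_measurable (borel :: (complex^'n) measure)"
   by (intro borel_measurable_continuous_onI continuous_intros)
  have "(\<integral>\<^sup>+w. u w * indicator (ball a \<delta>) w \<partial>lborel) = (\<integral>\<^sup>+w. u w * indicator (ball a \<delta>) w \<partial>distr lborel borel (%\<zeta>. a + cis \<theta> *s \<zeta>))"
   by (simp add: lborel_distr_rotation)
  also have "... = (\<integral>\<^sup>+\<zeta>. u (a + cis \<theta> *s \<zeta>) * indicator (ball a \<delta>) (a + cis \<theta> *s \<zeta>) \<partial>lborel)"
   by (rule nn_integral_distr) (use m mu in auto)
  finally have *: "(\<integral>\<^sup>+w. u w * indicator (ball a \<delta>) w \<partial>lborel) = (\<integral>\<^sup>+\<zeta>. u (a + cis \<theta> *s \<zeta>) * indicator (ball a \<delta>) (a + cis \<theta> *s \<zeta>) \<partial>lborel)" .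
  have "(%\<zeta>. u (a + cis \<theta> *s \<zeta>) * indicator (ball a \<delta>) (a + cis \<theta> *s \<zeta>)) \<in> borel_measurable lborel"
   using measurable_compose[OF m mu] by simp
  then show "(\<integral>\<^sup>+\<zeta>. F \<theta> \<zeta> \<partial>lborel) = (\<integral>\<^sup>+w. u w * indicator (ball a \<delta>) w \<partial>lborel) * indicator {0..2*pi} \<theta>"
   unfolding * F_def by (rule nn_integral_multc)
 qed
 also have "... = (\<integral>\<^sup>+w. u w * indicator (ball a \<delta>) w \<partial>lborel) * ennreal (2*pi)"
  by (subst nn_integral_cmult) (auto simp: pi_ge_zero)
 finally show ?thesis by (simp add: mult.commute)
qed

subsection \<open>Point evaluations\<close>

text \<open>Cauchy's formula is applied to the square of \<open>h\<close>, so that the norm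
  inequality for integrals immediately produces the mean of the squared modulus.\<close>

lemma circle_square_mean:
 assumes h: "h holomorphic_on ball 0 R" and R: "R > 1"
 shows "ennreal (2*pi * (cmod (h 0))\<^sup>2) <= (\<integral>\<^sup>+\<theta>\<in>{0..2*pi}. ennreal ((cmod (h (cis \<theta>)))\<^sup>2) \<partial>lborel)"
proof -
 have sub: "cball 0 1 \<subseteq> (ball 0 R :: complex set)" using R by auto
 have h2: "(%z. (h z)\<^sup>2) holomorphic_on cball 0 1"
  by (intro holomorphic_on_power holomorphic_on_subset[OF h sub])
 have "((%u. (h u)\<^sup>2 / (u - 0)) has_contour_integral (2 * of_real pi * \<i> * (h 0)\<^sup>2)) (circlepath 0 1)"
  by (rule Cauchy_integral_circlepath_simple[OF h2]) simp
 then have "((%t. (h (cis t))\<^sup>2 / cis t * \<i> * cis t) has_integral (2 * of_real pi * \<i> * (h 0)\<^sup>2)) {0..2*pi}"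
  unfolding circlepath_def by (subst (asm) has_contour_integral_part_circlepath_iff) auto
 then have "((%t. \<i> * (h (cis t))\<^sup>2) has_integral (2 * of_real pi * \<i> * (h 0)\<^sup>2)) {0..2*pi}"
  by (simp add: field_simps)
 from has_integral_mult_right[OF this, of "- \<i>"]
 have I: "((%t. (h (cis t))\<^sup>2) has_integral (2 * of_real pi * (h 0)\<^sup>2)) {0..2*pi}"
  by (simp add: algebra_simps)
 have ch: "continuous_on {0..2*pi} (%t. h (cis t))"
  by (rule continuous_on_compose2[OF holomorphic_on_imp_continuous_on[OF h]]) (use R in \<open>auto intro!: continuous_intros\<close>)
 have ci: "continuous_on {0..2*pi} (%t. (cmod (h (cis t)))\<^sup>2)" by (intro continuous_intros ch)
 have "norm (2 * of_real pi * (h 0)\<^sup>2) <= integral {0..2*pi} (%t. (cmod (h (cis t)))\<^sup>2)"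
  using integral_norm_bound_integral[of "%t. (h (cis t))\<^sup>2" "{0..2*pi}" "%t. (cmod (h (cis t)))\<^sup>2"] I
   integrable_continuous_interval[OF ci] by (auto simp: has_integral_iff norm_power)
 then have "2 * pi * (cmod (h 0))\<^sup>2 <= integral {0..2*pi} (%t. (cmod (h (cis t)))\<^sup>2)"
  by (simp add: norm_mult norm_power)
 also have "... = (LINT t:{0..2*pi}|lborel. (cmod (h (cis t)))\<^sup>2)"
  using set_borel_integral_eq_integral(2)[OF borel_integrable_atLeastAtMost'[OF ci]] by simp
 finally have "ennreal (2*pi * (cmod (h 0))\<^sup>2) <= ennreal (LINT t:{0..2*pi}|lborel. (cmod (h (cis t)))\<^sup>2)"
  by (rule ennreal_leI)
 also have "... = (\<integral>\<^sup>+t. ennreal (indicator {0..2*pi} t *\<^sub>R (cmod (h (cis t)))\<^sup>2) \<partial>lborel)"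
  unfolding set_lebesgue_integral_def
  by (rule nn_integral_eq_integral[symmetric])
    (use borel_integrable_atLeastAtMost'[OF ci] in \<open>auto simp: set_integrable_def\<close>)
 also have "... = (\<integral>\<^sup>+\<theta>\<in>{0..2*pi}. ennreal ((cmod (h (cis \<theta>)))\<^sup>2) \<partial>lborel)"
  by (intro nn_integral_cong) (auto simp: indicator_def)
 finally show ?thesis .
qed

text \<open>The Bergman space without the requirement that its members be \<open>undefined\<close>
  off the domain; in this form it is closed under pointwise operations.\<close>

definition A2 :: "(complex^'n) set => (complex^'n => complex) set" where
 "A2 \<Omega> = {f. holo_fun \<Omega> f \<and> set_integrable lborel \<Omega> (%z. (cmod (f z))\<^sup>2)}"

definition ip :: "(complex^'n) set => (complex^'n => complex) => (complex^'n => complex) => complex" where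
 "ip \<Omega> f g = (LINT z:\<Omega>|lborel. f z * cnj (g z))"

definition nrm2 :: "(complex^'n) set => (complex^'n => complex) => real" where
 "nrm2 \<Omega> f = (LINT z:\<Omega>|lborel. (cmod (f z))\<^sup>2)"

locale domain =
 fixes \<Omega> :: "(complex^'n) set"
 assumes open_dom: "open \<Omega>" and bounded_dom: "bounded \<Omega>"
begin

lemma A2_holo: "f \<in> A2 \<Omega> ==> holo_fun \<Omega> f" by (simp add: A2_def)

lemma A2_integrable: "f \<in> A2 \<Omega> ==> set_integrable lborel \<Omega> (%z. (cmod (f z))\<^sup>2)" by (simp add: A2_def)

lemma A2_integrable_mult:
 assumes f: "f \<in> A2 \<Omega>" and g: "g \<in> A2 \<Omega>"
 shows "set_integrable lborel \<Omega> (%z. f z * cnj (g z))"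
proof (rule set_integrable_bound)
 show "set_integrable lborel \<Omega> (%z. (cmod (f z))\<^sup>2 + (cmod (g z))\<^sup>2)"
  using assms by (intro set_integral_add) (auto simp: A2_def)
 show "set_borel_measurable lborel \<Omega> (%z. f z * cnj (g z))"
  by (intro set_borel_measurable_continuous_open open_dom continuous_intros holo_fun_continuous A2_holo f g)
 have "cmod (f z * cnj (g z)) <= (cmod (f z))\<^sup>2 + (cmod (g z))\<^sup>2" for z
 proof -
  have "0 <= cmod (f z) * cmod (g z)" by simp
  then show ?thesis
   using sum_squares_bound[of "cmod (f z)" "cmod (g z)"] unfolding norm_mult complex_mod_cnj mult.assoc by linarith
 qed
 then show "AE z in lborel. z \<in> \<Omega> \<longrightarrow> norm (f z * cnj (g z)) <= norm ((cmod (f z))\<^sup>2 + (cmod (g z))\<^sup>2)"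
  by (intro AE_I2 impI) (simp add: abs_of_nonneg)
qed

lemma A2_add: 
 assumes f: "f \<in> A2 \<Omega>" and g: "g \<in> A2 \<Omega>" shows "(%z. f z + g z) \<in> A2 \<Omega>"
proof -
 have h: "holo_fun \<Omega> (%z. f z + g z)" by (intro holo_fun_add A2_holo f g)
 have "set_integrable lborel \<Omega> (%z. (cmod (f z + g z))\<^sup>2)"
 proof (rule set_integrable_bound)
  show "set_integrable lborel \<Omega> (%z. 2 * (cmod (f z))\<^sup>2 + 2 * (cmod (g z))\<^sup>2)"
   using assms by (intro set_integral_add) (auto simp: A2_def)
  show "set_borel_measurable lborel \<Omega> (%z. (cmod (f z + g z))\<^sup>2)"
   by (intro set_borel_measurable_continuous_open open_dom continuous_intros holo_fun_continuous A2_holo f g)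
  have "(cmod (f z + g z))\<^sup>2 <= 2 * (cmod (f z))\<^sup>2 + 2 * (cmod (g z))\<^sup>2" for z
  proof -
   have "(cmod (f z + g z))\<^sup>2 <= (cmod (f z) + cmod (g z))\<^sup>2" by (intro power_mono norm_triangle_ineq) auto
   also have "... <= 2 * (cmod (f z))\<^sup>2 + 2 * (cmod (g z))\<^sup>2"
    using sum_squares_bound[of "cmod (f z)" "cmod (g z)"] by (simp add: power2_sum)
   finally show ?thesis .
  qed
  then show "AE z in lborel. z \<in> \<Omega> \<longrightarrow> norm ((cmod (f z + g z))\<^sup>2) <= norm (2 * (cmod (f z))\<^sup>2 + 2 * (cmod (g z))\<^sup>2)"
   by (intro AE_I2 impI) (simp add: abs_of_nonneg)
 qed
 with h show ?thesis by (simp add: A2_def)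
qed

lemma A2_cmult: "f \<in> A2 \<Omega> ==> (%z. c * f z) \<in> A2 \<Omega>"
 by (auto simp: A2_def norm_mult power_mult_distrib intro: holo_fun_cmult)

lemma A2_diff: "f \<in> A2 \<Omega> ==> g \<in> A2 \<Omega> ==> (%z. f z - g z) \<in> A2 \<Omega>"
 using A2_add[of f "%z. (-1) * g z"] A2_cmult[of g "-1"] by simp

lemma A2_cong: "(!!z. z \<in> \<Omega> ==> f z = g z) ==> f \<in> A2 \<Omega> ==> g \<in> A2 \<Omega>"
 using holo_fun_cong[OF open_dom, of f g] set_integrable_cong[of lborel lborel \<Omega> \<Omega> "%z. (cmod (f z))\<^sup>2" "%z. (cmod (g z))\<^sup>2"]
 by (auto simp: A2_def)

lemma ip_cong: "(!!z. z \<in> \<Omega> ==> f z = f' z) ==> (!!z. z \<in> \<Omega> ==> g z = g' z) ==> ip \<Omega> f g = ip \<Omega> f' g'"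
 unfolding ip_def by (rule set_lebesgue_integral_cong) (use open_dom in auto)

lemma A2_holo_bounded:
 assumes f: "holo_fun \<Omega> f" and M: "!!z. z \<in> \<Omega> ==> cmod (f z) <= M"
 shows "f \<in> A2 \<Omega>"
proof -
 have "set_integrable lborel \<Omega> (%_. M\<^sup>2)"
  using open_dom emeasure_bounded_finite[OF bounded_dom] by (auto simp: set_integrable_def)
 then have "set_integrable lborel \<Omega> (%z. (cmod (f z))\<^sup>2)"
 proof (rule set_integrable_bound)
  show "set_borel_measurable lborel \<Omega> (%z. (cmod (f z))\<^sup>2)"
   by (intro set_borel_measurable_continuous_open open_dom continuous_intros holo_fun_continuous f)
  show "AE z in lborel. z \<in> \<Omega> \<longrightarrow> norm ((cmod (f z))\<^sup>2) <= norm (M\<^sup>2)"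
   by (intro AE_I2 impI) (auto intro!: power_mono M)
 qed
 with f show ?thesis by (simp add: A2_def)
qed

lemma ip_add_left: "f \<in> A2 \<Omega> ==> g \<in> A2 \<Omega> ==> h \<in> A2 \<Omega> ==> ip \<Omega> (%z. f z + g z) h = ip \<Omega> f h + ip \<Omega> g h"
 unfolding ip_def by (subst set_integral_add(2)[symmetric]) (auto intro: A2_integrable_mult simp: distrib_right)

lemma ip_cnj: "cnj (ip \<Omega> f g) = ip \<Omega> g f"
proof -
 have "cnj (ip \<Omega> f g) = (LINT z|lborel. cnj (indicator \<Omega> z *\<^sub>R (f z * cnj (g z))))"
  unfolding ip_def set_lebesgue_integral_def by (rule Bochner_Integration.integral_cnj[symmetric])
 then show ?thesis unfolding ip_def set_lebesgue_integral_def by (simp add: mult.commute)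
qed

lemma ip_add_right: "f \<in> A2 \<Omega> ==> g \<in> A2 \<Omega> ==> h \<in> A2 \<Omega> ==> ip \<Omega> h (%z. f z + g z) = ip \<Omega> h f + ip \<Omega> h g"
 using arg_cong[OF ip_add_left[of f g h], of cnj] by (simp add: ip_cnj)

lemma ip_cmult_left: "ip \<Omega> (%z. c * f z) g = c * ip \<Omega> f g"
 unfolding ip_def by (simp add: mult.assoc)

lemma ip_cmult_right: "ip \<Omega> f (%z. c * g z) = cnj c * ip \<Omega> f g"
 using arg_cong[OF ip_cmult_left[of c g f], of cnj] by (simp add: ip_cnj)

lemma ip_diff_left: "f \<in> A2 \<Omega> ==> g \<in> A2 \<Omega> ==> h \<in> A2 \<Omega> ==> ip \<Omega> (%z. f z - g z) h = ip \<Omega> f h - ip \<Omega> g h"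
 using ip_add_left[of f "%z. (-1) * g z" h] A2_cmult[of g "-1"] ip_cmult_left[of "-1" g h] by simp

lemma ip_diff_right: "f \<in> A2 \<Omega> ==> g \<in> A2 \<Omega> ==> h \<in> A2 \<Omega> ==> ip \<Omega> h (%z. f z - g z) = ip \<Omega> h f - ip \<Omega> h g"
 using arg_cong[OF ip_diff_left[of f g h], of cnj] by (simp add: ip_cnj)

lemma ip_self: "ip \<Omega> f f = complex_of_real (nrm2 \<Omega> f)"
proof -
 have "ip \<Omega> f f = (LINT z:\<Omega>|lborel. complex_of_real ((cmod (f z))\<^sup>2))"
  unfolding ip_def by (simp only: complex_norm_square)
 also have "... = complex_of_real (nrm2 \<Omega> f)"
  unfolding nrm2_def set_lebesgue_integral_def
  by (subst integral_complex_of_real[symmetric]) (simp add: scaleR_conv_of_real)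
 finally show ?thesis .
qed

lemma nrm2_nonneg: "0 <= nrm2 \<Omega> f"
 unfolding nrm2_def set_lebesgue_integral_def by (rule integral_nonneg_AE) auto

lemma nrm2_add:
 assumes "f \<in> A2 \<Omega>" "g \<in> A2 \<Omega>"
 shows "nrm2 \<Omega> (%z. f z + c * g z) = nrm2 \<Omega> f + 2 * Re (cnj c * ip \<Omega> f g) + (cmod c)\<^sup>2 * nrm2 \<Omega> g"
proof -
 have c: "(%z. c * g z) \<in> A2 \<Omega>" by (rule A2_cmult) fact
 have "complex_of_real (nrm2 \<Omega> (%z. f z + c * g z)) = ip \<Omega> f f + ip \<Omega> f (%z. c * g z) + (ip \<Omega> (%z. c * g z) f + ip \<Omega> (%z. c * g z) (%z. c * g z))"
  unfolding ip_self[symmetric] using assms c by (simp add: ip_add_left ip_add_right A2_add)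
 also have "... = complex_of_real (nrm2 \<Omega> f) + (cnj c * ip \<Omega> f g + cnj (cnj c * ip \<Omega> f g)) + complex_of_real ((cmod c)\<^sup>2 * nrm2 \<Omega> g)"
  by (simp add: ip_cmult_left ip_cmult_right ip_self ip_cnj complex_norm_square[symmetric] mult.assoc[symmetric] del: of_real_power)
 finally have "complex_of_real (nrm2 \<Omega> (%z. f z + c * g z)) = complex_of_real (nrm2 \<Omega> f + 2 * Re (cnj c * ip \<Omega> f g) + (cmod c)\<^sup>2 * nrm2 \<Omega> g)"
  by (simp only: complex_add_cnj of_real_add)
 then show ?thesis by (simp only: of_real_eq_iff)
qed

text \<open>Adding to \<open>f\<close> the multiple of \<open>g\<close> by t<f,g> with real t makes
  the cross term equal to 2t|<f,g>|^2. The optimal t gives the claim; if \<open>g\<close> has norm 0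
  the expression is affine in t, and being nonnegative it must be constant.\<close>

lemma ip_Cauchy_Schwarz:
 assumes "f \<in> A2 \<Omega>" "g \<in> A2 \<Omega>"
 shows "(cmod (ip \<Omega> f g))\<^sup>2 <= nrm2 \<Omega> f * nrm2 \<Omega> g"
proof -
 let ?p = "ip \<Omega> f g"
 have *: "0 <= nrm2 \<Omega> f + 2 * t * (cmod ?p)\<^sup>2 + t\<^sup>2 * (cmod ?p)\<^sup>2 * nrm2 \<Omega> g" for t :: real
 proof -
  have "Re (cnj (of_real t * ?p) * ?p) = t * (cmod ?p)\<^sup>2"
   unfolding cmod_power2 by (simp add: power2_eq_square algebra_simps)
  then show ?thesis
   using nrm2_add[OF assms, of "of_real t * ?p"] nrm2_nonneg[of "%z. f z + of_real t * ?p * g z"]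
   by (simp add: norm_mult power_mult_distrib)
 qed
 show ?thesis
 proof (cases "nrm2 \<Omega> g = 0")
  case True
  have "(cmod ?p)\<^sup>2 <= 0"
  proof (rule ccontr)
   assume "\<not> (cmod ?p)\<^sup>2 <= 0"
   then have p: "(cmod ?p)\<^sup>2 > 0" by simp
   have "0 <= nrm2 \<Omega> f + 2 * (- (nrm2 \<Omega> f + 1) / (2 * (cmod ?p)\<^sup>2)) * (cmod ?p)\<^sup>2"
    using *[of "- (nrm2 \<Omega> f + 1) / (2 * (cmod ?p)\<^sup>2)"] True by simp
   also have "... = -1" using p by (simp add: field_simps)
   finally show False by simp
  qed
  then show ?thesis using True by simp
 next
  case False
  then have g: "nrm2 \<Omega> g > 0" using nrm2_nonneg[of g] by simp
  have "0 <= nrm2 \<Omega> f - (cmod ?p)\<^sup>2 / nrm2 \<Omega> g"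
   using *[of "- 1 / nrm2 \<Omega> g"] g by (simp add: power2_eq_square)
  then show ?thesis using g by (simp add: field_simps)
 qed
qed

text \<open>The circle mean inequality on the complex lines through \<open>w\<close>, averaged over
  a ball by \<open>nn_integral_rotation\<close>.\<close>

lemma point_evaluation_bound:
 assumes f: "f \<in> A2 \<Omega>" and \<delta>: "\<delta> > 0" and b: "ball w \<delta> \<subseteq> \<Omega>"
 shows "(cmod (f w))\<^sup>2 * measure lborel (ball (0::complex^'n) \<delta>) <= nrm2 \<Omega> f"
proof -
 define u where "u z = ennreal (indicator \<Omega> z *\<^sub>R (cmod (f z))\<^sup>2)" for z
 have u: "u \<in> borel_measurable borel"
  using borel_measurable_integrable[OF A2_integrable[OF f, unfolded set_integrable_def]] by (simp add: u_def[abs_def])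
 have fb: "holo_fun (ball w \<delta>) f" using A2_holo[OF f] b by (rule holo_fun_subset)
 have "ennreal (2*pi * (cmod (f w))\<^sup>2) * indicator (ball 0 \<delta>) \<zeta>
   <= (\<integral>\<^sup>+\<theta>\<in>{0..2*pi}. u (w + cis \<theta> *s \<zeta>) \<partial>lborel) * indicator (ball 0 \<delta>) \<zeta>" for \<zeta> :: "complex^'n"
 proof (cases "\<zeta> \<in> ball 0 \<delta>")
  case z: True
  have "ennreal (2*pi * (cmod (f w))\<^sup>2) <= (\<integral>\<^sup>+\<theta>\<in>{0..2*pi}. ennreal ((cmod (f (w + cis \<theta> *s \<zeta>)))\<^sup>2) \<partial>lborel)"
  proof (cases "\<zeta> = 0")
   case True
   have "ennreal (2*pi * (cmod (f w))\<^sup>2) = (\<integral>\<^sup>+\<theta>\<in>{0..2*pi}. ennreal ((cmod (f w))\<^sup>2) \<partial>(lborel::real measure))"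
    by (subst nn_integral_cmult) (auto simp: ennreal_mult'' mult.commute)
   then show ?thesis by (simp add: True)
  next
   case False
   define R where "R = \<delta> / norm \<zeta>"
   have R: "R > 1" using z False by (simp add: R_def)
   have "(%t::complex. f (w + t *s \<zeta>)) holomorphic_on ball 0 R"
    unfolding holomorphic_on_def
   proof
    fix t :: complex assume t: "t \<in> ball 0 R"
    have "w + t *s \<zeta> \<in> ball w \<delta>"
     using t False by (simp add: dist_norm R_def field_simps)
    then have "cmi.slice w \<zeta> t \<in> ball w \<delta>" by (simp add: slice_cmi)
    from cmi.slice_derivative[OF _ this] fb
    show "(%t. f (w + t *s \<zeta>)) field_differentiable (at t within ball 0 R)"
     unfolding slice_cmi holo_fun_iff_jholo by (meson field_differentiable_at_within field_differentiable_def)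
   qed
   from circle_square_mean[OF this R] show ?thesis by simp
  qed
  also have "... = (\<integral>\<^sup>+\<theta>\<in>{0..2*pi}. u (w + cis \<theta> *s \<zeta>) \<partial>lborel)"
  proof -
   have "w + cis \<theta> *s \<zeta> \<in> \<Omega>" for \<theta> using b z by (auto simp: dist_norm intro!: subsetD[OF b])
   then show ?thesis by (simp add: u_def)
  qed
  finally show ?thesis using z by simp
 qed simp
 then have "(\<integral>\<^sup>+\<zeta>. ennreal (2*pi * (cmod (f w))\<^sup>2) * indicator (ball 0 \<delta>) \<zeta> \<partial>(lborel :: (complex^'n) measure))
   <= (\<integral>\<^sup>+\<zeta>. (\<integral>\<^sup>+\<theta>\<in>{0..2*pi}. u (w + cis \<theta> *s \<zeta>) \<partial>lborel) * indicator (ball 0 \<delta>) \<zeta> \<partial>lborel)"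
  by (rule nn_integral_mono)
 also have "... = ennreal (2*pi) * (\<integral>\<^sup>+z. u z * indicator (ball w \<delta>) z \<partial>lborel)"
  by (rule nn_integral_rotation[OF u \<delta>])
 also have "... <= ennreal (2*pi) * (\<integral>\<^sup>+z. u z \<partial>lborel)"
  by (intro mult_left_mono nn_integral_mono) (auto simp: indicator_def)
 also have "(\<integral>\<^sup>+z. u z \<partial>lborel) = ennreal (nrm2 \<Omega> f)"
  unfolding u_def nrm2_def set_lebesgue_integral_def
  by (rule nn_integral_eq_integral) (use A2_integrable[OF f] in \<open>auto simp: set_integrable_def\<close>)
 finally have "ennreal (2*pi * (cmod (f w))\<^sup>2) * emeasure lborel (ball (0::complex^'n) \<delta>) <= ennreal (2*pi) * ennreal (nrm2 \<Omega> f)"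
  by (simp add: nn_integral_cmult_indicator)
 moreover have "emeasure lborel (ball (0::complex^'n) \<delta>) = ennreal (measure lborel (ball (0::complex^'n) \<delta>))"
  by (rule emeasure_eq_ennreal_measure) (use emeasure_bounded_finite[OF bounded_ball, of "0::complex^'n" \<delta>] in auto)
 ultimately have "ennreal (2*pi * (cmod (f w))\<^sup>2 * measure lborel (ball (0::complex^'n) \<delta>)) <= ennreal (2*pi * nrm2 \<Omega> f)"
  by (simp add: ennreal_mult'' [symmetric] measure_nonneg nrm2_nonneg)
 then have "2*pi * (cmod (f w))\<^sup>2 * measure lborel (ball (0::complex^'n) \<delta>) <= 2*pi * nrm2 \<Omega> f"
  by (subst (asm) ennreal_le_iff) (auto simp: nrm2_nonneg)
 then show ?thesis by (simp add: mult.assoc)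
qed

lemma local_bound:
 assumes z: "z \<in> \<Omega>"
 obtains r C where "r > 0" "C > 0" "ball z r \<subseteq> \<Omega>"
  "!!f w. f \<in> A2 \<Omega> ==> w \<in> ball z r ==> (cmod (f w))\<^sup>2 <= C * nrm2 \<Omega> f"
proof -
 obtain r where r: "r > 0" "ball z r \<subseteq> \<Omega>" using open_dom z openE by blast
 define V where "V = measure lborel (ball (0::complex^'n) (r/2))"
 have V: "V > 0" using r content_ball_pos[of "r/2" "0::complex^'n"] by (simp add: V_def)
 show ?thesis
 proof (rule that[of "r/2" "1 / V"])
  show "ball z (r/2) \<subseteq> \<Omega>" using r subset_ball[of "r/2" r z] by auto
  show "(cmod (f w))\<^sup>2 <= 1 / V * nrm2 \<Omega> f" if "f \<in> A2 \<Omega>" "w \<in> ball z (r/2)" for f w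
  proof -
   have "ball w (r/2) \<subseteq> ball z r"
   proof
    fix y assume "y \<in> ball w (r/2)"
    then show "y \<in> ball z r" using that dist_triangle[of z y w] by simp
   qed
   then have "(cmod (f w))\<^sup>2 * V <= nrm2 \<Omega> f"
    unfolding V_def using that r by (intro point_evaluation_bound) auto
   then show ?thesis using V by (simp add: field_simps)
  qed
 qed (use r V in auto)
qed

text \<open>Bounded point evaluations make the norm definite pointwise and not just almost
  everywhere; uniqueness of representers rests on this.\<close>

lemma nrm2_eq_0:
 assumes "f \<in> A2 \<Omega>" "nrm2 \<Omega> f = 0" "z \<in> \<Omega>"
 shows "f z = 0"
proof -
 obtain r C where rC: "r > 0" "!!f w. f \<in> A2 \<Omega> ==> w \<in> ball z r ==> (cmod (f w))\<^sup>2 <= C * nrm2 \<Omega> f"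
  using local_bound[OF assms(3)] by metis
 have "(cmod (f z))\<^sup>2 <= C * nrm2 \<Omega> f" using rC(2)[OF assms(1), of z] rC(1) by simp
 then show ?thesis using assms by simp
qed

end

section \<open>Completeness, Riesz representation and reproducing kernels\<close>

context domain
begin

lemma nrm2_cmult: "nrm2 \<Omega> (%z. c * f z) = (cmod c)\<^sup>2 * nrm2 \<Omega> f"
 unfolding nrm2_def by (simp add: norm_mult power_mult_distrib)

lemma A2_zero: "(%_. 0) \<in> A2 \<Omega>"
 by (rule A2_holo_bounded[of _ 0]) auto

lemma A2_sum_bound:
 assumes "f \<in> A2 \<Omega>" "g \<in> A2 \<Omega>"
 shows "nrm2 \<Omega> (%z. f z - g z) = 2 * nrm2 \<Omega> f + 2 * nrm2 \<Omega> g - 4 * nrm2 \<Omega> (%z. 1/2 * (f z + g z))"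
proof -
 have "nrm2 \<Omega> (%z. 1/2 * (f z + g z)) = (cmod (1/2))\<^sup>2 * nrm2 \<Omega> (%z. f z + g z)" by (rule nrm2_cmult)
 then show ?thesis
  using nrm2_add[OF assms, of 1] nrm2_add[OF assms, of "-1"] by (simp add: power2_eq_square)
qed

text \<open>Point evaluations are bounded locally uniformly, so a Cauchy sequence in norm converges
  locally uniformly to a holomorphic function. Fatou's lemma shows that this function is also the
  limit in norm.\<close>

lemma A2_complete:
 assumes F: "!!n. F n \<in> A2 \<Omega>"
  and C: "!!e. e > 0 ==> \<exists>N. \<forall>m\<ge>N. \<forall>n\<ge>N. nrm2 \<Omega> (%z. F m z - F n z) <= e"
 obtains G where "G \<in> A2 \<Omega>" "(%n. nrm2 \<Omega> (%z. F n z - G z)) \<longlonglongrightarrow> 0"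
proof -
 have unif: "\<exists>r>0. ball z r \<subseteq> \<Omega> \<and> (\<forall>e>0. \<exists>N. \<forall>m\<ge>N. \<forall>n\<ge>N. \<forall>w\<in>ball z r. cmod (F m w - F n w) < e)
   \<and> (\<exists>C>0. \<forall>f\<in>A2 \<Omega>. \<forall>w\<in>ball z r. (cmod (f w))\<^sup>2 <= C * nrm2 \<Omega> f)" if z: "z \<in> \<Omega>" for z
 proof -
  obtain r C' where r: "r > 0" "C' > 0" "ball z r \<subseteq> \<Omega>"
   and b: "!!f w. f \<in> A2 \<Omega> ==> w \<in> ball z r ==> (cmod (f w))\<^sup>2 <= C' * nrm2 \<Omega> f"
   using local_bound[OF z] by metis
  have "\<exists>N. \<forall>m\<ge>N. \<forall>n\<ge>N. \<forall>w\<in>ball z r. cmod (F m w - F n w) < e" if e: "e > 0" for e :: real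
  proof -
   obtain N where N: "!!m n. m \<ge> N ==> n \<ge> N ==> nrm2 \<Omega> (%z. F m z - F n z) <= e\<^sup>2 / (2 * C')"
    using C[of "e\<^sup>2 / (2 * C')"] e r by auto
   have "cmod (F m w - F n w) < e" if "m \<ge> N" "n \<ge> N" "w \<in> ball z r" for m n w
   proof (rule power2_less_imp_less)
    have "(cmod (F m w - F n w))\<^sup>2 <= C' * nrm2 \<Omega> (%z. F m z - F n z)"
     by (rule b[OF A2_diff[OF F F] that(3)])
    also have "... <= C' * (e\<^sup>2 / (2 * C'))" by (intro mult_left_mono N that) (use r in auto)
    also have "... < e\<^sup>2" using r e by simp
    finally show "(cmod (F m w - F n w))\<^sup>2 < e\<^sup>2" .
   qed (use e in auto)
   then show ?thesis by blast
  qed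
  then show ?thesis using r b by blast
 qed
 have conv: "convergent (%n. F n z)" if z: "z \<in> \<Omega>" for z
 proof (rule Cauchy_convergent, rule metric_CauchyI)
  fix e :: real assume "e > 0"
  then obtain r N where "r > 0" "\<forall>m\<ge>N. \<forall>n\<ge>N. \<forall>w\<in>ball z r. cmod (F m w - F n w) < e" using unif[OF z] by blast
  then show "\<exists>M. \<forall>m\<ge>M. \<forall>n\<ge>M. dist (F m z) (F n z) < e"
   by (intro exI[of _ N]) (auto simp: dist_norm)
 qed
 define G where "G z = lim (%n. F n z)" for z
 have lim: "(%n. F n z) \<longlonglongrightarrow> G z" if "z \<in> \<Omega>" for z
  using conv[OF that] by (simp add: G_def convergent_LIMSEQ_iff)
 have "jholo cmi \<Omega> G"
 proof (rule jholoI)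
  fix z assume z: "z \<in> \<Omega>"
  then obtain r C' where r: "r > 0" "ball z r \<subseteq> \<Omega>"
   and u: "!!e. e > 0 ==> \<exists>N. \<forall>m\<ge>N. \<forall>n\<ge>N. \<forall>w\<in>ball z r. cmod (F m w - F n w) < e"
   and C': "!!f w. f \<in> A2 \<Omega> ==> w \<in> ball z r ==> (cmod (f w))\<^sup>2 <= C' * nrm2 \<Omega> f"
   using unif[OF z] by blast
  obtain N where N: "!!m n w. m \<ge> N ==> n \<ge> N ==> w \<in> ball z r ==> cmod (F m w - F n w) < 1"
   using u[of 1] zero_less_one by meson
  show "\<exists>A. (G has_derivative A) (at z) \<and> (\<forall>v. A (cmi v) = \<i> * A v)"
  proof (rule cmi.jholo_limit[where F = "%n. F (n + N)" and r = r])
   show "jholo cmi (ball z r) (F (n + N))" for n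
    unfolding holo_fun_iff_jholo[symmetric] by (rule holo_fun_subset[OF A2_holo[OF F] r(2)])
   show "cmod (F (n + N) w) <= sqrt (C' * nrm2 \<Omega> (F N)) + 1" if w: "w \<in> ball z r" for n w
   proof -
    have "cmod (F N w) <= sqrt (C' * nrm2 \<Omega> (F N))" by (rule real_le_rsqrt) (rule C'[OF F w])
    moreover have "cmod (F (n + N) w) <= cmod (F (n + N) w - F N w) + cmod (F N w)"
     by (metis diff_add_cancel norm_triangle_ineq)
    ultimately show ?thesis using N[of "n + N" N w] w by simp
   qed
   show "uniformly_Cauchy_on (ball z r) (%n. F (n + N))"
    unfolding uniformly_Cauchy_on_def
   proof (intro allI impI)
    fix e :: real assume "e > 0"
    then obtain N' where "\<forall>m\<ge>N'. \<forall>n\<ge>N'. \<forall>w\<in>ball z r. cmod (F m w - F n w) < e" using u by blast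
    then show "\<exists>M. \<forall>x\<in>ball z r. \<forall>m\<ge>M. \<forall>n\<ge>M. dist (F (m + N) x) (F (n + N) x) < e"
     by (intro exI[of _ N']) (auto simp: dist_norm)
   qed
   show "(%n. F (n + N) w) \<longlonglongrightarrow> G w" if "w \<in> ball z r" for w
    using LIMSEQ_ignore_initial_segment[OF lim] that r by blast
  qed (use r in auto)
 qed
 then have hG: "holo_fun \<Omega> G" by (simp add: holo_fun_iff_jholo)
 \<comment> \<open>Fatou's lemma in the second index: a bound on F n - F m for all large m is
   inherited by F n - G.\<close>
 have fat: "(%z. F n z - G z) \<in> A2 \<Omega> \<and> nrm2 \<Omega> (%z. F n z - G z) <= e"
  if e: "e > 0" and N: "!!m n. m \<ge> N ==> n \<ge> N ==> nrm2 \<Omega> (%z. F m z - F n z) <= e" and n: "n \<ge> N" for e N n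
 proof -
  have h: "holo_fun \<Omega> (%z. F n z - G z)" by (intro holo_fun_diff A2_holo F hG)
  let ?g = "%z. indicator \<Omega> z *\<^sub>R (cmod (F n z - G z))\<^sup>2 :: real"
  let ?f = "%m z. indicator \<Omega> z *\<^sub>R (cmod (F n z - F m z))\<^sup>2 :: real"
  have mg: "?g \<in> borel_measurable lborel"
   using set_borel_measurable_continuous_open[OF open_dom, of "%z. (cmod (F n z - G z))\<^sup>2"]
   by (simp add: set_borel_measurable_def continuous_intros holo_fun_continuous[OF h])
  have If: "(\<integral>\<^sup>+z. ennreal (?f m z) \<partial>lborel) = ennreal (nrm2 \<Omega> (%z. F n z - F m z))" for m
   unfolding nrm2_def set_lebesgue_integral_def
   by (rule nn_integral_eq_integral) (use A2_integrable[OF A2_diff[OF F F]] in \<open>auto simp: set_integrable_def\<close>)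
  have "(\<integral>\<^sup>+z. ennreal (?g z) \<partial>lborel) = (\<integral>\<^sup>+z. liminf (%m. ennreal (?f m z)) \<partial>lborel)"
  proof (rule nn_integral_cong)
   fix z
   have "(%m. ?f m z) \<longlonglongrightarrow> ?g z"
    by (cases "z \<in> \<Omega>") (auto intro!: tendsto_intros lim)
   then have "(%m. ennreal (?f m z)) \<longlonglongrightarrow> ennreal (?g z)" by (rule tendsto_ennrealI)
   then show "ennreal (?g z) = liminf (%m. ennreal (?f m z))"
    using lim_imp_Liminf trivial_limit_sequentially by metis
  qed
  also have "... <= liminf (%m. \<integral>\<^sup>+z. ennreal (?f m z) \<partial>lborel)"
   by (rule nn_integral_liminf)
     (use borel_measurable_integrable[OF A2_integrable[OF A2_diff[OF F F], unfolded set_integrable_def]] in simp)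
  also have "... <= limsup (%m. \<integral>\<^sup>+z. ennreal (?f m z) \<partial>lborel)"
   by (rule Liminf_le_Limsup) simp
  also have "... <= ennreal e"
   unfolding If by (rule Limsup_bounded) (use N n in \<open>auto simp: eventually_sequentially intro!: ennreal_leI\<close>)
  finally have le: "(\<integral>\<^sup>+z. ennreal (?g z) \<partial>lborel) <= ennreal e" .
  have int: "integrable lborel ?g"
   by (rule integrableI_nonneg) (use mg le in \<open>auto simp: less_top[symmetric] top_unique\<close>)
  then have "ennreal (nrm2 \<Omega> (%z. F n z - G z)) <= ennreal e"
   using le nn_integral_eq_integral[OF int] by (simp add: nrm2_def set_lebesgue_integral_def)
  then show ?thesis using int h e by (simp add: A2_def set_integrable_def)
 qed
 have "G \<in> A2 \<Omega>"
 proof -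
  obtain N where "!!m n. m \<ge> N ==> n \<ge> N ==> nrm2 \<Omega> (%z. F m z - F n z) <= 1" using C[of 1] by auto
  then have "(%z. F N z - G z) \<in> A2 \<Omega>" using fat[of 1 N N] by auto
  from A2_diff[OF F[of N] this] show ?thesis by simp
 qed
 moreover have "(%n. nrm2 \<Omega> (%z. F n z - G z)) \<longlonglongrightarrow> 0"
 proof (rule LIMSEQ_I)
  fix e :: real assume e: "e > 0"
  then obtain N where N: "!!m n. m \<ge> N ==> n \<ge> N ==> nrm2 \<Omega> (%z. F m z - F n z) <= e/2" using C[of "e/2"] by auto
  have "nrm2 \<Omega> (%z. F n z - G z) < e" if "n \<ge> N" for n
   using fat[of "e/2" N n] N that e by auto
  then show "\<exists>no. \<forall>n\<ge>no. norm (nrm2 \<Omega> (%z. F n z - G z) - 0) < e" using nrm2_nonneg by auto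
 qed
 ultimately show ?thesis using that by blast
qed

text \<open>The representer minimises ||f||^2 - 2 Re l(f). Minimising sequences are Cauchy by the
  parallelogram law, and the first variation at the minimum identifies the real part of
  \<open>l\<close>; testing with \<open>\<i> * g\<close> gives the imaginary part.\<close>

lemma Riesz_representation:
 assumes add: "!!f g. f \<in> A2 \<Omega> ==> g \<in> A2 \<Omega> ==> l (%z. f z + g z) = l f + l g"
  and cm: "!!f c. f \<in> A2 \<Omega> ==> l (%z. c * f z) = c * l f"
  and bd: "!!f. f \<in> A2 \<Omega> ==> (cmod (l f))\<^sup>2 <= C * nrm2 \<Omega> f"
 shows "\<exists>k\<in>A2 \<Omega>. \<forall>f\<in>A2 \<Omega>. l f = ip \<Omega> f k"
proof -
 define \<Phi> where "\<Phi> f = nrm2 \<Omega> f - 2 * Re (l f)" for f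
 have lower: "- \<bar>C\<bar> <= \<Phi> f" if f: "f \<in> A2 \<Omega>" for f
 proof -
  have "2 * cmod (l f) <= \<bar>C\<bar> + nrm2 \<Omega> f"
  proof (rule power2_le_imp_le)
   have "(2 * cmod (l f))\<^sup>2 <= 4 * (C * nrm2 \<Omega> f)" using bd[OF f] by (simp add: power_mult_distrib)
   also have "... <= 4 * (\<bar>C\<bar> * nrm2 \<Omega> f)" by (intro mult_left_mono mult_right_mono nrm2_nonneg) auto
   also have "... <= (\<bar>C\<bar> + nrm2 \<Omega> f)\<^sup>2"
    using zero_le_power2[of "\<bar>C\<bar> - nrm2 \<Omega> f"] by (simp add: power2_eq_square algebra_simps)
   finally show "(2 * cmod (l f))\<^sup>2 <= (\<bar>C\<bar> + nrm2 \<Omega> f)\<^sup>2" .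
  qed (simp add: nrm2_nonneg)
  then show ?thesis using abs_Re_le_cmod[of "l f"] by (simp add: \<Phi>_def)
 qed
 define m where "m = Inf (\<Phi> ` A2 \<Omega>)"
 have bdd: "bdd_below (\<Phi> ` A2 \<Omega>)" using lower by (auto intro!: bdd_belowI)
 have m: "m <= \<Phi> f" if "f \<in> A2 \<Omega>" for f
  unfolding m_def using bdd that by (auto intro: cInf_lower)
 have "\<exists>f\<in>A2 \<Omega>. \<Phi> f < m + 1 / (real n + 1)" for n
  using cInf_lessD[of "\<Phi> ` A2 \<Omega>" "m + 1 / (real n + 1)"] A2_zero unfolding m_def by auto
 then obtain F where F: "!!n. F n \<in> A2 \<Omega>" and Fm: "!!n. \<Phi> (F n) < m + 1 / (real n + 1)" by metis
 have par: "nrm2 \<Omega> (%z. f z - g z) <= 2 * \<Phi> f + 2 * \<Phi> g - 4 * m" if f: "f \<in> A2 \<Omega>" and g: "g \<in> A2 \<Omega>" for f g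
 proof -
  have h: "(%z. 1/2 * (f z + g z)) \<in> A2 \<Omega>" by (intro A2_cmult A2_add f g)
  have "l (%z. 1/2 * (f z + g z)) = 1/2 * (l f + l g)"
   by (subst cm) (auto intro: A2_add f g simp: add f g)
  then have "4 * Re (l (%z. 1/2 * (f z + g z))) = 2 * Re (l f) + 2 * Re (l g)" by (simp only:) simp
  then show ?thesis using m[OF h] A2_sum_bound[OF f g] by (simp add: \<Phi>_def)
 qed
 have "\<exists>N. \<forall>m\<ge>N. \<forall>n\<ge>N. nrm2 \<Omega> (%z. F m z - F n z) <= e" if e: "e > 0" for e :: real
 proof -
  obtain N :: nat where N: "4 / e < real N" using reals_Archimedean2 by blast
  have "nrm2 \<Omega> (%z. F i z - F j z) <= e" if "i \<ge> N" "j \<ge> N" for i j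
  proof -
   have "4 / e < real i + 1" "4 / e < real j + 1" using that N by linarith+
   then have "4 * (1 / (real i + 1)) < e" "4 * (1 / (real j + 1)) < e" using e by (auto simp: field_simps)
   then show ?thesis using par[OF F[of i] F[of j]] Fm[of i] Fm[of j] by linarith
  qed
  then show ?thesis by blast
 qed
 from A2_complete[OF F this] obtain G where G: "G \<in> A2 \<Omega>" and GF: "(%n. nrm2 \<Omega> (%z. F n z - G z)) \<longlonglongrightarrow> 0" by blast
 have re: "Re (ip \<Omega> G g) = Re (l g)" if g: "g \<in> A2 \<Omega>" for g
 proof -
  have lim: "(%n. ip \<Omega> (F n) g) \<longlonglongrightarrow> ip \<Omega> G g"
  proof (rule LIM_zero_cancel, rule tendsto_norm_zero_cancel)
   have "(%n. sqrt (nrm2 \<Omega> (%z. F n z - G z) * nrm2 \<Omega> g)) \<longlonglongrightarrow> sqrt (0 * nrm2 \<Omega> g)"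
    by (intro tendsto_intros GF)
   then have l0: "(%n. sqrt (nrm2 \<Omega> (%z. F n z - G z) * nrm2 \<Omega> g)) \<longlonglongrightarrow> 0" by simp
   have "cmod (ip \<Omega> (F n) g - ip \<Omega> G g) <= sqrt (nrm2 \<Omega> (%z. F n z - G z) * nrm2 \<Omega> g)" for n
    using ip_Cauchy_Schwarz[OF A2_diff[OF F[of n] G] g] by (simp add: ip_diff_left F G g real_le_rsqrt)
   then show "(%n. cmod (ip \<Omega> (F n) g - ip \<Omega> G g)) \<longlonglongrightarrow> 0"
    by (intro Lim_null_comparison[OF _ l0]) auto
  qed
  define a where "a = Re (ip \<Omega> G g) - Re (l g)"
  define b where "b = nrm2 \<Omega> g"
  have b0: "b \<ge> 0" by (simp add: b_def nrm2_nonneg)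
  have "0 <= 2 * t * a + t\<^sup>2 * b" for t :: real
  proof (rule LIMSEQ_le_const)
   have l1: "(%n. 1 / (real n + 1)) \<longlonglongrightarrow> 0"
    using LIMSEQ_inverse_real_of_nat by (simp add: inverse_eq_divide add.commute)
   have "(%n. 1 / (real n + 1) + (2 * t * (Re (ip \<Omega> (F n) g) - Re (l g)) + t\<^sup>2 * b)) \<longlonglongrightarrow> 0 + (2 * t * (Re (ip \<Omega> G g) - Re (l g)) + t\<^sup>2 * b)"
    by (intro tendsto_intros lim l1)
   then show "(%n. 1 / (real n + 1) + (2 * t * (Re (ip \<Omega> (F n) g) - Re (l g)) + t\<^sup>2 * b)) \<longlonglongrightarrow> 2 * t * a + t\<^sup>2 * b"
    by (simp add: a_def)
   have "0 <= 1 / (real n + 1) + (2 * t * (Re (ip \<Omega> (F n) g) - Re (l g)) + t\<^sup>2 * b)" for n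
   proof -
    have h: "(%z. of_real t * g z) \<in> A2 \<Omega>" by (intro A2_cmult g)
    have "\<Phi> (%z. F n z + of_real t * g z) = \<Phi> (F n) + (2 * t * (Re (ip \<Omega> (F n) g) - Re (l g)) + t\<^sup>2 * b)"
     using nrm2_add[OF F[of n] g, of "of_real t"]
     by (simp add: \<Phi>_def add[OF F h] cm[OF g] b_def algebra_simps)
    moreover have "m <= \<Phi> (%z. F n z + of_real t * g z)" by (intro m A2_add F h)
    ultimately show ?thesis using Fm[of n] by linarith
   qed
   then show "\<exists>N. \<forall>n\<ge>N. 0 <= 1 / (real n + 1) + (2 * t * (Re (ip \<Omega> (F n) g) - Re (l g)) + t\<^sup>2 * b)" by blast
  qed
  \<comment> \<open>The quadratic polynomial 2ta + t^2 b in t is never negative, but at this t it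
    would be, unless a = 0. The added 1 covers the case b = 0.\<close>
  from this[of "- a / (b + 1)"] have "0 <= (2 * (- a / (b + 1)) * a + (- a / (b + 1))\<^sup>2 * b) * (b + 1)\<^sup>2"
   by (intro mult_nonneg_nonneg) auto
  also have "... = - 2 * a\<^sup>2 * (b + 1) + a\<^sup>2 * b"
  proof -
   have "(2 * (- a / c) * a + (- a / c)\<^sup>2 * b) * c\<^sup>2 = - 2 * a\<^sup>2 * c + a\<^sup>2 * b" if "c > 0" for c
    using that by (simp add: field_simps power2_eq_square)
   from this[of "b + 1"] show ?thesis using b0 by simp
  qed
  also have "... = - (a\<^sup>2 * (b + 2))" by (simp add: algebra_simps)
  finally have "a\<^sup>2 * (b + 2) <= 0" by simp
  then have "a = 0" using b0 by (simp add: mult_le_0_iff)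
  then show ?thesis by (simp add: a_def)
 qed
 have "l g = ip \<Omega> g G" if g: "g \<in> A2 \<Omega>" for g
 proof -
  have "Re (ip \<Omega> g G) = Re (ip \<Omega> G g)" by (subst ip_cnj[symmetric]) simp
  then have 1: "Re (l g) = Re (ip \<Omega> g G)" using re[OF g] by simp
  have "Re (ip \<Omega> (%z. \<i> * g z) G) = Re (ip \<Omega> G (%z. \<i> * g z))" by (subst ip_cnj[symmetric]) simp
  then have "Re (l (%z. \<i> * g z)) = Re (ip \<Omega> (%z. \<i> * g z) G)" using re[OF A2_cmult[OF g, of \<i>]] by simp
  then have "Im (l g) = Im (ip \<Omega> g G)" by (simp add: cm[OF g] ip_cmult_left)
  with 1 show ?thesis by (simp add: complex_eq_iff)
 qed
 then show ?thesis using G by blast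
qed

definition kk :: "complex^'n => complex^'n => complex" where
 "kk w = (SOME k. k \<in> A2 \<Omega> \<and> (\<forall>f\<in>A2 \<Omega>. f w = ip \<Omega> f k))"

text \<open>The representer of the derivative at \<open>w\<close> along \<open>v\<close>. Together
  with \<open>kk w\<close> it enters the Gram determinant that describes the Bergman metric.\<close>

definition dk :: "complex^'n => complex^'n => complex^'n => complex" where
 "dk w v = (SOME k. k \<in> A2 \<Omega> \<and> (\<forall>f\<in>A2 \<Omega>. fd f w v = ip \<Omega> f k))"

lemma kk:
 assumes w: "w \<in> \<Omega>"
 shows "kk w \<in> A2 \<Omega>" "f \<in> A2 \<Omega> ==> ip \<Omega> f (kk w) = f w"
proof -
 obtain r C where "r > 0" and C: "!!f z. f \<in> A2 \<Omega> ==> z \<in> ball w r ==> (cmod (f z))\<^sup>2 <= C * nrm2 \<Omega> f"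
  using local_bound[OF w] by metis
 then have "\<exists>k\<in>A2 \<Omega>. \<forall>f\<in>A2 \<Omega>. f w = ip \<Omega> f k"
  by (intro Riesz_representation[of "%f. f w" C]) auto
 then have "kk w \<in> A2 \<Omega> \<and> (\<forall>f\<in>A2 \<Omega>. f w = ip \<Omega> f (kk w))"
  unfolding kk_def by (intro someI_ex[of "%k. k \<in> A2 \<Omega> \<and> (\<forall>f\<in>A2 \<Omega>. f w = ip \<Omega> f k)"]) blast
 then show "kk w \<in> A2 \<Omega>" "f \<in> A2 \<Omega> ==> ip \<Omega> f (kk w) = f w" by auto
qed

lemma dk:
 assumes w: "w \<in> \<Omega>"
 shows "dk w v \<in> A2 \<Omega>" "f \<in> A2 \<Omega> ==> ip \<Omega> f (dk w v) = fd f w v"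
proof -
 obtain r C where r: "r > 0" "C > 0" "ball w r \<subseteq> \<Omega>"
  and C: "!!f z. f \<in> A2 \<Omega> ==> z \<in> ball w r ==> (cmod (f z))\<^sup>2 <= C * nrm2 \<Omega> f"
  using local_bound[OF w] by metis
 have "\<exists>k\<in>A2 \<Omega>. \<forall>f\<in>A2 \<Omega>. fd f w v = ip \<Omega> f k"
 proof (rule Riesz_representation)
  fix f g c assume f: "f \<in> A2 \<Omega>"
  have df: "f differentiable (at w)" using holo_fun_differentiable[OF A2_holo[OF f] w] .
  show "fd (%z. c * f z) w v = c * fd f w v" by (rule fd_linear_combination(2)[OF df df])
  have "cmod (fd f w v) <= 4 * sqrt (C * nrm2 \<Omega> f) / r * norm v"
  proof (rule cmi.jholo_deriv_bound)
   show "jholo cmi (ball w r) f"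
    unfolding holo_fun_iff_jholo[symmetric] by (rule holo_fun_subset[OF A2_holo[OF f] r(3)])
   show "cmod (f z) <= sqrt (C * nrm2 \<Omega> f)" if "z \<in> ball w r" for z
    by (rule real_le_rsqrt) (rule C[OF f that])
  qed (use r in auto)
  then have "(cmod (fd f w v))\<^sup>2 <= (4 * sqrt (C * nrm2 \<Omega> f) / r * norm v)\<^sup>2" by (intro power_mono) auto
  also have "... = 16 * C / r\<^sup>2 * (norm v)\<^sup>2 * nrm2 \<Omega> f"
   using r nrm2_nonneg[of f] by (simp add: power_mult_distrib power_divide real_sqrt_pow2)
  finally show "(cmod (fd f w v))\<^sup>2 <= 16 * C / r\<^sup>2 * (norm v)\<^sup>2 * nrm2 \<Omega> f" .
  assume g: "g \<in> A2 \<Omega>"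
  have dg: "g differentiable (at w)" using holo_fun_differentiable[OF A2_holo[OF g] w] .
  show "fd (%z. f z + g z) w v = fd f w v + fd g w v" by (rule fd_linear_combination(1)[OF df dg])
 qed
 then have "dk w v \<in> A2 \<Omega> \<and> (\<forall>f\<in>A2 \<Omega>. fd f w v = ip \<Omega> f (dk w v))"
  unfolding dk_def by (intro someI_ex[of "%k. k \<in> A2 \<Omega> \<and> (\<forall>f\<in>A2 \<Omega>. fd f w v = ip \<Omega> f k)"]) blast
 then show "dk w v \<in> A2 \<Omega>" "f \<in> A2 \<Omega> ==> ip \<Omega> f (dk w v) = fd f w v" by auto
qed

text \<open>Restricting the representer to the domain makes it extensional, and among extensional
  functions it is the unique solution that the definite description asks for.\<close>

lemma bergman_kernel_eq:
 assumes w: "w \<in> \<Omega>" and z: "z \<in> \<Omega>"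
 shows "bergman_kernel \<Omega> z w = kk w z"
proof -
 let ?P = "%k. k \<in> bergman_space \<Omega> \<and> (\<forall>f\<in>bergman_space \<Omega>. f w = (LINT \<zeta>:\<Omega>|lborel. f \<zeta> * cnj (k \<zeta>)))"
 have bs: "f \<in> bergman_space \<Omega> \<longleftrightarrow> f \<in> extensional \<Omega> \<and> f \<in> A2 \<Omega>" for f
  by (auto simp: bergman_space_def A2_def)
 define k where "k = restrict (kk w) \<Omega>"
 have kA: "k \<in> A2 \<Omega>" by (rule A2_cong[OF _ kk(1)[OF w]]) (simp add: k_def)
 have ipk: "ip \<Omega> f k = ip \<Omega> f (kk w)" for f by (rule ip_cong) (auto simp: k_def)
 have kP: "?P k"
 proof (intro conjI ballI)
  show "k \<in> bergman_space \<Omega>" unfolding bs using kA by (simp add: k_def)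
  show "f w = (LINT \<zeta>:\<Omega>|lborel. f \<zeta> * cnj (k \<zeta>))" if "f \<in> bergman_space \<Omega>" for f
   using kk(2)[OF w, of f] ipk[of f] that by (simp add: bs ip_def)
 qed
 have uniq: "k' = k" if k': "?P k'" for k'
 proof (rule extensionalityI[of _ \<Omega>])
  show e: "k' \<in> extensional \<Omega>" "k \<in> extensional \<Omega>" using k' kP by (auto simp: bs)
  have k'A: "k' \<in> A2 \<Omega>" using k' by (auto simp: bs)
  let ?d = "%z. k' z - k z"
  have dA: "?d \<in> A2 \<Omega>" by (rule A2_diff[OF k'A kA])
  define d where "d = restrict ?d \<Omega>"
  have dB: "d \<in> bergman_space \<Omega>" unfolding bs using A2_cong[OF _ dA, of d] by (auto simp: d_def)
  have ipd: "ip \<Omega> d h = ip \<Omega> ?d h" for h by (rule ip_cong) (auto simp: d_def)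
  have "ip \<Omega> d k' = d w" "ip \<Omega> d k = d w" using k' kP dB by (auto simp: ip_def)
  then have "ip \<Omega> ?d k' - ip \<Omega> ?d k = 0" by (simp add: ipd)
  then have "complex_of_real (nrm2 \<Omega> ?d) = 0"
   unfolding ip_self[symmetric] using dA k'A kA by (simp add: ip_diff_right)
  then show "k' z = k z" if "z \<in> \<Omega>" for z using nrm2_eq_0[OF dA _ that] by simp
 qed
 have "(THE k. ?P k) = k" by (rule the_equality[of ?P, OF kP]) (rule uniq)
 then show ?thesis unfolding bergman_kernel_def using z by (simp add: k_def)
qed

lemma kk_symmetric: "z \<in> \<Omega> ==> w \<in> \<Omega> ==> kk w z = cnj (kk z w)"
 using kk(2)[of z "kk w"] kk(2)[of w "kk z"] kk(1)[of w] kk(1)[of z] ip_cnj[of "kk z" "kk w"] by metis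

lemma kk_diagonal: "z \<in> \<Omega> ==> kk z z = of_real (nrm2 \<Omega> (kk z))"
 using kk(2)[of z "kk z"] kk(1)[of z] ip_self[of "kk z"] by metis

text \<open>Constants are square integrable because the domain is bounded, so evaluation at
  \<open>z\<close> is not the zero functional and the logarithm of the kernel makes sense.\<close>

lemma nrm2_kk_pos:
 assumes z: "z \<in> \<Omega>" shows "nrm2 \<Omega> (kk z) > 0"
proof (rule ccontr)
 assume "\<not> ?thesis"
 then have 0: "nrm2 \<Omega> (kk z) = 0" using nrm2_nonneg[of "kk z"] by simp
 have A: "(%_. 1) \<in> A2 \<Omega>" by (rule A2_holo_bounded[of _ 1]) auto
 have "(cmod (ip \<Omega> (%_. 1) (kk z)))\<^sup>2 <= 0"
  using ip_Cauchy_Schwarz[OF A kk(1)[OF z]] 0 by simp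
 then show False using kk(2)[OF z A] by simp
qed

end

section \<open>Second derivatives\<close>

lemma has_derivative_fd: "(f has_derivative A) (at z) ==> fd f z u = A u"
 by (metis frechet_derivative_at)

definition d2 :: "('a::real_normed_vector => real) => 'a => 'a => 'a => real" where
 "d2 f z a b = fd (%x. fd f x b) z a"

lemma fd_Basis_expansion:
 fixes f :: "'a::euclidean_space => real"
 assumes "f differentiable (at z)"
 shows "fd f z u = (\<Sum>b\<in>Basis. (u \<bullet> b) * fd f z b)"
proof -
 have "fd f z u = fd f z (\<Sum>b\<in>Basis. (u \<bullet> b) *\<^sub>R b)" by (simp add: euclidean_representation)
 also have "... = (\<Sum>b\<in>Basis. fd f z ((u \<bullet> b) *\<^sub>R b))"
  by (rule linear_sum[OF linear_frechet_derivative[OF assms]])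
 finally show ?thesis by (simp add: fd_scaleR[OF assms])
qed

text \<open>\<open>Ck_on\<close> speaks only of basis directions; linearity of the derivative in its
  direction carries the regularity over to all directions.\<close>

lemma C2_facts:
 fixes f :: "'a::euclidean_space => real"
 assumes S: "open S" and f: "Ck_on 2 S f"
 shows C2_differentiable: "z \<in> S ==> f differentiable (at z)"
  and C2_differentiable2: "z \<in> S ==> (%x. fd f x u) differentiable (at z)"
  and C2_d2_expansion: "z \<in> S ==> d2 f z a u = (\<Sum>i\<in>Basis. \<Sum>j\<in>Basis. (a \<bullet> i) * (u \<bullet> j) * d2 f z i j)"
  and C2_d2_continuous: "continuous_on S (%x. d2 f x a u)"
proof -
 have d1: "f differentiable (at z)" if "z \<in> S" for z using f that by (simp add: numeral_2_eq_2)
 show "z \<in> S ==> f differentiable (at z)" by (rule d1)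
 have dB: "(%x. fd f x b) differentiable (at z)" if "z \<in> S" "b \<in> Basis" for z b
  using f that by (simp add: numeral_2_eq_2)
 have cB: "continuous_on S (%x. d2 f x c b)" if "b \<in> Basis" "c \<in> Basis" for b c
  using f that by (simp add: numeral_2_eq_2 d2_def)
 have der: "((%x. fd f x u) has_derivative (%a. \<Sum>b\<in>Basis. (u \<bullet> b) * d2 f z a b)) (at z)" if z: "z \<in> S" for z u
 proof (rule has_derivative_transform_within_open[OF _ S z])
  show "((%x. \<Sum>b\<in>Basis. (u \<bullet> b) * fd f x b) has_derivative (%a. \<Sum>b\<in>Basis. (u \<bullet> b) * d2 f z a b)) (at z)"
   unfolding d2_def
   by (intro has_derivative_sum has_derivative_mult_right frechet_derivative_works[THEN iffD1] dB z)
  show "(\<Sum>b\<in>Basis. (u \<bullet> b) * fd f x b) = fd f x u" if "x \<in> S" for x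
   by (rule fd_Basis_expansion[symmetric, OF d1[OF that]])
 qed
 show "z \<in> S ==> (%x. fd f x u) differentiable (at z)" using der differentiable_def by blast
 have ex: "d2 f z a u = (\<Sum>i\<in>Basis. \<Sum>j\<in>Basis. (a \<bullet> i) * (u \<bullet> j) * d2 f z i j)" if z: "z \<in> S" for z a u
 proof -
  have "d2 f z a u = (\<Sum>b\<in>Basis. (u \<bullet> b) * d2 f z a b)"
   unfolding d2_def[of f z a u] by (rule has_derivative_fd[OF der[OF z]])
  also have "... = (\<Sum>b\<in>Basis. (u \<bullet> b) * (\<Sum>i\<in>Basis. (a \<bullet> i) * d2 f z i b))"
   by (intro sum.cong refl arg_cong2[where f = "(*)"]) (simp add: d2_def fd_Basis_expansion[OF dB[OF z], where u = a])
  also have "... = (\<Sum>b\<in>Basis. \<Sum>i\<in>Basis. (a \<bullet> i) * (u \<bullet> b) * d2 f z i b)"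
   by (simp add: sum_distrib_left mult_ac)
  finally show ?thesis by (subst sum.swap)
 qed
 show "z \<in> S ==> d2 f z a u = (\<Sum>i\<in>Basis. \<Sum>j\<in>Basis. (a \<bullet> i) * (u \<bullet> j) * d2 f z i j)" by (rule ex)
 have "continuous_on S (%x. \<Sum>i\<in>Basis. \<Sum>j\<in>Basis. (a \<bullet> i) * (u \<bullet> j) * d2 f x i j)"
  by (intro continuous_intros cB)
 then show "continuous_on S (%x. d2 f x a u)" by (simp add: ex cong: continuous_on_cong)
qed

lemma C2_d2_continuous_joint:
 fixes f :: "'a::euclidean_space => real"
 assumes "open S" "Ck_on 2 S f"
 shows "continuous_on (S \<times> UNIV) (%(x, v). d2 f x v v)"
proof -
 have c: "continuous_on (S \<times> (UNIV::'a set)) (%p. d2 f (fst p) i j)" for i j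
  by (rule continuous_on_compose2[OF C2_d2_continuous[OF assms]]) (auto intro!: continuous_intros)
 have "continuous_on (S \<times> UNIV) (%p. \<Sum>i\<in>Basis. \<Sum>j\<in>Basis. (snd p \<bullet> i) * (snd p \<bullet> j) * d2 f (fst p) i j)"
  by (intro continuous_intros c)
 then show ?thesis
  by (rule continuous_on_eq) (clarsimp, rule C2_d2_expansion[OF assms, symmetric])
qed

lemma complex_vec_expansion:
 "(v :: complex^'n) = (\<Sum>k\<in>UNIV. Re (v $ k) *\<^sub>R axis k 1 + Im (v $ k) *\<^sub>R axis k \<i>)"
proof -
 have "(\<Sum>k\<in>UNIV. Re (v $ k) *\<^sub>R axis k 1 + Im (v $ k) *\<^sub>R axis k \<i>) $ i = v $ i" for i
 proof -
  have "(\<Sum>k\<in>UNIV. Re (v $ k) *\<^sub>R axis k 1 + Im (v $ k) *\<^sub>R axis k \<i>) $ i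
   = (\<Sum>k\<in>UNIV. if k = i then v $ i else 0)"
   unfolding sum_component by (intro sum.cong refl) (auto simp: axis_def complex_eq_iff)
  then show ?thesis by simp
 qed
 then show ?thesis by (simp add: vec_eq_iff)
qed

lemma fd_axis_expansion:
 fixes f :: "complex^'n => real"
 assumes d: "f differentiable (at z)"
 shows "fd f z v = (\<Sum>k\<in>UNIV. Re (v $ k) * fd f z (axis k 1) + Im (v $ k) * fd f z (axis k \<i>))"
proof -
 have "fd f z v = fd f z (\<Sum>k\<in>UNIV. Re (v $ k) *\<^sub>R axis k 1 + Im (v $ k) *\<^sub>R axis k \<i>)"
  by (rule arg_cong[OF complex_vec_expansion])
 also have "... = (\<Sum>k\<in>UNIV. fd f z (Re (v $ k) *\<^sub>R axis k 1 + Im (v $ k) *\<^sub>R axis k \<i>))"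
  by (rule linear_sum[OF linear_frechet_derivative[OF d]])
 finally show ?thesis by (simp add: fd_scaleR[OF d] fd_add[OF d])
qed

lemma i_ddbar_scale: "i_ddbar f z (c *s u) (c *s v) = (cmod c)\<^sup>2 * i_ddbar f z u v"
proof -
 have "(\<Sum>j\<in>UNIV. \<Sum>k\<in>UNIV. wirt j (wirt_bar k (%w. complex_of_real (f w))) z
         * ((c *s u) $ j * cnj ((c *s v) $ k) - (c *s v) $ j * cnj ((c *s u) $ k)))
  = of_real ((cmod c)\<^sup>2) * (\<Sum>j\<in>UNIV. \<Sum>k\<in>UNIV. wirt j (wirt_bar k (%w. complex_of_real (f w))) z
         * (u $ j * cnj (v $ k) - v $ j * cnj (u $ k)))"
  unfolding sum_distrib_left complex_norm_square by (intro sum.cong refl) (simp add: algebra_simps)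
 then show ?thesis unfolding i_ddbar_def by (simp add: mult.left_commute[of \<i>])
qed

text \<open>On the pair (v, iv) the Levi form is half the Laplacian along the complex line of
  \<open>v\<close>. Test forms, curvature and the Bergman metric all enter through this value, which
  is what circle means detect.\<close>

lemma i_ddbar_eq_d2:
 fixes f :: "complex^'n => real"
 assumes S: "open S" and f: "Ck_on 2 S f" and z: "z \<in> S"
 shows "i_ddbar f z v (cmi v) = (d2 f z v v + d2 f z (cmi v) (cmi v)) / 2"
proof -
 let ?F = "%w. complex_of_real (f w)"
 have F1: "fd ?F w u = complex_of_real (fd f w u)" if "w \<in> S" for w u
 proof -
  have "(?F has_derivative (%u. complex_of_real (fd f w u))) (at w)"
   by (intro has_derivative_of_real frechet_derivative_works[THEN iffD1] C2_differentiable[OF S f that])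
  then show ?thesis by (rule has_derivative_fd)
 qed
 define G where "G k w = (complex_of_real (fd f w (axis k 1)) + \<i> * complex_of_real (fd f w (axis k \<i>))) / 2" for k w
 have wb: "wirt_bar k ?F w = G k w" if "w \<in> S" for k w
  by (simp add: wirt_bar_def G_def F1[OF that])
 have fG: "fd (wirt_bar k ?F) z u = (complex_of_real (d2 f z u (axis k 1)) + \<i> * complex_of_real (d2 f z u (axis k \<i>))) / 2" for k u
 proof -
  have "(G k has_derivative (%u. (complex_of_real (d2 f z u (axis k 1)) + \<i> * complex_of_real (d2 f z u (axis k \<i>))) / 2)) (at z)"
   unfolding G_def d2_def
   by (rule bounded_linear.has_derivative[OF bounded_linear_divide], intro has_derivative_add has_derivative_mult_right has_derivative_of_real
      frechet_derivative_works[THEN iffD1] C2_differentiable2[OF S f z])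
  then have "fd (G k) z u = (complex_of_real (d2 f z u (axis k 1)) + \<i> * complex_of_real (d2 f z u (axis k \<i>))) / 2"
   by (rule has_derivative_fd)
  moreover have "fd (wirt_bar k ?F) z = fd (G k) z" by (rule fd_cong_open[OF S z]) (rule wb)
  ultimately show ?thesis by simp
 qed
 define X where "X = d2 f z"
 have w: "wirt j (wirt_bar k ?F) z = (complex_of_real (X (axis j 1) (axis k 1)) + \<i> * complex_of_real (X (axis j 1) (axis k \<i>))
    - \<i> * (complex_of_real (X (axis j \<i>) (axis k 1)) + \<i> * complex_of_real (X (axis j \<i>) (axis k \<i>)))) / 4" for j k
  by (simp add: wirt_def fG X_def field_simps)
 define Q where "Q u b j k = Re (u $ j) * Re (b $ k) * X (axis j 1) (axis k 1) + Re (u $ j) * Im (b $ k) * X (axis j 1) (axis k \<i>)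
    + Im (u $ j) * Re (b $ k) * X (axis j \<i>) (axis k 1) + Im (u $ j) * Im (b $ k) * X (axis j \<i>) (axis k \<i>)"
  for u b :: "complex^'n" and j k
 have exp: "X u b = (\<Sum>j\<in>UNIV. \<Sum>k\<in>UNIV. Q u b j k)" for u b
 proof -
  have b1: "X a b = (\<Sum>k\<in>UNIV. Re (b $ k) * X a (axis k 1) + Im (b $ k) * X a (axis k \<i>))" for a
  proof -
   have "((%x. fd f x b) has_derivative (%a. \<Sum>k\<in>UNIV. Re (b $ k) * X a (axis k 1) + Im (b $ k) * X a (axis k \<i>))) (at z)"
   proof (rule has_derivative_transform_within_open[OF _ S z])
    show "((%x. \<Sum>k\<in>UNIV. Re (b $ k) * fd f x (axis k 1) + Im (b $ k) * fd f x (axis k \<i>)) has_derivative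
       (%a. \<Sum>k\<in>UNIV. Re (b $ k) * X a (axis k 1) + Im (b $ k) * X a (axis k \<i>))) (at z)"
     unfolding X_def d2_def
     by (intro has_derivative_sum has_derivative_add has_derivative_mult_right frechet_derivative_works[THEN iffD1] C2_differentiable2[OF S f z])
    show "(\<Sum>k\<in>UNIV. Re (b $ k) * fd f x (axis k 1) + Im (b $ k) * fd f x (axis k \<i>)) = fd f x b" if "x \<in> S" for x
     by (rule fd_axis_expansion[symmetric, OF C2_differentiable[OF S f that]])
   qed
   from has_derivative_fd[OF this] show ?thesis unfolding X_def d2_def .
  qed
  have a1: "X u c = (\<Sum>j\<in>UNIV. Re (u $ j) * X (axis j 1) c + Im (u $ j) * X (axis j \<i>) c)" for c
   unfolding X_def d2_def by (rule fd_axis_expansion[OF C2_differentiable2[OF S f z]])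
  have "X u b = (\<Sum>k\<in>UNIV. Re (b $ k) * (\<Sum>j\<in>UNIV. Re (u $ j) * X (axis j 1) (axis k 1) + Im (u $ j) * X (axis j \<i>) (axis k 1))
    + Im (b $ k) * (\<Sum>j\<in>UNIV. Re (u $ j) * X (axis j 1) (axis k \<i>) + Im (u $ j) * X (axis j \<i>) (axis k \<i>)))"
   by (subst b1) (simp only: a1[symmetric])
  also have "... = (\<Sum>k\<in>UNIV. \<Sum>j\<in>UNIV. Q u b j k)"
   unfolding sum_distrib_left sum.distrib[symmetric] Q_def by (intro sum.cong refl) (simp add: algebra_simps)
  finally show ?thesis by (subst (asm) sum.swap)
 qed
 have "i_ddbar f z v (cmi v) = (\<Sum>j\<in>UNIV. \<Sum>k\<in>UNIV. Re (\<i> * (wirt j (wirt_bar k ?F) z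
         * (v $ j * cnj (cmi v $ k) - cmi v $ j * cnj (v $ k)))))"
  unfolding i_ddbar_def by (simp only: sum_distrib_left Re_sum)
 \<comment> \<open>The identity holds separately for each pair j, k once both sides are written in
   the real and imaginary parts of \<open>v\<close>.\<close>
 also have "... = (\<Sum>j\<in>UNIV. \<Sum>k\<in>UNIV. (Q v v j k + Q (cmi v) (cmi v) j k) / 2)"
  by (intro sum.cong refl, unfold w Q_def) (simp add: field_simps)
 also have "... = (X v v + X (cmi v) (cmi v)) / 2"
  unfolding exp by (simp add: sum_divide_distrib sum.distrib[symmetric] add_divide_distrib)
 finally show ?thesis by (simp add: X_def)
qed

section \<open>The Bergman kernel and the Bergman metric\<close>

abbreviation cmi' :: "complex^'n => complex^'n" where "cmi' \<equiv> %v. - cmi v"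

lemma complex_structure_cmi': "complex_structure (cmi' :: complex^'n => _)"
proof (rule complex_structure.intro)
 show "linear (cmi' :: complex^'n => _)"
  by (rule linearI) (auto simp: vec_eq_iff algebra_simps)
qed (auto simp: vec_eq_iff)

abbreviation cmi2 :: "(complex^'n) \<times> (complex^'n) => (complex^'n) \<times> (complex^'n)" where
 "cmi2 \<equiv> prod_map cmi cmi'"

interpretation cmi2: complex_structure "cmi2 :: (complex^'n) \<times> (complex^'n) => _"
 by (intro complex_structure_prod complex_structure_cmi complex_structure_cmi')

lemma has_derivative_cnj: "(f has_derivative A) F ==> ((%w. cnj (f w)) has_derivative (%v. cnj (A v))) F"
 by (rule bounded_linear.has_derivative[OF bounded_linear_cnj])

lemma jholo_cnj:
 assumes f: "holo_fun S f" shows "jholo cmi' S (%w. cnj (f w))"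
proof (rule jholoI)
 fix z assume z: "z \<in> S"
 have "cnj (fd f z (cmi' v)) = \<i> * cnj (fd f z v)" for v
  using fd_cscalar[OF f z, of \<i> v] fd_minus[OF holo_fun_differentiable[OF f z]] by simp
 then show "\<exists>A. ((%w. cnj (f w)) has_derivative A) (at z) \<and> (\<forall>v. A (cmi' v) = \<i> * A v)"
  using has_derivative_cnj[OF holo_fun_has_derivative[OF f z]] by blast
qed

lemma jholo_diagonal_derivative:
 fixes F :: "(complex^'n) \<times> (complex^'n) => complex"
 assumes "jholo J (S \<times> S) F" "z \<in> S"
 shows "((%z. F (z, z)) has_derivative (%u. fd F (z, z) (u, u))) (at z)"
proof -
 have "((%z::complex^'n. (z, z)) has_derivative (%u. (u, u))) (at z)"
  by (intro has_derivative_Pair has_derivative_ident)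
 from has_derivative_compose[OF this jholo_has_derivative[OF assms(1)]] assms(2) show ?thesis by auto
qed

lemma jholo_partial_derivatives:
 fixes F :: "(complex^'n) \<times> (complex^'n) => complex"
 assumes F: "jholo J (S \<times> S) F" and z: "z \<in> S" and w: "w \<in> S"
 shows "((%z. F (z, w)) has_derivative (%u. fd F (z, w) (u, 0))) (at z)"
  and "((%w. F (z, w)) has_derivative (%u. fd F (z, w) (0, u))) (at w)"
proof -
 have "((%z::complex^'n. (z, w)) has_derivative (%u. (u, 0))) (at z)"
  by (intro has_derivative_Pair has_derivative_ident has_derivative_const)
 from has_derivative_compose[OF this jholo_has_derivative[OF F]] z w
 show "((%z. F (z, w)) has_derivative (%u. fd F (z, w) (u, 0))) (at z)" by auto
 have "((%w::complex^'n. (z, w)) has_derivative (%u. (0, u))) (at w)"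
  by (intro has_derivative_Pair has_derivative_ident has_derivative_const)
 from has_derivative_compose[OF this jholo_has_derivative[OF F]] z w
 show "((%w. F (z, w)) has_derivative (%u. fd F (z, w) (0, u))) (at w)" by auto
qed

section \<open>The kernel as a function of two variables\<close>

context domain
begin

definition Kf :: "(complex^'n) \<times> (complex^'n) => complex" where
 "Kf p = kk (snd p) (fst p)"

lemma kk_bound:
 assumes z: "z \<in> \<Omega>"
 obtains r C where "r > 0" "C > 0" "ball z r \<subseteq> \<Omega>"
  "!!f w. f \<in> A2 \<Omega> ==> w \<in> ball z r ==> (cmod (f w))\<^sup>2 <= C * nrm2 \<Omega> f"
  "!!w. w \<in> ball z r ==> nrm2 \<Omega> (kk w) <= C"
proof -
 obtain r C where r: "r > 0" "C > 0" "ball z r \<subseteq> \<Omega>"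
  and C: "!!f w. f \<in> A2 \<Omega> ==> w \<in> ball z r ==> (cmod (f w))\<^sup>2 <= C * nrm2 \<Omega> f"
  using local_bound[OF z] by metis
 have "nrm2 \<Omega> (kk w) <= C" if w: "w \<in> ball z r" for w
 proof -
  have wO: "w \<in> \<Omega>" using w r by auto
  have "(nrm2 \<Omega> (kk w))\<^sup>2 <= C * nrm2 \<Omega> (kk w)"
   using C[OF kk(1)[OF wO] w] kk_diagonal[OF wO] by simp
  then show ?thesis using nrm2_kk_pos[OF wO] by (simp add: power2_eq_square)
 qed
 then show ?thesis using that r C by blast
qed

text \<open>The kernel is holomorphic in z, antiholomorphic in w by its hermitian symmetry, and
  locally bounded since evaluations and the norms of \<open>kk w\<close> are; Osgood's lemma
  applies. The partial derivatives are read off from the reproducing properties of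
  \<open>dk\<close>.\<close>

lemma Kf_jholo: "jholo cmi2 (\<Omega> \<times> \<Omega>) Kf"
 and Kf_derivative: "z \<in> \<Omega> ==> w \<in> \<Omega> ==> fd Kf (z, w) (a, b) = cnj (dk z a w) + dk w b z"
proof -
 have main: "(Kf has_derivative (%p. fd (%z. Kf (z, w0)) z0 (fst p) + fd (%w. Kf (z0, w)) w0 (snd p))) (at (z0, w0)) \<and>
   (\<forall>p. (%p. fd (%z. Kf (z, w0)) z0 (fst p) + fd (%w. Kf (z0, w)) w0 (snd p)) (cmi2 p) =
    \<i> * (%p. fd (%z. Kf (z, w0)) z0 (fst p) + fd (%w. Kf (z0, w)) w0 (snd p)) p)"
  if z0: "z0 \<in> \<Omega>" and w0: "w0 \<in> \<Omega>" for z0 w0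
 proof -
  obtain r1 C1 where 1: "r1 > 0" "C1 > 0" "ball z0 r1 \<subseteq> \<Omega>"
   and C1: "!!f w. f \<in> A2 \<Omega> ==> w \<in> ball z0 r1 ==> (cmod (f w))\<^sup>2 <= C1 * nrm2 \<Omega> f"
   using kk_bound[OF z0] by metis
  obtain r2 C2 where 2: "r2 > 0" "C2 > 0" "ball w0 r2 \<subseteq> \<Omega>"
   and C2: "!!w. w \<in> ball w0 r2 ==> nrm2 \<Omega> (kk w) <= C2"
   using kk_bound[OF w0] by metis
  define r where "r = min r1 r2"
  have sub: "ball z0 r \<subseteq> \<Omega>" "ball w0 r \<subseteq> \<Omega>" using 1 2 by (auto simp: r_def)
  show ?thesis
  proof (rule jholo_Osgood[OF complex_structure_cmi complex_structure_cmi'])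
   show "r > 0" using 1 2 by (simp add: r_def)
   show "cmod (Kf (z, w)) <= sqrt (C1 * C2)" if z: "z \<in> ball z0 r" and w: "w \<in> ball w0 r" for z w
   proof (rule real_le_rsqrt)
    have "(cmod (Kf (z, w)))\<^sup>2 <= C1 * nrm2 \<Omega> (kk w)"
     unfolding Kf_def using C1[OF kk(1)] z w sub by (auto simp: r_def)
    also have "... <= C1 * C2" using C2[of w] w 1 by (intro mult_left_mono) (auto simp: r_def)
    finally show "(cmod (Kf (z, w)))\<^sup>2 <= C1 * C2" .
   qed
   show "jholo cmi (ball z0 r) (%z. Kf (z, w))" if "w \<in> ball w0 r" for w
   proof -
    have "holo_fun \<Omega> (kk w)" using A2_holo kk(1) that sub by blast
    then show ?thesis using holo_fun_subset[OF _ sub(1)] by (simp add: Kf_def holo_fun_iff_jholo[symmetric])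
   qed
   show "jholo cmi' (ball w0 r) (%w. Kf (z, w))" if "z \<in> ball z0 r" for z
   proof -
    have zO: "z \<in> \<Omega>" using that sub by auto
    have h: "holo_fun (ball w0 r) (kk z)" using A2_holo[OF kk(1)[OF zO]] sub(2) by (rule holo_fun_subset)
    show ?thesis
    proof (rule jholoI)
     fix w assume w: "w \<in> ball w0 r"
     obtain A where A: "((%w. cnj (kk z w)) has_derivative A) (at w)" "\<forall>v. A (cmi' v) = \<i> * A v"
      using jholo_has_derivative[OF jholo_cnj[OF h] w] jholo_cnj[OF h] w by (auto simp: jholo_def)
     have "((%w. Kf (z, w)) has_derivative A) (at w)"
      by (rule has_derivative_transform_within_open[OF A(1) open_ball w])
        (simp only: Kf_def fst_conv snd_conv, rule kk_symmetric[symmetric], use sub zO in auto)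
     then show "\<exists>A. ((%w. Kf (z, w)) has_derivative A) (at w) \<and> (\<forall>v. A (cmi' v) = \<i> * A v)" using A by blast
    qed
   qed
  qed
 qed
 show "jholo cmi2 (\<Omega> \<times> \<Omega>) Kf"
  by (rule jholoI) (use main in blast)
 assume z: "z \<in> \<Omega>" and w: "w \<in> \<Omega>"
 have "fd Kf (z, w) (a, b) = fd (%z. Kf (z, w)) z a + fd (%w. Kf (z, w)) w b"
  using has_derivative_fd[OF conjunct1[OF main[OF z w]], of "(a, b)"] by simp
 also have "fd (%z. Kf (z, w)) z a = ip \<Omega> (kk w) (dk z a)"
  using dk(2)[OF z kk(1)[OF w]] by (simp add: Kf_def)
 also have "... = cnj (ip \<Omega> (dk z a) (kk w))" by (simp add: ip_cnj)
 also have "... = cnj (dk z a w)" using kk(2)[OF w dk(1)[OF z]] by simp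
 also have "fd (%w. Kf (z, w)) w = fd (%w. cnj (kk z w)) w"
  by (rule fd_cong_open[OF open_dom w]) (simp only: Kf_def fst_conv snd_conv, rule kk_symmetric, use z in auto)
 also have "fd (%w. cnj (kk z w)) w b = cnj (fd (kk z) w b)"
  by (rule has_derivative_fd[OF has_derivative_cnj[OF holo_fun_has_derivative[OF A2_holo[OF kk(1)[OF z]] w]]])
 also have "... = cnj (ip \<Omega> (kk z) (dk w b))" using dk(2)[OF w kk(1)[OF z]] by simp
 also have "... = ip \<Omega> (dk w b) (kk z)" by (simp add: ip_cnj)
 also have "... = dk w b z" using kk(2)[OF z dk(1)[OF w]] by simp
 finally show "fd Kf (z, w) (a, b) = cnj (dk z a w) + dk w b z" .
qed

abbreviation D1 :: "complex^'n => (complex^'n) \<times> (complex^'n) => complex" where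
 "D1 u \<equiv> (%p. fd Kf p (u, u))"

lemma D1_jholo: "jholo cmi2 (\<Omega> \<times> \<Omega>) (%p. fd Kf p q)"
 by (rule cmi2.jholo_fd[OF _ Kf_jholo]) (intro open_Times open_dom)

lemma D2_jholo: "jholo cmi2 (\<Omega> \<times> \<Omega>) (%p. fd (%p. fd Kf p q) p q')"
 by (rule cmi2.jholo_fd[OF _ D1_jholo]) (intro open_Times open_dom)

text \<open>After one derivative the kernel has become \<open>dk z v\<close> or its conjugate; the
  next one evaluates the derivative of \<open>dk z v\<close> at z, which by reproduction is the
  inner product of \<open>dk z v\<close> with itself.\<close>

lemma Kf_mixed_derivatives:
 assumes z: "z \<in> \<Omega>"
 shows "fd (%p. fd Kf p (v, 0)) (z, z) (0, v) = of_real (nrm2 \<Omega> (dk z v))"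
  and "fd (%p. fd Kf p (0, v)) (z, z) (v, 0) = of_real (nrm2 \<Omega> (dk z v))"
proof -
 have d: "((%w. fd Kf (z, w) (v, 0)) has_derivative (%u. fd (%p. fd Kf p (v, 0)) (z, z) (0, u))) (at z)"
  using jholo_partial_derivatives(2)[OF D1_jholo z z] by simp
 have hd: "holo_fun \<Omega> (dk w v)" if "w \<in> \<Omega>" for w using A2_holo dk(1) that by blast
 have e: "fd (dk z v) z v = of_real (nrm2 \<Omega> (dk z v))"
  using dk(2)[OF z dk(1)[OF z, of v], of v] unfolding ip_self by (rule sym)
 \<comment> \<open>The representer for the direction 0 vanishes, which removes the second term of
   \<open>Kf_derivative\<close> when only one variable moves.\<close>
 have dk0: "dk w 0 x = 0" if "w \<in> \<Omega>" "x \<in> \<Omega>" for w x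
 proof (rule nrm2_eq_0[OF dk(1)[OF that(1)] _ that(2)])
  have "ip \<Omega> (dk w 0) (dk w 0) = 0"
   using dk(2)[OF that(1) dk(1)[OF that(1)]] fd_zero[OF holo_fun_differentiable[OF A2_holo[OF dk(1)[OF that(1)]] that(1)]] by simp
  then show "nrm2 \<Omega> (dk w 0) = 0" by (simp add: ip_self)
 qed
 have "((%w. fd Kf (z, w) (v, 0)) has_derivative (%u. cnj (fd (dk z v) z u))) (at z)"
  by (rule has_derivative_transform_within_open[OF has_derivative_cnj[OF holo_fun_has_derivative[OF hd[OF z] z]] open_dom z])
    (simp add: Kf_derivative z dk0)
 from has_derivative_unique[OF d this] have "fd (%p. fd Kf p (v, 0)) (z, z) (0, v) = cnj (fd (dk z v) z v)" by metis
 then show "fd (%p. fd Kf p (v, 0)) (z, z) (0, v) = of_real (nrm2 \<Omega> (dk z v))"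
  unfolding e by (simp only: complex_cnj_complex_of_real)
 have d: "((%x. fd Kf (x, z) (0, v)) has_derivative (%u. fd (%p. fd Kf p (0, v)) (z, z) (u, 0))) (at z)"
  using jholo_partial_derivatives(1)[OF D1_jholo z z] by simp
 have "((%x. fd Kf (x, z) (0, v)) has_derivative (%u. fd (dk z v) z u)) (at z)"
  by (rule has_derivative_transform_within_open[OF holo_fun_has_derivative[OF hd[OF z] z] open_dom z])
    (simp add: Kf_derivative z dk0)
 from has_derivative_unique[OF d this] have "fd (%p. fd Kf p (0, v)) (z, z) (v, 0) = fd (dk z v) z v" by metis
 then show "fd (%p. fd Kf p (0, v)) (z, z) (v, 0) = of_real (nrm2 \<Omega> (dk z v))"
  unfolding e .
qed

section \<open>The potential log K and the metric it defines\<close>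

definition logK :: "complex^'n => real" where
 "logK z = ln (Re (bergman_kernel \<Omega> z z))"

lemma logK_eq: "z \<in> \<Omega> ==> logK z = ln (nrm2 \<Omega> (kk z))"
 by (simp add: logK_def bergman_kernel_eq kk_diagonal)

lemma Kf_diag: "z \<in> \<Omega> ==> Re (Kf (z, z)) = nrm2 \<Omega> (kk z)"
 by (simp add: Kf_def kk_diagonal)

lemma logK_derivative:
 assumes z: "z \<in> \<Omega>"
 shows "(logK has_derivative (%u. Re (D1 u (z, z)) / Re (Kf (z, z)))) (at z)"
proof (rule has_derivative_transform_within_open[OF _ open_dom z])
 have p: "Re (Kf (z, z)) > 0" using nrm2_kk_pos[OF z] by (simp add: Kf_diag[OF z])
 have "((%z. Re (Kf (z, z))) has_derivative (%u. Re (D1 u (z, z)))) (at z)"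
  by (rule bounded_linear.has_derivative[OF bounded_linear_Re jholo_diagonal_derivative[OF Kf_jholo z]])
 from has_derivative_ln[OF p this]
 show "((%z. ln (Re (Kf (z, z)))) has_derivative (%u. Re (D1 u (z, z)) / Re (Kf (z, z)))) (at z)"
  by (simp add: divide_inverse mult.commute)
 show "ln (Re (Kf (x, x))) = logK x" if "x \<in> \<Omega>" for x using that by (simp add: logK_eq Kf_diag)
qed

lemma fd_logK: "z \<in> \<Omega> ==> fd logK z u = Re (D1 u (z, z)) / Re (Kf (z, z))"
 by (rule has_derivative_fd[OF logK_derivative])

lemma logK_derivative2:
 assumes z: "z \<in> \<Omega>"
 shows "((%x. fd logK x u) has_derivative (%c. Re (fd (D1 u) (z, z) (c, c)) / Re (Kf (z, z))
   - Re (D1 u (z, z)) * Re (D1 c (z, z)) / (Re (Kf (z, z)))\<^sup>2)) (at z)"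
proof (rule has_derivative_transform_within_open[OF _ open_dom z])
 have p: "Re (Kf (z, z)) \<noteq> 0" using nrm2_kk_pos[OF z] by (simp add: Kf_diag[OF z])
 have 1: "((%z. Re (Kf (z, z))) has_derivative (%c. Re (D1 c (z, z)))) (at z)"
  by (rule bounded_linear.has_derivative[OF bounded_linear_Re jholo_diagonal_derivative[OF Kf_jholo z]])
 have 2: "((%z. Re (D1 u (z, z))) has_derivative (%c. Re (fd (D1 u) (z, z) (c, c)))) (at z)"
  by (rule bounded_linear.has_derivative[OF bounded_linear_Re jholo_diagonal_derivative[OF D1_jholo z]])
 show "((%x. Re (D1 u (x, x)) / Re (Kf (x, x))) has_derivative (%c. Re (fd (D1 u) (z, z) (c, c)) / Re (Kf (z, z))
   - Re (D1 u (z, z)) * Re (D1 c (z, z)) / (Re (Kf (z, z)))\<^sup>2)) (at z)"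
  by (rule has_derivative_eq_rhs[OF has_derivative_divide[OF 2 1 p]])
    (use p in \<open>simp add: fun_eq_iff field_simps power2_eq_square\<close>)
qed (simp add: fd_logK)

lemma d2_logK: "z \<in> \<Omega> ==> d2 logK z c u = Re (fd (D1 u) (z, z) (c, c)) / Re (Kf (z, z))
   - Re (D1 u (z, z)) * Re (D1 c (z, z)) / (Re (Kf (z, z)))\<^sup>2"
 unfolding d2_def by (rule has_derivative_fd[OF logK_derivative2])

text \<open>First and second derivatives of log K are rational in the values and derivatives of
  \<open>Kf\<close> on the diagonal, all of which are J-holomorphic and therefore
  continuous.\<close>

lemma logK_C2: "Ck_on 2 \<Omega> logK"
proof -
 have dd: "continuous_on \<Omega> (%z. F (z, z))" if "jholo cmi2 (\<Omega> \<times> \<Omega>) F" for F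
  by (rule continuous_on_compose2[OF jholo_continuous[OF that]]) (auto intro!: continuous_intros)
 have "continuous_on \<Omega> (%z. Re (fd (D1 u) (z, z) (c, c)) / Re (Kf (z, z))
   - Re (D1 u (z, z)) * Re (D1 c (z, z)) / (Re (Kf (z, z)))\<^sup>2)" for u c
  by (intro continuous_intros dd Kf_jholo D1_jholo D2_jholo) (auto simp: Kf_diag dest: nrm2_kk_pos)
 then have "continuous_on \<Omega> (%z. d2 logK z c u)" for u c
  by (simp add: d2_logK cong: continuous_on_cong)
 moreover have "logK differentiable (at z)" "(%x. fd logK x u) differentiable (at z)" if "z \<in> \<Omega>" for z u
  using logK_derivative[OF that] logK_derivative2[OF that] by (auto simp: differentiable_def)
 ultimately show ?thesis by (simp add: numeral_2_eq_2 d2_def)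
qed

lemma bergman_riemannian_d2:
 assumes z: "z \<in> \<Omega>"
 shows "bergman_riemannian \<Omega> z v v = (d2 logK z v v + d2 logK z (cmi v) (cmi v)) / 2"
 using i_ddbar_eq_d2[OF open_dom logK_C2 z] by (simp add: bergman_riemannian_def bergman_form_def logK_def[abs_def])

text \<open>Split the derivative along the diagonal into its z-part \<open>A\<close> and its w-part
  \<open>B\<close>. Replacing v by iv multiplies them by i and -i, so in the sum over v and iv the
  unmixed second derivatives cancel and the mixed ones double. What remains is the Gram determinant
  of \<open>kk z\<close> and \<open>dk z v\<close>.\<close>

lemma bergman_riemannian_eq:
 assumes z: "z \<in> \<Omega>"
 shows "bergman_riemannian \<Omega> z v v =
   2 * (nrm2 \<Omega> (kk z) * nrm2 \<Omega> (dk z v) - (cmod (ip \<Omega> (kk z) (dk z v)))\<^sup>2) / (nrm2 \<Omega> (kk z))\<^sup>2"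
proof -
 let ?k = "nrm2 \<Omega> (kk z)" and ?d = "nrm2 \<Omega> (dk z v)"
 define P where "P = ip \<Omega> (kk z) (dk z v)"
 define A where "A = (%p. fd Kf p (v, 0))"
 define B where "B = (%p. fd Kf p (0, v))"
 have zz: "(z, z) \<in> \<Omega> \<times> \<Omega>" using z by simp
 have k: "?k > 0" by (rule nrm2_kk_pos[OF z])
 have jA: "jholo cmi2 (\<Omega> \<times> \<Omega>) A" and jB: "jholo cmi2 (\<Omega> \<times> \<Omega>) B" unfolding A_def B_def by (rule D1_jholo)+
 have dA: "A differentiable (at (z, z))" and dB: "B differentiable (at (z, z))" using jA jB zz by (auto simp: jholo_def)
 have dKp: "Kf differentiable (at p)" and jK: "fd Kf p (cmi2 q) = \<i> * fd Kf p q" if "p \<in> \<Omega> \<times> \<Omega>" for p q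
  using Kf_jholo that unfolding jholo_def by blast+
 have iA: "fd A (z, z) (cmi2 q) = \<i> * fd A (z, z) q" and iB: "fd B (z, z) (cmi2 q) = \<i> * fd B (z, z) q" for q
  using jA jB zz unfolding jholo_def by blast+
 have split: "(a, b) = (a, 0) + (0, b)" for a b :: "complex^'n" by simp
 have e1: "D1 v p = A p + B p" if "p \<in> \<Omega> \<times> \<Omega>" for p
  unfolding A_def B_def by (subst split) (rule fd_add[OF dKp[OF that]])
 have e2: "D1 (cmi v) p = \<i> * A p - \<i> * B p" if "p \<in> \<Omega> \<times> \<Omega>" for p
 proof -
  have "D1 (cmi v) p = fd Kf p (cmi2 (v, 0) + cmi2 (0, - v))"
   by (simp add: prod_map_def vec_eq_iff)
  also have "... = fd Kf p (cmi2 (v, 0)) + fd Kf p (cmi2 (- (0, v)))"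
   by (simp add: fd_add[OF dKp[OF that]])
  also have "... = \<i> * A p - \<i> * B p"
   unfolding jK[OF that] by (simp only: A_def B_def fd_minus[OF dKp[OF that]] mult_minus_right diff_conv_add_uminus)
  finally show ?thesis .
 qed
 have f1: "fd (D1 v) (z, z) q = fd A (z, z) q + fd B (z, z) q" for q
 proof -
  have "fd (D1 v) (z, z) = fd (%p. A p + B p) (z, z)"
   by (rule fd_cong_open[of "\<Omega> \<times> \<Omega>"]) (use open_dom z e1 in \<open>auto intro!: open_Times\<close>)
  then show ?thesis using fd_linear_combination(1)[OF dA dB] by simp
 qed
 have f2: "fd (D1 (cmi v)) (z, z) q = \<i> * fd A (z, z) q - \<i> * fd B (z, z) q" for q
 proof -
  have "fd (D1 (cmi v)) (z, z) = fd (%p. \<i> * A p - \<i> * B p) (z, z)"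
   by (rule fd_cong_open[of "\<Omega> \<times> \<Omega>"]) (use open_dom z e2 in \<open>auto intro!: open_Times\<close>)
  moreover have d: "(%p. \<i> * A p) differentiable (at (z, z))" "(%p. \<i> * B p) differentiable (at (z, z))"
   using dA dB by (auto intro!: derivative_intros)
  ultimately show ?thesis
   by (simp only: fd_linear_combination(3)[OF d] fd_linear_combination(2)[OF dA dA] fd_linear_combination(2)[OF dB dB])
 qed
 have sp: "fd F (z, z) (v, v) = fd F (z, z) (v, 0) + fd F (z, z) (0, v)"
  "fd F (z, z) (cmi v, cmi v) = \<i> * fd F (z, z) (v, 0) - \<i> * fd F (z, z) (0, v)"
  if F: "F differentiable (at (z, z))" "!!q. fd F (z, z) (cmi2 q) = \<i> * fd F (z, z) q" for F :: "(complex^'n) \<times> (complex^'n) => complex"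
 proof -
  show "fd F (z, z) (v, v) = fd F (z, z) (v, 0) + fd F (z, z) (0, v)" by (subst split) (rule fd_add[OF F(1)])
  have "fd F (z, z) (cmi v, cmi v) = fd F (z, z) (cmi2 (v, 0) + cmi2 (- (0, v)))"
   by (simp add: prod_map_def vec_eq_iff)
  also have "... = \<i> * fd F (z, z) (v, 0) - \<i> * fd F (z, z) (0, v)"
   unfolding fd_add[OF F(1)] F(2) by (simp only: fd_minus[OF F(1)] mult_minus_right diff_conv_add_uminus)
  finally show "fd F (z, z) (cmi v, cmi v) = \<i> * fd F (z, z) (v, 0) - \<i> * fd F (z, z) (0, v)" .
 qed
 have "fd (D1 v) (z, z) (v, v) + fd (D1 (cmi v)) (z, z) (cmi v, cmi v) = 2 * fd A (z, z) (0, v) + 2 * fd B (z, z) (v, 0)"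
  unfolding f1 f2 sp[OF dA iA] sp[OF dB iB] by (simp add: algebra_simps)
 also have "... = 4 * of_real ?d"
  unfolding A_def B_def Kf_mixed_derivatives[OF z] by simp
 finally have s2: "fd (D1 v) (z, z) (v, v) + fd (D1 (cmi v)) (z, z) (cmi v, cmi v) = 4 * of_real ?d" .
 then have s2': "Re (fd (D1 v) (z, z) (v, v)) + Re (fd (D1 (cmi v)) (z, z) (cmi v, cmi v)) = 4 * ?d"
  by (metis plus_complex.sel(1) Re_complex_of_real of_real_mult of_real_numeral)
 have dP: "dk z u z = cnj (ip \<Omega> (kk z) (dk z u))" for u
  using kk(2)[OF z dk(1)[OF z]] by (simp add: ip_cnj)
 have D1z: "Re (D1 u (z, z)) = 2 * Re (ip \<Omega> (kk z) (dk z u))" for u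
  by (simp add: Kf_derivative[OF z z] dP)
 have "ip \<Omega> (kk z) (dk z (cmi v)) = \<i> * P"
  unfolding P_def dk(2)[OF z kk(1)[OF z]] by (rule fd_cscalar[OF A2_holo[OF kk(1)[OF z]] z])
 then have sq: "(Re (D1 v (z, z)))\<^sup>2 + (Re (D1 (cmi v) (z, z)))\<^sup>2 = 4 * (cmod P)\<^sup>2"
  unfolding D1z by (simp add: P_def cmod_power2 power_mult_distrib)
 have "d2 logK z v v + d2 logK z (cmi v) (cmi v) = (Re (fd (D1 v) (z, z) (v, v)) + Re (fd (D1 (cmi v)) (z, z) (cmi v, cmi v))) / ?k
   - ((Re (D1 v (z, z)))\<^sup>2 + (Re (D1 (cmi v) (z, z)))\<^sup>2) / ?k\<^sup>2"
  by (simp add: d2_logK[OF z] Kf_diag[OF z] power2_eq_square add_divide_distrib)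
 also have "... = 4 * ?d / ?k - 4 * (cmod P)\<^sup>2 / ?k\<^sup>2" by (simp only: s2' sq)
 finally show ?thesis using k by (simp add: bergman_riemannian_d2[OF z] P_def field_simps power2_eq_square)
qed

text \<open>A vanishing Gram determinant would make \<open>dk z v\<close> a multiple of
  \<open>kk z\<close>, and every square integrable holomorphic function vanishing at z would have
  derivative zero along v. A coordinate function centred at z, bounded on the domain, contradicts
  this.\<close>

lemma bergman_riemannian_pos:
 assumes z: "z \<in> \<Omega>" and v: "v \<noteq> 0"
 shows "bergman_riemannian \<Omega> z v v > 0"
proof -
 obtain i where i: "v $ i \<noteq> 0" using v by (auto simp: vec_eq_iff)
 define f where "f = (%x::complex^'n. x $ i - z $ i)"
 have hf: "holo_fun \<Omega> f" unfolding f_def by (intro holo_fun_diff) auto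
 obtain M where M: "!!x. x \<in> \<Omega> ==> norm x <= M" using bounded_dom bounded_iff by metis
 have fA: "f \<in> A2 \<Omega>"
 proof (rule A2_holo_bounded[OF hf])
  fix x assume x: "x \<in> \<Omega>"
  have "cmod (f x) <= cmod (x $ i) + cmod (z $ i)" unfolding f_def by (rule norm_triangle_ineq4)
  also have "... <= M + M" by (intro add_mono order_trans[OF Finite_Cartesian_Product.norm_nth_le M[OF x]] order_trans[OF Finite_Cartesian_Product.norm_nth_le M[OF z]])
  finally show "cmod (f x) <= M + M" .
 qed
 have "(f has_derivative (%v. v $ i)) (at z)"
  unfolding f_def by (auto intro!: derivative_eq_intros bounded_linear_imp_has_derivative bounded_linear_vec_nth)
 then have fv: "fd f z v = v $ i" by (rule has_derivative_fd)
 let ?k = "nrm2 \<Omega> (kk z)" and ?p = "ip \<Omega> (dk z v) (kk z)"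
 have k: "?k > 0" by (rule nrm2_kk_pos[OF z])
 \<comment> \<open>With this coefficient \<open>d\<close> is the component of \<open>dk z v\<close>
   orthogonal to \<open>kk z\<close>.\<close>
 define c where "c = - ?p / of_real ?k"
 define d where "d = (%x. dk z v x + c * kk z x)"
 have dA: "d \<in> A2 \<Omega>" unfolding d_def by (intro A2_add A2_cmult kk dk z)
 have "ip \<Omega> f d = ip \<Omega> f (dk z v) + cnj c * ip \<Omega> f (kk z)"
  unfolding d_def by (subst ip_add_right) (auto intro: A2_cmult kk dk z fA simp: ip_cmult_right)
 also have "... = v $ i" using dk(2)[OF z fA] kk(2)[OF z fA] fv by (simp add: f_def)
 finally have "(cmod (v $ i))\<^sup>2 <= nrm2 \<Omega> f * nrm2 \<Omega> d" using ip_Cauchy_Schwarz[OF fA dA] by simp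
 moreover have "(cmod (v $ i))\<^sup>2 > 0" using i by simp
 ultimately have "nrm2 \<Omega> d \<noteq> 0" by auto
 then have d0: "nrm2 \<Omega> d > 0" using nrm2_nonneg[of d] by simp
 have cc: "Re (cnj c * ?p) = - (cmod ?p)\<^sup>2 / ?k" "(cmod c)\<^sup>2 = (cmod ?p)\<^sup>2 / ?k\<^sup>2"
 proof -
  have "cnj c * ?p = - (?p * cnj ?p) / of_real ?k" by (simp add: c_def)
  also have "... = of_real (- (cmod ?p)\<^sup>2 / ?k)" unfolding complex_norm_square[symmetric] by simp
  finally show "Re (cnj c * ?p) = - (cmod ?p)\<^sup>2 / ?k" by (metis Re_complex_of_real)
  show "(cmod c)\<^sup>2 = (cmod ?p)\<^sup>2 / ?k\<^sup>2" using k by (simp add: c_def norm_divide power_divide)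
 qed
 have "nrm2 \<Omega> d = nrm2 \<Omega> (dk z v) + 2 * Re (cnj c * ?p) + (cmod c)\<^sup>2 * ?k"
  unfolding d_def by (rule nrm2_add[OF dk(1)[OF z] kk(1)[OF z]])
 then have "?k * nrm2 \<Omega> d = ?k * nrm2 \<Omega> (dk z v) - (cmod ?p)\<^sup>2"
  unfolding cc using k by (simp add: field_simps power2_eq_square)
 moreover have "cmod (ip \<Omega> (kk z) (dk z v)) = cmod ?p" by (metis ip_cnj complex_mod_cnj)
 ultimately have "bergman_riemannian \<Omega> z v v = 2 * (?k * nrm2 \<Omega> d) / ?k\<^sup>2"
  by (simp add: bergman_riemannian_eq[OF z])
 then show ?thesis using k d0 by simp
qed

lemma bergman_riemannian_scale: "bergman_riemannian \<Omega> z (c *s v) (c *s v) = (cmod c)\<^sup>2 * bergman_riemannian \<Omega> z v v"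
proof -
 have "cmi (c *s v) = c *s cmi v" by (simp add: vec_eq_iff)
 then show ?thesis unfolding bergman_riemannian_def bergman_form_def by (simp only: i_ddbar_scale)
qed

lemma bergman_riemannian_continuous: "continuous_on (\<Omega> \<times> UNIV) (%(z, v). bergman_riemannian \<Omega> z v v)"
proof -
 note c = C2_d2_continuous_joint[OF open_dom logK_C2]
 have "continuous_on (\<Omega> \<times> UNIV) (%p. (d2 logK (fst p) (snd p) (snd p) + d2 logK (fst p) (cmi (snd p)) (cmi (snd p))) / 2)"
 proof (intro continuous_intros)
  show "continuous_on (\<Omega> \<times> UNIV) (%p. d2 logK (fst p) (snd p) (snd p))" using c by (simp add: case_prod_beta')
  have "continuous_on (\<Omega> \<times> UNIV) (%p. (%(x, v). d2 logK x v v) (fst p, cmi (snd p)))"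
   by (rule continuous_on_compose2[OF c]) (auto intro!: continuous_intros)
  then show "continuous_on (\<Omega> \<times> UNIV) (%p. d2 logK (fst p) (cmi (snd p)) (cmi (snd p)))" by simp
 qed simp
 then show ?thesis by (rule continuous_on_eq) (clarsimp simp: bergman_riemannian_d2)
qed

end

section \<open>Invariance under biholomorphic maps\<close>

text \<open>Assembled from the derivatives of the components, to which \<open>holo_fun\<close>
  applies directly; for holomorphic maps its determinant is \<open>complex_jacobian\<close>.\<close>

definition cjac :: "(complex^'n => complex^'n) => complex^'n => complex^'n^'n" where
 "cjac f z = (\<chi> i j. fd (%x. f x $ i) z (axis j 1))"

lemma holo_map_has_derivative:
 fixes f :: "complex^'n => complex^'n"
 assumes f: "holo_map S f" and z: "z \<in> S"
 shows "(f has_derivative (*v) (cjac f z)) (at z)"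
proof -
 have h: "holo_fun S (%x. f x $ i)" for i using f by (simp add: holo_map_def)
 have row: "(cjac f z *v v) $ i = fd (%x. f x $ i) z v" for v i
 proof -
  have d: "(%x. f x $ i) differentiable (at z)" by (rule holo_fun_differentiable[OF h z])
  have "fd (%x. f x $ i) z v = fd (%x. f x $ i) z (\<Sum>j\<in>UNIV. (v $ j) *s axis j 1)"
   by (simp add: basis_expansion)
  also have "... = (\<Sum>j\<in>UNIV. fd (%x. f x $ i) z ((v $ j) *s axis j 1))"
   by (rule linear_sum[OF linear_frechet_derivative[OF d]])
  also have "... = (cjac f z *v v) $ i"
   by (simp add: fd_cscalar[OF h z] matrix_vector_mult_def cjac_def mult.commute)
  finally show ?thesis by simp
 qed
 show ?thesis
  unfolding has_derivative_componentwise_within[of f]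
 proof
  fix b :: "complex^'n" assume "b \<in> Basis"
  then obtain i u where b: "b = axis i u" by (auto simp: Basis_vec_def)
  have "((%x. f x $ i \<bullet> u) has_derivative (%v. fd (%x. f x $ i) z v \<bullet> u)) (at z)"
   by (rule has_derivative_inner_left[OF holo_fun_has_derivative[OF h z]])
  then show "((%x. f x \<bullet> b) has_derivative (%v. (cjac f z *v v) \<bullet> b)) (at z)"
   by (simp add: b inner_axis row)
 qed
qed

lemma complex_jacobian_eq:
 assumes f: "holo_map S f" and z: "z \<in> S"
 shows "complex_jacobian f z = det (cjac f z)"
proof -
 have "fd f z (axis j 1) $ i = cjac f z $ i $ j" for i j
  using has_derivative_fd[OF holo_map_has_derivative[OF f z], of "axis j 1"]
  by (simp add: matrix_vector_mult_def axis_def if_distrib[of "(*) _"] cong: if_cong)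
 then have "(\<chi> i j. fd f z (axis j 1) $ i) = cjac f z" by (simp add: vec_eq_iff)
 then show ?thesis by (simp add: complex_jacobian_def)
qed

lemma holo_fun_sum: "finite I ==> (!!i. i \<in> I ==> holo_fun S (f i)) ==> holo_fun S (%z. \<Sum>i\<in>I. f i z)"
 by (induction I rule: finite_induct) (auto intro: holo_fun_add)

lemma holo_fun_prod: "finite I ==> (!!i. i \<in> I ==> holo_fun S (f i)) ==> holo_fun S (%z. \<Prod>i\<in>I. f i z)"
 by (induction I rule: finite_induct) (auto intro: holo_fun_mult)

lemma holo_fun_det_cjac: "open S ==> holo_map S f ==> holo_fun S (%z. det (cjac f z))"
 unfolding det_def cjac_def
 by (intro holo_fun_sum holo_fun_mult holo_fun_prod) (auto simp: holo_map_def intro: holo_fun_fd finite_permutations)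

lemma holo_fun_compose:
 assumes g: "holo_map S g" and f: "holo_fun T f" and st: "!!z. z \<in> S ==> g z \<in> T"
 shows "holo_fun S (%z. f (g z))"
  and "z \<in> S ==> fd (%z. f (g z)) z v = fd f (g z) (cjac g z *v v)"
proof -
 have d: "((%z. f (g z)) has_derivative (%v. fd f (g z) (cjac g z *v v))) (at z)" if z: "z \<in> S" for z
  by (rule has_derivative_compose[OF holo_map_has_derivative[OF g z] holo_fun_has_derivative[OF f st[OF z]]])
 show "z \<in> S ==> fd (%z. f (g z)) z v = fd f (g z) (cjac g z *v v)" by (rule has_derivative_fd[OF d])
 show "holo_fun S (%z. f (g z))"
  unfolding holo_fun_def
 proof
  fix z assume z: "z \<in> S"
  show "\<exists>f'. ((%z. f (g z)) has_derivative f') (at z) \<and> (\<forall>c v. f' (c *s v) = c * f' v)"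
   by (intro exI[of _ "%v. fd f (g z) (cjac g z *v v)"] conjI d z)
     (simp add: vector_scalar_commute fd_cscalar[OF f st[OF z]])
 qed
qed

lemma cjac_compose_inverse:
 assumes S: "open S" and g: "holo_map S g" and h: "holo_map T h"
  and gS: "!!z. z \<in> S ==> g z \<in> T \<and> h (g z) = z" and z: "z \<in> S"
 shows "det (cjac g z) * det (cjac h (g z)) = 1"
proof -
 have gz: "g z \<in> T" using gS z by auto
 have "((%x. h (g x)) has_derivative (%v. cjac h (g z) *v (cjac g z *v v))) (at z)"
  by (rule has_derivative_compose[OF holo_map_has_derivative[OF g z] holo_map_has_derivative[OF h gz]])
 moreover have "((%x. h (g x)) has_derivative (%v. v)) (at z)"
  by (rule has_derivative_transform_within_open[OF has_derivative_ident S z]) (use gS in auto)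
 ultimately have "(%v. cjac h (g z) *v (cjac g z *v v)) = (%v. v)" by (rule has_derivative_unique)
 then have "cjac h (g z) ** cjac g z = mat 1"
  by (subst matrix_eq) (metis matrix_vector_mul_assoc matrix_vector_mul_lid)
 then have "det (cjac h (g z) ** cjac g z) = 1" by simp
 then show ?thesis by (simp add: det_mul mult.commute)
qed

section \<open>The unitary action of an automorphism\<close>

locale biholo = domain \<Omega> for \<Omega> :: "(complex^'n) set" +
 fixes g h :: "complex^'n => complex^'n"
 assumes g: "holo_map \<Omega> g" and h: "holo_map \<Omega> h"
  and gO: "z \<in> \<Omega> ==> g z \<in> \<Omega>" and hO: "z \<in> \<Omega> ==> h z \<in> \<Omega>"
  and hg: "z \<in> \<Omega> ==> h (g z) = z" and gh: "z \<in> \<Omega> ==> g (h z) = z"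
begin

lemma inverse_biholo: "biholo \<Omega> h g"
 by unfold_locales (use g h gO hO hg gh in auto)

abbreviation "jac \<equiv> %z. det (cjac g z)"

text \<open>The pull-back of the (n,0)-form with coefficient \<open>f\<close>. Its square integral
  is intrinsic, which is why the operator is unitary.\<close>

definition U :: "(complex^'n => complex) => complex^'n => complex" where
 "U f z = jac z * f (g z)"

lemma jac_holo: "holo_fun \<Omega> jac" by (rule holo_fun_det_cjac[OF open_dom g])

lemma jac_inverse: "z \<in> \<Omega> ==> jac z * det (cjac h (g z)) = 1"
 by (rule cjac_compose_inverse[OF open_dom g h]) (use gO hg in auto)

lemma jac_nonzero: "z \<in> \<Omega> ==> jac z \<noteq> 0"
 using jac_inverse by force

lemma U_isometry:
 assumes f: "f \<in> A2 \<Omega>"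
 shows "U f \<in> A2 \<Omega>" "nrm2 \<Omega> (U f) = nrm2 \<Omega> f"
proof -
 have hU: "holo_fun \<Omega> (U f)"
  unfolding U_def by (intro holo_fun_mult jac_holo holo_fun_compose(1)[OF g A2_holo[OF f]] gO)
 have c: "continuous_on \<Omega> (%z. (cmod (f z))\<^sup>2)" by (intro continuous_intros holo_fun_continuous A2_holo f)
 note cov = change_of_variables_biholomorphic[OF open_dom open_dom, where g = g and h = h and G = "cjac g" and H = "cjac h",
   OF holo_map_has_derivative[OF g] holo_map_has_derivative[OF h] _ _ c holo_fun_continuous[OF jac_holo]]
 have e: "(cmod (U f z))\<^sup>2 = (cmod (jac z))\<^sup>2 * (cmod (f (g z)))\<^sup>2" for z
  by (simp add: U_def norm_mult power_mult_distrib)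
 have "set_integrable lborel \<Omega> (%z. (cmod (U f z))\<^sup>2)"
  unfolding e by (subst cov(1)) (use gO hO hg gh A2_integrable[OF f] in auto)
 then show "U f \<in> A2 \<Omega>" using hU by (simp add: A2_def)
 show "nrm2 \<Omega> (U f) = nrm2 \<Omega> f"
  unfolding nrm2_def e by (rule cov(2)) (use gO hO hg gh A2_integrable[OF f] in auto)
qed

lemma U_linear: "U (%z. f z + c * k z) = (%z. U f z + c * U k z)"
 by (auto simp: U_def algebra_simps)

text \<open>Polarisation: the norms of f + ck for c = 1 and c = i determine the inner
  product.\<close>

lemma ip_U:
 assumes f: "f \<in> A2 \<Omega>" and k: "k \<in> A2 \<Omega>"
 shows "ip \<Omega> (U f) (U k) = ip \<Omega> f k"
proof -
 have "Re (cnj c * ip \<Omega> (U f) (U k)) = Re (cnj c * ip \<Omega> f k)" for c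
 proof -
  have ck: "(%z. f z + c * k z) \<in> A2 \<Omega>" by (intro A2_add A2_cmult f k)
  show ?thesis
   using nrm2_add[OF f k, of c] nrm2_add[OF U_isometry(1)[OF f] U_isometry(1)[OF k], of c]
    U_isometry(2)[OF ck] U_isometry(2)[OF f] U_isometry(2)[OF k] by (simp add: U_linear)
 qed
 from this[of 1] this[of \<i>] show ?thesis by (simp add: complex_eq_iff)
qed

lemma U_surj:
 assumes f: "f \<in> A2 \<Omega>"
 obtains k where "k \<in> A2 \<Omega>" "!!z. z \<in> \<Omega> ==> U k z = f z"
proof -
 interpret i: biholo \<Omega> h g by (rule inverse_biholo)
 have "U (i.U f) z = f z" if z: "z \<in> \<Omega>" for z
  using jac_inverse[OF z] hg[OF z] by (simp add: U_def i.U_def mult.assoc[symmetric])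
 then show ?thesis using that i.U_isometry(1)[OF f] by blast
qed

lemma representer_unique:
 assumes "k \<in> A2 \<Omega>" "k' \<in> A2 \<Omega>" "!!f. f \<in> A2 \<Omega> ==> ip \<Omega> f k = ip \<Omega> f k'" "z \<in> \<Omega>"
 shows "k z = k' z"
proof -
 have d: "(%z. k z - k' z) \<in> A2 \<Omega>" by (rule A2_diff[OF assms(1,2)])
 have "ip \<Omega> (%z. k z - k' z) (%z. k z - k' z) = 0"
  by (subst ip_diff_right[OF assms(1,2) d]) (simp add: assms(3)[OF d])
 then have "nrm2 \<Omega> (%z. k z - k' z) = 0" by (simp add: ip_self)
 from nrm2_eq_0[OF d this assms(4)] show ?thesis by simp
qed

lemma kk_transform:
 assumes z: "z \<in> \<Omega>" and x: "x \<in> \<Omega>"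
 shows "kk z x = cnj (jac z) * U (kk (g z)) x"
proof (rule representer_unique[OF kk(1)[OF z] _ _ x])
 have k': "kk (g z) \<in> A2 \<Omega>" by (rule kk(1)[OF gO[OF z]])
 show "(%x. cnj (jac z) * U (kk (g z)) x) \<in> A2 \<Omega>" by (intro A2_cmult U_isometry k')
 fix f assume f: "f \<in> A2 \<Omega>"
 obtain k where k: "k \<in> A2 \<Omega>" "!!z. z \<in> \<Omega> ==> U k z = f z" using U_surj[OF f] by blast
 have "ip \<Omega> f (U (kk (g z))) = ip \<Omega> (U k) (U (kk (g z)))" by (rule ip_cong) (use k in auto)
 also have "... = k (g z)" by (simp add: ip_U k k' kk(2)[OF gO[OF z]])
 finally show "ip \<Omega> f (kk z) = ip \<Omega> f (%x. cnj (jac z) * U (kk (g z)) x)"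
  using k(2)[OF z] by (simp add: ip_cmult_right kk(2)[OF z f] U_def[of k z])
qed

text \<open>The product rule contributes a second term, which carries the derivative of the Jacobian
  and is a multiple of the transformed \<open>kk\<close>.\<close>

lemma dk_transform:
 assumes z: "z \<in> \<Omega>" and x: "x \<in> \<Omega>"
 shows "dk z v x = cnj (jac z) * U (dk (g z) (cjac g z *v v)) x + cnj (fd jac z v) * U (kk (g z)) x"
proof (rule representer_unique[OF dk(1)[OF z] _ _ x])
 let ?d = "dk (g z) (cjac g z *v v)" and ?k = "kk (g z)"
 have gz: "g z \<in> \<Omega>" by (rule gO[OF z])
 have k': "?k \<in> A2 \<Omega>" "?d \<in> A2 \<Omega>" by (rule kk(1)[OF gz], rule dk(1)[OF gz])
 have A: "(%x. cnj (jac z) * U ?d x) \<in> A2 \<Omega>" "(%x. cnj (fd jac z v) * U ?k x) \<in> A2 \<Omega>"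
  by (intro A2_cmult U_isometry k')+
 show "(%x. cnj (jac z) * U ?d x + cnj (fd jac z v) * U ?k x) \<in> A2 \<Omega>" by (rule A2_add[OF A])
 fix f assume f: "f \<in> A2 \<Omega>"
 obtain k where k: "k \<in> A2 \<Omega>" "!!z. z \<in> \<Omega> ==> U k z = f z" using U_surj[OF f] by blast
 have i: "ip \<Omega> f (U l) = ip \<Omega> k l" if "l \<in> A2 \<Omega>" for l
 proof -
  have "ip \<Omega> f (U l) = ip \<Omega> (U k) (U l)" by (rule ip_cong) (use k in auto)
  then show ?thesis by (simp add: ip_U k that)
 qed
 have "fd f z v = fd (U k) z v"
  using fd_cong_open[OF open_dom z, of "U k" f] k(2) by simp
 also have "... = jac z * fd k (g z) (cjac g z *v v) + fd jac z v * k (g z)"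
 proof -
  have hk: "holo_fun \<Omega> (%z. k (g z))" by (rule holo_fun_compose(1)[OF g A2_holo[OF k(1)] gO])
  have "(U k has_derivative (%v. jac z * fd (%z. k (g z)) z v + fd jac z v * k (g z))) (at z)"
   unfolding U_def by (intro has_derivative_mult holo_fun_has_derivative[OF _ z] jac_holo hk)
  from has_derivative_fd[OF this] show ?thesis by (simp only: holo_fun_compose(2)[OF g A2_holo[OF k(1)] gO z])
 qed
 also have "... = jac z * ip \<Omega> k ?d + fd jac z v * ip \<Omega> k ?k"
  by (simp add: kk(2)[OF gz k(1)] dk(2)[OF gz k(1)])
 also have "... = ip \<Omega> f (%x. cnj (jac z) * U ?d x + cnj (fd jac z v) * U ?k x)"
  by (subst ip_add_right[OF A f]) (simp add: ip_cmult_right i k')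
 finally show "ip \<Omega> f (dk z v) = ip \<Omega> f (%x. cnj (jac z) * U ?d x + cnj (fd jac z v) * U ?k x)"
  by (simp add: dk(2)[OF z f])
qed

lemma nrm2_cong: "(!!z. z \<in> \<Omega> ==> f z = f' z) ==> nrm2 \<Omega> f = nrm2 \<Omega> f'"
 using ip_cong[of f f' f f'] by (simp add: ip_self)

lemma nrm2_kk_transform:
 assumes z: "z \<in> \<Omega>"
 shows "nrm2 \<Omega> (kk z) = (cmod (jac z))\<^sup>2 * nrm2 \<Omega> (kk (g z))"
proof -
 have "nrm2 \<Omega> (kk z) = nrm2 \<Omega> (%x. cnj (jac z) * U (kk (g z)) x)"
  by (rule nrm2_cong) (rule kk_transform[OF z])
 then show ?thesis by (simp add: nrm2_cmult U_isometry(2) kk(1)[OF gO[OF z]])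
qed

lemma logK_transform:
 assumes z: "z \<in> \<Omega>" shows "logK z = ln ((cmod (jac z))\<^sup>2) + logK (g z)"
 unfolding logK_eq[OF z] logK_eq[OF gO[OF z]] nrm2_kk_transform[OF z]
 by (rule ln_mult_pos) (use jac_nonzero[OF z] nrm2_kk_pos[OF gO[OF z]] in auto)

text \<open>The derivative of the Jacobian only adds a multiple of the representer of evaluation to
  that of differentiation, and this leaves a Gram determinant unchanged. The remaining factor |J|^4
  cancels against the denominator.\<close>

lemma bergman_riemannian_invariant:
 assumes z: "z \<in> \<Omega>"
 shows "bergman_riemannian \<Omega> (g z) (cjac g z *v v) (cjac g z *v v) = bergman_riemannian \<Omega> z v v"
proof -
 let ?d = "dk (g z) (cjac g z *v v)" and ?k = "kk (g z)" and ?J = "jac z" and ?c = "fd jac z v"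
 have gz: "g z \<in> \<Omega>" by (rule gO[OF z])
 have k': "?k \<in> A2 \<Omega>" "?d \<in> A2 \<Omega>" by (rule kk(1)[OF gz], rule dk(1)[OF gz])
 have uk: "U ?k \<in> A2 \<Omega>" "U ?d \<in> A2 \<Omega>" by (intro U_isometry k')+
 define A where "A = nrm2 \<Omega> ?k"
 define D where "D = nrm2 \<Omega> ?d"
 define P where "P = ip \<Omega> ?k ?d"
 have A0: "A > 0" unfolding A_def by (rule nrm2_kk_pos[OF gz])
 have J0: "cmod ?J \<noteq> 0" using jac_nonzero[OF z] by simp
 have nd: "nrm2 \<Omega> (dk z v) = (cmod ?J)\<^sup>2 * D + 2 * Re (?c * cnj ?J * cnj P) + (cmod ?c)\<^sup>2 * A"
 proof -
  have "nrm2 \<Omega> (dk z v) = nrm2 \<Omega> (%x. cnj ?J * U ?d x + cnj ?c * U ?k x)"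
   by (rule nrm2_cong) (rule dk_transform[OF z])
  also have "... = nrm2 \<Omega> (%x. cnj ?J * U ?d x) + 2 * Re (cnj (cnj ?c) * ip \<Omega> (%x. cnj ?J * U ?d x) (U ?k)) + (cmod (cnj ?c))\<^sup>2 * nrm2 \<Omega> (U ?k)"
   by (rule nrm2_add[OF A2_cmult[OF uk(2)] uk(1)])
  also have "ip \<Omega> (%x. cnj ?J * U ?d x) (U ?k) = cnj ?J * cnj P"
   unfolding P_def ip_cnj by (simp add: ip_cmult_left ip_U k')
  finally show ?thesis by (simp add: nrm2_cmult U_isometry(2) k' A_def D_def mult.assoc)
 qed
 have pk: "ip \<Omega> (kk z) (dk z v) = of_real ((cmod ?J)\<^sup>2) * P + cnj ?J * ?c * of_real A"
 proof -
  have "ip \<Omega> (kk z) (dk z v) = ip \<Omega> (%x. cnj ?J * U ?k x) (%x. cnj ?J * U ?d x + cnj ?c * U ?k x)"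
   by (rule ip_cong) (rule kk_transform[OF z], assumption, rule dk_transform[OF z], assumption)
  also have "... = cnj ?J * (?J * P + ?c * of_real A)"
  proof -
   have A: "(%x. cnj ?J * U ?k x) \<in> A2 \<Omega>" "(%x. cnj ?J * U ?d x) \<in> A2 \<Omega>" "(%x. cnj ?c * U ?k x) \<in> A2 \<Omega>"
    by (intro A2_cmult uk)+
   show ?thesis
    unfolding ip_add_right[OF A(2,3,1)] ip_cmult_left ip_cmult_right complex_cnj_cnj ip_U[OF k'] ip_U[OF k'(1) k'(1)] ip_self U_isometry(2)[OF k'(1)]
     P_def[symmetric] A_def[symmetric] by (simp add: algebra_simps)
  qed
  also have "... = of_real ((cmod ?J)\<^sup>2) * P + cnj ?J * ?c * of_real A"
   unfolding complex_norm_square by (simp add: algebra_simps)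
  finally show ?thesis .
 qed
 have sq: "(cmod (ip \<Omega> (kk z) (dk z v)))\<^sup>2 = (cmod ?J)^4 * (cmod P)\<^sup>2 + 2 * (cmod ?J)\<^sup>2 * A * Re (?c * cnj ?J * cnj P) + (cmod ?J)\<^sup>2 * (cmod ?c)\<^sup>2 * A\<^sup>2"
 proof -
  define q where "q = cnj ?J * ?c"
  have "(cmod (of_real a * P + q * of_real A))\<^sup>2 = a\<^sup>2 * (cmod P)\<^sup>2 + 2 * a * A * Re (q * cnj P) + (cmod q)\<^sup>2 * A\<^sup>2" for a :: real
   unfolding cmod_power2 by (simp add: power2_eq_square algebra_simps)
  from this[of "(cmod ?J)\<^sup>2"] show ?thesis
   unfolding pk q_def by (simp add: norm_mult power_mult_distrib mult.commute mult.left_commute flip: power_mult)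
 qed
 define r where "r = Re (?c * cnj ?J * cnj P)"
 define j where "j = cmod ?J"
 have nk: "nrm2 \<Omega> (kk z) = j\<^sup>2 * A" unfolding A_def j_def by (rule nrm2_kk_transform[OF z])
 have "bergman_riemannian \<Omega> z v v = 2 * (j\<^sup>2 * A * (j\<^sup>2 * D + 2 * r + (cmod ?c)\<^sup>2 * A) - (j^4 * (cmod P)\<^sup>2 + 2 * j\<^sup>2 * A * r + j\<^sup>2 * (cmod ?c)\<^sup>2 * A\<^sup>2)) / (j\<^sup>2 * A)\<^sup>2"
  unfolding bergman_riemannian_eq[OF z] nk nd sq r_def[symmetric] j_def[symmetric] ..
 also have "j\<^sup>2 * A * (j\<^sup>2 * D + 2 * r + (cmod ?c)\<^sup>2 * A) - (j^4 * (cmod P)\<^sup>2 + 2 * j\<^sup>2 * A * r + j\<^sup>2 * (cmod ?c)\<^sup>2 * A\<^sup>2) = j^4 * (A * D - (cmod P)\<^sup>2)"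
  by (simp add: power2_eq_square power4_eq_xxxx algebra_simps)
 also have "2 * (j^4 * (A * D - (cmod P)\<^sup>2)) / (j\<^sup>2 * A)\<^sup>2 = 2 * (A * D - (cmod P)\<^sup>2) / A\<^sup>2"
  using J0 by (simp add: j_def power_mult_distrib flip: power_mult)
 finally show ?thesis by (simp add: bergman_riemannian_eq[OF gz] A_def D_def P_def)
qed

end

section \<open>The Bergman distance\<close>

context domain
begin

abbreviation E :: "complex^'n => complex^'n => real" where "E z v \<equiv> bergman_riemannian \<Omega> z v v"

abbreviation bd :: "complex^'n => complex^'n => real" where "bd \<equiv> bergman_dist \<Omega>"

definition admissible :: "complex^'n => complex^'n => (real => complex^'n) => bool" where
 "admissible x y p \<longleftrightarrow> valid_path p \<and> path_image p \<subseteq> \<Omega> \<and> pathstart p = x \<and> pathfinish p = y \<and>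
   bergman_speed \<Omega> p integrable_on {0..1}"

lemma bd_eq: "bd x y = Inf {integral {0..1} (bergman_speed \<Omega> p) | p. admissible x y p}"
 unfolding bergman_dist_def admissible_def by simp

lemma E_scaleR: "E z (c *\<^sub>R v) = c\<^sup>2 * E z v"
 using bergman_riemannian_scale[of z "of_real c" v] by (simp add: scaleR_complex_vec)

lemma E_0: "E z 0 = 0" using E_scaleR[of z 0 0] by simp

lemma E_nonneg: "z \<in> \<Omega> ==> 0 <= E z v"
 using bergman_riemannian_pos[of z v] E_0 by (cases "v = 0") auto

lemma speed_nonneg: "p t \<in> \<Omega> ==> 0 <= bergman_speed \<Omega> p t"
 by (simp add: bergman_speed_def E_nonneg)

lemma admissible_in: "admissible x y p ==> t \<in> {0..1} ==> p t \<in> \<Omega>"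
 by (auto simp: admissible_def path_image_def)

lemma length_nonneg: "admissible x y p ==> 0 <= integral {0..1} (bergman_speed \<Omega> p)"
 by (rule integral_nonneg) (auto simp: admissible_in speed_nonneg, simp add: admissible_def)

lemma bd_le_length: "admissible x y p ==> bd x y <= integral {0..1} (bergman_speed \<Omega> p)"
 unfolding bd_eq by (rule cInf_lower) (auto intro!: bdd_belowI[of _ 0] length_nonneg)

lemma E_continuous_on:
 assumes "continuous_on S p" "continuous_on S q" "p ` S \<subseteq> \<Omega>"
 shows "continuous_on S (%t. E (p t) (q t))"
 using continuous_on_compose2[OF bergman_riemannian_continuous continuous_on_Pair[OF assms(1,2)]] assms(3) by auto

lemma admissible_smooth:
 assumes "valid_path p" "path_image p \<subseteq> \<Omega>" and p': "!!t. t \<in> {0..1} ==> (p has_vector_derivative p' t) (at t)"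
  and c: "continuous_on {0..1} p'"
 shows "admissible (pathstart p) (pathfinish p) p"
proof -
 have "continuous_on {0..1} (%t. sqrt (E (p t) (p' t)))"
  by (intro continuous_on_real_sqrt E_continuous_on c)
    (use assms valid_path_imp_path[of p] in \<open>auto simp: path_def path_image_def\<close>)
 then have "(%t. sqrt (E (p t) (p' t))) integrable_on {0..1}" by (rule integrable_continuous_interval)
 then have "bergman_speed \<Omega> p integrable_on {0..1}"
  by (rule integrable_eq) (simp add: bergman_speed_def vector_derivative_at[OF p'])
 then show ?thesis using assms by (simp add: admissible_def)
qed

lemma bd_segment:
 assumes sub: "closed_segment z (z + w) \<subseteq> \<Omega>" and M: "!!y. y \<in> closed_segment z (z + w) ==> E y w <= M\<^sup>2" and M0: "0 <= M"
 shows "bd z (z + w) <= M"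
proof -
 let ?p = "linepath z (z + w)"
 have d: "(?p has_vector_derivative w) (at t)" for t
  using has_vector_derivative_linepath_within[of z "z + w" t UNIV] by simp
 have "admissible (pathstart ?p) (pathfinish ?p) ?p"
  by (rule admissible_smooth[where p' = "%_. w"]) (use sub d in auto)
 then have a: "admissible z (z + w) ?p" by simp
 have "bd z (z + w) <= integral {0..1} (bergman_speed \<Omega> ?p)" by (rule bd_le_length[OF a])
 also have "... <= integral {0..1} (%_::real. M)"
 proof (rule integral_le)
  show "bergman_speed \<Omega> ?p integrable_on {0..1}" using a by (simp add: admissible_def)
  show "bergman_speed \<Omega> ?p t <= M" if "t \<in> {0..1}" for t
  proof -
   have "?p t \<in> closed_segment z (z + w)" using that by (metis image_eqI path_image_def path_image_linepath)
   then have "E (?p t) w <= M\<^sup>2" by (rule M)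
   then have "sqrt (E (?p t) w) <= M" using M0 by (simp add: real_le_lsqrt)
   then show ?thesis by (simp add: bergman_speed_def)
  qed
 qed auto
 finally show ?thesis by simp
qed

text \<open>Quadratic homogeneity reduces both bounds to unit vectors over \<open>K\<close>, a
  compact set on which the metric is continuous and positive.\<close>

lemma E_compact_bounds:
 assumes K: "compact K" "K \<subseteq> \<Omega>"
 obtains c M where "c > 0" "M > 0" "!!z v. z \<in> K ==> c\<^sup>2 * (norm v)\<^sup>2 <= E z v" "!!z v. z \<in> K ==> E z v <= M\<^sup>2 * (norm v)\<^sup>2"
proof -
 let ?S = "K \<times> sphere (0::complex^'n) 1"
 have cS: "compact ?S" by (intro compact_Times K compact_sphere)
 have ce: "continuous_on ?S (%(z, v). E z v)"
  by (rule continuous_on_subset[OF bergman_riemannian_continuous]) (use K in auto)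
 have nz: "E z v = (norm v)\<^sup>2 * E z ((1 / norm v) *\<^sub>R v)" for z v
  by (cases "v = 0") (simp_all add: E_scaleR power_divide E_0)
 obtain m where m: "m > 0" "!!p. p \<in> ?S ==> m <= (%(z, v). E z v) p"
 proof (cases "?S = {}")
  case False
  obtain p where p: "p \<in> ?S" "\<forall>q\<in>?S. (%(z, v). E z v) p <= (%(z, v). E z v) q"
   using continuous_attains_inf[OF cS False ce] by blast
  have "(%(z, v). E z v) p > 0" using p(1) K by (auto intro!: bergman_riemannian_pos)
  then show ?thesis using that p(2) by blast
 qed (use that[of 1] in auto)
 have "bounded ((%(z, v). E z v) ` ?S)" by (intro compact_imp_bounded compact_continuous_image ce cS)
 then obtain M where "M > 0" "\<forall>x\<in>(%(z, v). E z v) ` ?S. norm x <= M"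
  by (auto simp: bounded_pos)
 then have M: "M > 0" "!!p. p \<in> ?S ==> (%(z, v). E z v) p <= M" by force+
 show ?thesis
 proof (rule that[of "sqrt m" "sqrt M"])
  fix z v assume z: "z \<in> K"
  show "(sqrt m)\<^sup>2 * (norm v)\<^sup>2 <= E z v"
  proof (cases "v = 0")
   case False
   have "m <= E z ((1 / norm v) *\<^sub>R v)" using m(2)[of "(z, (1 / norm v) *\<^sub>R v)"] z False by simp
   then have "(norm v)\<^sup>2 * m <= (norm v)\<^sup>2 * E z ((1 / norm v) *\<^sub>R v)" by (intro mult_left_mono) auto
   then show ?thesis using nz[of z v] m by (simp add: mult.commute)
  qed (simp add: E_0)
  show "E z v <= (sqrt M)\<^sup>2 * (norm v)\<^sup>2"
  proof (cases "v = 0")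
   case False
   have "E z ((1 / norm v) *\<^sub>R v) <= M" using M(2)[of "(z, (1 / norm v) *\<^sub>R v)"] z False by simp
   then have "(norm v)\<^sup>2 * E z ((1 / norm v) *\<^sub>R v) <= (norm v)\<^sup>2 * M" by (intro mult_left_mono) auto
   then show ?thesis using nz[of z v] M by (simp add: mult.commute)
  qed (simp add: E_0)
 qed (use m M in auto)
qed

text \<open>Only the initial piece of the path is measured, up to the first time at which its
  Euclidean distance from \<open>x\<close> reaches the minimum in the claim. Up to then the path
  stays in the ball where the metric is bounded below.\<close>

lemma length_lower_bound:
 assumes p: "admissible x y p" and r: "r > 0" and c: "c > 0"
  and lower: "!!z v. z \<in> cball x r ==> c\<^sup>2 * (norm v)\<^sup>2 <= E z v"
 shows "c * min r (norm (y - x)) <= integral {0..1} (bergman_speed \<Omega> p)"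
proof -
 define \<rho> where "\<rho> = min r (norm (y - x))"
 have vp: "valid_path p" and p0: "p 0 = x" and p1: "p 1 = y" and int: "bergman_speed \<Omega> p integrable_on {0..1}"
  using p by (auto simp: admissible_def pathstart_def pathfinish_def)
 have cp: "continuous_on {0..1} p" using valid_path_imp_path[OF vp] by (simp add: path_def)
 obtain S where S: "finite S" "!!t. t \<in> {0..1} - S ==> p differentiable at t"
  using vp by (auto simp: valid_path_def piecewise_C1_differentiable_on_def C1_differentiable_on_eq)
 let ?T = "{t\<in>{0..1}. \<rho> <= norm (p t - x)}"
 have T1: "1 \<in> ?T" by (simp add: p1 \<rho>_def)
 have clT: "closed ?T"
  using continuous_closed_preimage[OF continuous_on_norm[OF continuous_on_diff[OF cp continuous_on_const]] closed_atLeastAtMost, of "{\<rho>..}" x]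
  by (simp add: vimage_def Int_def conj_commute)
 moreover have "bounded ?T" by (rule bounded_subset[OF bounded_closed_interval[of 0 1]]) auto
 ultimately have "compact ?T" by (simp add: compact_eq_bounded_closed)
 then obtain t0 where t0: "t0 \<in> ?T" and t0min: "!!t. t \<in> ?T ==> t0 <= t"
  using compact_attains_inf[of ?T] T1 by blast
 have t01: "0 <= t0" "t0 <= 1" using t0 by auto
 have in_ball: "norm (p t - x) <= r" if t: "0 <= t" "t <= t0" for t
 proof (cases "t < t0")
  case True
  then have "t \<notin> ?T" using t0min[of t] by linarith
  then show ?thesis using t t01 by (simp add: \<rho>_def)
 next
  case False
  then have t: "t = t0" using t by simp
  show ?thesis
  proof (cases "t0 = 0")
   case True then show ?thesis using t p0 r by simp
  next
   case F: False
   \<comment> \<open>The hitting time is a limit of earlier times, and the condition on the distance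
     is closed.\<close>
   have "closed {t\<in>{0..1}. norm (p t - x) <= r}"
    using continuous_closed_preimage[OF continuous_on_norm[OF continuous_on_diff[OF cp continuous_on_const]] closed_atLeastAtMost, of "{..r}" x]
    by (simp add: vimage_def Int_def conj_commute)
   moreover have "{0..<t0} \<subseteq> {t\<in>{0..1}. norm (p t - x) <= r}"
   proof
    fix s assume s: "s \<in> {0..<t0}"
    then have "s \<notin> ?T" using t0min[of s] by auto
    then show "s \<in> {t\<in>{0..1}. norm (p t - x) <= r}" using s t01 by (simp add: \<rho>_def)
   qed
   ultimately have "closure {0..<t0} \<subseteq> {t\<in>{0..1}. norm (p t - x) <= r}" by (rule closure_minimal[rotated])
   moreover have "t0 \<in> closure {0..<t0}" using F t01 by simp
   ultimately show ?thesis using t by blast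
  qed
 qed
 have int0: "bergman_speed \<Omega> p integrable_on {0..t0}"
  by (rule integrable_subinterval_real[OF int]) (use t01 in auto)
 let ?p' = "%t. vector_derivative p (at t)"
 \<comment> \<open>The interior form of the fundamental theorem, since the path is differentiable
   only off the finite set \<open>S\<close>.\<close>
 have ftc: "(?p' has_integral (p t0 - p 0)) {0..t0}"
 proof (rule fundamental_theorem_of_calculus_interior_strong[OF S(1) t01(1)])
  show "(p has_vector_derivative ?p' t) (at t)" if "t \<in> {0<..<t0} - S" for t
   using S(2)[of t] that t01 by (auto simp: vector_derivative_works)
  show "continuous_on {0..t0} p" by (rule continuous_on_subset[OF cp]) (use t01 in auto)
 qed
 have "norm (integral {0..t0} ?p') <= integral {0..t0} (%t. bergman_speed \<Omega> p t / c)"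
 proof (rule Henstock_Kurzweil_Integration.integral_norm_bound_integral)
  show "?p' integrable_on {0..t0}" using ftc by blast
  show "(%t. bergman_speed \<Omega> p t / c) integrable_on {0..t0}" using integrable_cmul[OF int0, of "1 / c"] by simp
  show "norm (?p' t) <= bergman_speed \<Omega> p t / c" if "t \<in> {0..t0}" for t
  proof -
   have "(c * norm (?p' t))\<^sup>2 <= E (p t) (?p' t)"
    using lower[of "p t" "?p' t"] in_ball[of t] that by (simp add: dist_norm norm_minus_commute power_mult_distrib)
   then have "c * norm (?p' t) <= bergman_speed \<Omega> p t" unfolding bergman_speed_def by (rule real_le_rsqrt)
   then show ?thesis using c by (simp add: field_simps)
  qed
 qed
 also have "... = integral {0..t0} (bergman_speed \<Omega> p) / c" by simp
 also have "... <= integral {0..1} (bergman_speed \<Omega> p) / c"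
  by (intro divide_right_mono integral_subset_le int0 int) (use t01 c admissible_in[OF p] in \<open>auto simp: speed_nonneg\<close>)
 finally have "norm (p t0 - x) <= integral {0..1} (bergman_speed \<Omega> p) / c"
  using integral_unique[OF ftc] by (simp add: p0)
 moreover have "\<rho> <= norm (p t0 - x)" using t0 by simp
 ultimately have "\<rho> <= integral {0..1} (bergman_speed \<Omega> p) / c" by linarith
 then show ?thesis using c by (simp add: \<rho>_def field_simps)
qed

text \<open>At break points \<open>vector_derivative\<close> has no prescribed value, so speeds are
  compared only off a finite set, which integrals do not see.\<close>

lemma admissible_reverse:
 assumes p: "admissible x y p"
 shows "admissible y x (reversepath p)"
  and "integral {0..1} (bergman_speed \<Omega> (reversepath p)) = integral {0..1} (bergman_speed \<Omega> p)"
proof -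
 have vp: "valid_path p" and int: "bergman_speed \<Omega> p integrable_on {0..1}" using p by (auto simp: admissible_def)
 obtain S where S: "finite S" "!!t. t \<in> {0..1} - S ==> p differentiable at t"
  using vp by (auto simp: valid_path_def piecewise_C1_differentiable_on_def C1_differentiable_on_eq)
 let ?L = "integral {0..1} (bergman_speed \<Omega> p)"
 have 1: "((%t. bergman_speed \<Omega> p (1 - t)) has_integral ?L) {0..1}"
  using has_integral_affinity01[where m = "-1" and c = 1, OF integrable_integral[OF int]] by simp
 have 2: "(bergman_speed \<Omega> (reversepath p) has_integral ?L) {0..1}"
 proof (rule has_integral_spike_finite[OF _ _ 1])
  show "finite ((%t. 1 - t) ` S)" using S by simp
  fix t assume t: "t \<in> {0..1} - (%t. 1 - t) ` S"
  have "1 - t \<notin> S" using t by (metis DiffD2 diff_diff_cancel image_eqI diff_add_cancel add_diff_cancel_left' diff_diff_eq2)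
  then have d: "(p has_vector_derivative vector_derivative p (at (1 - t))) (at (1 - t))"
   using S(2)[of "1 - t"] t by (simp add: vector_derivative_works)
  have "((p \<circ> (%t. 1 - t)) has_vector_derivative (-1) *\<^sub>R vector_derivative p (at (1 - t))) (at t)"
   by (rule vector_diff_chain_at[where f = "%t. 1 - t" and g = p, OF _ d]) (auto intro!: derivative_eq_intros)
  then have "vector_derivative (reversepath p) (at t) = (-1) *\<^sub>R vector_derivative p (at (1 - t))"
   unfolding reversepath_def o_def by (rule vector_derivative_at)
  then show "bergman_speed \<Omega> (reversepath p) t = bergman_speed \<Omega> p (1 - t)"
   unfolding bergman_speed_def reversepath_def by (simp only: E_scaleR) simp
 qed
 then show "integral {0..1} (bergman_speed \<Omega> (reversepath p)) = ?L" by (rule integral_unique)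
 show "admissible y x (reversepath p)"
  using p 2 valid_path_imp_reverse[OF vp] by (auto simp: admissible_def)
qed

lemma admissible_join:
 assumes p: "admissible x y p" and q: "admissible y z q"
 shows "admissible x z (p +++ q)"
  and "integral {0..1} (bergman_speed \<Omega> (p +++ q)) = integral {0..1} (bergman_speed \<Omega> p) + integral {0..1} (bergman_speed \<Omega> q)"
proof -
 have vp: "valid_path p" "valid_path q" and int: "bergman_speed \<Omega> p integrable_on {0..1}" "bergman_speed \<Omega> q integrable_on {0..1}"
  and pq: "pathfinish p = pathstart q" using p q by (auto simp: admissible_def)
 obtain S where S: "finite S" "!!t. t \<in> {0..1} - S ==> p differentiable at t"
  using vp by (auto simp: valid_path_def piecewise_C1_differentiable_on_def C1_differentiable_on_eq)
 obtain S' where S': "finite S'" "!!t. t \<in> {0..1} - S' ==> q differentiable at t"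
  using vp by (auto simp: valid_path_def piecewise_C1_differentiable_on_def C1_differentiable_on_eq)
 let ?L = "integral {0..1} (bergman_speed \<Omega> p)" and ?L' = "integral {0..1} (bergman_speed \<Omega> q)"
 have 1: "((%t. 2 * bergman_speed \<Omega> p (2 * t)) has_integral ?L) {0..1/2}"
  and 2: "((%t. 2 * bergman_speed \<Omega> q (2 * t - 1)) has_integral ?L') {1/2..1}"
  using has_integral_affinity01[where m = 2 and c = 0, OF integrable_integral[OF int(1)], THEN has_integral_cmul[where c = 2]]
   has_integral_affinity01[where m = 2 and c = "-1", OF integrable_integral[OF int(2)], THEN has_integral_cmul[where c = 2]]
  by (simp_all only: image_affinity_atLeastAtMost_div_diff, simp_all)
 have j1: "(bergman_speed \<Omega> (p +++ q) has_integral ?L) {0..1/2}"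
 proof (rule has_integral_spike_finite[OF _ _ 1])
  show "finite (insert (1/2) ((*) 2 -` S))" using S by (force intro: finite_vimageI[where h = "(*) 2"] inj_onI)
  fix t :: real assume t: "t \<in> {0..1/2} - insert (1/2) ((*) 2 -` S)"
  have d: "(p has_vector_derivative vector_derivative p (at (2 * t))) (at (2 * t))"
   using S(2)[of "2 * t"] t by (auto simp: vector_derivative_works)
  have "((p \<circ> (%t. 2 * t)) has_vector_derivative 2 *\<^sub>R vector_derivative p (at (2 * t))) (at t)"
   by (rule vector_diff_chain_at[where f = "%t. 2 * t" and g = p, OF _ d]) (auto intro!: derivative_eq_intros)
  then have "((p +++ q) has_vector_derivative 2 *\<^sub>R vector_derivative p (at (2 * t))) (at t)"
   by (rule has_vector_derivative_transform_within_open[where S = "{..<1/2}"]) (use t in \<open>auto simp: joinpaths_def\<close>)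
  then have "vector_derivative (p +++ q) (at t) = 2 *\<^sub>R vector_derivative p (at (2 * t))" by (rule vector_derivative_at)
  then show "bergman_speed \<Omega> (p +++ q) t = 2 * bergman_speed \<Omega> p (2 * t)"
   using t unfolding bergman_speed_def by (simp only: E_scaleR) (simp add: joinpaths_def real_sqrt_mult)
 qed
 have j2: "(bergman_speed \<Omega> (p +++ q) has_integral ?L') {1/2..1}"
 proof (rule has_integral_spike_finite[OF _ _ 2])
  show "finite (insert (1/2) ((%x. 2 * x - 1) -` S'))" using S' by (force intro: finite_vimageI[where h = "%x. 2 * x - 1"] inj_onI)
  fix t :: real assume t: "t \<in> {1/2..1} - insert (1/2) ((%x. 2 * x - 1) -` S')"
  have d: "(q has_vector_derivative vector_derivative q (at (2 * t - 1))) (at (2 * t - 1))"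
   using S'(2)[of "2 * t - 1"] t by (auto simp: vector_derivative_works)
  have "((q \<circ> (%t. 2 * t - 1)) has_vector_derivative 2 *\<^sub>R vector_derivative q (at (2 * t - 1))) (at t)"
   by (rule vector_diff_chain_at[where f = "%t. 2 * t - 1" and g = q, OF _ d]) (auto intro!: derivative_eq_intros)
  then have "((p +++ q) has_vector_derivative 2 *\<^sub>R vector_derivative q (at (2 * t - 1))) (at t)"
   by (rule has_vector_derivative_transform_within_open[where S = "{1/2<..}"]) (use t in \<open>auto simp: joinpaths_def\<close>)
  then have "vector_derivative (p +++ q) (at t) = 2 *\<^sub>R vector_derivative q (at (2 * t - 1))" by (rule vector_derivative_at)
  then show "bergman_speed \<Omega> (p +++ q) t = 2 * bergman_speed \<Omega> q (2 * t - 1)"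
   using t unfolding bergman_speed_def by (simp only: E_scaleR) (simp add: joinpaths_def real_sqrt_mult)
 qed
 have 3: "(bergman_speed \<Omega> (p +++ q) has_integral ?L + ?L') {0..1}"
  by (rule has_integral_combine[OF _ _ j1 j2]) auto
 then show "integral {0..1} (bergman_speed \<Omega> (p +++ q)) = ?L + ?L'" by (rule integral_unique)
 show "admissible x z (p +++ q)"
  using p q 3 valid_path_join[OF vp pq] pq by (auto simp: admissible_def path_image_join)
qed

end

text \<open>Connectedness provides an admissible path between any two points; otherwise the infimum
  defining the distance could run over the empty set.\<close>

locale bergman_domain = domain +
 assumes connected_dom: "connected \<Omega>"
begin

lemma admissible_ex:
 assumes "x \<in> \<Omega>" "y \<in> \<Omega>" obtains p where "admissible x y p"
proof -
 obtain p where p: "polynomial_function p" "path_image p \<subseteq> \<Omega>" "pathstart p = x" "pathfinish p = y"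
  using connected_open_polynomial_connected[OF open_dom connected_dom assms] by blast
 obtain p' where p': "polynomial_function p'" "!!t. (p has_vector_derivative p' t) (at t)"
  using has_vector_derivative_polynomial_function[OF p(1)] by blast
 have "admissible (pathstart p) (pathfinish p) p"
  by (rule admissible_smooth[OF valid_path_polynomial_function[OF p(1)] p(2) p'(2)])
    (use p'(1) in \<open>simp add: continuous_on_polymonial_function\<close>)
 then show ?thesis using that p by simp
qed

lemma lengths_nonempty: "x \<in> \<Omega> ==> y \<in> \<Omega> ==> {integral {0..1} (bergman_speed \<Omega> p) | p. admissible x y p} \<noteq> {}"
 using admissible_ex[of x y] by blast

lemma bd_greatest:
 assumes "x \<in> \<Omega>" "y \<in> \<Omega>" "!!p. admissible x y p ==> m <= integral {0..1} (bergman_speed \<Omega> p)"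
 shows "m <= bd x y"
 unfolding bd_eq using lengths_nonempty[OF assms(1,2)] assms(3) by (intro cInf_greatest) auto

lemma bd_approx:
 assumes "x \<in> \<Omega>" "y \<in> \<Omega>" "e > 0"
 obtains p where "admissible x y p" "integral {0..1} (bergman_speed \<Omega> p) < bd x y + e"
 using cInf_lessD[OF lengths_nonempty[OF assms(1,2)], of "bd x y + e"] assms(3) that unfolding bd_eq by auto

lemma bd_nonneg: "x \<in> \<Omega> ==> y \<in> \<Omega> ==> 0 <= bd x y"
 by (rule bd_greatest) (auto intro: length_nonneg)

lemma bd_self: "x \<in> \<Omega> ==> bd x x = 0"
 using bd_segment[of x 0 0] bd_nonneg[of x x] by (simp add: E_0)

lemma bd_triangle:
 assumes "x \<in> \<Omega>" "y \<in> \<Omega>" "z \<in> \<Omega>"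
 shows "bd x z <= bd x y + bd y z"
proof (rule field_le_epsilon)
 fix e :: real assume e: "e > 0"
 obtain p where p: "admissible x y p" "integral {0..1} (bergman_speed \<Omega> p) < bd x y + e/2"
  using bd_approx[of x y "e/2"] assms e by auto
 obtain q where q: "admissible y z q" "integral {0..1} (bergman_speed \<Omega> q) < bd y z + e/2"
  using bd_approx[of y z "e/2"] assms e by auto
 show "bd x z <= bd x y + bd y z + e"
  using bd_le_length[OF admissible_join(1)[OF p(1) q(1)]] admissible_join(2)[OF p(1) q(1)] p(2) q(2) by linarith
qed

lemma bd_sym:
 assumes "x \<in> \<Omega>" "y \<in> \<Omega>" shows "bd x y = bd y x"
proof -
 have "bd x y <= bd y x" if "x \<in> \<Omega>" "y \<in> \<Omega>" for x y
 proof (rule bd_greatest)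
  fix p assume "admissible y x p"
  from bd_le_length[OF admissible_reverse(1)[OF this]] admissible_reverse(2)[OF this]
  show "bd x y <= integral {0..1} (bergman_speed \<Omega> p)" by simp
 qed (use that in auto)
 then show ?thesis using assms by (simp add: order_antisym)
qed

text \<open>A path that leaves the small ball is already at least c r long. The truncated form is
  therefore valid for all y in the domain, and it shows that the distance separates points.\<close>

lemma bd_local_lower:
 assumes x: "x \<in> \<Omega>"
 obtains c r where "c > 0" "r > 0" "!!y. y \<in> \<Omega> ==> c * min r (norm (y - x)) <= bd x y"
proof -
 obtain r where r: "r > 0" "cball x r \<subseteq> \<Omega>" using open_dom x open_contains_cball by blast
 obtain c M where c: "c > 0" "!!z v. z \<in> cball x r ==> c\<^sup>2 * (norm v)\<^sup>2 <= E z v"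
  using E_compact_bounds[OF compact_cball r(2)] by metis
 have "c * min r (norm (y - x)) <= bd x y" if "y \<in> \<Omega>" for y
  by (rule bd_greatest[OF x that]) (rule length_lower_bound[OF _ r(1) c])
 then show ?thesis using that c r by blast
qed

lemma bd_local_upper:
 assumes K: "compact K" "K \<subseteq> \<Omega>"
 obtains M where "M > 0" "!!z w. closed_segment z (z + w) \<subseteq> K ==> bd z (z + w) <= M * norm w"
proof -
 obtain c M where M: "M > 0" "!!z v. z \<in> K ==> E z v <= M\<^sup>2 * (norm v)\<^sup>2"
  using E_compact_bounds[OF K] by metis
 show ?thesis
  by (rule that[OF M(1)], rule bd_segment) (use K M in \<open>auto simp: power_mult_distrib\<close>)
qed

lemma bd_pos: "x \<in> \<Omega> ==> y \<in> \<Omega> ==> x \<noteq> y ==> bd x y > 0"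
proof -
 assume x: "x \<in> \<Omega>" and y: "y \<in> \<Omega>" and ne: "x \<noteq> y"
 obtain c r where "c > 0" "r > 0" "c * min r (norm (y - x)) <= bd x y" using bd_local_lower[OF x] y by metis
 moreover have "0 < c * min r (norm (y - x))" using calculation ne by simp
 ultimately show ?thesis by linarith
qed

end

context biholo
begin

lemma admissible_image:
 assumes p: "admissible x y p"
 shows "admissible (g x) (g y) (g \<circ> p)"
  and "integral {0..1} (bergman_speed \<Omega> (g \<circ> p)) = integral {0..1} (bergman_speed \<Omega> p)"
proof -
 have vp: "valid_path p" and int: "bergman_speed \<Omega> p integrable_on {0..1}" using p by (auto simp: admissible_def)
 obtain S where S: "finite S" "p C1_differentiable_on ({0..1} - S)"
  using vp by (auto simp: valid_path_def piecewise_C1_differentiable_on_def)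
 then obtain D where D: "!!t. t \<in> {0..1} - S ==> (p has_vector_derivative D t) (at t)" and cD: "continuous_on ({0..1} - S) D"
  unfolding C1_differentiable_on_def by blast
 have cp: "continuous_on {0..1} p" using valid_path_imp_path[OF vp] by (simp add: path_def)
 have pO: "p t \<in> \<Omega>" if "t \<in> {0..1}" for t using admissible_in[OF p that] .
 have der: "((g \<circ> p) has_vector_derivative (cjac g (p t) *v D t)) (at t)" if t: "t \<in> {0..1} - S" for t
 proof -
  have "p t \<in> \<Omega>" using pO t by auto
  from has_derivative_compose[OF D[OF t, unfolded has_vector_derivative_def] holo_map_has_derivative[OF g this]]
  show ?thesis unfolding has_vector_derivative_def o_def
   by (simp add: scaleR_complex_vec vector_scalar_commute)
 qed
 have cg: "continuous_on \<Omega> g"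
  by (intro continuous_at_imp_continuous_on ballI has_derivative_continuous[OF holo_map_has_derivative[OF g]])
 have ce: "continuous_on \<Omega> (%z. cjac g z $ i $ j)" for i j
  unfolding cjac_def using g by (auto intro!: holo_fun_continuous holo_fun_fd open_dom simp: holo_map_def)
 have "continuous_on ({0..1} - S) (%t. cjac g (p t) *v D t)"
  unfolding matrix_vector_mult_def
  by (intro continuous_on_vec_lambda continuous_intros continuous_on_compose2[OF ce] cD continuous_on_subset[OF cp])
    (use pO in auto)
 then have "(g \<circ> p) C1_differentiable_on ({0..1} - S)"
  unfolding C1_differentiable_on_def by (intro exI[of _ "%t. cjac g (p t) *v D t"]) (use der in auto)
 moreover have "continuous_on {0..1} (g \<circ> p)"
  by (rule continuous_on_compose[OF cp continuous_on_subset[OF cg]]) (use pO in auto)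
 ultimately have vg: "valid_path (g \<circ> p)"
  using S unfolding valid_path_def piecewise_C1_differentiable_on_def by blast
 have sp: "bergman_speed \<Omega> (g \<circ> p) t = bergman_speed \<Omega> p t" if t: "t \<in> {0..1} - S" for t
  using bergman_riemannian_invariant[OF pO, of t "D t"] t
  by (simp add: bergman_speed_def vector_derivative_at[OF der[OF t]] vector_derivative_at[OF D[OF t]])
 have "(bergman_speed \<Omega> (g \<circ> p) has_integral integral {0..1} (bergman_speed \<Omega> p)) {0..1}"
  by (rule has_integral_spike_finite[OF S(1) sp integrable_integral[OF int]])
 then show "integral {0..1} (bergman_speed \<Omega> (g \<circ> p)) = integral {0..1} (bergman_speed \<Omega> p)"
  "admissible (g x) (g y) (g \<circ> p)"
  using p vg pO gO by (auto simp: admissible_def path_image_def pathstart_def pathfinish_def integral_unique)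
qed

lemma bd_invariant:
 assumes "x \<in> \<Omega>" "y \<in> \<Omega>" and c: "connected \<Omega>"
 shows "bd (g x) (g y) = bd x y"
proof -
 interpret bergman_domain \<Omega> by unfold_locales (rule c)
 interpret i: biholo \<Omega> h g by (rule inverse_biholo)
 have 1: "bd (g x) (g y) <= bd x y" if "x \<in> \<Omega>" "y \<in> \<Omega>" for x y
  by (rule bd_greatest[OF that]) (use bd_le_length[OF admissible_image(1)] admissible_image(2) in force)
 have 2: "bd (h x) (h y) <= bd x y" if "x \<in> \<Omega>" "y \<in> \<Omega>" for x y
  by (rule bd_greatest[OF that]) (use bd_le_length[OF i.admissible_image(1)] i.admissible_image(2) in force)
 have "bd x y <= bd (g x) (g y)" using 2[of "g x" "g y"] assms by (simp add: gO hg)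
 then show ?thesis using 1[OF assms(1,2)] by simp
qed

end

section \<open>Circle means\<close>

definition cint :: "(real => real) => real" where
 "cint f = (LINT \<theta>:{0..2*pi}|lborel. f \<theta>)"

abbreviation cintegrable :: "(real => real) => bool" where
 "cintegrable \<equiv> set_integrable lborel {0..2*pi}"

lemma cint_eq_integral: "cintegrable f ==> cint f = integral {0..2*pi} f"
 unfolding cint_def by (rule set_borel_integral_eq_integral)

lemma cint_continuous: "continuous_on {0..2*pi} f ==> cint f = integral {0..2*pi} f"
 by (intro cint_eq_integral borel_integrable_atLeastAtMost')

lemma trig_integral:
 "((%\<theta>. c0 + c1 * cos \<theta> + c2 * sin \<theta> + c3 * (cos \<theta>)\<^sup>2 + c4 * (cos \<theta> * sin \<theta>) + c5 * (sin \<theta>)\<^sup>2)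
   has_integral (2 * pi * c0 + pi * (c3 + c5))) {0..2*pi}"
proof -
 define F where "F = (%\<theta>::real. c0 * \<theta> + c1 * sin \<theta> - c2 * cos \<theta> + c3 * (\<theta> + sin \<theta> * cos \<theta>) / 2
   + c4 * (sin \<theta>)\<^sup>2 / 2 + c5 * (\<theta> - sin \<theta> * cos \<theta>) / 2)"
 have s: "1 - (sin \<theta>)\<^sup>2 = (cos \<theta>)\<^sup>2" for \<theta> :: real using sin_cos_squared_add[of \<theta>] by linarith
 have "(F has_real_derivative c0 + c1 * cos \<theta> + c2 * sin \<theta> + c3 * (cos \<theta>)\<^sup>2 + c4 * (cos \<theta> * sin \<theta>) + c5 * (sin \<theta>)\<^sup>2) (at \<theta>)" for \<theta>
 proof -
  have "(F has_real_derivative c0 + c1 * cos \<theta> + c2 * sin \<theta> + c3 * (1 + (cos \<theta> * cos \<theta> - sin \<theta> * sin \<theta>)) / 2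
    + c4 * (2 * sin \<theta> * cos \<theta>) / 2 + c5 * (1 - (cos \<theta> * cos \<theta> - sin \<theta> * sin \<theta>)) / 2) (at \<theta>)"
   unfolding F_def by (auto intro!: derivative_eq_intros)
  moreover have "1 + (cos \<theta> * cos \<theta> - sin \<theta> * sin \<theta>) = 2 * (cos \<theta>)\<^sup>2" "1 - (cos \<theta> * cos \<theta> - sin \<theta> * sin \<theta>) = 2 * (sin \<theta>)\<^sup>2"
   using s[of \<theta>] by (simp_all add: power2_eq_square)
  ultimately show ?thesis by (simp add: mult_ac)
 qed
 then have "((%\<theta>. c0 + c1 * cos \<theta> + c2 * sin \<theta> + c3 * (cos \<theta>)\<^sup>2 + c4 * (cos \<theta> * sin \<theta>) + c5 * (sin \<theta>)\<^sup>2) has_integral (F (2*pi) - F 0)) {0..2*pi}"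
  by (intro fundamental_theorem_of_calculus) (auto simp: has_real_derivative_iff_has_vector_derivative[symmetric] intro: has_field_derivative_at_within)
 moreover have "F (2*pi) - F 0 = 2 * pi * c0 + pi * (c3 + c5)" by (simp add: F_def algebra_simps)
 ultimately show ?thesis by simp
qed

text \<open>Multiplication by i is a shift by a quarter of the period. Later this allows the
  energies in the directions v and iv to be averaged together.\<close>

lemma cint_rotate:
 fixes f :: "complex => real"
 assumes f: "continuous_on UNIV f"
 shows "cint (%\<theta>. f (\<i> * cis \<theta>)) = cint (%\<theta>. f (cis \<theta>))"
proof -
 define g where "g \<theta> = f (cis \<theta>)" for \<theta>
 have cg: "continuous_on X g" for X
  unfolding g_def by (intro continuous_on_compose2[OF f] continuous_intros) auto
 have ig: "g integrable_on {a..b}" for a b by (intro integrable_continuous_interval cg)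
 have per: "g (\<theta> + 2 * pi) = g \<theta>" for \<theta> by (simp add: g_def cis.ctr)
 have r: "f (\<i> * cis \<theta>) = g (\<theta> + pi/2)" for \<theta>
  by (simp add: g_def cis_mult[symmetric] mult.commute)
 have sh: "integral {a..b} (%\<theta>. g (\<theta> + c)) = integral {a+c..b+c} g" for a b c
  using integral_shift_Icc_real[of a b g c] by (simp add: o_def add.commute)
 have "cint (%\<theta>. f (\<i> * cis \<theta>)) = integral {0..2*pi} (%\<theta>. g (\<theta> + pi/2))"
  unfolding r by (intro cint_continuous continuous_on_compose2[OF cg[of UNIV]] continuous_intros) auto
 also have "... = integral {pi/2..2*pi + pi/2} g" by (simp add: sh)
 also have "... = integral {pi/2..2*pi} g + integral {2*pi..2*pi + pi/2} g"
  by (rule Henstock_Kurzweil_Integration.integral_combine[symmetric]) (auto intro: ig)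
 also have "integral {2*pi..2*pi + pi/2} g = integral {0..pi/2} (%\<theta>. g (\<theta> + 2*pi))"
  by (simp add: sh add.commute)
 also have "... = integral {0..pi/2} g" by (simp add: per)
 also have "integral {pi/2..2*pi} g + integral {0..pi/2} g = integral {0..2*pi} g"
  using Henstock_Kurzweil_Integration.integral_combine[of 0 "pi/2" "2*pi" g] ig by simp
 also have "... = cint (%\<theta>. f (cis \<theta>))"
  unfolding cint_continuous[OF cg, symmetric] by (simp only: g_def[abs_def])
 finally show ?thesis .
qed

lemma cis_cscalar: "cis \<theta> *s v = cos \<theta> *\<^sub>R v + sin \<theta> *\<^sub>R cmi v"
 using cscalar_eq[of "cis \<theta>" v] by simp

lemma d2_bilinear:
 fixes f :: "complex^'n => real"
 assumes S: "open S" and f: "Ck_on 2 S f" and z: "z \<in> S"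
 shows "d2 f z (a *\<^sub>R x + b *\<^sub>R y) (a *\<^sub>R x + b *\<^sub>R y)
   = a\<^sup>2 * d2 f z x x + a * b * (d2 f z x y + d2 f z y x) + b\<^sup>2 * d2 f z y y"
proof -
 have e: "d2 f z p q = (\<Sum>i\<in>Basis. \<Sum>j\<in>Basis. (p \<bullet> i) * (q \<bullet> j) * d2 f z i j)" for p q
  by (rule C2_d2_expansion[OF S f z])
 show ?thesis
  unfolding e[of x x] e[of x y] e[of y x] e[of y y] e[of "a *\<^sub>R x + b *\<^sub>R y" "a *\<^sub>R x + b *\<^sub>R y"]
  by (simp add: inner_add_left sum_distrib_left sum.distrib[symmetric] power2_eq_square)
    (intro sum.cong refl, simp add: algebra_simps)
qed

text \<open>The Laplacian along the complex line of \<open>v\<close>, twice the value of the Levi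
  form on (v, iv).\<close>

definition lapl :: "(complex^'n => real) => complex^'n => complex^'n => real" where
 "lapl f v z = d2 f z v v + d2 f z (cmi v) (cmi v)"

lemma C2_line_Taylor:
 fixes f :: "complex^'n => real"
 assumes S: "open S" and f: "Ck_on 2 S f" and r: "r > 0" and seg: "!!s. 0 <= s ==> s <= r ==> z + s *\<^sub>R u \<in> S"
 obtains \<xi> where "0 < \<xi>" "\<xi> < r" "f (z + r *\<^sub>R u) = f z + r * fd f z u + r\<^sup>2 / 2 * d2 f (z + \<xi> *\<^sub>R u) u u"
proof -
 define diff where "diff m s = (if m = 0 then f (z + s *\<^sub>R u) else if m = 1 then fd f (z + s *\<^sub>R u) u else d2 f (z + s *\<^sub>R u) u u)" for m :: nat and s
 have line: "((%s. z + s *\<^sub>R u) has_derivative (%h. h *\<^sub>R u)) (at s)" for s by (auto intro!: derivative_eq_intros)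
 have d1: "((%s. f (z + s *\<^sub>R u)) has_real_derivative fd f (z + s *\<^sub>R u) u) (at s)" if "0 <= s" "s <= r" for s
 proof -
  note d = C2_differentiable[OF S f seg[OF that]]
  from has_derivative_compose[OF line d[unfolded frechet_derivative_works]] show ?thesis
   by (simp add: has_field_derivative_def fd_scaleR[OF d] mult_commute_abs)
 qed
 have d2: "((%s. fd f (z + s *\<^sub>R u) u) has_real_derivative d2 f (z + s *\<^sub>R u) u u) (at s)" if "0 <= s" "s <= r" for s
 proof -
  note d = C2_differentiable2[OF S f seg[OF that], of u]
  from has_derivative_compose[OF line d[unfolded frechet_derivative_works]] show ?thesis
   by (simp add: has_field_derivative_def fd_scaleR[OF d] mult_commute_abs d2_def)
 qed
 have "\<exists>\<xi>. 0 < \<xi> \<and> \<xi> < r \<and> f (z + r *\<^sub>R u) = (\<Sum>m<2. (diff m 0 / fact m) * r ^ m) + (diff 2 \<xi> / fact 2) * r ^ 2"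
 proof (rule Maclaurin[OF r, of 2 diff "%s. f (z + s *\<^sub>R u)"])
  show "diff 0 = (%s. f (z + s *\<^sub>R u))" by (auto simp: diff_def)
  show "\<forall>m t. m < 2 \<and> 0 <= t \<and> t <= r \<longrightarrow> (diff m has_real_derivative diff (Suc m) t) (at t)"
  proof (intro allI impI)
   fix m :: nat and t assume mt: "m < 2 \<and> 0 <= t \<and> t <= r"
   then consider "m = 0" | "m = 1" by linarith
   then show "(diff m has_real_derivative diff (Suc m) t) (at t)"
    using d1[of t] d2[of t] mt by cases (auto simp: diff_def[abs_def])
  qed
 qed simp
 then show ?thesis using that by (auto simp: diff_def numeral_2_eq_2 mult_ac)
qed

text \<open>Taylor expansion along each radius: the linear terms have mean zero and the quadratic
  ones average to the Laplacian. Uniformity over \<open>K\<close> comes from uniform continuity of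
  the second derivatives on a compact neighbourhood.\<close>

lemma C2_circle_mean:
 fixes f :: "complex^'n => real"
 assumes S: "open S" and f: "Ck_on 2 S f" and K: "compact K" "K \<subseteq> S" and e: "e > 0"
 obtains r0 where "r0 > 0" "!!z r. z \<in> K ==> 0 < r ==> r <= r0 ==>
  (\<forall>\<theta>. z + (of_real r * cis \<theta>) *s v \<in> S) \<and>
  \<bar>cint (%\<theta>. f (z + (of_real r * cis \<theta>) *s v)) - 2 * pi * f z - pi * r\<^sup>2 / 2 * lapl f v z\<bar> <= e * r\<^sup>2"
proof -
 obtain \<delta> where \<delta>: "\<delta> > 0" "(\<Union>x\<in>K. cball x \<delta>) \<subseteq> S" using compact_subset_open_imp_cball_epsilon_subset[OF K(1) S K(2)] by blast
 define K' where "K' = (\<Union>x\<in>K. cball x \<delta>)"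
 have K'eq: "K' = {x + y | x y. x \<in> K \<and> y \<in> cball 0 \<delta>}"
 proof safe
  fix x assume "x \<in> K'"
  then obtain y where y: "y \<in> K" "x \<in> cball y \<delta>" by (auto simp: K'_def)
  then show "\<exists>p q. x = p + q \<and> p \<in> K \<and> q \<in> cball 0 \<delta>"
   by (intro exI[of _ y] exI[of _ "x - y"]) (auto simp: dist_norm norm_minus_commute)
 next
  fix p q :: "complex^'n" assume "p \<in> K" "q \<in> cball 0 \<delta>"
  then show "p + q \<in> K'" by (auto simp: K'_def dist_norm intro!: bexI[of _ p])
 qed
 have cK': "compact K'" unfolding K'eq by (intro compact_sums K compact_cball)
 \<comment> \<open>Points are paired with directions because the direction
   \<open>cis \<theta> *s v\<close> turns along the circle.\<close>
 let ?B = "K' \<times> cball (0 :: complex^'n) (norm v)"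
 define g where "g = (%p. d2 f (fst p) (snd p) (snd p))"
 have "uniformly_continuous_on ?B g"
 proof (intro compact_uniformly_continuous compact_Times cK' compact_cball)
  have "continuous_on (S \<times> UNIV) g" using C2_d2_continuous_joint[OF S f] by (simp add: g_def case_prod_beta')
  then show "continuous_on ?B g" by (rule continuous_on_subset) (use \<delta> K'_def in auto)
 qed
 moreover have "e / pi > 0" using e by simp
 ultimately obtain d where d: "d > 0" "!!p q. p \<in> ?B ==> q \<in> ?B ==> dist q p < d ==> dist (g q) (g p) < e / pi"
  unfolding uniformly_continuous_on_def by blast
 define r0 where "r0 = min \<delta> d / (2 * (norm v + 1))"
 have r0: "r0 > 0" using \<delta> d by (simp add: r0_def add_nonneg_pos)
 have r0v: "r0 * norm v < \<delta>" "r0 * norm v < d"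
 proof -
  have "r0 * norm v <= r0 * (norm v + 1)" using r0 by (intro mult_left_mono) auto
  also have "... = min \<delta> d / 2" by (simp add: r0_def add_nonneg_eq_0_iff field_simps)
  finally show "r0 * norm v < \<delta>" "r0 * norm v < d" using \<delta> d by (auto simp: min_def split: if_splits)
 qed
 show ?thesis
 proof (rule that[OF r0], intro conjI allI)
  fix z r assume z: "z \<in> K" and r: "0 < r" "r <= r0"
  have rv: "r * norm v < \<delta>" "r * norm v < d"
   using mult_right_mono[OF r(2) norm_ge_zero[of v]] r0v by linarith+
  have zK': "z \<in> K'" using z \<delta> by (auto simp: K'_def intro!: bexI[of _ z])
  have zS: "z \<in> S" using zK' \<delta> unfolding K'_def by blast
  have inK': "z + s *\<^sub>R u \<in> K'" if "norm u = norm v" "0 <= s" "s <= r" for s u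
  proof -
   have "s * norm v <= r * norm v" using that by (intro mult_right_mono) auto
   then have "z + s *\<^sub>R u \<in> cball z \<delta>" using rv that by (simp add: dist_norm)
   then show ?thesis using z by (auto simp: K'_def)
  qed
  have nu: "norm (cis \<theta> *s v) = norm v" for \<theta> by simp
  have eq: "(of_real r * cis \<theta>) *s v = r *\<^sub>R (cis \<theta> *s v)" for \<theta>
   by (simp add: vec_eq_iff scaleR_conv_of_real[where 'a = complex] mult.assoc)
  show inS: "z + (of_real r * cis \<theta>) *s v \<in> S" for \<theta>
   unfolding eq using inK'[OF nu, of r] r \<delta> by (auto simp: K'_def)
  \<comment> \<open>The second order Taylor polynomial at \<open>z\<close>, restricted to the circle
    and sorted by trigonometric monomials for \<open>trig_integral\<close>.\<close>
  define T where "T \<theta> = f z + r * fd f z v * cos \<theta> + r * fd f z (cmi v) * sin \<theta> + r\<^sup>2 / 2 * d2 f z v v * (cos \<theta>)\<^sup>2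
    + r\<^sup>2 / 2 * (d2 f z v (cmi v) + d2 f z (cmi v) v) * (cos \<theta> * sin \<theta>) + r\<^sup>2 / 2 * d2 f z (cmi v) (cmi v) * (sin \<theta>)\<^sup>2" for \<theta>
  have pt: "\<bar>f (z + (of_real r * cis \<theta>) *s v) - T \<theta>\<bar> <= r\<^sup>2 / 2 * (e / pi)" for \<theta>
  proof -
   let ?u = "cis \<theta> *s v"
   obtain \<xi> where \<xi>: "0 < \<xi>" "\<xi> < r" and ty: "f (z + r *\<^sub>R ?u) = f z + r * fd f z ?u + r\<^sup>2 / 2 * d2 f (z + \<xi> *\<^sub>R ?u) ?u ?u"
    by (rule C2_line_Taylor[OF S f r(1), of z ?u]) (use inK'[OF nu] \<delta> in \<open>auto simp: K'_def\<close>)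
   have dz: "f differentiable (at z)" by (rule C2_differentiable[OF S f zS])
   have "fd f z ?u = fd f z v * cos \<theta> + fd f z (cmi v) * sin \<theta>"
    unfolding cis_cscalar by (simp add: fd_add[OF dz] fd_scaleR[OF dz])
   moreover have "d2 f z ?u ?u = (cos \<theta>)\<^sup>2 * d2 f z v v + cos \<theta> * sin \<theta> * (d2 f z v (cmi v) + d2 f z (cmi v) v) + (sin \<theta>)\<^sup>2 * d2 f z (cmi v) (cmi v)"
    unfolding cis_cscalar by (rule d2_bilinear[OF S f zS])
   ultimately have m1: "f (z + r *\<^sub>R ?u) - T \<theta> = r\<^sup>2 / 2 * (d2 f (z + \<xi> *\<^sub>R ?u) ?u ?u - d2 f z ?u ?u)"
    unfolding ty T_def by (simp add: algebra_simps)
   have m2: "\<bar>d2 f (z + \<xi> *\<^sub>R ?u) ?u ?u - d2 f z ?u ?u\<bar> < e / pi"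
   proof -
    have "\<xi> * norm v <= r * norm v" using \<xi> by (intro mult_right_mono) auto
    then have "dist (z + \<xi> *\<^sub>R ?u, ?u) (z, ?u) < d" using \<xi> rv by (simp add: dist_Pair_Pair dist_norm)
    then show ?thesis
     using d(2)[of "(z, ?u)" "(z + \<xi> *\<^sub>R ?u, ?u)"] inK'[OF nu, of \<xi>] zK' \<xi> by (simp add: dist_real_def g_def)
   qed
   show ?thesis unfolding eq m1 abs_mult by (rule mult_mono[OF _ less_imp_le[OF m2]]) auto
  qed
  have cf: "continuous_on {0..2*pi} (%\<theta>. f (z + (of_real r * cis \<theta>) *s v))"
  proof (rule continuous_on_compose2[of S f])
   show "continuous_on S f" by (intro continuous_at_imp_continuous_on ballI differentiable_imp_continuous_within C2_differentiable[OF S f])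
  qed (use inS in \<open>auto intro!: continuous_intros\<close>)
  have iT: "(T has_integral (2 * pi * f z + pi * r\<^sup>2 / 2 * lapl f v z)) {0..2*pi}"
   using trig_integral[of "f z" "r * fd f z v" "r * fd f z (cmi v)" "r\<^sup>2 / 2 * d2 f z v v" "r\<^sup>2 / 2 * (d2 f z v (cmi v) + d2 f z (cmi v) v)" "r\<^sup>2 / 2 * d2 f z (cmi v) (cmi v)"]
   by (simp add: T_def[abs_def] lapl_def algebra_simps)
  have if': "((%\<theta>. f (z + (of_real r * cis \<theta>) *s v)) has_integral cint (%\<theta>. f (z + (of_real r * cis \<theta>) *s v))) {0..2*pi}"
   using cint_continuous[OF cf] integrable_integral[OF integrable_continuous_interval[OF cf]] by simp
  have "norm (cint (%\<theta>. f (z + (of_real r * cis \<theta>) *s v)) - (2 * pi * f z + pi * r\<^sup>2 / 2 * lapl f v z)) <= r\<^sup>2 / 2 * (e / pi) * measure lborel (cbox 0 (2*pi))"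
   by (rule has_integral_bound[where f = "%\<theta>. f (z + (of_real r * cis \<theta>) *s v) - T \<theta>"])
     (use has_integral_diff[OF if' iT] pt e in auto)
  also have "... = e * r\<^sup>2" by simp
  finally show "\<bar>cint (%\<theta>. f (z + (of_real r * cis \<theta>) *s v)) - 2 * pi * f z - pi * r\<^sup>2 / 2 * lapl f v z\<bar> <= e * r\<^sup>2"
   by (simp add: algebra_simps)
 qed
qed

section \<open>The cut-off logarithm\<close>

text \<open>The quadratic coefficient has to be exact, since it decides the final constant; only the
  cubic remainder may be crude.\<close>

lemma ln_one_plus_lower3:
 fixes x :: real
 assumes "\<bar>x\<bar> <= 1/2"
 shows "ln (1 + x) \<ge> x - x\<^sup>2 / 2 - \<bar>x\<bar> ^ 3"
proof (cases "x \<ge> 0")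
 case True
 define F where "F y = ln (1 + y) - y + y\<^sup>2 / 2" for y :: real
 have "F 0 <= F x"
 proof (rule DERIV_nonneg_imp_nondecreasing[OF True])
  fix y :: real assume y: "0 <= y" "y <= x"
  have "(F has_real_derivative 1 / (1 + y) - 1 + y) (at y)"
   unfolding F_def using y by (auto intro!: derivative_eq_intros)
  moreover have "1 / (1 + y) - 1 + y = y\<^sup>2 / (1 + y)" using y by (simp add: field_simps power2_eq_square)
  ultimately show "\<exists>D. (F has_real_derivative D) (at y) \<and> 0 <= D" using y by auto
 qed
 then show ?thesis using True by (simp add: F_def) (smt (verit) zero_le_power)
next
 case False
 define F where "F y = ln (1 + y) - y + y\<^sup>2 / 2 - y ^ 3" for y :: real
 have "F x \<ge> F 0"
 proof (rule DERIV_nonpos_imp_nonincreasing[of x 0 F])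
  show "x <= 0" using False by simp
  fix y :: real assume y: "x <= y" "y <= 0"
  have y': "y \<ge> - (1/2)" using assms y by linarith
  have "(F has_real_derivative 1 / (1 + y) - 1 + y - 3 * y\<^sup>2) (at y)"
   unfolding F_def using y' by (auto intro!: derivative_eq_intros)
  moreover have "1 / (1 + y) - 1 + y - 3 * y\<^sup>2 = y\<^sup>2 * (1 / (1 + y) - 3)" using y' by (simp add: field_simps power2_eq_square)
  moreover have "1 / (1 + y) <= 2" using y' by (simp add: divide_le_eq)
  ultimately show "\<exists>D. (F has_real_derivative D) (at y) \<and> D <= 0"
   by (intro exI[of _ "y\<^sup>2 * (1 / (1 + y) - 3)"]) (auto intro!: mult_nonneg_nonpos)
 qed
 then show ?thesis using False by (simp add: F_def power3_eq_cube)
qed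

text \<open>Both pieces and their first derivatives vanish at \<open>b = 1\<close>. At
  \<open>b = 0\<close> the convention \<open>ln 0 = 0\<close> produces a finite default value; the
  pole is put back by \<open>cutpole\<close>.\<close>

definition cutlog :: "real => real" where
 "cutlog b = (if b < 1 then 2 * ln b + 1 - b\<^sup>2 else 0)"

text \<open>Since ln (b^2) <= b^2 - 1, the unrestricted formula lies below the cut-off everywhere.
  Lower bounds at a point of a circle can thus use it without deciding on which side of 1 the point
  lies.\<close>

lemma cutlog_ge: "b \<ge> 0 ==> cutlog b \<ge> 2 * ln b + 1 - b\<^sup>2"
proof (cases "b < 1")
 case False
 assume "b \<ge> 0"
 have "2 * ln b = ln (b\<^sup>2)" using False by (simp add: ln_realpow)
 also have "... <= b\<^sup>2 - 1" using False by (intro ln_le_minus_one) auto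
 finally show ?thesis using False by (simp add: cutlog_def)
qed (simp add: cutlog_def)

text \<open>Third order in \<kappa> while the circle is small compared with the distance to the
  pole, second order otherwise. At a fixed point off the pole the first case eventually
  applies.\<close>

definition cuterr :: "real => real => real" where
 "cuterr a \<kappa> = (if 2 * \<kappa> <= min a 1 then 2 * \<kappa> ^ 3 / min a 1 else 5 * \<kappa>\<^sup>2)"

lemma log_quadratic_lower:
 fixes x :: real
 assumes "\<bar>x\<bar> <= 1/2"
 shows "2 * ln (1 + x) + 1 - (1 + x)\<^sup>2 \<ge> - 2 * x\<^sup>2 - 2 * \<bar>x\<bar> ^ 3"
 using ln_one_plus_lower3[OF assms] by (simp add: power2_eq_square algebra_simps)

text \<open>With b = a(1 + x), comparing (1 + x)^2 with ln (1 + x) trades the increment of b^2 for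
  a^2 times that of 2 ln b, plus twice the squared increment of b. The coefficient 1 - a^2 left in
  front of the logarithm is nonnegative, so a submean inequality for log b can be inserted.\<close>

lemma cutlog_increment_near:
 assumes a: "0 < a" "a < 1" and \<kappa>: "0 <= \<kappa>" "2 * \<kappa> <= a" and b: "\<bar>b - a\<bar> <= \<kappa>"
 shows "cutlog b - cutlog a \<ge> (1 - a\<^sup>2) * (2 * (ln b - ln a)) - 2 * (b - a)\<^sup>2 - 2 * \<kappa> ^ 3 / a"
proof -
 have b0: "b > 0" using a \<kappa> b by linarith
 define x where "x = (b - a) / a"
 have xa: "\<bar>x\<bar> = \<bar>b - a\<bar> / a" using a by (simp add: x_def)
 have x: "\<bar>x\<bar> <= 1/2" unfolding xa using a \<kappa> b by (simp add: divide_le_eq)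
 have bx: "b = a * (1 + x)" using a by (simp add: x_def field_simps)
 have "1 + x > 0" using x by linarith
 then have lb: "ln b - ln a = ln (1 + x)" unfolding bx using a by (simp add: ln_mult_pos)
 have "a\<^sup>2 * (2 * ln (1 + x) + 1 - (1 + x)\<^sup>2) \<ge> a\<^sup>2 * (- 2 * x\<^sup>2 - 2 * \<bar>x\<bar> ^ 3)"
  by (intro mult_left_mono log_quadratic_lower x) auto
 moreover have "a\<^sup>2 * x\<^sup>2 = (b - a)\<^sup>2" using a by (simp add: x_def power_divide)
 moreover have "a\<^sup>2 * \<bar>x\<bar> ^ 3 = \<bar>b - a\<bar> ^ 3 / a" unfolding xa using a by (simp add: power_divide power3_eq_cube power2_eq_square)
 moreover have "\<bar>b - a\<bar> ^ 3 / a <= \<kappa> ^ 3 / a" using a b by (intro divide_right_mono power_mono) auto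
 ultimately have "a\<^sup>2 * (2 * ln (1 + x) + 1 - (1 + x)\<^sup>2) \<ge> - 2 * (b - a)\<^sup>2 - 2 * (\<kappa> ^ 3 / a)"
  by (simp add: algebra_simps)
 moreover have "a\<^sup>2 * (1 + x)\<^sup>2 = b\<^sup>2" unfolding bx by (simp add: power_mult_distrib)
 moreover have "cutlog b - cutlog a \<ge> 2 * (ln b - ln a) + a\<^sup>2 - b\<^sup>2"
  using cutlog_ge[of b] b0 a by (simp add: cutlog_def[of a])
 ultimately show ?thesis unfolding lb by (simp add: algebra_simps)
qed

text \<open>Close to the pole a < 2\<kappa> and b <= 3\<kappa>, hence b^2 - a^2 <= 5\<kappa>^2: the
  logarithm keeps its full coefficient and the squares go into the error.\<close>

lemma cutlog_increment_far:
 assumes a: "0 < a" "a < 1" and \<kappa>: "a < 2 * \<kappa>" and b: "\<bar>b - a\<bar> <= \<kappa>" "0 <= b"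
 shows "cutlog b - cutlog a \<ge> 2 * (ln b - ln a) - 5 * \<kappa>\<^sup>2"
proof -
 have "b\<^sup>2 - a\<^sup>2 = (b - a) * (b + a)" by (simp add: power2_eq_square algebra_simps)
 also have "... <= \<bar>b - a\<bar> * (b + a)" using a b by (intro mult_right_mono) auto
 also have "... <= \<kappa> * (5 * \<kappa>)"
  using a b \<kappa> by (intro mult_mono) (auto simp: abs_le_iff)
 finally have "b\<^sup>2 - a\<^sup>2 <= 5 * \<kappa>\<^sup>2" by (simp add: power2_eq_square)
 then show ?thesis using cutlog_ge[OF b(2)] a by (simp add: cutlog_def[of a])
qed

text \<open>Only values b < 1 can lower the cut-off, and for them |b - 1| is at most the increment;
  the first order contact at 1 makes the loss quadratic.\<close>

lemma cutlog_increment_outside: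
 assumes a: "1 <= a" and \<kappa>: "0 <= \<kappa>" "\<kappa> <= 1/2" and b: "\<bar>b - a\<bar> <= \<kappa>"
 shows "cutlog b - cutlog a \<ge> - 2 * (b - a)\<^sup>2 - 2 * \<kappa> ^ 3"
proof (cases "b < 1")
 case True
 define x where "x = b - 1"
 have x: "\<bar>x\<bar> <= \<bar>b - a\<bar>" using True a by (simp add: x_def)
 have "2 * ln (1 + x) + 1 - (1 + x)\<^sup>2 \<ge> - 2 * x\<^sup>2 - 2 * \<bar>x\<bar> ^ 3"
  by (rule log_quadratic_lower) (use x b \<kappa> in linarith)
 moreover have "x\<^sup>2 <= (b - a)\<^sup>2" using x by (simp add: abs_le_square_iff)
 moreover have "\<bar>x\<bar> ^ 3 <= \<kappa> ^ 3" using x b by (intro power_mono) auto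
 ultimately show ?thesis using True a by (simp add: cutlog_def x_def)
next
 case False
 have "0 <= \<kappa> ^ 3" "0 <= (b - a)\<^sup>2" using \<kappa> by auto
 moreover have "cutlog a = 0" "cutlog b = 0" using a False by (simp_all add: cutlog_def)
 ultimately show ?thesis by linarith
qed

lemma cutlog_borel [measurable]: "cutlog \<in> borel_measurable borel"
 unfolding cutlog_def[abs_def] by measurable

text \<open>The three comparisons integrated over a circle, where the submean inequality removes the
  logarithmic terms. The factor 2 in front of the squared increments is the loss that the energy
  inequality must pay for.\<close>

lemma cutlog_circle_mean:
 assumes a: "a > 0" and \<kappa>: "0 <= \<kappa>" "\<kappa> <= 1/2" and cb: "continuous_on UNIV b"
  and b: "!!\<theta>. 0 <= b \<theta>" "!!\<theta>. \<bar>b \<theta> - a\<bar> <= \<kappa>"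
  and sub: "a < 1 ==> cintegrable (%\<theta>. ln (b \<theta>)) \<and> 2 * pi * ln a <= cint (%\<theta>. ln (b \<theta>))"
 shows "cintegrable (%\<theta>. cutlog (b \<theta>))"
  and "cint (%\<theta>. cutlog (b \<theta>)) \<ge> 2 * pi * cutlog a - 2 * cint (%\<theta>. (b \<theta> - a)\<^sup>2) - 2 * pi * cuterr a \<kappa>"
proof -
 have mb[measurable]: "b \<in> borel_measurable borel" by (rule borel_measurable_continuous_onI[OF cb])
 have cont: "cintegrable f" if "continuous_on {0..2*pi} f" for f :: "real => real"
  by (rule borel_integrable_atLeastAtMost'[OF that])
 have cb': "continuous_on X b" for X using cb continuous_on_subset by blast
 have sq: "cintegrable (%\<theta>. (b \<theta> - a)\<^sup>2)" by (intro cont continuous_intros cb')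
 have cc: "cintegrable (%\<theta>. c)" for c :: real by (intro cont continuous_intros)
 show int: "cintegrable (%\<theta>. cutlog (b \<theta>))"
 proof (cases "a < 1")
  case True
  show ?thesis
  proof (rule set_integrable_bound)
   show "cintegrable (%\<theta>. 2 * \<bar>ln (b \<theta>)\<bar> + (1 + (b \<theta>)\<^sup>2))"
   proof (rule set_integral_add(1))
    show "cintegrable (%\<theta>. 2 * \<bar>ln (b \<theta>)\<bar>)"
     using sub[OF True] by (intro set_integrable_mult_right set_integrable_abs) auto
    show "cintegrable (%\<theta>. 1 + (b \<theta>)\<^sup>2)" by (intro cont continuous_intros cb')
   qed
   show "set_borel_measurable lborel {0..2*pi} (%\<theta>. cutlog (b \<theta>))" unfolding set_borel_measurable_def by measurable
   have "\<bar>cutlog (b \<theta>)\<bar> <= 2 * \<bar>ln (b \<theta>)\<bar> + (1 + (b \<theta>)\<^sup>2)" for \<theta>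
    using zero_le_power2[of "b \<theta>"] by (smt (verit) cutlog_def)
   then show "AE \<theta> in lborel. \<theta> \<in> {0..2*pi} \<longrightarrow> norm (cutlog (b \<theta>)) <= norm (2 * \<bar>ln (b \<theta>)\<bar> + (1 + (b \<theta>)\<^sup>2))"
    by (intro AE_I2 impI) (simp add: abs_of_nonneg)
  qed
 next
  case False
  show ?thesis
  proof (rule set_integrable_bound[OF cc[of "2 * ln 2 + 1"]])
   show "set_borel_measurable lborel {0..2*pi} (%\<theta>. cutlog (b \<theta>))" unfolding set_borel_measurable_def by measurable
   have "\<bar>cutlog (b \<theta>)\<bar> <= 2 * ln 2 + 1" for \<theta>
   proof (cases "b \<theta> < 1")
    case True
    have "b \<theta> \<ge> 1/2" using b(2)[of \<theta>] False \<kappa> by linarith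
    then have "ln (b \<theta>) \<ge> - ln 2" using ln_le_cancel_iff[of "1/2" "b \<theta>"] by (simp add: ln_div)
    moreover have "ln (b \<theta>) <= 0" using True \<open>b \<theta> \<ge> 1/2\<close> by simp
    moreover have "(b \<theta>)\<^sup>2 <= 1" using True b(1)[of \<theta>] by (simp add: power_le_one)
    ultimately show ?thesis using True zero_le_power2[of "b \<theta>"] by (smt (verit) cutlog_def)
   qed (simp add: cutlog_def)
   then show "AE \<theta> in lborel. \<theta> \<in> {0..2*pi} \<longrightarrow> norm (cutlog (b \<theta>)) <= norm (2 * ln 2 + 1 :: real)"
    by (intro AE_I2 impI) (simp add: abs_of_nonneg)
  qed
 qed
 have c2: "cint (%\<theta>. c) = 2 * pi * c" for c
  using trig_integral[of c 0 0 0 0 0] cint_continuous[of "%\<theta>. c"] by (simp add: integral_unique)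
 have mono: "cint f <= cint g" if "cintegrable f" "cintegrable g" "!!\<theta>. f \<theta> <= g \<theta>" for f g
  unfolding cint_def by (rule set_integral_mono) (use that in auto)
 have add: "cint (%\<theta>. f \<theta> + g \<theta>) = cint f + cint g" if "cintegrable f" "cintegrable g" for f g
  unfolding cint_def by (rule set_integral_add(2)) (use that in auto)
 have mul: "cint (%\<theta>. c * f \<theta>) = c * cint f" for c f unfolding cint_def by simp
 have sq0: "cint (%\<theta>. (b \<theta> - a)\<^sup>2) \<ge> 0" using mono[OF cc[of 0] sq] c2[of 0] by simp
 consider "a < 1" "2 * \<kappa> <= a" | "a < 1" "a < 2 * \<kappa>" | "1 <= a" by linarith
 then show "cint (%\<theta>. cutlog (b \<theta>)) \<ge> 2 * pi * cutlog a - 2 * cint (%\<theta>. (b \<theta> - a)\<^sup>2) - 2 * pi * cuterr a \<kappa>"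
 proof cases
  case 1
  note l = sub[OF 1(1), THEN conjunct1] and s = sub[OF 1(1), THEN conjunct2]
  let ?k = "cutlog a - 2 * \<kappa> ^ 3 / a - (1 - a\<^sup>2) * 2 * ln a"
  have i1: "cintegrable (%\<theta>. ((1 - a\<^sup>2) * 2) * ln (b \<theta>))" using l by (rule set_integrable_mult_right) 
  have i2: "cintegrable (%\<theta>. (-2) * (b \<theta> - a)\<^sup>2)" using sq by (rule set_integrable_mult_right)
  have "cint (%\<theta>. ?k + (((1 - a\<^sup>2) * 2) * ln (b \<theta>) + (-2) * (b \<theta> - a)\<^sup>2)) <= cint (%\<theta>. cutlog (b \<theta>))"
  proof (rule mono[OF set_integral_add(1)[OF cc set_integral_add(1)[OF i1 i2]] int])
   show "?k + (((1 - a\<^sup>2) * 2) * ln (b \<theta>) + (-2) * (b \<theta> - a)\<^sup>2) <= cutlog (b \<theta>)" for \<theta>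
    using cutlog_increment_near[OF a 1(1) \<kappa>(1) 1(2) b(2)[of \<theta>]] by (simp add: algebra_simps)
  qed
  also have "cint (%\<theta>. ?k + (((1 - a\<^sup>2) * 2) * ln (b \<theta>) + (-2) * (b \<theta> - a)\<^sup>2))
    = 2 * pi * ?k + (((1 - a\<^sup>2) * 2) * cint (%\<theta>. ln (b \<theta>)) + (-2) * cint (%\<theta>. (b \<theta> - a)\<^sup>2))"
   by (simp only: add[OF cc set_integral_add(1)[OF i1 i2]] add[OF i1 i2] c2 mul)
  finally have "2 * pi * ?k + ((1 - a\<^sup>2) * 2) * cint (%\<theta>. ln (b \<theta>)) - 2 * cint (%\<theta>. (b \<theta> - a)\<^sup>2) <= cint (%\<theta>. cutlog (b \<theta>))" by simp
  moreover have "((1 - a\<^sup>2) * 2) * cint (%\<theta>. ln (b \<theta>)) \<ge> ((1 - a\<^sup>2) * 2) * (2 * pi * ln a)"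
   using s 1 a by (intro mult_left_mono) (auto simp: power_le_one)
  moreover have "cuterr a \<kappa> = 2 * \<kappa> ^ 3 / a" using 1 by (simp add: cuterr_def)
  ultimately show ?thesis by (simp add: algebra_simps)
 next
  case 2
  note l = sub[OF 2(1), THEN conjunct1] and s = sub[OF 2(1), THEN conjunct2]
  let ?k = "cutlog a - 5 * \<kappa>\<^sup>2 - 2 * ln a"
  have i1: "cintegrable (%\<theta>. 2 * ln (b \<theta>))" using l by (rule set_integrable_mult_right)
  have "cint (%\<theta>. ?k + 2 * ln (b \<theta>)) <= cint (%\<theta>. cutlog (b \<theta>))"
  proof (rule mono[OF set_integral_add(1)[OF cc i1] int])
   show "?k + 2 * ln (b \<theta>) <= cutlog (b \<theta>)" for \<theta>
    using cutlog_increment_far[OF a 2 b(2)[of \<theta>] b(1)] by (simp add: algebra_simps)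
  qed
  also have "cint (%\<theta>. ?k + 2 * ln (b \<theta>)) = 2 * pi * ?k + 2 * cint (%\<theta>. ln (b \<theta>))"
   by (simp only: add[OF cc i1] c2 mul)
  finally have "2 * pi * ?k + 2 * cint (%\<theta>. ln (b \<theta>)) <= cint (%\<theta>. cutlog (b \<theta>))" .
  moreover have "cuterr a \<kappa> = 5 * \<kappa>\<^sup>2" using 2 by (simp add: cuterr_def)
  ultimately show ?thesis using s sq0 by (simp add: algebra_simps)
 next
  case 3
  let ?k = "cutlog a - 2 * \<kappa> ^ 3"
  have i2: "cintegrable (%\<theta>. (-2) * (b \<theta> - a)\<^sup>2)" using sq by (rule set_integrable_mult_right)
  have "cint (%\<theta>. ?k + (-2) * (b \<theta> - a)\<^sup>2) <= cint (%\<theta>. cutlog (b \<theta>))"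
  proof (rule mono[OF set_integral_add(1)[OF cc i2] int])
   show "?k + (-2) * (b \<theta> - a)\<^sup>2 <= cutlog (b \<theta>)" for \<theta>
    using cutlog_increment_outside[OF 3 \<kappa> b(2)[of \<theta>]] by (simp add: algebra_simps)
  qed
  also have "cint (%\<theta>. ?k + (-2) * (b \<theta> - a)\<^sup>2) = 2 * pi * ?k + (-2) * cint (%\<theta>. (b \<theta> - a)\<^sup>2)"
   by (simp only: add[OF cc i2] c2 mul)
  finally have "2 * pi * ?k - 2 * cint (%\<theta>. (b \<theta> - a)\<^sup>2) <= cint (%\<theta>. cutlog (b \<theta>))" by simp
  moreover have "cuterr a \<kappa> = 2 * \<kappa> ^ 3" using 3 \<kappa> by (simp add: cuterr_def)
  ultimately show ?thesis by (simp add: algebra_simps)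
 qed
qed

text \<open>The uniform second order bound serves as dominating function when the error is divided
  by r^2.\<close>

lemma cuterr_bounds:
 assumes "a > 0" "0 <= \<kappa>"
 shows "0 <= cuterr a \<kappa>" "cuterr a \<kappa> <= 5 * \<kappa>\<^sup>2"
proof -
 show "0 <= cuterr a \<kappa>" using assms by (auto simp: cuterr_def)
 show "cuterr a \<kappa> <= 5 * \<kappa>\<^sup>2"
 proof (cases "2 * \<kappa> <= min a 1")
  case True
  have "2 * \<kappa> ^ 3 / min a 1 = \<kappa>\<^sup>2 * (2 * \<kappa> / min a 1)" by (simp add: power2_eq_square power3_eq_cube)
  also have "... <= \<kappa>\<^sup>2 * 1" using True assms by (intro mult_left_mono) (auto simp: divide_le_eq_1)
  also have "... <= 5 * \<kappa>\<^sup>2" by simp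
  finally show ?thesis using True by (simp add: cuterr_def)
 next
  case False
  then show ?thesis unfolding cuterr_def by (simp only: if_False)
 qed
qed

lemma cuterr_limit:
 assumes a: "a > 0" and \<kappa>: "0 <= \<kappa>"
 shows "((%r. cuterr a (\<kappa> * r) / r\<^sup>2) \<longlongrightarrow> 0) (at_right 0)"
proof -
 define M where "M = min a 1"
 have m: "M > 0" using a by (simp add: M_def)
 have l: "((%r. 2 * \<kappa> ^ 3 / M * r) \<longlongrightarrow> 0) (at_right 0)" using m by (auto intro!: tendsto_eq_intros)
 have l2: "((%r. 2 * (\<kappa> * r)) \<longlongrightarrow> 0) (at_right 0)" by (auto intro!: tendsto_eq_intros)
 have ev1: "eventually (%r. 2 * (\<kappa> * r) < M) (at_right 0)" by (rule order_tendstoD(2)[OF l2 m])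
 have ev2: "eventually (%r::real. r > 0) (at_right 0)" by (simp add: eventually_at_right_less)
 have imp: "2 * \<kappa> ^ 3 / M * r = cuterr a (\<kappa> * r) / r\<^sup>2" if "2 * (\<kappa> * r) < M" "r > 0" for r
  using that m by (simp add: cuterr_def M_def[symmetric] field_simps power2_eq_square power3_eq_cube)
 have "eventually (%r. 2 * \<kappa> ^ 3 / M * r = cuterr a (\<kappa> * r) / r\<^sup>2) (at_right 0)"
  using ev1 ev2 by eventually_elim (rule imp)
 from tendsto_cong[OF this, THEN iffD1, OF l] show ?thesis .
qed

section \<open>The energy of Lipschitz functions\<close>

lemma continuous_on_box_integral:
 fixes h :: "'a::real_normed_vector => real => real"
 assumes "continuous_on (UNIV \<times> {0..e}) (%(x, b). h x b)"
 shows "continuous_on UNIV (%x. integral {0..e} (h x))"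
 using integral_continuous_on_param[of UNIV 0 e h] assms by (simp add: cbox_interval)

lemma moving_integral_derivative:
 fixes k :: "real => real"
 assumes k: "continuous_on UNIV k" and e: "e > 0"
 shows "((%s. integral {0..e} (%a. k (s + a))) has_real_derivative (k (s + e) - k s)) (at s)"
proof -
 define F where "F x = integral {s - 1..x} k" for x
 have ck: "continuous_on X k" for X using k continuous_on_subset by blast
 have ik: "k integrable_on {a..b}" for a b by (rule integrable_continuous_interval[OF ck])
 have dF: "(F has_real_derivative k x) (at x)" if "x \<in> {s-1<..<s+e+1}" for x
 proof -
  have "(F has_real_derivative k x) (at x within {s-1..s+e+1})"
   unfolding F_def by (rule integral_has_real_derivative[OF ck]) (use that in auto)
  then show ?thesis using that by (simp add: at_within_Icc_at)
 qed
 have "((%t. F (t + e) - F t) has_real_derivative (k (s + e) - k s)) (at s)"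
 proof (intro DERIV_diff)
  show "(F has_real_derivative k s) (at s)" by (rule dF) (use e in auto)
  have "(F has_real_derivative k (s + e)) (at (s + e))" by (rule dF) (use e in auto)
  then show "((%t. F (t + e)) has_real_derivative k (s + e)) (at s)" by (simp add: DERIV_shift)
 qed
 then show ?thesis
 proof (rule has_field_derivative_transform_within[of _ _ _ _ 1])
  fix t assume "dist t s < 1"
  then have t: "s - 1 <= t" by (auto simp: dist_real_def)
  have "integral {s-1..t} k + integral {t..t+e} k = integral {s-1..t+e} k"
   by (rule Henstock_Kurzweil_Integration.integral_combine[OF t _ ik]) (use e in auto)
  moreover have "integral {0..e} (%a. k (t + a)) = integral {t..t+e} k"
   using integral_shift_Icc_real[of 0 e k t] by (simp add: o_def add.commute)
  ultimately show "F (t + e) - F t = integral {0..e} (%a. k (t + a))" by (simp add: F_def)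
 qed auto
qed

text \<open>Averaging over a square turns each partial derivative into a difference of integrals
  over opposite sides, which is continuous even if \<open>H\<close> is merely continuous; this gives
  total differentiability.\<close>

lemma box_average_differentiable:
 fixes H :: "real => real => real"
 assumes H: "continuous_on UNIV (%p. H (fst p) (snd p))" and e: "e > 0"
 obtains A B where
  "((%(s, t). integral {0..e} (%a. integral {0..e} (%b. H (s + a) (t + b)))) has_derivative (%(x, y). A * x + B * y)) (at (0, 0))"
proof -
 have Hc: "continuous_on X (%p. H (f p) (g p))" if "continuous_on X f" "continuous_on X g" for X :: "'x::topological_space set" and f g
  using continuous_on_compose2[OF H continuous_on_Pair[OF that]] by simp
 define k where "k t x = integral {0..e} (%b. H x (t + b))" for t x
 define l where "l s y = integral {0..e} (%a. H (s + a) y)" for s y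
 have k: "continuous_on UNIV (k t)" for t
  unfolding k_def by (rule continuous_on_box_integral) (simp add: case_prod_beta', intro Hc continuous_intros)
 have l: "continuous_on UNIV (%p. l (fst p) (snd p))"
  unfolding l_def by (rule continuous_on_box_integral) (simp add: case_prod_beta', intro Hc continuous_intros)
 have ls: "continuous_on UNIV (l s)" for s
  using continuous_on_compose2[OF l, of UNIV "%y. (s, y)"] by (simp add: continuous_on_Pair)
 define q where "q s t = integral {0..e} (%a. integral {0..e} (%b. H (s + a) (t + b)))" for s t
 have q1: "q s t = integral {0..e} (%a. k t (s + a))" for s t by (simp add: q_def k_def)
 \<comment> \<open>Exchanging the order of integration makes either variable the outer one, so that
   both partial derivatives come from \<open>moving_integral_derivative\<close>.\<close>
 have q2: "q s t = integral {0..e} (%b. l s (t + b))" for s t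
  unfolding q_def l_def using integral_swap_continuous[of 0 0 e e "%a b. H (s + a) (t + b)"]
  by (simp add: case_prod_beta' Hc continuous_intros cbox_interval)
 have fx: "((%s. q s 0) has_derivative (%x. (k 0 (0 + e) - k 0 0) * x)) (at 0 within UNIV)"
  unfolding q1 using moving_integral_derivative[OF k e, of 0 0] by (simp add: has_field_derivative_def)
 have fy: "((%t. q s t) has_derivative blinfun_apply (blinfun_scaleR_left (l s (t + e) - l s t))) (at t within UNIV)" for s t
  unfolding q2 using moving_integral_derivative[OF ls e, of s t] by (simp add: has_field_derivative_def mult.commute[of _ "l s (t + e) - l s t"])
 have "continuous_on UNIV (%p. blinfun_scaleR_left (l (fst p) (snd p + e) - l (fst p) (snd p)))"
  by (intro continuous_intros continuous_on_compose2[OF l, of _ "%p. (fst p, snd p + e)", simplified] l)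
 then have fc: "continuous (at (0, 0) within UNIV \<times> UNIV) (%(s, t). blinfun_scaleR_left (l s (t + e) - l s t))"
  by (simp add: case_prod_beta' continuous_on_eq_continuous_within)
 have "((%(s, t). q s t) has_derivative (%(tx, ty). (k 0 (0 + e) - k 0 0) * tx + blinfun_apply (blinfun_scaleR_left (l 0 (0 + e) - l 0 0)) ty)) (at (0, 0) within UNIV \<times> UNIV)"
  by (rule has_derivative_partialsI[OF fx fy fc UNIV_I convex_UNIV])
 then show ?thesis
  using that[of "k 0 (0 + e) - k 0 0" "l 0 (0 + e) - l 0 0"] by (simp add: q_def mult.commute[of _ "l 0 e - l 0 0"])
qed

lemma directional_limit:
 fixes q :: "real => real => real"
 assumes d: "((%(s, t). q s t) has_derivative (%(x, y). A * x + B * y)) (at (0, 0))"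
  and h: "h \<longlonglongrightarrow> 0" "!!n. h n \<noteq> (0::real)"
 shows "(%n. (q (h n * \<alpha>) (h n * \<beta>) - q 0 0) / h n) \<longlonglongrightarrow> A * \<alpha> + B * \<beta>"
proof -
 have "((%s. (s * \<alpha>, s * \<beta>)) has_derivative (%x. (x * \<alpha>, x * \<beta>))) (at 0)"
  by (auto intro!: derivative_eq_intros)
 moreover have "((%(s, t). q s t) has_derivative (%(x, y). A * x + B * y)) (at ((%s. (s * \<alpha>, s * \<beta>)) 0))" using d by simp
 ultimately have "((%s. q (s * \<alpha>) (s * \<beta>)) has_derivative (%x. (A * \<alpha> + B * \<beta>) * x)) (at 0)"
  using has_derivative_compose by (fastforce simp: algebra_simps)
 then have "((%s. q (s * \<alpha>) (s * \<beta>)) has_real_derivative (A * \<alpha> + B * \<beta>)) (at 0)"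
  by (simp add: has_field_derivative_def)
 then have "((%s. (q (s * \<alpha>) (s * \<beta>) - q 0 0) / s) \<longlongrightarrow> A * \<alpha> + B * \<beta>) (at 0)"
  by (simp add: has_field_derivative_iff)
 from tendsto_compose_eventually[OF this h(1)] h(2) show ?thesis by auto
qed

lemma integrable_compact_support:
 fixes f :: "'a::euclidean_space => real"
 assumes C: "compact C" and f: "continuous_on C f" and z: "!!z. z \<notin> C ==> f z = 0"
 shows "integrable lborel f"
proof -
 have "(%z. indicator C z *\<^sub>R f z) = f" using z by (fastforce simp: indicator_def)
 then show ?thesis using borel_integrable_compact[OF C f] by simp
qed

lemma lborel_integral_translate:
 fixes f :: "'a::euclidean_space => real"
 assumes f: "f \<in> borel_measurable borel"
 shows "(LINT z|lborel. f (z + c)) = (LINT z|lborel. f z)"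
proof -
 have "(LINT z|lborel. f z) = integral\<^sup>L (distr lborel borel ((+) c)) f" by (simp add: lborel_distr_plus)
 also have "... = (LINT z|lborel. f (c + z))" by (rule integral_distr) (use f in auto)
 finally show ?thesis by (simp add: add.commute)
qed

lemma telescoping_square:
 fixes f :: "nat => real"
 shows "(f N - f 0)\<^sup>2 <= real N * (\<Sum>k<N. (f (Suc k) - f k)\<^sup>2)"
proof -
 have "f N - f 0 = (\<Sum>k<N. f (Suc k) - f k)" by (simp add: sum_lessThan_telescope)
 then show ?thesis using sum_squared_le_sum_of_squares[of "%k. f (Suc k) - f k" "{..<N}"] by (simp add: mult.commute)
qed

text \<open>Here m z bounds the Lipschitz constant of \<open>D\<close> on the complex line through z
  in the direction \<open>v\<close>, \<open>C1\<close> is a neighbourhood of the support of the test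
  function \<eta>, and \<omega> bounds the oscillation of \<eta> at the scale r|v|.\<close>

locale energy_setup =
 fixes D \<eta> m :: "complex^'n => real" and v :: "complex^'n" and C C1 :: "(complex^'n) set" and \<delta> r \<omega> :: real
 assumes contD: "continuous_on UNIV D" and cont\<eta>: "continuous_on UNIV \<eta>" and \<eta>0: "!!z. 0 <= \<eta> z"
  and supp: "!!z. z \<notin> C ==> \<eta> z = 0" and cC: "compact C" and cC1: "compact C1" and m: "continuous_on C1 m"
  and m0: "!!z. z \<in> C1 ==> 0 <= m z" and \<delta>: "\<delta> > 0"
  and nbhd: "!!z w. z \<in> C ==> norm w <= r * norm v ==> z + w \<in> C1"
  and lip: "!!z \<zeta> \<zeta>'. z \<in> C1 ==> cmod \<zeta> <= \<delta> ==> cmod \<zeta>' <= \<delta> ==> \<bar>D (z + \<zeta> *s v) - D (z + \<zeta>' *s v)\<bar> <= m z * cmod (\<zeta> - \<zeta>')"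
  and r: "0 < r" "2 * r <= \<delta>"
  and \<omega>: "!!z w. norm w <= r * norm v ==> \<bar>\<eta> (z + w) - \<eta> z\<bar> <= \<omega>"
begin

lemma \<omega>0: "0 <= \<omega>" using \<omega>[of 0 0] r by simp

text \<open>Translating an integral by at most r|v| changes the weight \<eta> by at most \<omega>;
  the enlarged weight absorbs all these translations at once.\<close>

definition W :: "complex^'n => real" where "W z = \<eta> z + \<omega>"

lemma W0: "0 <= W z" using \<eta>0[of z] \<omega>0 by (simp add: W_def)

lemma contW: "continuous_on X W"
 unfolding W_def using cont\<eta> by (intro continuous_intros) (auto intro: continuous_on_subset)

lemma shift_le:
 assumes F: "continuous_on UNIV F" and c: "norm w <= r * norm v"
 shows "(LINT z|lborel. \<eta> z * (F (z + w + u) - F (z + w))\<^sup>2) <= (LINT z:C1|lborel. W z * (F (z + u) - F z)\<^sup>2)"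
  and "integrable lborel (%z. \<eta> z * (F (z + w + u) - F (z + w))\<^sup>2)"
proof -
 have cF: "continuous_on X F" for X using F continuous_on_subset by blast
 have Fc: "continuous_on X (%z. F (g z))" if "continuous_on X g" for X g by (rule continuous_on_compose2[OF F that]) auto
 have ec: "continuous_on X (%z. \<eta> (g z))" if "continuous_on X g" for X g by (rule continuous_on_compose2[OF cont\<eta> that]) auto
 show int: "integrable lborel (%z. \<eta> z * (F (z + w + u) - F (z + w))\<^sup>2)"
  by (rule integrable_compact_support[OF cC]) (auto simp: supp intro!: continuous_intros Fc ec)
 define f where "f = (%z. \<eta> (z - w) * (F (z + u) - F z)\<^sup>2)"
 have f0: "f z = 0" if "z \<notin> C1" for z
  using nbhd[of "z - w" w] c supp[of "z - w"] that by (auto simp: f_def)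
 have cf: "continuous_on X f" for X unfolding f_def by (intro continuous_intros Fc ec cF)
 have if': "integrable lborel f" by (rule integrable_compact_support[OF cC1 cf f0])
 have "(LINT z|lborel. \<eta> z * (F (z + w + u) - F (z + w))\<^sup>2) = (LINT z|lborel. f (z + w))" by (simp add: f_def)
 also have "... = (LINT z|lborel. f z)" by (rule lborel_integral_translate[OF borel_measurable_continuous_onI[OF cf]])
 also have "... <= (LINT z|lborel. indicator C1 z *\<^sub>R (W z * (F (z + u) - F z)\<^sup>2))"
 proof (rule integral_mono[OF if'])
  show "integrable lborel (%z. indicator C1 z *\<^sub>R (W z * (F (z + u) - F z)\<^sup>2))"
   by (rule borel_integrable_compact[OF cC1]) (intro continuous_intros Fc contW cF)
  fix z
  show "f z <= indicator C1 z *\<^sub>R (W z * (F (z + u) - F z)\<^sup>2)"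
  proof (cases "z \<in> C1")
   case True
   have "\<eta> (z - w) <= W z" using \<omega>[of "- w" z] c by (simp add: W_def)
   then show ?thesis using True by (simp add: f_def mult_right_mono)
  qed (simp add: f0)
 qed
 finally show "(LINT z|lborel. \<eta> z * (F (z + w + u) - F (z + w))\<^sup>2) <= (LINT z:C1|lborel. W z * (F (z + u) - F z)\<^sup>2)"
  by (simp add: set_lebesgue_integral_def)
qed

text \<open>The increment over r is a telescoping sum of N increments over r/N. Cauchy-Schwarz and
  translation bound its energy by that of the short difference quotients, which become derivatives
  as N grows.\<close>

lemma subdivide:
 assumes F: "continuous_on UNIV F" and N: "N > 0" and u: "norm u = norm v"
 shows "(LINT z|lborel. \<eta> z * (F (z + r *\<^sub>R u) - F z)\<^sup>2)
  <= r\<^sup>2 * (LINT z:C1|lborel. W z * ((F (z + (r / real N) *\<^sub>R u) - F z) / (r / real N))\<^sup>2)"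
proof -
 define h where "h = r / real N"
 have h: "h > 0" "real N * h = r" using r N by (auto simp: h_def)
 have kh: "norm ((real k * h) *\<^sub>R u) <= r * norm v" if "k <= N" for k
 proof -
  have "real k * h <= real N * h" using that h by (intro mult_right_mono) auto
  then show ?thesis using h u by (simp add: abs_of_nonneg mult_right_mono)
 qed
 have pt: "\<eta> z * (F (z + r *\<^sub>R u) - F z)\<^sup>2 <= (\<Sum>k<N. real N * (\<eta> z * (F (z + (real k * h) *\<^sub>R u + h *\<^sub>R u) - F (z + (real k * h) *\<^sub>R u))\<^sup>2))" for z
 proof -
  have "(F (z + r *\<^sub>R u) - F z)\<^sup>2 <= real N * (\<Sum>k<N. (F (z + (real k * h) *\<^sub>R u + h *\<^sub>R u) - F (z + (real k * h) *\<^sub>R u))\<^sup>2)"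
   using telescoping_square[of "%k. F (z + (real k * h) *\<^sub>R u)" N] h(2)
   by (simp add: algebra_simps)
  then have "\<eta> z * (F (z + r *\<^sub>R u) - F z)\<^sup>2 <= \<eta> z * (real N * (\<Sum>k<N. (F (z + (real k * h) *\<^sub>R u + h *\<^sub>R u) - F (z + (real k * h) *\<^sub>R u))\<^sup>2))"
   by (intro mult_left_mono \<eta>0)
  then show ?thesis by (simp add: sum_distrib_left mult_ac)
 qed
 have "(LINT z|lborel. \<eta> z * (F (z + r *\<^sub>R u) - F z)\<^sup>2)
   <= (LINT z|lborel. (\<Sum>k<N. real N * (\<eta> z * (F (z + (real k * h) *\<^sub>R u + h *\<^sub>R u) - F (z + (real k * h) *\<^sub>R u))\<^sup>2)))"
  by (rule integral_mono)
    (use shift_le(2)[OF F, of 0 "r *\<^sub>R u"] r shift_le(2)[OF F kh] pt in \<open>auto intro!: Bochner_Integration.integrable_sum\<close>)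
 also have "... = (\<Sum>k<N. real N * (LINT z|lborel. \<eta> z * (F (z + (real k * h) *\<^sub>R u + h *\<^sub>R u) - F (z + (real k * h) *\<^sub>R u))\<^sup>2))"
  by (subst Bochner_Integration.integral_sum) (use shift_le(2)[OF F kh] in auto)
 also have "... <= (\<Sum>k<N. real N * (LINT z:C1|lborel. W z * (F (z + h *\<^sub>R u) - F z)\<^sup>2))"
  by (intro sum_mono mult_left_mono shift_le(1)[OF F kh]) auto
 also have "... = (real N)\<^sup>2 * (LINT z:C1|lborel. W z * (F (z + h *\<^sub>R u) - F z)\<^sup>2)"
  by (simp add: power2_eq_square)
 also have "... = r\<^sup>2 * (LINT z:C1|lborel. W z * ((F (z + h *\<^sub>R u) - F z) / h)\<^sup>2)"
 proof -
  have sc: "W z * ((F (z + h *\<^sub>R u) - F z) / h)\<^sup>2 = (1 / h\<^sup>2) * (W z * (F (z + h *\<^sub>R u) - F z)\<^sup>2)" for z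
   by (simp add: power_divide)
  have "(LINT z:C1|lborel. W z * ((F (z + h *\<^sub>R u) - F z) / h)\<^sup>2) = (1 / h\<^sup>2) * (LINT z:C1|lborel. W z * (F (z + h *\<^sub>R u) - F z)\<^sup>2)"
   unfolding sc by (rule set_integral_mult_right)
  moreover have "r\<^sup>2 = (real N)\<^sup>2 * h\<^sup>2" unfolding h(2)[symmetric] by (rule power_mult_distrib)
  ultimately show ?thesis using h(1) by simp
 qed
 finally show ?thesis unfolding h_def .
qed

text \<open>The average runs over a square inside the complex line of \<open>v\<close> only: the
  energy involves derivatives along v and iv, and the Lipschitz bound is available only on that
  line.\<close>

definition mollify :: "real => complex^'n => real" where
 "mollify e z = (1 / e\<^sup>2) * integral {0..e} (%a. integral {0..e} (%b. D (z + Complex a b *s v)))"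

lemma continuous_Complex: "continuous_on X f ==> continuous_on X g ==> continuous_on X (%x. Complex (f x) (g x))"
 by (simp add: Complex_eq) (intro continuous_intros)

lemma D_comp: "continuous_on X g ==> continuous_on X (%z. D (g z))"
 by (rule continuous_on_compose2[OF contD]) auto

lemma mollify_continuous: "continuous_on UNIV (mollify e)"
proof -
 have "continuous_on UNIV (%p. integral {0..e} (%b. D (fst p + Complex (snd p) b *s v)))"
  by (rule continuous_on_box_integral) (simp add: case_prod_beta', intro D_comp continuous_intros continuous_Complex)
 then have "continuous_on (UNIV \<times> {0..e}) (%(z, a). integral {0..e} (%b. D (z + Complex a b *s v)))"
  by (simp add: case_prod_beta') (meson continuous_on_subset subset_UNIV)
 then have "continuous_on UNIV (%z. integral {0..e} (%a. integral {0..e} (%b. D (z + Complex a b *s v))))"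
  by (rule continuous_on_box_integral)
 then show ?thesis unfolding mollify_def by (intro continuous_intros)
qed

lemma box_integral_bound:
 assumes f: "continuous_on UNIV (%p. f (fst p) (snd p) :: real)" and e: "e > 0"
  and B: "!!a b. 0 <= a ==> a <= e ==> 0 <= b ==> b <= e ==> \<bar>f a b\<bar> <= B"
 shows "\<bar>(1 / e\<^sup>2) * integral {0..e} (%a. integral {0..e} (f a))\<bar> <= B"
proof -
 have fa: "continuous_on UNIV (f a)" for a
  using continuous_on_compose2[OF f, of UNIV "%b. (a, b)"] by (simp add: continuous_on_Pair)
 have i: "continuous_on UNIV (%a. integral {0..e} (f a))"
  by (rule continuous_on_box_integral) (use f continuous_on_subset in \<open>force simp: case_prod_beta'\<close>)
 have B0: "0 <= B" using B[of 0 0] e by simp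
 have "\<bar>integral {0..e} (f a)\<bar> <= B * e" if "0 <= a" "a <= e" for a
  using integral_bound[of 0 e "f a" B] e B[OF that] continuous_on_subset[OF fa] by auto
 then have "\<bar>integral {0..e} (%a. integral {0..e} (f a))\<bar> <= (B * e) * e"
  using integral_bound[of 0 e "%a. integral {0..e} (f a)" "B * e"] e continuous_on_subset[OF i] by auto
 then have "\<bar>integral {0..e} (%a. integral {0..e} (f a))\<bar> / e\<^sup>2 <= B"
  using e by (simp add: field_simps power2_eq_square)
 then show ?thesis by (simp add: abs_mult)
qed

lemma mollify_diff:
 assumes e: "e > 0"
 shows "mollify e x - mollify e y = (1 / e\<^sup>2) * integral {0..e} (%a. integral {0..e} (%b. D (x + Complex a b *s v) - D (y + Complex a b *s v)))"
proof -
 have c: "continuous_on UNIV (%p. D (z + Complex (fst p) (snd p) *s v))" for z by (intro D_comp continuous_intros continuous_Complex)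
 have ca: "continuous_on X (%b. D (z + Complex a b *s v))" for z a X by (intro D_comp continuous_intros continuous_Complex)
 have ci: "continuous_on UNIV (%a. integral {0..e} (%b. D (z + Complex a b *s v)))" for z
  by (rule continuous_on_box_integral) (use c continuous_on_subset in \<open>force simp: case_prod_beta'\<close>)
 show ?thesis
  unfolding mollify_def
  by (simp add: Henstock_Kurzweil_Integration.integral_diff integrable_continuous_interval ca continuous_on_subset[OF ci] right_diff_distrib)
qed

lemma box_norm: "0 <= a ==> a <= e ==> 0 <= b ==> b <= e ==> cmod (Complex a b) <= 2 * e"
 using cmod_le[of "Complex a b"] by simp

text \<open>The hypothesis bounds, by the constant at the centre \<open>z\<close>, all increments
  within a disc about \<open>z\<close>. It thus covers every shifted pair in the average, which
  inherits the constant without loss.\<close>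

lemma mollify_lip:
 assumes e: "e > 0" "4 * e <= \<delta>" and z: "z \<in> C1" and \<zeta>: "2 * cmod \<zeta> <= \<delta>"
 shows "\<bar>mollify e (z + \<zeta> *s v) - mollify e z\<bar> <= m z * cmod \<zeta>"
 unfolding mollify_diff[OF e(1)]
proof (rule box_integral_bound[OF _ e(1)])
 show "continuous_on UNIV (%p. D (z + \<zeta> *s v + Complex (fst p) (snd p) *s v) - D (z + Complex (fst p) (snd p) *s v))"
  by (intro continuous_intros D_comp continuous_Complex)
 fix a b assume ab: "0 <= a" "a <= e" "0 <= b" "b <= e"
 have "cmod (\<zeta> + Complex a b) <= \<delta>" "cmod (Complex a b) <= \<delta>"
  using norm_triangle_ineq[of \<zeta> "Complex a b"] box_norm[OF ab] e \<zeta> by linarith+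
 from lip[OF z this]
 have "\<bar>D (z + (\<zeta> + Complex a b) *s v) - D (z + Complex a b *s v)\<bar> <= m z * cmod \<zeta>" by simp
 then show "\<bar>D (z + \<zeta> *s v + Complex a b *s v) - D (z + Complex a b *s v)\<bar> <= m z * cmod \<zeta>"
  by (simp add: vector_sadd_rdistrib add.assoc)
qed

lemma mollify_close:
 assumes e: "e > 0" "4 * e <= \<delta>" and z: "z \<in> C1"
 shows "\<bar>mollify e z - D z\<bar> <= 2 * e * m z"
proof -
 have c: "integral {0..e} (%a::real. integral {0..e} (%b::real. D z)) = e\<^sup>2 * D z" using e by (simp add: power2_eq_square)
 have ca: "continuous_on X (%b. D (z + Complex a b *s v))" for a X by (intro D_comp continuous_intros continuous_Complex)
 have ci: "continuous_on UNIV (%a. integral {0..e} (%b. D (z + Complex a b *s v)))"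
  by (rule continuous_on_box_integral) (simp add: case_prod_beta', intro D_comp continuous_intros continuous_Complex)
 have "mollify e z - D z = (1 / e\<^sup>2) * (integral {0..e} (%a. integral {0..e} (%b. D (z + Complex a b *s v))) - integral {0..e} (%a::real. integral {0..e} (%b::real. D z)))"
  unfolding c mollify_def using e by (simp add: right_diff_distrib)
 also have "... = (1 / e\<^sup>2) * integral {0..e} (%a. integral {0..e} (%b. D (z + Complex a b *s v) - D z))"
  by (simp add: Henstock_Kurzweil_Integration.integral_diff integrable_continuous_interval ca continuous_on_subset[OF ci])
 finally have eq: "mollify e z - D z = (1 / e\<^sup>2) * integral {0..e} (%a. integral {0..e} (%b. D (z + Complex a b *s v) - D z))" .
 show ?thesis
  unfolding eq
 proof (rule box_integral_bound[OF _ e(1)])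
  show "continuous_on UNIV (%p. D (z + Complex (fst p) (snd p) *s v) - D z)"
   by (intro continuous_intros D_comp continuous_Complex)
  fix a b assume ab: "0 <= a" "a <= e" "0 <= b" "b <= e"
  have "cmod (Complex a b) <= \<delta>" using box_norm[OF ab] e by linarith
  then have "\<bar>D (z + Complex a b *s v) - D (z + 0 *s v)\<bar> <= m z * cmod (Complex a b - 0)"
   by (intro lip z) (use \<delta> in auto)
  also have "... <= m z * (2 * e)" using box_norm[OF ab] m0[OF z] by (intro mult_left_mono) auto
  finally show "\<bar>D (z + Complex a b *s v) - D z\<bar> <= 2 * e * m z" by (simp add: mult_ac)
 qed
qed

text \<open>The Lipschitz bound in the direction of the gradient controls the sum of both squared
  partial derivatives. Bounding the two directions separately would give twice as much; this is
  where the factor two is saved.\<close>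

lemma mollify_gradient:
 assumes e: "e > 0" "4 * e <= \<delta>" and z: "z \<in> C1" and h: "h \<longlonglongrightarrow> 0" "!!n. h n > 0"
 obtains A B where "A\<^sup>2 + B\<^sup>2 <= (m z)\<^sup>2"
  "!!\<alpha> \<beta>. (%n. (mollify e (z + h n *\<^sub>R (Complex \<alpha> \<beta> *s v)) - mollify e z) / h n) \<longlonglongrightarrow> A * \<alpha> + B * \<beta>"
proof -
 define q where "q s t = integral {0..e} (%a. integral {0..e} (%b. D (z + Complex (s + a) (t + b) *s v)))" for s t
 have H: "continuous_on UNIV (%p. D (z + Complex (fst p) (snd p) *s v))" by (intro D_comp continuous_intros continuous_Complex)
 obtain A B where AB: "((%(s, t). q s t) has_derivative (%(x, y). A * x + B * y)) (at (0, 0))"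
  unfolding q_def using box_average_differentiable[OF H e(1)] by blast
 have mq: "mollify e (z + Complex s t *s v) = (1 / e\<^sup>2) * q s t" for s t
 proof -
  have zz: "z + Complex s t *s v + Complex a b *s v = z + Complex (s + a) (t + b) *s v" for a b
   by (simp only: add.assoc vector_sadd_rdistrib complex_add[symmetric])
  show ?thesis unfolding mollify_def q_def zz ..
 qed
 define A' where "A' = A / e\<^sup>2"
 define B' where "B' = B / e\<^sup>2"
 have lim: "(%n. (mollify e (z + h n *\<^sub>R (Complex \<alpha> \<beta> *s v)) - mollify e z) / h n) \<longlonglongrightarrow> A' * \<alpha> + B' * \<beta>" for \<alpha> \<beta>
 proof -
  have "(%n. (1 / e\<^sup>2) * ((q (h n * \<alpha>) (h n * \<beta>) - q 0 0) / h n)) \<longlonglongrightarrow> (1 / e\<^sup>2) * (A * \<alpha> + B * \<beta>)"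
   by (intro tendsto_mult tendsto_const directional_limit[OF AB h(1)]) (use h(2) in \<open>simp add: less_imp_neq[THEN not_sym]\<close>)
  moreover have "z + h n *\<^sub>R (Complex \<alpha> \<beta> *s v) = z + Complex (h n * \<alpha>) (h n * \<beta>) *s v" for n
   by (simp add: scaleR_complex_vec vec_eq_iff complex_eq_iff Complex_eq algebra_simps)
  moreover have "mollify e z = (1 / e\<^sup>2) * q 0 0" using mq[of 0 0] by (simp add: Complex_eq)
  ultimately show ?thesis by (simp add: mq A'_def B'_def right_diff_distrib diff_divide_distrib add_divide_distrib)
 qed
 have "A'\<^sup>2 + B'\<^sup>2 <= (m z)\<^sup>2"
 proof (cases "A'\<^sup>2 + B'\<^sup>2 = 0")
  case False
  define n where "n = sqrt (A'\<^sup>2 + B'\<^sup>2)"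
  have p: "0 < A'\<^sup>2 + B'\<^sup>2" using False by (metis less_le sum_power2_ge_zero)
  then have n: "n > 0" "n\<^sup>2 = A'\<^sup>2 + B'\<^sup>2" by (simp_all add: n_def)
  \<comment> \<open>The unit vector in the direction of the gradient.\<close>
  let ?c = "Complex (A' / n) (B' / n)"
  have c1: "cmod ?c = 1" using p n by (auto simp: cmod_def power_divide add_divide_distrib[symmetric])
  have "(%k. \<bar>(mollify e (z + h k *\<^sub>R (?c *s v)) - mollify e z) / h k\<bar>) \<longlonglongrightarrow> \<bar>A' * (A' / n) + B' * (B' / n)\<bar>"
   by (intro tendsto_rabs lim)
  moreover have "eventually (%k. \<bar>(mollify e (z + h k *\<^sub>R (?c *s v)) - mollify e z) / h k\<bar> <= m z) sequentially"
  proof -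
   have "eventually (%k. h k < \<delta> / 2) sequentially" by (rule order_tendstoD(2)[OF h(1)]) (use \<delta> in simp)
   then show ?thesis
   proof eventually_elim
    case (elim k)
    have "\<bar>mollify e (z + (of_real (h k) * ?c) *s v) - mollify e z\<bar> <= m z * cmod (of_real (h k) * ?c)"
     by (rule mollify_lip[OF e z]) (use elim h(2)[of k] c1 in \<open>simp add: norm_mult\<close>)
    moreover have "(of_real (h k) * ?c) *s v = h k *\<^sub>R (?c *s v)" by (simp add: scaleR_complex_vec)
    moreover have "cmod (of_real (h k) * ?c) = h k" using c1 h(2)[of k] by (simp add: norm_mult)
    ultimately show ?case using h(2)[of k] by (simp add: divide_le_eq)
   qed
  qed
  ultimately have "\<bar>A' * (A' / n) + B' * (B' / n)\<bar> <= m z" by (rule tendsto_upperbound) simp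
  moreover have "A' * (A' / n) + B' * (B' / n) = n" using n by (simp add: power2_eq_square[symmetric] add_divide_distrib[symmetric] flip: n(2)) (simp add: power2_eq_square)
  ultimately have "n <= m z" using n by simp
  then have "n\<^sup>2 <= (m z)\<^sup>2" using n by (intro power_mono) auto
  then show ?thesis using n by simp
 qed simp
 then show ?thesis using that lim by blast
qed

text \<open>As the subdivision is refined, the squared quotients along cv and icv add up to the
  squared gradient in the limit, which is at most (m z)^2 for every unimodular \<open>c\<close>. So
  only the excess over (m z)^2 has to be shown to disappear.\<close>

lemma energy_mollified:
 assumes e: "e > 0" "4 * e <= \<delta>" and c: "cmod c = 1"
 defines "F \<equiv> mollify e"
 shows "(LINT z|lborel. \<eta> z * (F (z + r *\<^sub>R (c *s v)) - F z)\<^sup>2) + (LINT z|lborel. \<eta> z * (F (z + r *\<^sub>R ((\<i> * c) *s v)) - F z)\<^sup>2)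
   <= r\<^sup>2 * (LINT z:C1|lborel. W z * (m z)\<^sup>2)"
proof -
 have F: "continuous_on UNIV F" unfolding F_def by (rule mollify_continuous)
 have Fc: "continuous_on X (%z. F (g z))" if "continuous_on X g" for X g by (rule continuous_on_compose2[OF F that]) auto
 define h where "h n = r / real (Suc n)" for n
 have h: "h n > 0" "h n <= r" for n using r by (auto simp: h_def divide_le_eq)
 have hl: "h \<longlonglongrightarrow> 0" unfolding h_def by (rule lim_const_over_n[THEN LIMSEQ_Suc])
 let ?u = "c *s v" and ?w = "(\<i> * c) *s v"
 define s where "s n z = ((F (z + h n *\<^sub>R ?u) - F z) / h n)\<^sup>2 + ((F (z + h n *\<^sub>R ?w) - F z) / h n)\<^sup>2" for n z
 have sc: "continuous_on X (s n)" for n X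
  unfolding s_def by (intro continuous_intros Fc) (use h(1)[of n] in auto)
 have quot: "((F (z + h n *\<^sub>R (k *s v)) - F z) / h n)\<^sup>2 <= (m z)\<^sup>2" if k: "cmod k = 1" and z: "z \<in> C1" for k n z
 proof -
  have "\<bar>F (z + (of_real (h n) * k) *s v) - F z\<bar> <= m z * cmod (of_real (h n) * k)"
   unfolding F_def by (rule mollify_lip[OF e z]) (use h[of n] r k in \<open>simp add: norm_mult\<close>)
  then have "\<bar>(F (z + h n *\<^sub>R (k *s v)) - F z) / h n\<bar> <= m z"
   using h[of n] k by (simp add: norm_mult divide_le_eq scaleR_complex_vec)
  then show ?thesis using m0[OF z] abs_le_square_iff[of "(F (z + h n *\<^sub>R (k *s v)) - F z) / h n" "m z"] by simp
 qed
 have ic: "cmod (\<i> * c) = 1" using c by (simp add: norm_mult)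
 have s_le: "s n z <= 2 * (m z)\<^sup>2" if "z \<in> C1" for n z
  using quot[OF c that, of n] quot[OF ic that, of n] by (simp add: s_def)
 have s0: "0 <= s n z" for n z by (simp add: s_def)
 \<comment> \<open>The weighted excess over (m z)^2. Each of the two quotients alone is bounded by m
   z, so the excess is dominated by the weighted (m z)^2.\<close>
 let ?p = "%n z. indicator C1 z *\<^sub>R (W z * max 0 (s n z - (m z)\<^sup>2))"
 have im: "integrable lborel (%z. indicator C1 z *\<^sub>R (W z * (m z)\<^sup>2))"
  by (rule borel_integrable_compact[OF cC1]) (intro continuous_intros contW m)
 have ip: "integrable lborel (?p n)" for n
  by (rule borel_integrable_compact[OF cC1]) (intro continuous_intros contW m sc)
 have isn: "integrable lborel (%z. indicator C1 z *\<^sub>R (W z * s n z))" for n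
  by (rule borel_integrable_compact[OF cC1]) (intro continuous_intros contW m sc)
 have plim: "(%n. ?p n z) \<longlonglongrightarrow> 0" for z
 proof (cases "z \<in> C1")
  case True
  obtain A B where AB: "A\<^sup>2 + B\<^sup>2 <= (m z)\<^sup>2"
   and l: "!!\<alpha> \<beta>. (%n. (F (z + h n *\<^sub>R (Complex \<alpha> \<beta> *s v)) - F z) / h n) \<longlonglongrightarrow> A * \<alpha> + B * \<beta>"
   unfolding F_def using mollify_gradient[OF e True hl h(1)] by blast
  obtain \<alpha> \<beta> where cab: "c = Complex \<alpha> \<beta>" by (cases c)
  have icab: "\<i> * c = Complex (- \<beta>) \<alpha>" by (simp add: cab complex_eq_iff)
  have ab: "\<alpha>\<^sup>2 + \<beta>\<^sup>2 = 1" using c by (simp add: cab cmod_def)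
  have "(%n. s n z) \<longlonglongrightarrow> (A * \<alpha> + B * \<beta>)\<^sup>2 + (A * (- \<beta>) + B * \<alpha>)\<^sup>2"
   unfolding s_def icab unfolding cab by (intro tendsto_intros l)
  also have "(A * \<alpha> + B * \<beta>)\<^sup>2 + (A * (- \<beta>) + B * \<alpha>)\<^sup>2 = (A\<^sup>2 + B\<^sup>2) * (\<alpha>\<^sup>2 + \<beta>\<^sup>2)"
   by (simp add: power2_eq_square algebra_simps)
  finally have "(%n. s n z) \<longlonglongrightarrow> A\<^sup>2 + B\<^sup>2" by (simp add: ab)
  then have "(%n. indicator C1 z *\<^sub>R (W z * max 0 (s n z - (m z)\<^sup>2))) \<longlonglongrightarrow> indicator C1 z *\<^sub>R (W z * max 0 (A\<^sup>2 + B\<^sup>2 - (m z)\<^sup>2))"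
   by (intro tendsto_intros)
  then show ?thesis using AB by simp
 qed simp
 have "(%n. LINT z|lborel. ?p n z) \<longlonglongrightarrow> (LINT z|(lborel :: (complex^'n) measure). 0 :: real)"
 proof (rule integral_dominated_convergence[where w = "%z. indicator C1 z *\<^sub>R (W z * (m z)\<^sup>2)"])
  show "integrable lborel (%z. indicator C1 z *\<^sub>R (W z * (m z)\<^sup>2))" by (rule im)
  show "AE z in lborel. (%n. ?p n z) \<longlonglongrightarrow> 0" using plim by simp
  show "AE z in lborel. norm (?p n z) <= indicator C1 z *\<^sub>R (W z * (m z)\<^sup>2)" for n
  proof (rule AE_I2)
   fix z
   show "norm (?p n z) <= indicator C1 z *\<^sub>R (W z * (m z)\<^sup>2)"
   proof (cases "z \<in> C1")
    case True
    have "max 0 (s n z - (m z)\<^sup>2) <= (m z)\<^sup>2" using s_le[OF True, of n] by simp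
    then show ?thesis using True W0[of z] by (simp add: abs_mult mult_left_mono)
   qed simp
  qed
 qed (use borel_measurable_integrable[OF ip] in auto)
 then have l0: "(%n. r\<^sup>2 * (LINT z:C1|lborel. W z * (m z)\<^sup>2) + r\<^sup>2 * (LINT z|lborel. ?p n z)) \<longlonglongrightarrow> r\<^sup>2 * (LINT z:C1|lborel. W z * (m z)\<^sup>2) + r\<^sup>2 * 0"
  by (intro tendsto_intros) simp
 show ?thesis (is "?E <= ?R")
 proof (rule LIMSEQ_le_const)
  show "(%n. r\<^sup>2 * (LINT z:C1|lborel. W z * (m z)\<^sup>2) + r\<^sup>2 * (LINT z|lborel. ?p n z)) \<longlonglongrightarrow> ?R" using l0 by simp
  have "?E <= ?R + r\<^sup>2 * (LINT z|lborel. ?p n z)" for n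
  proof -
   have nu: "norm (k *s v) = norm v" if "cmod k = 1" for k using that by simp
   have i1: "set_integrable lborel C1 (%z. W z * ((F (z + h n *\<^sub>R (k *s v)) - F z) / h n)\<^sup>2)" for k
    unfolding set_integrable_def
    by (rule borel_integrable_compact[OF cC1]) (intro continuous_intros contW Fc, use h(1)[of n] in auto)
   have "?E <= r\<^sup>2 * (LINT z:C1|lborel. W z * ((F (z + h n *\<^sub>R ?u) - F z) / h n)\<^sup>2) + r\<^sup>2 * (LINT z:C1|lborel. W z * ((F (z + h n *\<^sub>R ?w) - F z) / h n)\<^sup>2)"
    using subdivide[OF F _ nu[OF c], of "Suc n"] subdivide[OF F _ nu[OF ic], of "Suc n"] unfolding h_def by (intro add_mono) auto
   also have "... = r\<^sup>2 * (LINT z:C1|lborel. W z * s n z)"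
    unfolding s_def distrib_left by (subst set_integral_add(2)[OF i1 i1]) (simp add: distrib_left)
   also have "(LINT z:C1|lborel. W z * s n z) <= (LINT z|lborel. indicator C1 z *\<^sub>R (W z * (m z)\<^sup>2) + ?p n z)"
    unfolding set_lebesgue_integral_def
   proof (rule integral_mono[OF isn Bochner_Integration.integrable_add[OF im ip]])
    fix z
    have "W z * s n z <= W z * ((m z)\<^sup>2 + max 0 (s n z - (m z)\<^sup>2))" by (intro mult_left_mono W0) auto
    then show "indicator C1 z *\<^sub>R (W z * s n z) <= indicator C1 z *\<^sub>R (W z * (m z)\<^sup>2) + ?p n z"
     by (auto simp: indicator_def distrib_left)
   qed
   also have "(LINT z|lborel. indicator C1 z *\<^sub>R (W z * (m z)\<^sup>2) + ?p n z) = (LINT z:C1|lborel. W z * (m z)\<^sup>2) + (LINT z|lborel. ?p n z)"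
    unfolding set_lebesgue_integral_def by (rule Bochner_Integration.integral_add[OF im ip])
   finally show ?thesis by (simp add: distrib_left mult_left_mono)
  qed
  then show "\<exists>N. \<forall>n\<ge>N. ?E <= ?R + r\<^sup>2 * (LINT z|lborel. ?p n z)" by blast
 qed
qed

lemma energy_pair:
 assumes c: "cmod c = 1"
 shows "(LINT z|lborel. \<eta> z * (D (z + r *\<^sub>R (c *s v)) - D z)\<^sup>2) + (LINT z|lborel. \<eta> z * (D (z + r *\<^sub>R ((\<i> * c) *s v)) - D z)\<^sup>2)
   <= r\<^sup>2 * (LINT z:C1|lborel. W z * (m z)\<^sup>2)"
proof -
 define e where "e n = \<delta> / 4 / real (Suc n)" for n
 have e: "e n > 0" "4 * e n <= \<delta>" for n using \<delta> by (auto simp: e_def divide_le_eq)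
 have el: "e \<longlonglongrightarrow> 0" unfolding e_def by (rule lim_const_over_n[THEN LIMSEQ_Suc])
 have CC1: "z \<in> C1" if "z \<in> C" for z using nbhd[OF that, of 0] r by simp
 have lim: "(%n. LINT z|lborel. \<eta> z * (mollify (e n) (z + r *\<^sub>R (k *s v)) - mollify (e n) z)\<^sup>2) \<longlonglongrightarrow> (LINT z|lborel. \<eta> z * (D (z + r *\<^sub>R (k *s v)) - D z)\<^sup>2)"
  if k: "cmod k = 1" for k
 proof (rule integral_dominated_convergence[where w = "%z. indicator C1 z *\<^sub>R (W z * ((m z)\<^sup>2 * r\<^sup>2))"])
  show "integrable lborel (%z. indicator C1 z *\<^sub>R (W z * ((m z)\<^sup>2 * r\<^sup>2)))"
   by (rule borel_integrable_compact[OF cC1]) (intro continuous_intros contW m)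
  have cc: "continuous_on UNIV (%z. \<eta> z * (G (z + r *\<^sub>R (k *s v)) - G z)\<^sup>2)" if "continuous_on UNIV G" for G
   by (intro continuous_intros continuous_on_compose2[OF that] cont\<eta> that) auto
  show "(%z. \<eta> z * (D (z + r *\<^sub>R (k *s v)) - D z)\<^sup>2) \<in> borel_measurable lborel"
   using borel_measurable_continuous_onI[OF cc[OF contD]] by simp
  show "(%z. \<eta> z * (mollify (e n) (z + r *\<^sub>R (k *s v)) - mollify (e n) z)\<^sup>2) \<in> borel_measurable lborel" for n
   using borel_measurable_continuous_onI[OF cc[OF mollify_continuous]] by simp
  have conv: "(%n. mollify (e n) z) \<longlonglongrightarrow> D z" if z: "z \<in> C1" for z
  proof (rule LIM_zero_cancel, rule Lim_null_comparison)
   show "eventually (%n. norm (mollify (e n) z - D z) <= 2 * e n * m z) sequentially"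
    using mollify_close[OF e z] by simp
   show "(%n. 2 * e n * m z) \<longlonglongrightarrow> 0" using el by (auto intro!: tendsto_eq_intros)
  qed
  have in1: "z + r *\<^sub>R (k *s v) \<in> C1" if "z \<in> C" for z
   by (rule nbhd[OF that]) (use r k in simp)
  show "AE z in lborel. (%n. \<eta> z * (mollify (e n) (z + r *\<^sub>R (k *s v)) - mollify (e n) z)\<^sup>2) \<longlonglongrightarrow> \<eta> z * (D (z + r *\<^sub>R (k *s v)) - D z)\<^sup>2"
  proof (rule AE_I2)
   fix z
   show "(%n. \<eta> z * (mollify (e n) (z + r *\<^sub>R (k *s v)) - mollify (e n) z)\<^sup>2) \<longlonglongrightarrow> \<eta> z * (D (z + r *\<^sub>R (k *s v)) - D z)\<^sup>2"
   proof (cases "z \<in> C")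
    case True then show ?thesis by (intro tendsto_intros conv CC1 in1)
   qed (simp add: supp)
  qed
  show "AE z in lborel. norm (\<eta> z * (mollify (e n) (z + r *\<^sub>R (k *s v)) - mollify (e n) z)\<^sup>2) <= indicator C1 z *\<^sub>R (W z * ((m z)\<^sup>2 * r\<^sup>2))" for n
  proof (rule AE_I2)
   fix z
   show "norm (\<eta> z * (mollify (e n) (z + r *\<^sub>R (k *s v)) - mollify (e n) z)\<^sup>2) <= indicator C1 z *\<^sub>R (W z * ((m z)\<^sup>2 * r\<^sup>2))"
   proof (cases "z \<in> C")
    case True
    have z1: "z \<in> C1" by (rule CC1[OF True])
    have "\<bar>mollify (e n) (z + (of_real r * k) *s v) - mollify (e n) z\<bar> <= m z * cmod (of_real r * k)"
     by (rule mollify_lip[OF e z1]) (use r k in \<open>simp add: norm_mult\<close>)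
    then have "\<bar>mollify (e n) (z + r *\<^sub>R (k *s v)) - mollify (e n) z\<bar> <= m z * r"
     using r k by (simp add: norm_mult scaleR_complex_vec)
    then have "(mollify (e n) (z + r *\<^sub>R (k *s v)) - mollify (e n) z)\<^sup>2 <= (m z * r)\<^sup>2"
     using abs_le_square_iff[of _ "m z * r"] m0[OF z1] r by simp
    then have "\<eta> z * (mollify (e n) (z + r *\<^sub>R (k *s v)) - mollify (e n) z)\<^sup>2 <= W z * (m z * r)\<^sup>2"
     using \<eta>0[of z] \<omega>0 W0[of z] by (intro mult_mono) (auto simp: W_def)
    then show ?thesis using z1 \<eta>0[of z] by (simp add: abs_mult power_mult_distrib)
   qed (use supp W0 in \<open>auto simp: indicator_def\<close>)
  qed
 qed
 have ic: "cmod (\<i> * c) = 1" using c by (simp add: norm_mult)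
 show ?thesis
  by (rule LIMSEQ_le_const2[OF tendsto_add[OF lim[OF c] lim[OF ic]]])
    (use energy_mollified[OF e c] in blast)
qed

text \<open>Averaging \<open>energy_pair\<close> over all angles counts each direction twice, since
  multiplication by i permutes the circle. The result has \<pi> r^2 where the bare Lipschitz bound
  would give 2 \<pi> r^2.\<close>

lemma energy_mean:
 "(LINT z|lborel. \<eta> z * cint (%\<theta>. (D (z + r *\<^sub>R (cis \<theta> *s v)) - D z)\<^sup>2)) <= pi * r\<^sup>2 * (LINT z:C1|lborel. W z * (m z)\<^sup>2)"
proof -
 let ?X = "LINT z:C1|lborel. W z * (m z)\<^sup>2"
 define f where "f k z = \<eta> z * (D (z + r *\<^sub>R (k *s v)) - D z)\<^sup>2" for k z
 have cf: "continuous_on X (%p. f (g p) (h p))" if "continuous_on X g" "continuous_on X h" for X :: "'x::topological_space set" and g h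
  unfolding f_def by (intro continuous_intros D_comp continuous_on_compose2[OF cont\<eta> that(2)] that) auto
 \<comment> \<open>Used with k = 1 and k = i: the same circle mean, started at two angles.\<close>
 define e where "e k = (%z \<theta>. indicator {0..2*pi} \<theta> *\<^sub>R f (k * cis \<theta>) z)" for k
 have eint: "integrable (lborel \<Otimes>\<^sub>M lborel) (case_prod (e k))" for k
 proof -
  have "integrable lborel (%p. indicator (C \<times> {0..2*pi}) p *\<^sub>R f (k * cis (snd p)) (fst p))"
   by (rule borel_integrable_compact) (auto intro!: compact_Times cC cf continuous_intros)
  moreover have "(%p. indicator (C \<times> {0..2*pi}) p *\<^sub>R f (k * cis (snd p)) (fst p)) = case_prod (e k)"
   using supp by (auto simp: fun_eq_iff e_def indicator_def f_def)
  ultimately show ?thesis by (simp add: lborel_prod)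
 qed
 have cz: "(LINT \<theta>|lborel. e k z \<theta>) = \<eta> z * cint (%\<theta>. (D (z + r *\<^sub>R ((k * cis \<theta>) *s v)) - D z)\<^sup>2)" for k z
  unfolding cint_def e_def f_def by (simp add: set_lebesgue_integral_def mult.left_commute[of _ "\<eta> z"])
 have rot: "cint (%\<theta>. (D (z + r *\<^sub>R ((\<i> * cis \<theta>) *s v)) - D z)\<^sup>2) = cint (%\<theta>. (D (z + r *\<^sub>R (cis \<theta> *s v)) - D z)\<^sup>2)" for z
  by (rule cint_rotate[of "%k. (D (z + r *\<^sub>R (k *s v)) - D z)\<^sup>2"]) (intro continuous_intros D_comp)
 let ?L = "LINT z|lborel. \<eta> z * cint (%\<theta>. (D (z + r *\<^sub>R (cis \<theta> *s v)) - D z)\<^sup>2)"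
 have sw: "(LINT z|lborel. LINT \<theta>|lborel. e k z \<theta>) = (LINT \<theta>|lborel. LINT z|lborel. e k z \<theta>)" for k
  using lborel_pair.Fubini_integral[OF eint[of k]] by simp
 have inner: "(LINT z|lborel. e k z \<theta>) = indicator {0..2*pi} \<theta> *\<^sub>R (LINT z|lborel. f (k * cis \<theta>) z)" for k \<theta>
  by (simp add: e_def)
 have oint: "integrable lborel (%\<theta>. LINT z|lborel. e k z \<theta>)" for k
  using lborel_pair.integrable_snd[OF eint[of k]] by simp
 have "2 * ?L = (LINT z|lborel. LINT \<theta>|lborel. e 1 z \<theta>) + (LINT z|lborel. LINT \<theta>|lborel. e \<i> z \<theta>)"
  unfolding cz by (simp add: rot)
 also have "... = (LINT \<theta>|lborel. (LINT z|lborel. e 1 z \<theta>) + (LINT z|lborel. e \<i> z \<theta>))"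
  unfolding sw by (rule Bochner_Integration.integral_add[symmetric, OF oint oint])
 also have "... <= (LINT \<theta>|lborel. indicator {0..2*pi} \<theta> *\<^sub>R (r\<^sup>2 * ?X))"
 proof (rule integral_mono)
  show "integrable lborel (%\<theta>. (LINT z|lborel. e 1 z \<theta>) + (LINT z|lborel. e \<i> z \<theta>))" using oint by auto
  show "integrable lborel (%\<theta>::real. indicator {0..2*pi} \<theta> *\<^sub>R (r\<^sup>2 * ?X))"
   by (rule borel_integrable_compact) auto
  fix \<theta>
  show "(LINT z|lborel. e 1 z \<theta>) + (LINT z|lborel. e \<i> z \<theta>) <= indicator {0..2*pi} \<theta> *\<^sub>R (r\<^sup>2 * ?X)"
   unfolding inner using energy_pair[of "cis \<theta>"] by (simp add: f_def[abs_def] indicator_def)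
 qed
 also have "... = 2 * pi * (r\<^sup>2 * ?X)" by (simp add: pi_ge_zero)
 finally show ?thesis by simp
qed

end

section \<open>Positivity of the current\<close>

lemma lapl_scale:
 fixes f :: "complex^'n => real"
 assumes "open S" "Ck_on 2 S f" "z \<in> S"
 shows "lapl f (c *s v) z = (cmod c)\<^sup>2 * lapl f v z"
proof -
 have c: "c *s v = Re c *\<^sub>R v + Im c *\<^sub>R cmi v" "cmi (c *s v) = Re c *\<^sub>R cmi v + (- Im c) *\<^sub>R v"
  by (simp_all add: vec_eq_iff complex_eq_iff)
 show ?thesis
  unfolding lapl_def c(2) unfolding c(1) d2_bilinear[OF assms] by (simp add: cmod_power2 algebra_simps)
qed

lemma lapl_uminus:
 fixes f :: "complex^'n => real"
 assumes "open S" "Ck_on 2 S f" "z \<in> S"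
 shows "lapl f (- v) z = lapl f v z"
 using lapl_scale[OF assms, of "-1" v] by simp

lemma lapl_continuous:
 fixes f :: "complex^'n => real"
 assumes "open S" "Ck_on 2 S f"
 shows "continuous_on S (lapl f v)"
 unfolding lapl_def by (intro continuous_intros C2_d2_continuous[OF assms])

lemma C2_continuous:
 fixes f :: "'a::euclidean_space => real"
 assumes "open S" "Ck_on 2 S f"
 shows "continuous_on S f"
 by (intro continuous_at_imp_continuous_on ballI differentiable_imp_continuous_within C2_differentiable[OF assms])

lemma lapl_vanishing:
 fixes f :: "complex^'n => real"
 assumes C: "closed C" and f: "!!z. z \<notin> C ==> f z = 0" and z: "z \<notin> C"
 shows "lapl f v z = 0"
proof -
 have o: "open (- C)" using C by auto
 have 1: "fd f x b = 0" if "x \<in> - C" for x b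
  using fd_cong_open[OF o that, of f "%_. 0"] f by simp
 have "d2 f z a b = 0" for a b
  unfolding d2_def using fd_cong_open[OF o, of z "%x. fd f x b" "%_. 0"] 1 z by simp
 then show ?thesis by (simp add: lapl_def)
qed

lemma lborel_integrable_translate:
 fixes f :: "'a::euclidean_space => real"
 assumes f: "integrable lborel f"
 shows "integrable lborel (%z. f (z + c))"
proof -
 have "integrable (distr lborel borel ((+) c)) f" using f by (simp add: lborel_distr_plus)
 then have "integrable lborel (%z. f (c + z))" by (rule integrable_distr[rotated]) simp
 then show ?thesis by (simp add: add.commute)
qed

text \<open>Fubini and translation invariance move the circle mean from the potential, which is not
  smooth, to the test function, where a Taylor expansion is available.\<close>

lemma circle_convolution:
 fixes u \<eta> :: "complex^'n => real" and c :: "real => complex^'n"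
 assumes u: "integrable lborel u" and \<eta>: "continuous_on UNIV \<eta>" and B: "!!z. \<bar>\<eta> z\<bar> <= B"
  and c: "continuous_on UNIV c"
 shows "(LINT z|lborel. u z * cint (%\<theta>. \<eta> (z - c \<theta>))) = (LINT z|lborel. \<eta> z * cint (%\<theta>. u (z + c \<theta>)))"
  and "integrable lborel (%z. u z * cint (%\<theta>. \<eta> (z - c \<theta>)))"
  and "integrable lborel (%z. \<eta> z * cint (%\<theta>. u (z + c \<theta>)))"
proof -
 have [measurable]: "u \<in> borel_measurable borel" using u by (simp add: borel_measurable_integrable)
 have [measurable]: "\<eta> \<in> borel_measurable borel" "c \<in> borel_measurable borel"
  using \<eta> c by (auto intro: borel_measurable_continuous_onI)
 define f where "f \<theta> z = indicator {0..2*pi} \<theta> * (u z * \<eta> (z - c \<theta>))" for \<theta> :: real and z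
 define g where "g \<theta> z = indicator {0..2*pi} \<theta> * (\<eta> z * u (z + c \<theta>))" for \<theta> :: real and z
 have fm[measurable]: "case_prod f \<in> borel_measurable (lborel \<Otimes>\<^sub>M lborel)" unfolding f_def by measurable
 have gm[measurable]: "case_prod g \<in> borel_measurable (lborel \<Otimes>\<^sub>M lborel)" unfolding g_def by measurable
 have fi: "integrable lborel (f \<theta>)" for \<theta>
 proof (rule Bochner_Integration.integrable_bound[where f = "%z. B * \<bar>u z\<bar>"])
  show "AE z in lborel. norm (f \<theta> z) <= norm (B * \<bar>u z\<bar>)"
  proof (rule AE_I2)
   fix z
   have "\<bar>u z\<bar> * \<bar>\<eta> (z - c \<theta>)\<bar> <= \<bar>u z\<bar> * B" by (rule mult_left_mono[OF B]) simp
   moreover have "0 <= B" using B[of 0] by simp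
   ultimately show "norm (f \<theta> z) <= norm (B * \<bar>u z\<bar>)" by (auto simp: f_def indicator_def abs_mult mult.commute)
  qed
  show "f \<theta> \<in> borel_measurable lborel" unfolding f_def by measurable
 qed (use u in auto)
 have gf: "g \<theta> z = f \<theta> (z + c \<theta>)" for \<theta> z by (simp add: f_def g_def)
 have gi: "integrable lborel (g \<theta>)" for \<theta> unfolding gf by (rule lborel_integrable_translate[OF fi])
 have fmb: "f \<theta> \<in> borel_measurable borel" for \<theta> unfolding f_def by measurable
 have eq: "(LINT z|lborel. g \<theta> z) = (LINT z|lborel. f \<theta> z)" for \<theta>
  unfolding gf by (rule lborel_integral_translate[OF fmb])
 have eqn: "(LINT z|lborel. norm (g \<theta> z)) = (LINT z|lborel. norm (f \<theta> z))" for \<theta>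
  unfolding gf by (rule lborel_integral_translate) (use fmb in measurable)
 have bound: "(LINT z|lborel. norm (f \<theta> z)) <= indicator {0..2*pi} \<theta> * (B * (LINT z|lborel. \<bar>u z\<bar>))" for \<theta>
 proof -
  have "(LINT z|lborel. norm (f \<theta> z)) <= (LINT z|lborel. indicator {0..2*pi} \<theta> * (B * \<bar>u z\<bar>))"
  proof (rule integral_mono)
   fix z
   have "\<bar>u z\<bar> * \<bar>\<eta> (z - c \<theta>)\<bar> <= \<bar>u z\<bar> * B" by (rule mult_left_mono[OF B]) simp
   then show "norm (f \<theta> z) <= indicator {0..2*pi} \<theta> * (B * \<bar>u z\<bar>)"
    by (auto simp: f_def indicator_def abs_mult mult.commute)
  qed (use fi u in auto)
  then show ?thesis by simp
 qed
 have oi: "integrable lborel (%\<theta>. LINT z|lborel. norm (f \<theta> z))"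
 proof (rule Bochner_Integration.integrable_bound[where f = "%\<theta>::real. indicator {0..2*pi} \<theta> * (B * (LINT z|lborel. \<bar>u z\<bar>))"])
  show "integrable lborel (%\<theta>::real. indicator {0..2*pi} \<theta> * (B * (LINT z|lborel. \<bar>u z\<bar>)))"
   using borel_integrable_compact[of "{0..2*pi}" "%\<theta>::real. B * (LINT z|lborel. \<bar>u z\<bar>)"] by simp
  show "(%\<theta>. LINT z|lborel. norm (f \<theta> z)) \<in> borel_measurable lborel" by measurable
  show "AE \<theta> in lborel. norm (LINT z|lborel. norm (f \<theta> z)) <= norm (indicator {0..2*pi} \<theta> * (B * (LINT z|lborel. \<bar>u z\<bar>)))"
  proof (rule AE_I2)
   fix \<theta> :: real
   have "0 <= (LINT z|lborel. norm (f \<theta> z))" by (rule integral_nonneg_AE) simp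
   then show "norm (LINT z|lborel. norm (f \<theta> z)) <= norm (indicator {0..2*pi} \<theta> * (B * (LINT z|lborel. \<bar>u z\<bar>)))"
    using bound[of \<theta>] unfolding real_norm_def by linarith
  qed
 qed
 have F: "integrable (lborel \<Otimes>\<^sub>M lborel) (case_prod f)"
  by (rule lborel_pair.Fubini_integrable) (use fi oi in auto)
 have G: "integrable (lborel \<Otimes>\<^sub>M lborel) (case_prod g)"
  by (rule lborel_pair.Fubini_integrable) (use gi oi eqn in auto)
 have cf: "(LINT \<theta>|lborel. f \<theta> z) = u z * cint (%\<theta>. \<eta> (z - c \<theta>))" for z
  by (simp add: f_def cint_def set_lebesgue_integral_def mult.left_commute[of _ "u z"])
 have cg: "(LINT \<theta>|lborel. g \<theta> z) = \<eta> z * cint (%\<theta>. u (z + c \<theta>))" for z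
  by (simp add: g_def cint_def set_lebesgue_integral_def mult.left_commute[of _ "\<eta> z"])
 show "integrable lborel (%z. u z * cint (%\<theta>. \<eta> (z - c \<theta>)))"
  using lborel_pair.integrable_snd[OF F] by (simp add: cf)
 show "integrable lborel (%z. \<eta> z * cint (%\<theta>. u (z + c \<theta>)))"
  using lborel_pair.integrable_snd[OF G] by (simp add: cg)
 have "(LINT z|lborel. LINT \<theta>|lborel. f \<theta> z) = (LINT z|lborel. LINT \<theta>|lborel. g \<theta> z)"
  using lborel_pair.Fubini_integral[OF F] lborel_pair.Fubini_integral[OF G] by (simp add: eq)
 then show "(LINT z|lborel. u z * cint (%\<theta>. \<eta> (z - c \<theta>))) = (LINT z|lborel. \<eta> z * cint (%\<theta>. u (z + c \<theta>)))"
  by (simp add: cf cg)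
qed

lemma compact_Union_cball:
 fixes K :: "'a::euclidean_space set"
 assumes "compact K"
 shows "compact (\<Union>x\<in>K. cball x e)"
proof -
 have "(\<Union>x\<in>K. cball x e) = {x + y | x y. x \<in> K \<and> y \<in> cball 0 e}"
 proof (intro equalityI subsetI)
  fix z assume "z \<in> (\<Union>x\<in>K. cball x e)"
  then obtain x where "x \<in> K" "dist x z <= e" by auto
  then show "z \<in> {x + y | x y. x \<in> K \<and> y \<in> cball 0 e}"
   by (intro CollectI exI[of _ x] exI[of _ "z - x"]) (simp add: dist_norm norm_minus_commute)
 next
  fix z assume "z \<in> {x + y | x y. x \<in> K \<and> y \<in> cball 0 e}"
  then obtain x y where "z = x + y" "x \<in> K" "norm y <= e" by auto
  then show "z \<in> (\<Union>x\<in>K. cball x e)" by (auto simp: dist_norm intro!: bexI[of _ x])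
 qed
 then show ?thesis using compact_sums[OF assms compact_cball[of 0 e]] by simp
qed

text \<open>At zeros of \<open>k\<close> the convention \<open>ln 0 = 0\<close> breaks the rule ln
  (k/R) = ln k - ln R; the angles where this happens form a null set.\<close>

lemma ln_quotient_circle_mean:
 assumes k: "continuous_on UNIV k" and R: "0 < R" and A: "0 < A"
  and i: "cintegrable (%\<theta>. ln (k \<theta>))" and le: "2 * pi * ln A <= cint (%\<theta>. ln (k \<theta>))"
  and ae0: "AE \<theta> in lborel. \<theta> \<in> {0..2*pi} \<longrightarrow> 0 < k \<theta>"
 shows "cintegrable (%\<theta>. ln (k \<theta> / R)) \<and> 2 * pi * ln (A / R) <= cint (%\<theta>. ln (k \<theta> / R))"
proof -
 let ?I = "%\<theta>. indicator {0..2*pi} \<theta> :: real"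
 have [measurable]: "k \<in> borel_measurable borel" by (rule borel_measurable_continuous_onI[OF k])
 have cln: "cintegrable (%\<theta>::real. ln R)"
  unfolding set_integrable_def by (rule borel_integrable_compact) auto
 have i2: "integrable lborel (%\<theta>. ?I \<theta> *\<^sub>R (ln (k \<theta>) - ln R))"
  using set_integral_diff(1)[OF i cln] by (simp add: set_integrable_def)
 have ae: "AE \<theta> in lborel. ?I \<theta> *\<^sub>R (ln (k \<theta>) - ln R) = ?I \<theta> *\<^sub>R ln (k \<theta> / R)"
  using ae0 by eventually_elim (use R in \<open>auto simp: indicator_def ln_div\<close>)
 have "cintegrable (%\<theta>. ln (k \<theta> / R))"
  unfolding set_integrable_def by (rule integrable_cong_AE_imp[OF i2 _ ae]) simp
 moreover have "cint (%\<theta>. ln (k \<theta> / R)) = cint (%\<theta>. ln (k \<theta>) - ln R)"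
  unfolding cint_def set_lebesgue_integral_def by (rule integral_cong_AE[symmetric, OF _ _ ae]) simp_all
 moreover have "cint (%\<theta>. ln (k \<theta>) - ln R) = cint (%\<theta>. ln (k \<theta>)) - 2 * pi * ln R"
  using set_integral_diff(2)[OF i cln] by (simp add: cint_def set_lebesgue_integral_def)
 ultimately show ?thesis using le A R by (simp add: ln_div right_diff_distrib)
qed

text \<open>What the current requires of the distance to an orbit: d is 1-Lipschitz for the metric
  whose squared length is half of \<open>lapl L\<close>, and log d has the submean property where d
  < R0. The gap between R and R0 leaves room for small circles about points with d < R.\<close>

locale cut_potential =
 fixes \<Omega> :: "(complex^'n) set" and L d :: "complex^'n => real" and R R0 :: real
 assumes open_set: "open \<Omega>" and L: "Ck_on 2 \<Omega> L" and L_psh: "!!z v. z \<in> \<Omega> ==> 0 <= lapl L v z"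
  and d_cont: "continuous_on \<Omega> d" and d0: "!!z. z \<in> \<Omega> ==> 0 <= d z" and zeros: "countable {z \<in> \<Omega>. d z = 0}"
  and R: "0 < R" "R < R0"
  and d_lip: "!!z w M. closed_segment z (z + w) \<subseteq> \<Omega> ==> 0 <= M ==>
    (!!y. y \<in> closed_segment z (z + w) ==> lapl L w y <= 2 * M\<^sup>2) ==> \<bar>d (z + w) - d z\<bar> <= M"
  and sub: "!!a b. 0 < d a ==> (!!\<zeta>. cmod \<zeta> <= 1 ==> a + \<zeta> *s b \<in> \<Omega> \<and> d (a + \<zeta> *s b) < R0) ==>
    cintegrable (%\<theta>. ln (d (a + cis \<theta> *s b))) \<and>
    2 * pi * ln (d a) <= cint (%\<theta>. ln (d (a + cis \<theta> *s b))) \<and>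
    (AE \<theta> in lborel. \<theta> \<in> {0..2*pi} \<longrightarrow> 0 < d (a + cis \<theta> *s b))"
begin

definition cl :: "complex^'n => real" where "cl z = cutlog (d z / R)"

lemma AE_pos: "AE z in lborel. z \<in> \<Omega> \<longrightarrow> 0 < d z"
proof (rule AE_mp[OF AE_not_in[OF countable_imp_null_set_lborel[OF zeros]]], rule AE_I2, intro impI)
 fix z assume "z \<notin> {z \<in> \<Omega>. d z = 0}" "z \<in> \<Omega>"
 then show "0 < d z" using d0[of z] by auto
qed

lemma cl_measurable: "A \<in> sets borel ==> A \<subseteq> \<Omega> ==> set_borel_measurable lborel A cl"
proof -
 assume A: "A \<in> sets borel" "A \<subseteq> \<Omega>"
 have [measurable]: "(%z. if z \<in> \<Omega> then d z else 0) \<in> borel_measurable borel"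
  by (rule borel_measurable_continuous_on_if) (use open_set d_cont in auto)
 have "(%z. indicator A z *\<^sub>R cutlog ((if z \<in> \<Omega> then d z else 0) / R)) \<in> borel_measurable borel"
  using A(1) by measurable
 also have "(%z. indicator A z *\<^sub>R cutlog ((if z \<in> \<Omega> then d z else 0) / R)) = (%z. indicator A z *\<^sub>R cl z)"
  using A(2) by (auto simp: fun_eq_iff indicator_def cl_def)
 finally show ?thesis by (simp add: set_borel_measurable_def)
qed

text \<open>The summand |ln R| keeps the right side at least 1 at zeros of d, where
  \<open>ln 0 = 0\<close> makes \<open>cl\<close> equal to 1.\<close>

lemma cl_bound: "0 <= d z ==> d z < R ==> \<bar>cl z\<bar> <= 1 + 2 * (ln R - ln (d z) + \<bar>ln R\<bar>)"
proof (cases "d z = 0")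
 case False
 assume "0 <= d z" "d z < R"
 with False have dz: "0 < d z" "d z < R" by auto
 then have b: "0 < d z / R" "d z / R < 1" using R by auto
 have l: "ln (d z / R) = ln (d z) - ln R" using dz R by (simp add: ln_div)
 have n: "ln (d z) <= ln R" using dz by simp
 have aux: "x <= 0 ==> 0 <= q ==> q <= 1 ==> \<bar>2 * x + 1 - q\<bar> <= 1 - 2 * x" for x q :: real by linarith
 have "(d z / R)\<^sup>2 <= 1" using b by (simp add: power_le_one)
 then have "\<bar>2 * ln (d z / R) + 1 - (d z / R)\<^sup>2\<bar> <= 1 + 2 * (ln R - ln (d z))"
  using aux[of "ln (d z) - ln R" "(d z / R)\<^sup>2"] n unfolding l by simp
 then show ?thesis using b(2) unfolding cl_def cutlog_def by simp
qed (use R in \<open>simp add: cl_def cutlog_def\<close>)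

text \<open>Only zeros of d are problematic. Since they are countable, there is a nearby centre
  \<open>a\<close> with d a > 0, and the submean inequality on all circles about \<open>a\<close>
  bounds the integral of -log d over a ball about \<open>a\<close> that covers a neighbourhood of
  the zero.\<close>

lemma cl_local:
 assumes p: "p \<in> \<Omega>"
 obtains \<rho> where "\<rho> > 0" "ball p \<rho> \<subseteq> \<Omega>" "set_integrable lborel (ball p \<rho>) cl"
proof (cases "0 < d p")
 case True
 have "continuous (at p) d" using d_cont open_set p by (simp add: continuous_on_eq_continuous_at)
 then obtain e where e: "e > 0" "!!z. dist z p < e ==> dist (d z) (d p) < d p / 2"
  unfolding continuous_at_eps_delta using True by (meson half_gt_zero)
 obtain e' where e': "e' > 0" "ball p e' \<subseteq> \<Omega>" using open_set p open_contains_ball by blast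
 define \<rho> where "\<rho> = min e e'"
 have sub\<rho>: "ball p \<rho> \<subseteq> \<Omega>" using e' by (auto simp: \<rho>_def)
 define B where "B = 1 + 2 * (ln R - ln (d p / 2) + \<bar>ln R\<bar>)"
 have bd: "\<bar>cl z\<bar> <= \<bar>B\<bar>" if "z \<in> ball p \<rho>" for z
 proof (cases "d z < R")
  case d: True
  have "dist (d z) (d p) < d p / 2" using e(2)[of z] that by (simp add: \<rho>_def dist_commute)
  then have h: "d z > d p / 2" by (simp add: dist_real_def abs_if split: if_splits)
  then have "ln (d z) \<ge> ln (d p / 2)" using True by simp
  moreover have "0 <= d z" using h True by linarith
  ultimately show ?thesis using cl_bound[OF _ d] unfolding B_def by fastforce
 qed (use R in \<open>simp add: cl_def cutlog_def\<close>)
 have "set_integrable lborel (ball p \<rho>) cl"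
  unfolding set_integrable_def
 proof (rule Bochner_Integration.integrable_bound)
  show "integrable lborel (%z. indicator (cball p \<rho>) z *\<^sub>R \<bar>B\<bar>)" by (rule borel_integrable_compact) auto
  show "(%z. indicator (ball p \<rho>) z *\<^sub>R cl z) \<in> borel_measurable lborel"
   using cl_measurable[of "ball p \<rho>"] sub\<rho> by (simp add: set_borel_measurable_def)
  show "AE z in lborel. norm (indicator (ball p \<rho>) z *\<^sub>R cl z) <= norm (indicator (cball p \<rho>) z *\<^sub>R \<bar>B\<bar>)"
   using bd by (auto simp: indicator_def)
 qed
 then show ?thesis using that[of \<rho>] e e' sub\<rho> by (simp add: \<rho>_def)
next
 case False
 then have p0: "d p = 0" using d0[OF p] by simp
 have "continuous (at p) d" using d_cont open_set p by (simp add: continuous_on_eq_continuous_at)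
 then obtain e where e: "e > 0" "!!z. dist z p < e ==> dist (d z) (d p) < R"
  unfolding continuous_at_eps_delta using R by meson
 obtain e' where e': "e' > 0" "ball p e' \<subseteq> \<Omega>" using open_set p open_contains_ball by blast
 \<comment> \<open>A quarter, so that discs of radius below 2\<rho> about a point within \<rho> of
   \<open>p\<close> stay where d < R, while the ball of radius 2\<rho> about that point contains the
   one of radius \<rho> about \<open>p\<close>.\<close>
 define \<rho> where "\<rho> = min e e' / 4"
 have \<rho>: "\<rho> > 0" using e e' by (simp add: \<rho>_def)
 have near: "z \<in> \<Omega> \<and> 0 <= d z \<and> d z < R" if "dist p z < 4 * \<rho>" for z
 proof -
  have "z \<in> \<Omega>" "dist (d z) (d p) < R" using that e(2)[of z] e' by (auto simp: \<rho>_def dist_commute)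
  then show ?thesis using d0[of z] by (simp add: p0)
 qed
 have "uncountable (ball p \<rho>)" using \<rho> by (rule uncountable_ball)
 then have "\<not> ball p \<rho> \<subseteq> {z \<in> \<Omega>. d z = 0}" using zeros countable_subset by blast
 then obtain a where "a \<in> ball p \<rho>" "a \<notin> {z \<in> \<Omega>. d z = 0}" by blast
 then have a: "dist p a < \<rho>" "\<not> (a \<in> \<Omega> \<and> d a = 0)" by auto
 have "a \<in> \<Omega> \<and> 0 <= d a" using near[of a] a \<rho> by simp
 then have da: "a \<in> \<Omega>" "0 < d a" using a by auto
 have disc: "a + \<zeta> *s b \<in> \<Omega> \<and> 0 <= d (a + \<zeta> *s b) \<and> d (a + \<zeta> *s b) < R" if "cmod \<zeta> <= 1" "norm b < 2 * \<rho>" for \<zeta> b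
 proof (rule near)
  have "dist p (a + \<zeta> *s b) <= dist p a + norm (\<zeta> *s b)" by (metis add_diff_cancel_left' dist_norm dist_triangle norm_minus_commute)
  moreover have "norm (\<zeta> *s b) <= 1 * norm b" unfolding norm_cvec_scalar by (rule mult_right_mono[OF that(1)]) simp
  ultimately show "dist p (a + \<zeta> *s b) < 4 * \<rho>" using a(1) that \<rho> by linarith
 qed
 define k where "k w = ln R - ln (d w) + \<bar>ln R\<bar>" for w
 have k0: "0 <= k w" if "0 <= d w" "d w < R" for w
 proof (cases "d w = 0")
  case False
  then have "ln (d w) <= ln R" using that by simp
  then show ?thesis by (simp add: k_def)
 qed (simp add: k_def)
 define u where "u w = (if w \<in> \<Omega> then ennreal (k w) else 0)" for w
 have [measurable]: "(%z. if z \<in> \<Omega> then d z else 0) \<in> borel_measurable borel"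
  by (rule borel_measurable_continuous_on_if) (use open_set d_cont in auto)
 have [measurable]: "\<Omega> \<in> sets borel" using open_set by simp
 have "(%w. if w \<in> \<Omega> then ennreal (ln R - ln (if w \<in> \<Omega> then d w else 0) + \<bar>ln R\<bar>) else 0) \<in> borel_measurable borel" by measurable
 also have "(%w. if w \<in> \<Omega> then ennreal (ln R - ln (if w \<in> \<Omega> then d w else 0) + \<bar>ln R\<bar>) else 0) = u"
  by (auto simp: u_def k_def)
 finally have um[measurable]: "u \<in> borel_measurable borel" .
 have circ: "(\<integral>\<^sup>+\<theta>\<in>{0..2*pi}. u (a + cis \<theta> *s b) \<partial>lborel) <= ennreal (2 * pi * \<bar>k a\<bar>)" if b: "norm b < 2 * \<rho>" for b
 proof -
  have si: "cintegrable (%\<theta>. ln (d (a + cis \<theta> *s b)))"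
   and le: "2 * pi * ln (d a) <= cint (%\<theta>. ln (d (a + cis \<theta> *s b)))"
   using sub[OF da(2), of b] disc[OF _ b] R by (metis less_trans)+
  have sc: "cintegrable (%\<theta>::real. ln R + \<bar>ln R\<bar>)"
   unfolding set_integrable_def by (rule borel_integrable_compact) auto
  have sk: "cintegrable (%\<theta>. k (a + cis \<theta> *s b))"
   using set_integral_diff(1)[OF sc si] by (simp add: k_def algebra_simps)
  have "(\<integral>\<^sup>+\<theta>\<in>{0..2*pi}. u (a + cis \<theta> *s b) \<partial>lborel) = (\<integral>\<^sup>+\<theta>. ennreal (indicator {0..2*pi} \<theta> *\<^sub>R k (a + cis \<theta> *s b)) \<partial>lborel)"
   by (rule nn_integral_cong) (use disc[OF _ b] in \<open>auto simp: u_def indicator_def\<close>)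
  also have "... = ennreal (LINT \<theta>|lborel. indicator {0..2*pi} \<theta> *\<^sub>R k (a + cis \<theta> *s b))"
  proof (rule nn_integral_eq_integral)
   show "integrable lborel (%\<theta>. indicator {0..2*pi} \<theta> *\<^sub>R k (a + cis \<theta> *s b))" using sk by (simp add: set_integrable_def)
   show "AE \<theta> in lborel. 0 <= indicator {0..2*pi} \<theta> *\<^sub>R k (a + cis \<theta> *s b)"
    using disc[OF _ b] k0 by (auto simp: indicator_def)
  qed
  also have "(LINT \<theta>|lborel. indicator {0..2*pi} \<theta> *\<^sub>R k (a + cis \<theta> *s b)) = (LINT \<theta>:{0..2*pi}|lborel. (ln R + \<bar>ln R\<bar>) - ln (d (a + cis \<theta> *s b)))"
   by (simp add: set_lebesgue_integral_def k_def algebra_simps)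
  also have "... = 2 * pi * (ln R + \<bar>ln R\<bar>) - cint (%\<theta>. ln (d (a + cis \<theta> *s b)))"
   by (subst set_integral_diff(2)[OF sc si]) (simp add: cint_def set_lebesgue_integral_def)
  also have "... <= 2 * pi * k a" using le by (simp add: k_def algebra_simps)
  also have "... <= 2 * pi * \<bar>k a\<bar>" by simp
  finally show ?thesis by (simp add: ennreal_leI)
 qed
 have "ennreal (2*pi) * (\<integral>\<^sup>+w. u w * indicator (ball a (2 * \<rho>)) w \<partial>lborel)
   = (\<integral>\<^sup>+\<zeta>. (\<integral>\<^sup>+\<theta>\<in>{0..2*pi}. u (a + cis \<theta> *s \<zeta>) \<partial>lborel) * indicator (ball 0 (2 * \<rho>)) \<zeta> \<partial>lborel)"
  using nn_integral_rotation[OF um, of "2 * \<rho>" a] \<rho> by simp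
 also have "... <= (\<integral>\<^sup>+\<zeta>. ennreal (2 * pi * \<bar>k a\<bar>) * indicator (ball (0::complex^'n) (2 * \<rho>)) \<zeta> \<partial>lborel)"
  by (rule nn_integral_mono) (use circ in \<open>auto simp: indicator_def\<close>)
 also have "... = ennreal (2 * pi * \<bar>k a\<bar>) * emeasure lborel (ball (0::complex^'n) (2 * \<rho>))"
  by (simp add: nn_integral_cmult_indicator)
 also have "... < \<infinity>" using emeasure_lborel_ball_finite[of "0::complex^'n" "2 * \<rho>"] by (simp add: ennreal_mult_less_top)
 finally have fin: "(\<integral>\<^sup>+w. u w * indicator (ball a (2 * \<rho>)) w \<partial>lborel) < \<infinity>"
  by (auto simp: ennreal_mult_less_top)
 have sub1: "ball p \<rho> \<subseteq> \<Omega>" using near \<rho> by auto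
 have sub2: "ball p \<rho> \<subseteq> ball a (2 * \<rho>)"
 proof
  fix w assume "w \<in> ball p \<rho>"
  then have "dist a w < \<rho> + \<rho>" using a dist_triangle[of a w p] by (simp add: dist_commute)
  then show "w \<in> ball a (2 * \<rho>)" by simp
 qed
 have "set_integrable lborel (ball p \<rho>) cl"
  unfolding set_integrable_def integrable_iff_bounded
 proof
  show "(%x. indicat_real (ball p \<rho>) x *\<^sub>R cl x) \<in> borel_measurable lborel"
   using cl_measurable[of "ball p \<rho>"] sub1 by (simp add: set_borel_measurable_def)
  have "(\<integral>\<^sup>+ x. ennreal (norm (indicat_real (ball p \<rho>) x *\<^sub>R cl x)) \<partial>lborel)
    <= (\<integral>\<^sup>+ x. 1 * indicator (ball p \<rho>) x + 2 * (u x * indicator (ball a (2 * \<rho>)) x) \<partial>lborel)"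
  proof (rule nn_integral_mono)
   fix x
   show "ennreal (norm (indicat_real (ball p \<rho>) x *\<^sub>R cl x)) <= 1 * indicator (ball p \<rho>) x + 2 * (u x * indicator (ball a (2 * \<rho>)) x)"
   proof (cases "x \<in> ball p \<rho>")
    case True
    then have x: "x \<in> \<Omega>" "0 <= d x" "d x < R" "x \<in> ball a (2 * \<rho>)" using near[of x] \<rho> sub2 by auto
    have "ennreal \<bar>cl x\<bar> <= ennreal (1 + 2 * k x)" using cl_bound[OF x(2,3)] by (simp add: k_def ennreal_leI)
    also have "... = 1 + 2 * ennreal (k x)" using k0[OF x(2,3)] by (simp add: ennreal_plus ennreal_mult)
    finally show ?thesis using True x by (simp add: u_def)
   qed simp
  qed
  also have "... = emeasure lborel (ball p \<rho>) + 2 * (\<integral>\<^sup>+ x. u x * indicator (ball a (2 * \<rho>)) x \<partial>lborel)"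
  proof -
   have [measurable]: "ball p \<rho> \<in> sets borel" "ball a (2 * \<rho>) \<in> sets borel" by simp_all
   have "(\<integral>\<^sup>+ x. 1 * indicator (ball p \<rho>) x + 2 * (u x * indicator (ball a (2 * \<rho>)) x) \<partial>lborel)
     = (\<integral>\<^sup>+ x. 1 * indicator (ball p \<rho>) x \<partial>lborel) + (\<integral>\<^sup>+ x. 2 * (u x * indicator (ball a (2 * \<rho>)) x) \<partial>lborel)"
    by (rule nn_integral_add) measurable
   also have "(\<integral>\<^sup>+ x. 2 * (u x * indicator (ball a (2 * \<rho>)) x) \<partial>lborel) = 2 * (\<integral>\<^sup>+ x. u x * indicator (ball a (2 * \<rho>)) x \<partial>lborel)"
    by (rule nn_integral_cmult) measurable
   finally show ?thesis by simp
  qed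
  also have "... < \<infinity>" using fin emeasure_lborel_ball_finite[of p \<rho>] by (simp add: ennreal_mult_less_top)
  finally show "(\<integral>\<^sup>+ x. ennreal (norm (indicat_real (ball p \<rho>) x *\<^sub>R cl x)) \<partial>lborel) < \<infinity>" .
 qed
 then show ?thesis using that[OF \<rho> sub1] by blast
qed

lemma cl_compact:
 assumes K: "compact K" "K \<subseteq> \<Omega>"
 shows "set_integrable lborel K cl"
proof -
 have "\<exists>\<rho>. \<rho> > 0 \<and> set_integrable lborel (ball p \<rho>) cl" if p: "p \<in> K" for p
 proof -
  from p K(2) have "p \<in> \<Omega>" by blast
  then show ?thesis by (rule cl_local) blast
 qed
 then have "\<forall>p\<in>K. \<exists>\<rho>. \<rho> > 0 \<and> set_integrable lborel (ball p \<rho>) cl" by blast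
 from bchoice[OF this] obtain \<rho> where \<rho>: "!!p. p \<in> K ==> \<rho> p > 0 \<and> set_integrable lborel (ball p (\<rho> p)) cl"
  by blast
 then have "K \<subseteq> (\<Union>p\<in>K. ball p (\<rho> p))" by force
 then obtain I where I: "I \<subseteq> K" "finite I" "K \<subseteq> (\<Union>p\<in>I. ball p (\<rho> p))"
  using compactE_image[OF K(1), of K "%p. ball p (\<rho> p)"] by (metis open_ball)
 have "set_integrable lborel (\<Union>p\<in>I. ball p (\<rho> p)) cl"
 proof (rule set_integrable_UN[OF I(2)])
  show "set_integrable lborel (ball p (\<rho> p)) cl" if "p \<in> I" for p using \<rho> I(1) that by blast
 qed simp
 moreover have "K \<in> sets lborel" using K(1) by (simp add: borel_compact)
 ultimately show ?thesis using I(3) by (rule set_integrable_subset)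
qed

text \<open>Freezes the metric at the centre: by uniform continuity of the Laplacian, the constant
  at \<open>z\<close>, enlarged by e under the root, serves for all segments in a small disc of
  complex multiples of \<open>v\<close>.\<close>

lemma lapl_bound_Lipschitz:
 assumes K: "compact K" "K \<subseteq> \<Omega>" and e: "e > 0" and \<rho>: "\<rho> > 0" and sub\<rho>: "(\<Union>x\<in>K. cball x \<rho>) \<subseteq> \<Omega>"
 obtains \<delta> where "\<delta> > 0" "\<delta> * norm v <= \<rho>"
  "!!z \<zeta> \<zeta>'. z \<in> K ==> cmod \<zeta> <= \<delta> ==> cmod \<zeta>' <= \<delta> ==>
    \<bar>d (z + \<zeta> *s v) - d (z + \<zeta>' *s v)\<bar> <= sqrt (lapl L v z / 2 + e) * cmod (\<zeta> - \<zeta>')"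
proof -
 let ?K = "\<Union>x\<in>K. cball x \<rho>"
 have cK: "compact ?K" by (rule compact_Union_cball[OF K(1)])
 have "uniformly_continuous_on ?K (lapl L v)"
  by (rule compact_uniformly_continuous[OF continuous_on_subset[OF lapl_continuous[OF open_set L] sub\<rho>] cK])
 then obtain s where s: "s > 0" "!!x y. x \<in> ?K ==> y \<in> ?K ==> dist y x < s ==> dist (lapl L v y) (lapl L v x) < e"
  unfolding uniformly_continuous_on_def using e by metis
 define \<delta> where "\<delta> = min \<rho> (s / 2) / (norm v + 1)"
 have nv: "norm v + 1 > 0" by (simp add: add_nonneg_pos)
 have \<delta>: "\<delta> > 0" using \<rho> s nv by (simp add: \<delta>_def)
 have "\<delta> * norm v <= \<delta> * (norm v + 1)" using \<delta> by (intro mult_left_mono) auto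
 also have "... = min \<rho> (s / 2)" using nv by (simp add: \<delta>_def)
 finally have \<delta>v: "\<delta> * norm v <= min \<rho> (s / 2)" .
 show ?thesis
 proof (rule that[OF \<delta>])
  show "\<delta> * norm v <= \<rho>" using \<delta>v by simp
  fix z \<zeta> \<zeta>' assume z: "z \<in> K" and \<zeta>: "cmod \<zeta> <= \<delta>" "cmod \<zeta>' <= \<delta>"
  define x where "x = z + \<zeta>' *s v"
  define w where "w = (\<zeta> - \<zeta>') *s v"
  have xw: "x + w = z + \<zeta> *s v" by (simp add: x_def w_def)
  have inb: "z + k *s v \<in> cball z (min \<rho> (s / 2))" if "cmod k <= \<delta>" for k
  proof -
   have "cmod k * norm v <= \<delta> * norm v" using that by (rule mult_right_mono) simp
   then show ?thesis using \<delta>v by (simp add: dist_norm)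
  qed
  have seg: "closed_segment x (x + w) \<subseteq> cball z (min \<rho> (s / 2))"
   unfolding xw unfolding x_def by (rule closed_segment_subset[OF inb[OF \<zeta>(2)] inb[OF \<zeta>(1)] convex_cball])
  have zO: "z \<in> \<Omega>" using z K by blast
  have e0: "0 <= lapl L v z / 2 + e" using L_psh[OF zO, of v] e by simp
  have "\<bar>d (x + w) - d x\<bar> <= sqrt (lapl L v z / 2 + e) * cmod (\<zeta> - \<zeta>')"
  proof (rule d_lip)
   show "closed_segment x (x + w) \<subseteq> \<Omega>" using seg sub\<rho> z by fastforce
   show "0 <= sqrt (lapl L v z / 2 + e) * cmod (\<zeta> - \<zeta>')" using e0 by simp
   fix y assume y: "y \<in> closed_segment x (x + w)"
   then have yb: "dist z y <= \<rho>" "dist z y <= s / 2" using seg by auto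
   have yK: "y \<in> ?K" using z yb by auto
   have zK: "z \<in> ?K" by (rule UN_I[OF z]) (use \<rho> in simp)
   have "dist y z < s" using yb s by (simp add: dist_commute)
   then have "dist (lapl L v y) (lapl L v z) < e" by (rule s(2)[OF zK yK])
   then have le: "lapl L v y <= 2 * (lapl L v z / 2 + e)" using e by (simp add: dist_real_def abs_if split: if_splits)
   have "lapl L w y = (cmod (\<zeta> - \<zeta>'))\<^sup>2 * lapl L v y"
    unfolding w_def by (rule lapl_scale[OF open_set L]) (use yK sub\<rho> in blast)
   also have "... <= (cmod (\<zeta> - \<zeta>'))\<^sup>2 * (2 * (lapl L v z / 2 + e))" by (rule mult_left_mono[OF le]) simp
   also have "... = 2 * (sqrt (lapl L v z / 2 + e) * cmod (\<zeta> - \<zeta>'))\<^sup>2" using e0 by (simp add: power_mult_distrib)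
   finally show "lapl L w y <= 2 * (sqrt (lapl L v z / 2 + e) * cmod (\<zeta> - \<zeta>'))\<^sup>2" .
  qed
  then show "\<bar>d (z + \<zeta> *s v) - d (z + \<zeta>' *s v)\<bar> <= sqrt (lapl L v z / 2 + e) * cmod (\<zeta> - \<zeta>')"
   unfolding xw by (simp add: x_def)
 qed
qed

text \<open>One small circle radius r is tested. The mean of L gains \<pi> r^2/2 times its
  Laplacian, the cut-off loses the squared increments of d, and the energy inequality bounds the
  loss by the gain up to terms of order e r^2. The circle mean of the potential is then transferred
  to \<eta> and expanded there.\<close>

lemma current_inequality_approx:
 fixes \<eta> w :: "complex^'n => real"
 assumes \<eta>: "Ck_on 2 UNIV \<eta>" "!!z. 0 <= \<eta> z" "!!z. z \<notin> C ==> \<eta> z = 0" and w: "Ck_on 2 \<Omega> w"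
  and C: "compact C" and \<rho>: "\<rho> > 0" and C2: "(\<Union>x\<in>C. cball x (2 * \<rho>)) \<subseteq> \<Omega>"
 defines "C1 \<equiv> \<Union>x\<in>C. cball x \<rho>"
 defines "u \<equiv> %z. R\<^sup>2 / 2 * cl z + L z - w z"
 defines "u0 \<equiv> %z. indicator C1 z * u z"
 assumes e: "0 < e" "e <= 1"
 shows "0 <= (LINT z|lborel. u0 z * lapl \<eta> v z) / 2 + (LINT z|lborel. \<eta> z * lapl w v z) / 2
   + e * ((LINT z:C1|lborel. \<eta> z + lapl L v z / 2 + 1) + R\<^sup>2 + (LINT z|lborel. \<bar>u0 z\<bar>) + 2 * (LINT z|lborel. \<eta> z))"
proof -
 let ?Iw = "(LINT z|lborel. \<eta> z * lapl w v z)"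
 let ?Iu = "(LINT z|lborel. u0 z * lapl \<eta> v z)"
 let ?IL = "(LINT z|lborel. \<eta> z * lapl L v z)"
 let ?U = "(LINT z|lborel. \<bar>u0 z\<bar>)"
 let ?H = "(LINT z|lborel. \<eta> z)"
 let ?K1 = "(LINT z:C1|lborel. \<eta> z + lapl L v z / 2 + 1)"
 define C2 where "C2 = (\<Union>x\<in>C. cball x (2 * \<rho>))"
 have C12: "C \<subseteq> C1" "C1 \<subseteq> C2" "C2 \<subseteq> \<Omega>" using \<rho> C2 unfolding C1_def C2_def by (force, force, simp)
 have cC1: "compact C1" and cC2: "compact C2" unfolding C1_def C2_def by (rule compact_Union_cball[OF C])+
 have C1O: "C1 \<subseteq> \<Omega>" and CO: "C \<subseteq> \<Omega>" using C12 by auto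
 have C1C2: "(\<Union>x\<in>C1. cball x \<rho>) \<subseteq> C2"
 proof
  fix y assume "y \<in> (\<Union>x\<in>C1. cball x \<rho>)"
  then obtain x x' where "dist x y <= \<rho>" "x' \<in> C" "dist x' x <= \<rho>" by (auto simp: C1_def)
  then show "y \<in> C2" unfolding C2_def using dist_triangle[of x' y x] by (auto intro!: bexI[of _ x'])
 qed
 have Lc: "continuous_on \<Omega> L" and wc: "continuous_on \<Omega> w" and c\<eta>: "continuous_on UNIV \<eta>"
  by (rule C2_continuous[OF open_set L], rule C2_continuous[OF open_set w], rule C2_continuous[OF open_UNIV \<eta>(1)])
 have c\<eta>': "continuous_on X \<eta>" for X using c\<eta> continuous_on_subset by blast
 have lL: "continuous_on X (lapl L v)" "continuous_on X (lapl w v)" if "X \<subseteq> \<Omega>" for X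
  by (rule continuous_on_subset[OF lapl_continuous[OF open_set L] that], rule continuous_on_subset[OF lapl_continuous[OF open_set w] that])
 have l\<eta>: "continuous_on X (lapl \<eta> v)" for X
  by (rule continuous_on_subset[OF lapl_continuous[OF open_UNIV \<eta>(1)]]) simp
 have l\<eta>0: "lapl \<eta> v z = 0" if "z \<notin> C" for z by (rule lapl_vanishing[OF compact_imp_closed[OF C] \<eta>(3) that])
 \<comment> \<open>The energy inequality and the translations need a function continuous on the
   whole space; a Tietze extension of d from the compact neighbourhood \<open>C2\<close> changes
   nothing where the support of \<eta> is felt.\<close>
 obtain D where D: "continuous_on UNIV D" "!!z. z \<in> C2 ==> D z = d z"
  using Tietze_unbounded[of C2 d UNIV] continuous_on_subset[OF d_cont C12(3)] compact_imp_closed[OF cC2] by auto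
 have Dc: "continuous_on X (%z. D (g z))" if "continuous_on X g" for X :: "'x::topological_space set" and g
  by (rule continuous_on_compose2[OF D(1) that]) auto
 have [measurable]: "D \<in> borel_measurable borel" "\<eta> \<in> borel_measurable borel"
  using D(1) c\<eta> by (auto intro: borel_measurable_continuous_onI)
 have "set_integrable lborel C1 (%z. R\<^sup>2 / 2 * cl z + (L z - w z))"
 proof (rule set_integral_add(1))
  show "set_integrable lborel C1 (%z. R\<^sup>2 / 2 * cl z)" by (simp add: cl_compact[OF cC1 C1O])
  show "set_integrable lborel C1 (%z. L z - w z)"
   unfolding set_integrable_def
   by (rule borel_integrable_compact[OF cC1]) (intro continuous_intros continuous_on_subset[OF Lc C1O] continuous_on_subset[OF wc C1O])
 qed
 then have u0: "integrable lborel u0" by (simp add: u0_def u_def set_integrable_def add_diff_eq)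
 obtain B where B: "!!z. \<bar>\<eta> z\<bar> <= B"
 proof -
  have "bounded (\<eta> ` C)" by (intro compact_imp_bounded compact_continuous_image c\<eta>' C)
  then obtain B where "!!z. z \<in> C ==> \<bar>\<eta> z\<bar> <= B" by (auto simp: bounded_iff)
  then have "\<bar>\<eta> z\<bar> <= \<bar>B\<bar>" for z by (cases "z \<in> C") (force simp: \<eta>(3))+
  then show ?thesis by (rule that)
 qed
 have \<eta>i: "integrable lborel (%z. \<eta> z * f z)" if "continuous_on C f" for f
  by (rule integrable_compact_support[OF C]) (auto simp: \<eta>(3) intro!: continuous_intros c\<eta>' that)
 have u0\<eta>: "integrable lborel (%z. u0 z * f z)" if "continuous_on UNIV f" "!!z. \<bar>f z\<bar> <= b" for f b
 proof (rule Bochner_Integration.integrable_bound)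
  have [measurable]: "f \<in> borel_measurable borel" using that(1) by (rule borel_measurable_continuous_onI)
  have [measurable]: "u0 \<in> borel_measurable borel" using u0 by (simp add: borel_measurable_integrable)
  show "integrable lborel (%z. b * \<bar>u0 z\<bar>)" using u0 by simp
  show "(%z. u0 z * f z) \<in> borel_measurable lborel" by simp
  have "\<bar>u0 z\<bar> * \<bar>f z\<bar> <= \<bar>b\<bar> * \<bar>u0 z\<bar>" for z
   using mult_left_mono[OF that(2)[of z], of "\<bar>u0 z\<bar>"] mult_right_mono[OF abs_ge_self[of b], of "\<bar>u0 z\<bar>"] by (simp add: mult.commute)
  then show "AE z in lborel. norm (u0 z * f z) <= norm (b * \<bar>u0 z\<bar>)" by (simp add: abs_mult)
 qed
 \<comment> \<open>Since \<open>lapl L v\<close> is twice the squared length of \<open>v\<close>,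
   this is the Lipschitz constant of d along \<open>v\<close>, enlarged by e under the root.\<close>
 define m where "m z = sqrt (lapl L v z / 2 + e)" for z
 have m_ge: "0 <= lapl L v z / 2" if "z \<in> C1" for z using L_psh[of z v] C1O that by auto
 have m2: "(m z)\<^sup>2 = lapl L v z / 2 + e" if "z \<in> C1" for z using m_ge[OF that] e by (simp add: m_def)
 have cm: "continuous_on C1 m" unfolding m_def by (intro continuous_intros lL C1O) auto
 obtain M0 where M0: "M0 \<ge> 0" "!!z. z \<in> C1 ==> m z <= M0"
 proof -
  have "bounded (m ` C1)" by (intro compact_imp_bounded compact_continuous_image cm cC1)
  then obtain b where "!!z. z \<in> C1 ==> \<bar>m z\<bar> <= b" by (auto simp: bounded_iff)
  then have "m z <= \<bar>b\<bar>" if "z \<in> C1" for z using that by force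
  then show ?thesis using that[of "\<bar>b\<bar>"] by simp
 qed
 obtain \<delta> where \<delta>: "\<delta> > 0" "\<delta> * norm v <= \<rho>" and lip: "!!z \<zeta> \<zeta>'. z \<in> C1 ==> cmod \<zeta> <= \<delta> ==> cmod \<zeta>' <= \<delta> ==>
    \<bar>d (z + \<zeta> *s v) - d (z + \<zeta>' *s v)\<bar> <= m z * cmod (\<zeta> - \<zeta>')"
  unfolding m_def using lapl_bound_Lipschitz[OF cC1 C1O e(1) \<rho> subset_trans[OF C1C2 C12(3)]] by blast
 have inC2: "z + \<zeta> *s v \<in> C2" if "z \<in> C1" "cmod \<zeta> <= \<delta>" for z \<zeta>
 proof -
  have "cmod \<zeta> * norm v <= \<delta> * norm v" by (rule mult_right_mono[OF that(2)]) simp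
  then have "z + \<zeta> *s v \<in> cball z \<rho>" using \<delta> by (simp add: dist_norm)
  then show ?thesis using C1C2 that by blast
 qed
 have inC1: "z + y \<in> C1" if "z \<in> C" "norm y <= \<rho>" for z y
  using that by (auto simp: C1_def dist_norm intro!: bexI[of _ z])
 obtain rL where rL: "rL > 0" "!!z r. z \<in> C1 ==> 0 < r ==> r <= rL ==> (\<forall>\<theta>. z + (of_real r * cis \<theta>) *s v \<in> \<Omega>) \<and>
   \<bar>cint (%\<theta>. L (z + (of_real r * cis \<theta>) *s v)) - 2 * pi * L z - pi * r\<^sup>2 / 2 * lapl L v z\<bar> <= e * r\<^sup>2"
  using C2_circle_mean[OF open_set L cC1 C1O e(1)] by blast
 obtain rw where rw: "rw > 0" "!!z r. z \<in> C1 ==> 0 < r ==> r <= rw ==> (\<forall>\<theta>. z + (of_real r * cis \<theta>) *s v \<in> \<Omega>) \<and>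
   \<bar>cint (%\<theta>. w (z + (of_real r * cis \<theta>) *s v)) - 2 * pi * w z - pi * r\<^sup>2 / 2 * lapl w v z\<bar> <= e * r\<^sup>2"
  using C2_circle_mean[OF open_set w cC1 C1O e(1)] by blast
 obtain r\<eta> where r\<eta>: "r\<eta> > 0" "!!z r. z \<in> C1 ==> 0 < r ==> r <= r\<eta> ==> (\<forall>\<theta>. z + (of_real r * cis \<theta>) *s (- v) \<in> UNIV) \<and>
   \<bar>cint (%\<theta>. \<eta> (z + (of_real r * cis \<theta>) *s (- v))) - 2 * pi * \<eta> z - pi * r\<^sup>2 / 2 * lapl \<eta> (- v) z\<bar> <= e * r\<^sup>2"
  using C2_circle_mean[OF open_UNIV \<eta>(1) cC1 subset_UNIV e(1)] by blast
 obtain s where s: "s > 0" "!!x y. x \<in> C1 ==> y \<in> C1 ==> dist y x < s ==> dist (\<eta> y) (\<eta> x) < e"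
  using compact_uniformly_continuous[OF c\<eta>' cC1] e(1) unfolding uniformly_continuous_on_def by metis
 \<comment> \<open>If neither point lies in the support, the difference is zero; otherwise both lie
   in \<open>C1\<close>, where \<eta> is uniformly continuous.\<close>
 have osc: "\<bar>\<eta> (z + y) - \<eta> z\<bar> <= e" if "norm y < s" "norm y <= \<rho>" for z y
 proof (cases "z \<in> C \<or> z + y \<in> C")
  case True
  then have "z \<in> C1" "z + y \<in> C1"
   using inC1[of z y] inC1[of "z + y" "- y"] that C12(1) by auto
  then show ?thesis using s(2)[of z "z + y"] that by (simp add: dist_norm dist_real_def)
 qed (use e in \<open>simp add: \<eta>(3)\<close>)
 \<comment> \<open>Bounds for the radius: \<open>b1\<close> for the disc of the Lipschitz bound,
   \<open>b5\<close> for the oscillation of \<eta>, \<open>b6\<close> for the condition of smallness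
   in the cut-off estimate, and \<open>b7\<close> to keep circles that start in d < R inside d <
   R0.\<close>
 define b1 where "b1 = \<delta> / 2"
 define b5 where "b5 = s / (2 * (norm v + 1))"
 define b6 where "b6 = R / (2 * (M0 + 1))"
 define b7 where "b7 = (R0 - R) / (2 * (M0 + 1))"
 define r0 where "r0 = Min {b1, rL, rw, r\<eta>, b5, b6, b7}"
 have nv: "norm v + 1 > 0" "M0 + 1 > 0" using M0 by (auto simp: add_nonneg_pos)
 have bs: "b1 > 0" "b5 > 0" "b6 > 0" "b7 > 0" using \<delta>(1) s(1) R nv by (auto simp: b1_def b5_def b6_def b7_def)
 have r0: "r0 > 0" unfolding r0_def using bs rL(1) rw(1) r\<eta>(1) by (subst Min_gr_iff) auto
 have small: "2 * r <= \<delta>" "r <= rL" "r <= rw" "r <= r\<eta>" "r * norm v < s" "r * norm v <= \<rho>" "M0 * r / R <= 1/2" "M0 * r < R0 - R"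
  if r: "0 < r" "r <= r0" for r
 proof -
  have le: "r <= \<delta> / 2" "r <= rL" "r <= rw" "r <= r\<eta>" "r <= s / (2 * (norm v + 1))" "r <= R / (2 * (M0 + 1))" "r <= (R0 - R) / (2 * (M0 + 1))"
   unfolding b1_def[symmetric] b5_def[symmetric] b6_def[symmetric] b7_def[symmetric]
   using order_trans[OF r(2)[unfolded r0_def] Min_le] by auto
  show "2 * r <= \<delta>" "r <= rL" "r <= rw" "r <= r\<eta>" using le by auto
  have "r * norm v <= \<delta> * norm v" using le(1) \<delta> r by (intro mult_right_mono) auto
  then show "r * norm v <= \<rho>" using \<delta> by simp
  have "r * norm v <= r * (norm v + 1)" using r by (simp add: mult_left_mono)
  also have "... <= s / 2" using le(5) nv by (simp add: field_simps)
  finally show "r * norm v < s" using s by simp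
  have a: "M0 * r <= (M0 + 1) * r" using r by (simp add: mult_right_mono)
  also have "... <= R / 2" using le(6) nv by (simp add: field_simps)
  finally show "M0 * r / R <= 1/2" using R by (simp add: field_simps)
  have "(M0 + 1) * r <= (R0 - R) / 2" using le(7) nv by (simp add: field_simps)
  with a have "M0 * r <= (R0 - R) / 2" by (rule order_trans)
  then show "M0 * r < R0 - R" using R(2) by (simp add: field_simps)
 qed
 define \<kappa> where "\<kappa> = M0 / R"
 have \<kappa>: "0 <= \<kappa>" using M0 R by (simp add: \<kappa>_def)
 \<comment> \<open>The cut-off error already divided by r^2. It is dominated by a fixed multiple of
   \<eta> and tends to 0 wherever d > 0, that is almost everywhere, so some radius makes its
   integral smaller than e.\<close>
 define err where "err r z = \<eta> z * (cuterr (D z / R) (\<kappa> * r) / r\<^sup>2)" for r z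
 have errm: "err r \<in> borel_measurable borel" for r
  unfolding err_def cuterr_def by measurable
 have posae: "AE z in lborel. z \<in> C \<longrightarrow> 0 < D z / R"
  using AE_pos by eventually_elim (use CO C12 D(2) R in auto)
 have erri: "AE z in lborel. norm (err r z) <= \<eta> z * (5 * \<kappa>\<^sup>2)" if "r > 0" for r
  using posae
 proof eventually_elim
  case (elim z)
  show ?case
  proof (cases "z \<in> C")
   case True
   have b: "0 <= cuterr (D z / R) (\<kappa> * r)" "cuterr (D z / R) (\<kappa> * r) <= 5 * (\<kappa> * r)\<^sup>2"
    using cuterr_bounds[of "D z / R" "\<kappa> * r"] elim True \<kappa> that by auto
   then have "cuterr (D z / R) (\<kappa> * r) / r\<^sup>2 <= 5 * \<kappa>\<^sup>2" using that by (simp add: divide_le_eq power_mult_distrib mult_ac)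
   from mult_left_mono[OF this \<eta>(2)[of z]] show ?thesis using b \<eta>(2)[of z] by (simp add: err_def abs_mult)
  qed (simp add: err_def \<eta>(3))
 qed
 have \<eta>int: "integrable lborel \<eta>" using \<eta>i[of "%_. 1"] by simp
 obtain r where r: "0 < r" "r <= r0" and errle: "R\<^sup>2 * (LINT z|lborel. err r z) <= e * R\<^sup>2"
 proof -
  define q where "q n = r0 / real (Suc n)" for n
  have q: "0 < q n" "q n <= r0" for n using r0 by (auto simp: q_def divide_le_eq)
  have ql: "q \<longlonglongrightarrow> 0" unfolding q_def by (rule lim_const_over_n[THEN LIMSEQ_Suc])
  have qr: "filterlim q (at_right 0) sequentially"
   unfolding filterlim_at using ql q(1) less_imp_neq[OF q(1)] by (auto intro!: always_eventually)
  have "(%n. LINT z|lborel. err (q n) z) \<longlonglongrightarrow> (LINT z|(lborel :: (complex^'n) measure). 0 :: real)"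
  proof (rule integral_dominated_convergence[where w = "%z. \<eta> z * (5 * \<kappa>\<^sup>2)"])
   show "AE z in lborel. (%n. err (q n) z) \<longlonglongrightarrow> 0"
    using posae
   proof eventually_elim
    case (elim z)
    show ?case
    proof (cases "z \<in> C")
     case True
     have "(%n. \<eta> z * (cuterr (D z / R) (\<kappa> * q n) / (q n)\<^sup>2)) \<longlonglongrightarrow> \<eta> z * 0"
      by (intro tendsto_mult tendsto_const filterlim_compose[OF cuterr_limit[OF _ \<kappa>] qr]) (use elim True in simp)
     then show ?thesis by (simp add: err_def)
    qed (simp add: err_def \<eta>(3))
   qed
  qed (use errm erri[OF q(1)] \<eta>int in auto)
  then have "(%n. LINT z|lborel. err (q n) z) \<longlonglongrightarrow> 0" by simp
  then have "eventually (%n. (LINT z|lborel. err (q n) z) < e) sequentially" by (rule order_tendstoD(2)) (rule e(1))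
  then obtain n where "(LINT z|lborel. err (q n) z) < e" by (auto simp: eventually_at_top_linorder)
  then have "R\<^sup>2 * (LINT z|lborel. err (q n) z) <= e * R\<^sup>2" by (simp add: mult.commute mult_right_mono)
  then show ?thesis using that[of "q n"] q by blast
 qed
 note sm = small[OF r]
 define c where "c \<theta> = (of_real r * cis \<theta>) *s v" for \<theta>
 have cc: "continuous_on X c" for X unfolding c_def by (intro continuous_intros)
 have nc: "norm (c \<theta>) = r * norm v" for \<theta> using r by (simp add: c_def norm_mult)
 have cR: "c \<theta> = r *\<^sub>R (cis \<theta> *s v)" for \<theta> by (simp add: c_def scaleR_complex_vec)
 let ?cu = "%z. cint (%\<theta>. u0 (z + c \<theta>))"
 let ?cL = "%z. cint (%\<theta>. L (z + c \<theta>))"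
 let ?cw = "%z. cint (%\<theta>. w (z + c \<theta>))"
 let ?ce = "%z. cint (%\<theta>. \<eta> (z - c \<theta>))"
 let ?ck = "%z. cint (%\<theta>. cutlog (D (z + c \<theta>) / R))"
 have circ1: "z + c \<theta> \<in> C1" if "z \<in> C" for z \<theta> by (rule inC1[OF that]) (simp add: nc sm(6))
 interpret en: energy_setup D \<eta> m v C C1 \<delta> r e
 proof unfold_locales
  show "\<bar>D (z + \<zeta> *s v) - D (z + \<zeta>' *s v)\<bar> <= m z * cmod (\<zeta> - \<zeta>')" if "z \<in> C1" "cmod \<zeta> <= \<delta>" "cmod \<zeta>' <= \<delta>" for z \<zeta> \<zeta>'
   using lip[OF that] D(2)[OF inC2[OF that(1,2)]] D(2)[OF inC2[OF that(1,3)]] by simp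
  show "0 <= m z" if "z \<in> C1" for z unfolding m_def using m_ge[OF that] e by simp
  show "z + y \<in> C1" if "z \<in> C" "norm y <= r * norm v" for z y using inC1[OF that(1), of y] that(2) sm(6) by linarith
  show "\<bar>\<eta> (z + y) - \<eta> z\<bar> <= e" if "norm y <= r * norm v" for z y using osc[of y z] that sm(5,6) by linarith
 qed (use D(1) c\<eta> \<eta> C cC1 cm \<delta> r sm in auto)
 define sq where "sq z = cint (%\<theta>. (D (z + c \<theta>) - D z)\<^sup>2)" for z
 have csq: "continuous_on UNIV sq"
 proof -
  have "sq z = integral {0..2*pi} (%\<theta>. (D (z + c \<theta>) - D z)\<^sup>2)" for z
   unfolding sq_def by (rule cint_continuous) (intro continuous_intros Dc cc)
  moreover have "continuous_on UNIV (%z. integral {0..2*pi} (%\<theta>. (D (z + c \<theta>) - D z)\<^sup>2))"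
   by (rule continuous_on_box_integral) (simp add: case_prod_beta', intro continuous_intros Dc continuous_on_compose2[OF cc[of UNIV]], auto)
  ultimately show ?thesis by (simp add: fun_eq_iff[symmetric])
 qed
 have energy: "(LINT z|lborel. \<eta> z * sq z) <= pi * r\<^sup>2 * (?IL / 2 + e * ?K1)"
 proof -
  have "(LINT z|lborel. \<eta> z * sq z) <= pi * r\<^sup>2 * (LINT z:C1|lborel. en.W z * (m z)\<^sup>2)"
   using en.energy_mean by (simp add: sq_def cR)
  also have "(LINT z:C1|lborel. en.W z * (m z)\<^sup>2) <= (LINT z|lborel. \<eta> z * lapl L v z / 2 + e * (indicator C1 z *\<^sub>R (\<eta> z + lapl L v z / 2 + 1)))"
   unfolding set_lebesgue_integral_def
  proof (rule integral_mono)
   show "integrable lborel (%z. indicator C1 z *\<^sub>R (en.W z * (m z)\<^sup>2))"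
    by (rule borel_integrable_compact[OF cC1]) (intro continuous_intros en.contW cm)
   have "integrable lborel (%z. indicator C1 z *\<^sub>R (\<eta> z + lapl L v z / 2 + 1))"
    by (rule borel_integrable_compact[OF cC1]) (intro continuous_intros c\<eta>' lL C1O, auto)
   moreover have "integrable lborel (%z. \<eta> z * lapl L v z)" by (rule \<eta>i[OF lL(1)[OF CO]])
   ultimately show "integrable lborel (%z. \<eta> z * lapl L v z / 2 + e * (indicator C1 z *\<^sub>R (\<eta> z + lapl L v z / 2 + 1)))" by simp
   fix z
   show "indicator C1 z *\<^sub>R (en.W z * (m z)\<^sup>2) <= \<eta> z * lapl L v z / 2 + e * (indicator C1 z *\<^sub>R (\<eta> z + lapl L v z / 2 + 1))"
   proof (cases "z \<in> C1")
    case True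
    \<comment> \<open>Both the weight and the squared Lipschitz constant are perturbed by e; the
      resulting product e^2 is reduced to e.\<close>
    have "e * e <= e * 1" using e by (intro mult_left_mono) auto
    then show ?thesis using True unfolding m2[OF True] en.W_def by (simp add: algebra_simps add_divide_distrib)
   next
    case False
    then have "z \<notin> C" using C12 by auto
    then show ?thesis using False by (simp add: \<eta>(3))
   qed
  qed
  also have "(LINT z|lborel. \<eta> z * lapl L v z / 2 + e * (indicator C1 z *\<^sub>R (\<eta> z + lapl L v z / 2 + 1)))
   = ?IL / 2 + e * ?K1"
  proof -
   have i: "integrable lborel (%z. indicator C1 z *\<^sub>R (\<eta> z + lapl L v z / 2 + 1))"
    by (rule borel_integrable_compact[OF cC1]) (intro continuous_intros c\<eta>' lL C1O, auto)
   have j: "integrable lborel (%z. \<eta> z * lapl L v z)" by (rule \<eta>i[OF lL(1)[OF CO]])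
   show ?thesis
    unfolding set_lebesgue_integral_def
    by (subst Bochner_Integration.integral_add) (use i j in auto)
  qed
  finally show ?thesis using r by (simp add: mult_left_mono)
 qed
 have si_c: "cintegrable f" if "continuous_on {0..2*pi} f" for f :: "real => real"
  unfolding set_integrable_def by (rule borel_integrable_compact[OF _ that]) simp
 have pointwise: "AE z in lborel. \<eta> z * (- sq z - pi * R\<^sup>2 * cuterr (D z / R) (\<kappa> * r) + pi * r\<^sup>2 / 2 * (lapl L v z - lapl w v z) - 2 * e * r\<^sup>2)
   <= \<eta> z * ?cu z - 2 * pi * (u0 z * \<eta> z)"
  using AE_pos
 proof eventually_elim
  case (elim z)
  show ?case
  proof (cases "z \<in> C")
   case True
   have zC1: "z \<in> C1" and zO: "z \<in> \<Omega>" and zC2: "z \<in> C2" using True C12 by auto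
   then have dz: "0 < d z" using elim by simp
   have Dz: "D z = d z" "D (z + c \<theta>) = d (z + c \<theta>)" for \<theta>
    by (rule D(2)[OF zC2], rule D(2)[OF subsetD[OF C12(2) circ1[OF True]]])
   have lipc: "\<bar>d (z + \<zeta> *s v) - d z\<bar> <= M0 * r" if "cmod \<zeta> <= r" for \<zeta>
   proof -
    have "\<bar>d (z + \<zeta> *s v) - d (z + 0 *s v)\<bar> <= m z * cmod (\<zeta> - 0)"
     by (rule lip[OF zC1]) (use that sm(1) r \<delta> in auto)
    also have "... <= M0 * r" using that M0 M0(2)[OF zC1] by (intro mult_mono) auto
    finally show ?thesis by simp
   qed
    have c1: "0 < D z / R" using dz R by (simp add: Dz)
    have c2: "0 <= \<kappa> * r" "\<kappa> * r <= 1/2" using mult_nonneg_nonneg[OF \<kappa> less_imp_le[OF r(1)]] sm(7) by (auto simp: \<kappa>_def)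
    have c3: "continuous_on UNIV (%\<theta>. D (z + c \<theta>) / R)" using R by (intro continuous_intros Dc cc) auto
    have c4: "0 <= D (z + c \<theta>) / R" for \<theta> using d0 circ1[OF True, of \<theta>] C1O R by (auto simp: Dz)
    have c5: "\<bar>D (z + c \<theta>) / R - D z / R\<bar> <= \<kappa> * r" for \<theta>
    proof -
     have "\<bar>d (z + c \<theta>) - d z\<bar> <= M0 * r" unfolding c_def by (rule lipc) (use r in \<open>simp add: norm_mult\<close>)
     then have "\<bar>d (z + c \<theta>) - d z\<bar> / R <= \<kappa> * r" using R by (simp add: \<kappa>_def divide_right_mono)
     then show ?thesis using R by (simp add: Dz diff_divide_distrib[symmetric])
    qed
    have c6: "cintegrable (%\<theta>. ln (D (z + c \<theta>) / R)) \<and> 2 * pi * ln (D z / R) <= cint (%\<theta>. ln (D (z + c \<theta>) / R))"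
     if "D z / R < 1"
    proof -
    have dR: "d z < R" using that R by (simp add: Dz)
    \<comment> \<open>The submean property is granted only if the whole closed disc, not just its
      boundary circle, lies in d < R0.\<close>
    have "a + \<zeta> *s b \<in> \<Omega> \<and> d (a + \<zeta> *s b) < R0" if "cmod \<zeta> <= 1" "a = z" "b = of_real r *s v" for \<zeta> a b
    proof -
     have k: "cmod (\<zeta> * of_real r) <= r" using that r by (simp add: norm_mult mult_left_le_one_le)
     have "norm ((\<zeta> * of_real r) *s v) <= r * norm v" using mult_right_mono[OF k, of "norm v"] by simp
     then have "z + (\<zeta> * of_real r) *s v \<in> C1" using inC1[OF True] sm(6) by (metis order_trans)
     moreover have "d (z + (\<zeta> * of_real r) *s v) < R0" using lipc[OF k] dR sm(8) by linarith
     ultimately show ?thesis using that C1O by auto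
    qed
    from sub[OF dz this[of _ z "of_real r *s v"]]
    have "cintegrable (%\<theta>. ln (d (z + c \<theta>))) \<and> 2 * pi * ln (d z) <= cint (%\<theta>. ln (d (z + c \<theta>))) \<and>
      (AE \<theta> in lborel. \<theta> \<in> {0..2*pi} \<longrightarrow> 0 < d (z + c \<theta>))"
     by (simp add: c_def mult.commute)
    then have l: "cintegrable (%\<theta>. ln (d (z + c \<theta>)))" "2 * pi * ln (d z) <= cint (%\<theta>. ln (d (z + c \<theta>)))" "AE \<theta> in lborel. \<theta> \<in> {0..2*pi} \<longrightarrow> 0 < d (z + c \<theta>)" by auto
    show "cintegrable (%\<theta>. ln (D (z + c \<theta>) / R)) \<and> 2 * pi * ln (D z / R) <= cint (%\<theta>. ln (D (z + c \<theta>) / R))"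
    proof (rule ln_quotient_circle_mean[OF _ R(1)])
     show "continuous_on UNIV (%\<theta>. D (z + c \<theta>))" by (intro continuous_intros Dc cc)
    qed (use dz l Dz in auto)
   qed
   have cl1: "cintegrable (%\<theta>. cutlog (D (z + c \<theta>) / R))"
    and cl2: "?ck z \<ge> 2 * pi * cutlog (D z / R) - 2 * cint (%\<theta>. (D (z + c \<theta>) / R - D z / R)\<^sup>2) - 2 * pi * cuterr (D z / R) (\<kappa> * r)"
    using cutlog_circle_mean[OF c1 c2 c3 c4 c5 c6] by simp_all
   have zc: "continuous_on X (%\<theta>. z + c \<theta>)" for X by (intro continuous_intros cc)
   have iL: "cintegrable (%\<theta>. L (z + c \<theta>))"
    by (rule si_c, rule continuous_on_compose2[OF Lc zc]) (use circ1[OF True] C1O in auto)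
   have iw: "cintegrable (%\<theta>. w (z + c \<theta>))"
    by (rule si_c, rule continuous_on_compose2[OF wc zc]) (use circ1[OF True] C1O in auto)
   have ic: "cintegrable (%\<theta>. R\<^sup>2 / 2 * cutlog (D (z + c \<theta>) / R))" using cl1 by simp
   have "?cu z = cint (%\<theta>. R\<^sup>2 / 2 * cutlog (D (z + c \<theta>) / R) + (L (z + c \<theta>) - w (z + c \<theta>)))"
    by (simp add: u0_def u_def cl_def circ1[OF True] Dz add_diff_eq)
   also have "... = R\<^sup>2 / 2 * ?ck z + (?cL z - ?cw z)"
    unfolding cint_def using set_integral_add(2)[OF ic set_integral_diff(1)[OF iL iw]] set_integral_diff(2)[OF iL iw] by simp
   finally have cu: "?cu z = R\<^sup>2 / 2 * ?ck z + (?cL z - ?cw z)" .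
   have "(D (z + c \<theta>) / R - D z / R)\<^sup>2 = (1 / R\<^sup>2) * (D (z + c \<theta>) - D z)\<^sup>2" for \<theta>
    by (simp add: diff_divide_distrib[symmetric] power_divide)
   then have sqR: "cint (%\<theta>. (D (z + c \<theta>) / R - D z / R)\<^sup>2) = (1 / R\<^sup>2) * sq z"
    unfolding sq_def cint_def by (simp only: set_integral_mult_right)
   \<comment> \<open>The factor R^2/2 cancels both the 1/R^2 from rescaling d and the factor 2 of
     the cut-off estimate, so that the loss is exactly \<open>sq z\<close>.\<close>
   have "R\<^sup>2 / 2 * ?ck z \<ge> R\<^sup>2 / 2 * (2 * pi * cutlog (D z / R) - 2 * ((1 / R\<^sup>2) * sq z) - 2 * pi * cuterr (D z / R) (\<kappa> * r))"
    using cl2 unfolding sqR by (intro mult_left_mono) auto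
   also have "R\<^sup>2 / 2 * (2 * pi * cutlog (D z / R) - 2 * ((1 / R\<^sup>2) * sq z) - 2 * pi * cuterr (D z / R) (\<kappa> * r))
     = 2 * pi * (R\<^sup>2 / 2 * cutlog (D z / R)) - sq z - pi * R\<^sup>2 * cuterr (D z / R) (\<kappa> * r)"
    using R by (simp add: field_simps)
   finally have k1: "R\<^sup>2 / 2 * ?ck z \<ge> 2 * pi * (R\<^sup>2 / 2 * cutlog (D z / R)) - sq z - pi * R\<^sup>2 * cuterr (D z / R) (\<kappa> * r)" .
   have k2: "\<bar>?cL z - 2 * pi * L z - pi * r\<^sup>2 / 2 * lapl L v z\<bar> <= e * r\<^sup>2"
    using rL(2)[OF zC1 r(1) sm(2)] by (simp add: c_def)
   have k3: "\<bar>?cw z - 2 * pi * w z - pi * r\<^sup>2 / 2 * lapl w v z\<bar> <= e * r\<^sup>2"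
    using rw(2)[OF zC1 r(1) sm(3)] by (simp add: c_def)
   have k4: "2 * pi * u0 z = 2 * pi * (R\<^sup>2 / 2 * cutlog (D z / R)) + 2 * pi * L z - 2 * pi * w z"
    using zC1 by (simp add: u0_def u_def cl_def Dz algebra_simps)
   have k5: "pi * r\<^sup>2 / 2 * (lapl L v z - lapl w v z) = pi * r\<^sup>2 / 2 * lapl L v z - pi * r\<^sup>2 / 2 * lapl w v z" by (rule right_diff_distrib)
   have "- sq z - pi * R\<^sup>2 * cuterr (D z / R) (\<kappa> * r) + pi * r\<^sup>2 / 2 * (lapl L v z - lapl w v z) - 2 * e * r\<^sup>2
     <= ?cu z - 2 * pi * u0 z"
    unfolding cu k4 k5 using k1 k2 k3 unfolding abs_le_iff by linarith
   from mult_left_mono[OF this \<eta>(2)[of z]] show ?thesis by (simp add: algebra_simps)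
  qed (simp add: \<eta>(3))
 qed
 note conv = circle_convolution[OF u0 c\<eta> B cc]
 have u0\<eta>i: "integrable lborel (%z. u0 z * \<eta> z)" by (rule u0\<eta>[OF c\<eta> B])
 have erri': "integrable lborel (err r)"
  by (rule Bochner_Integration.integrable_bound[where f = "%z. \<eta> z * (5 * \<kappa>\<^sup>2)"])
    (use \<eta>int errm erri[OF r(1)] \<eta>(2) in \<open>auto simp: abs_of_nonneg\<close>)
 have sqi: "integrable lborel (%z. \<eta> z * sq z)" by (rule \<eta>i[OF continuous_on_subset[OF csq subset_UNIV]])
 have Li: "integrable lborel (%z. \<eta> z * lapl L v z)" and wi: "integrable lborel (%z. \<eta> z * lapl w v z)"
  by (rule \<eta>i[OF lL(1)[OF CO]], rule \<eta>i[OF lL(2)[OF CO]])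
 \<comment> \<open>The common scale by which the final inequality is divided; error terms in r^2 are
   absorbed because r^2 <= P.\<close>
 define P where "P = pi * r\<^sup>2"
 have P: "P > 0" "r\<^sup>2 <= P" using r mult_right_mono[of 1 pi "r\<^sup>2"] pi_ge_two by (auto simp: P_def)
 let ?lhs = "%z. - (\<eta> z * sq z) - P * R\<^sup>2 * err r z + P / 2 * (\<eta> z * lapl L v z) - P / 2 * (\<eta> z * lapl w v z) - 2 * e * r\<^sup>2 * \<eta> z"
 have lhs: "\<eta> z * (- sq z - pi * R\<^sup>2 * cuterr (D z / R) (\<kappa> * r) + pi * r\<^sup>2 / 2 * (lapl L v z - lapl w v z) - 2 * e * r\<^sup>2)
   = ?lhs z" for z
  using r by (simp add: err_def P_def field_simps)
 have "- (LINT z|lborel. \<eta> z * sq z) - P * R\<^sup>2 * (LINT z|lborel. err r z) + P / 2 * ?IL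
   - P / 2 * ?Iw - 2 * e * r\<^sup>2 * ?H
  = (LINT z|lborel. ?lhs z)"
  using sqi erri' Li wi \<eta>int by simp
 also have "... <= (LINT z|lborel. \<eta> z * ?cu z - 2 * pi * (u0 z * \<eta> z))"
 proof (rule integral_mono_AE)
  show "integrable lborel (%z. ?lhs z)"
   using sqi erri' Li wi \<eta>int by simp
  show "integrable lborel (%z. \<eta> z * ?cu z - 2 * pi * (u0 z * \<eta> z))"
   using conv(3) u0\<eta>i by simp
 qed (rule pointwise[unfolded lhs])
 also have "... = (LINT z|lborel. u0 z * ?ce z - 2 * pi * (u0 z * \<eta> z))"
  using conv u0\<eta>i by simp
 also have "... <= (LINT z|lborel. P / 2 * (u0 z * lapl \<eta> v z) + e * r\<^sup>2 * \<bar>u0 z\<bar>)"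
 proof (rule integral_mono)
  show "integrable lborel (%z. u0 z * ?ce z - 2 * pi * (u0 z * \<eta> z))" using conv(2) u0\<eta>i by simp
  have "bounded (lapl \<eta> v ` C)" by (intro compact_imp_bounded compact_continuous_image l\<eta> C)
  then obtain b where "!!z. z \<in> C ==> \<bar>lapl \<eta> v z\<bar> <= b" by (auto simp: bounded_iff)
  then have "\<bar>lapl \<eta> v z\<bar> <= \<bar>b\<bar>" for z by (cases "z \<in> C") (force simp: l\<eta>0)+
  then have lui: "integrable lborel (%z. u0 z * lapl \<eta> v z)" by (rule u0\<eta>[OF l\<eta>])
  show "integrable lborel (%z. P / 2 * (u0 z * lapl \<eta> v z) + e * r\<^sup>2 * \<bar>u0 z\<bar>)"
   using lui u0 by simp
  fix z
  show "u0 z * ?ce z - 2 * pi * (u0 z * \<eta> z) <= P / 2 * (u0 z * lapl \<eta> v z) + e * r\<^sup>2 * \<bar>u0 z\<bar>"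
  proof (cases "z \<in> C1")
   case True
   \<comment> \<open>Convolution has reflected the circle, so the expansion of \<eta> is used in the
     direction -v, which has the same Laplacian.\<close>
   have "z + (of_real r * cis \<theta>) *s (- v) = z - c \<theta>" for \<theta> by (simp add: c_def)
   then have "\<bar>?ce z - 2 * pi * \<eta> z - P / 2 * lapl \<eta> v z\<bar> <= e * r\<^sup>2"
    using r\<eta>(2)[OF True r(1) sm(4)] lapl_uminus[OF open_UNIV \<eta>(1) UNIV_I, of v z] by (simp add: P_def)
   then have "\<bar>u0 z\<bar> * \<bar>?ce z - 2 * pi * \<eta> z - P / 2 * lapl \<eta> v z\<bar> <= \<bar>u0 z\<bar> * (e * r\<^sup>2)"
    by (rule mult_left_mono) simp
   then have "u0 z * (?ce z - 2 * pi * \<eta> z - P / 2 * lapl \<eta> v z) <= \<bar>u0 z\<bar> * (e * r\<^sup>2)"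
    unfolding abs_mult[symmetric] by linarith
   then show ?thesis by (simp add: algebra_simps)
  qed (simp add: u0_def)
 qed
 also have "... = P / 2 * ?Iu + e * r\<^sup>2 * ?U"
 proof -
  have "bounded (lapl \<eta> v ` C)" by (intro compact_imp_bounded compact_continuous_image l\<eta> C)
  then obtain b where "!!z. z \<in> C ==> \<bar>lapl \<eta> v z\<bar> <= b" by (auto simp: bounded_iff)
  then have "\<bar>lapl \<eta> v z\<bar> <= \<bar>b\<bar>" for z by (cases "z \<in> C") (force simp: l\<eta>0)+
  then have lui: "integrable lborel (%z. u0 z * lapl \<eta> v z)" by (rule u0\<eta>[OF l\<eta>])
  then show ?thesis using u0 by simp
 qed
 finally have main: "- (LINT z|lborel. \<eta> z * sq z) - P * R\<^sup>2 * (LINT z|lborel. err r z) + P / 2 * ?IL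
   - P / 2 * ?Iw - 2 * e * r\<^sup>2 * ?H
  <= P / 2 * ?Iu + e * r\<^sup>2 * ?U" .
 have n0: "0 <= e * (2 * ?H + ?U)"
  using e \<eta>(2) by (intro mult_nonneg_nonneg add_nonneg_nonneg integral_nonneg_AE) auto
 \<comment> \<open>The gain P/2 times the Laplacian of L meets the same quantity from the energy
   bound; they cancel and leave the two desired integrals with terms carrying the factor e.\<close>
 have "0 <= P * (?Iu / 2 + ?Iw / 2
   + e * (?K1 + R\<^sup>2 + ?U + 2 * ?H))"
  using main energy[folded P_def] mult_left_mono[OF errle less_imp_le[OF P(1)]] mult_right_mono[OF P(2) n0]
  by (simp add: algebra_simps)
 then show ?thesis using P(1) by (simp add: zero_le_mult_iff)
qed

text \<open>The neighbourhood \<open>C1\<close> is fixed beforehand, so the expression multiplied by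
  e does not depend on e, and e can tend to 0.\<close>

theorem current_inequality:
 fixes \<eta> w :: "complex^'n => real"
 assumes \<eta>: "Ck_on 2 UNIV \<eta>" "!!z. 0 <= \<eta> z" "!!z. z \<notin> C ==> \<eta> z = 0" and w: "Ck_on 2 \<Omega> w"
  and C: "compact C" "C \<subseteq> \<Omega>"
 shows "0 <= (LINT z:\<Omega>|lborel. (R\<^sup>2 / 2 * cl z + L z - w z) * (lapl \<eta> v z / 2)) + (LINT z:\<Omega>|lborel. \<eta> z * (lapl w v z / 2))"
proof -
 obtain s where s: "s > 0" "(\<Union>x\<in>C. cball x s) \<subseteq> \<Omega>"
  using compact_subset_open_imp_cball_epsilon_subset[OF C(1) open_set C(2)] by blast
 define \<rho> where "\<rho> = s / 2"
 have \<rho>: "\<rho> > 0" "(\<Union>x\<in>C. cball x (2 * \<rho>)) \<subseteq> \<Omega>" using s by (auto simp: \<rho>_def)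
 define C1 where "C1 = (\<Union>x\<in>C. cball x \<rho>)"
 have CC1: "C \<subseteq> C1" using \<rho>(1) by (force simp: C1_def)
 let ?u = "%z. R\<^sup>2 / 2 * cl z + L z - w z"
 let ?X = "(LINT z|lborel. indicator C1 z * ?u z * lapl \<eta> v z) / 2 + (LINT z|lborel. \<eta> z * lapl w v z) / 2"
 let ?Y = "(LINT z:C1|lborel. \<eta> z + lapl L v z / 2 + 1) + R\<^sup>2 + (LINT z|lborel. \<bar>indicator C1 z * ?u z\<bar>) + 2 * (LINT z|lborel. \<eta> z)"
 have "0 <= ?X + (1 / real (Suc n)) * ?Y" for n
  using current_inequality_approx[OF \<eta> w C(1) \<rho>, of "1 / real (Suc n)"] by (simp add: C1_def mult.assoc)
 moreover have "(%n. ?X + (1 / real (Suc n)) * ?Y) \<longlonglongrightarrow> ?X + 0 * ?Y"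
  by (intro tendsto_intros lim_const_over_n[THEN LIMSEQ_Suc])
 ultimately have X: "0 <= ?X + 0 * ?Y" by (intro LIMSEQ_le_const) auto
 have l0: "lapl \<eta> v z = 0" if "z \<notin> C" for z by (rule lapl_vanishing[OF compact_imp_closed[OF C(1)] \<eta>(3) that])
 have 1: "indicator \<Omega> z *\<^sub>R (?u z * (lapl \<eta> v z / 2)) = (indicator C1 z * ?u z * lapl \<eta> v z) / 2" for z
  using CC1 C(2) l0[of z] by (cases "z \<in> C") (auto simp: subset_iff)
 have 2: "indicator \<Omega> z *\<^sub>R (\<eta> z * (lapl w v z / 2)) = (\<eta> z * lapl w v z) / 2" for z
  using C(2) \<eta>(3)[of z] by (cases "z \<in> C") (auto simp: subset_iff)
 show ?thesis using X unfolding set_lebesgue_integral_def 1 2 by simp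
qed

end

section \<open>Circle means and plurisubharmonicity\<close>

lemma ennreal_finiteE:
 assumes "p \<noteq> (\<infinity> :: ennreal)" obtains x where "0 <= x" "p = ennreal x"
 using assms by (cases p rule: ennreal_cases) auto

lemma circle_mean_eq:
 assumes F: "cintegrable F"
  and h: "AE \<theta> in lborel. \<theta> \<in> {0..2*pi} \<longrightarrow> h \<theta> = ereal (F \<theta>)"
 shows "circle_mean h = ereal (cint F / (2 * pi))"
proof -
 let ?I = "%\<theta>. indicator {0..2*pi} \<theta> :: real"
 let ?f = "%\<theta>. ?I \<theta> *\<^sub>R F \<theta>"
 have i: "integrable lborel ?f" using F by (simp add: set_integrable_def)
 have p: "(\<integral>\<^sup>+\<theta>\<in>{0..2*pi}. e2ennreal (h \<theta>) \<partial>lborel) = (\<integral>\<^sup>+\<theta>. ennreal (?f \<theta>) \<partial>lborel)"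
  by (rule nn_integral_cong_AE, use h in eventually_elim) (auto simp: indicator_def)
 have n: "(\<integral>\<^sup>+\<theta>\<in>{0..2*pi}. e2ennreal (- h \<theta>) \<partial>lborel) = (\<integral>\<^sup>+\<theta>. ennreal (- ?f \<theta>) \<partial>lborel)"
  by (rule nn_integral_cong_AE, use h in eventually_elim) (auto simp: indicator_def)
 have "(\<integral>\<^sup>+\<theta>. ennreal (?f \<theta>) \<partial>lborel) \<noteq> \<infinity>" "(\<integral>\<^sup>+\<theta>. ennreal (- ?f \<theta>) \<partial>lborel) \<noteq> \<infinity>"
  using i unfolding real_integrable_def by auto
 then obtain x y where xy: "0 <= x" "(\<integral>\<^sup>+\<theta>. ennreal (?f \<theta>) \<partial>lborel) = ennreal x" "0 <= y" "(\<integral>\<^sup>+\<theta>. ennreal (- ?f \<theta>) \<partial>lborel) = ennreal y"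
  by (elim ennreal_finiteE)
 have "cint F = x - y"
  unfolding cint_def set_lebesgue_integral_def real_lebesgue_integral_def[OF i] xy using xy(1,3) by simp
 then show ?thesis unfolding circle_mean_def p n xy using xy(1,3) by simp
qed

text \<open>The value at the centre is finite, so the mean cannot be -infinity. Hence the negative
  part of log g is integrable and g vanishes only for a null set of angles, which permits the
  passage from extended to real integrals.\<close>

lemma log_circle_mean:
 assumes g: "continuous_on UNIV g" "!!\<theta>. 0 <= g \<theta>" "!!\<theta>. g \<theta> <= M" and A: "0 < A"
  and le: "log0 A <= circle_mean (%\<theta>. log0 (g \<theta>))"
 shows "cintegrable (%\<theta>. ln (g \<theta>))" "2 * pi * ln A <= cint (%\<theta>. ln (g \<theta>))"
  "AE \<theta> in lborel. \<theta> \<in> {0..2*pi} \<longrightarrow> 0 < g \<theta>"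
proof -
 have [measurable]: "g \<in> borel_measurable borel" by (rule borel_measurable_continuous_onI[OF g(1)])
 let ?f = "%\<theta>. indicator {0..2*pi} \<theta> *\<^sub>R ln (g \<theta>)"
 let ?N = "\<integral>\<^sup>+\<theta>\<in>{0..2*pi}. e2ennreal (- log0 (g \<theta>)) \<partial>lborel"
 have e: "(\<integral>\<^sup>+\<theta>\<in>{0..2*pi}. e2ennreal (log0 (g \<theta>)) \<partial>lborel) = (\<integral>\<^sup>+\<theta>. ennreal (?f \<theta>) \<partial>lborel)"
  by (rule nn_integral_cong) (use g(2) in \<open>auto simp: indicator_def log0_def e2ennreal_neg not_le dest: order_antisym\<close>)
 have bound: "?f \<theta> <= indicator {0..2*pi} \<theta> *\<^sub>R \<bar>ln (max M 1)\<bar>" for \<theta>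
 proof (cases "g \<theta> = 0")
  case False
  then have "0 < g \<theta>" using g(2)[of \<theta>] by simp
  then have "ln (g \<theta>) <= ln (max M 1)" using g(3)[of \<theta>] by simp
  then show ?thesis by (auto simp: indicator_def)
 qed simp
 have "(\<integral>\<^sup>+\<theta>. ennreal (?f \<theta>) \<partial>lborel) <= (\<integral>\<^sup>+\<theta>. ennreal \<bar>ln (max M 1)\<bar> * indicator {0..2*pi} (\<theta> :: real) \<partial>lborel)"
 proof (rule nn_integral_mono)
  fix \<theta> :: real
  show "ennreal (?f \<theta>) <= ennreal \<bar>ln (max M 1)\<bar> * indicator {0..2*pi} \<theta>"
   using bound[of \<theta>] by (auto simp: indicator_def ennreal_leI)
 qed
 also have "... = ennreal \<bar>ln (max M 1)\<bar> * emeasure lborel {0..2*pi::real}" by (rule nn_integral_cmult_indicator) simp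
 also have "... < \<infinity>" by (simp add: ennreal_mult_less_top)
 finally have P: "(\<integral>\<^sup>+\<theta>. ennreal (?f \<theta>) \<partial>lborel) < \<infinity>" .
 then obtain x where x: "0 <= x" "(\<integral>\<^sup>+\<theta>. ennreal (?f \<theta>) \<partial>lborel) = ennreal x"
  by (elim ennreal_finiteE[OF less_imp_neq])
 have N: "?N \<noteq> \<infinity>"
 proof
  assume "?N = \<infinity>"
  then have "circle_mean (%\<theta>. log0 (g \<theta>)) = -\<infinity>"
   unfolding circle_mean_def e x using x(1) by (simp add: top_ennreal.rep_eq)
  then show False using le A by (simp add: log0_def)
 qed
 have "(%\<theta>. e2ennreal (- log0 (g \<theta>)) * indicator {0..2*pi} \<theta>) \<in> borel_measurable lborel"
  unfolding log0_def by measurable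
 from nn_integral_PInf_AE[OF this N] show ae: "AE \<theta> in lborel. \<theta> \<in> {0..2*pi} \<longrightarrow> 0 < g \<theta>"
 proof eventually_elim
  case (elim \<theta>)
  then show ?case by (cases "g \<theta> <= 0") (auto simp: log0_def)
 qed
 have "(\<integral>\<^sup>+\<theta>. ennreal (- ?f \<theta>) \<partial>lborel) <= ?N"
  by (rule nn_integral_mono) (use g(2) in \<open>auto simp: indicator_def log0_def dest: order_antisym\<close>)
 then have "(\<integral>\<^sup>+\<theta>. ennreal (- ?f \<theta>) \<partial>lborel) \<noteq> \<infinity>" using N by (metis infinity_ennreal_def top.extremum_uniqueI)
 moreover have "?f \<in> borel_measurable lborel" by measurable
 ultimately show si: "cintegrable (%\<theta>. ln (g \<theta>))"
  using P unfolding set_integrable_def real_integrable_def by auto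
 have "circle_mean (%\<theta>. log0 (g \<theta>)) = ereal (cint (%\<theta>. ln (g \<theta>)) / (2 * pi))"
  by (rule circle_mean_eq[OF si], use ae in eventually_elim) (auto simp: log0_def)
 then have "ln A <= cint (%\<theta>. ln (g \<theta>)) / (2 * pi)" using le A by (simp add: log0_def)
 then show "2 * pi * ln A <= cint (%\<theta>. ln (g \<theta>))" by (simp add: field_simps)
qed

section \<open>Calculus of C^k functions and means over circles of any size\<close>

lemma Ck_on_cong:
 fixes f :: "'a::euclidean_space => real"
 assumes "open S"
 shows "(!!x. x \<in> S ==> f x = g x) ==> Ck_on k S f ==> Ck_on k S g"
proof (induction k arbitrary: f g)
 case 0 then show ?case by (simp cong: continuous_on_cong)
next
 case (Suc k)
 have fg: "fd f x = fd g x" if "x \<in> S" for x using fd_cong_open[OF assms that Suc.prems(1)] .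
 have "g differentiable (at x)" if "x \<in> S" for x
 proof -
  have "(f has_derivative fd f x) (at x)" using Suc.prems(2) that by (simp add: frechet_derivative_works)
  then have "(g has_derivative fd f x) (at x)"
   by (rule has_derivative_transform_within_open[OF _ assms that Suc.prems(1)])
  then show ?thesis by (auto simp: differentiable_def)
 qed
 moreover have "Ck_on k S (%x. fd g x b)" if "b \<in> Basis" for b
  by (rule Suc.IH[of "%x. fd f x b"]) (use fg Suc.prems(2) that in auto)
 ultimately show ?case by simp
qed

lemma Ck_on_subset: "Ck_on k S f ==> T \<subseteq> S ==> Ck_on k T f"
 by (induction k arbitrary: f) (auto intro: continuous_on_subset)

lemma Ck_on_const: "Ck_on k S (%x. c)"
 by (induction k arbitrary: c) auto

lemma Ck_on_inner: "Ck_on k S (%x. c * (x \<bullet> b))"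
proof (cases k)
 case (Suc j)
 have d: "((%x. c * (x \<bullet> b)) has_derivative (%v. c * (v \<bullet> b))) (at x)" for x by (auto intro!: derivative_eq_intros)
 have "fd (%x. c * (x \<bullet> b)) x v = c * (v \<bullet> b)" for x v by (rule has_derivative_fd[OF d])
 then show ?thesis using Suc d by (auto simp: differentiable_def Ck_on_const)
qed (auto intro!: continuous_intros)

lemma Ck_on_square: "Ck_on k S (%x. c * (x \<bullet> x))"
proof (cases k)
 case (Suc j)
 have d: "((%x. c * (x \<bullet> x)) has_derivative (%v. (2 * c) * (x \<bullet> v))) (at x)" for x :: 'a
  by (auto intro!: derivative_eq_intros simp: inner_commute)
 have "fd (%x. c * (x \<bullet> x)) x b = (2 * c) * (x \<bullet> b)" for x b :: 'a by (rule has_derivative_fd[OF d])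
 then show ?thesis using Suc d Ck_on_inner[of j S "2 * c"] by (auto simp: differentiable_def)
qed (auto intro!: continuous_intros)

lemma Ck_on_diff:
 fixes f g :: "'a::euclidean_space => real"
 assumes S: "open S"
 shows "Ck_on k S f ==> Ck_on k S g ==> Ck_on k S (%x. f x - g x)"
proof (induction k arbitrary: f g)
 case (Suc k)
 have d: "((%x. f x - g x) has_derivative (%b. fd f x b - fd g x b)) (at x)" if "x \<in> S" for x
  using Suc.prems that by (intro has_derivative_diff) (auto simp: frechet_derivative_works)
 have "Ck_on k S (%x. fd (%x. f x - g x) x b)" if b: "b \<in> Basis" for b
  by (rule Ck_on_cong[OF S _ Suc.IH[of "%x. fd f x b" "%x. fd g x b"]]) (use Suc.prems b has_derivative_fd[OF d] in auto)
 moreover have "(%x. f x - g x) differentiable (at x)" if "x \<in> S" for x using d[OF that] by (auto simp: differentiable_def)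
 ultimately show ?case by simp
qed (auto intro!: continuous_intros)

lemma cint_trig: "cint (%\<theta>. c0 + c1 * cos \<theta> + c2 * sin \<theta>) = 2 * pi * c0"
 using trig_integral[of c0 c1 c2 0 0 0] by (subst cint_continuous) (auto intro!: continuous_intros integral_unique)

text \<open>The gain of |z|^2 on a circle is a multiple of |b|^2; it will pay for all losses of that
  order when the potential is made locally plurisubharmonic.\<close>

lemma cint_norm_square: "cint (%\<theta>. (norm (a + cis \<theta> *s b))\<^sup>2) = 2 * pi * ((norm a)\<^sup>2 + (norm b)\<^sup>2)"
proof -
 have o: "b \<bullet> cmi b = 0" "cmi b \<bullet> b = 0"
  by (simp_all add: inner_vec_def inner_complex_def)
 have n: "b \<bullet> b = (norm b)\<^sup>2" "cmi b \<bullet> cmi b = (norm b)\<^sup>2" "a \<bullet> a = (norm a)\<^sup>2"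
  using norm_cvec_scalar[of \<i> b] by (simp_all add: power2_norm_eq_inner[symmetric])
 have "(norm (a + cis \<theta> *s b))\<^sup>2 = ((norm a)\<^sup>2 + (norm b)\<^sup>2) + (2 * (a \<bullet> b)) * cos \<theta> + (2 * (a \<bullet> cmi b)) * sin \<theta>" for \<theta>
 proof -
  have "(norm (a + cis \<theta> *s b))\<^sup>2 = (a + (cos \<theta> *\<^sub>R b + sin \<theta> *\<^sub>R cmi b)) \<bullet> (a + (cos \<theta> *\<^sub>R b + sin \<theta> *\<^sub>R cmi b))"
   by (simp only: cis_cscalar power2_norm_eq_inner)
  also have "... = a \<bullet> a + 2 * cos \<theta> * (a \<bullet> b) + 2 * sin \<theta> * (a \<bullet> cmi b) + (cos \<theta>)\<^sup>2 * (b \<bullet> b) + (sin \<theta>)\<^sup>2 * (cmi b \<bullet> cmi b)"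
   unfolding inner_add_left inner_add_right inner_scaleR_left inner_scaleR_right o
   by (simp add: inner_commute power2_eq_square algebra_simps)
  also have "... = (norm a)\<^sup>2 + 2 * cos \<theta> * (a \<bullet> b) + 2 * sin \<theta> * (a \<bullet> cmi b) + ((sin \<theta>)\<^sup>2 + (cos \<theta>)\<^sup>2) * (norm b)\<^sup>2"
   unfolding n by (simp add: algebra_simps del: sin_cos_squared_add sin_cos_squared_add2)
  finally show ?thesis unfolding sin_cos_squared_add by (simp add: mult_ac)
 qed
 then show ?thesis by (simp only: cint_trig)
qed

text \<open>Unlike the expansion for small radii, this holds on every disc contained in
  \<open>S\<close>, as \<open>psh_on\<close> demands. The price is a bound for the second
  derivatives over the whole disc.\<close>

lemma C2_circle_lower:
 fixes f :: "complex^'n => real"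
 assumes S: "open S" and f: "Ck_on 2 S f" and disc: "!!\<zeta>. cmod \<zeta> <= 1 ==> a + \<zeta> *s b \<in> S"
  and B: "!!\<zeta> c. cmod \<zeta> <= 1 ==> cmod c = 1 ==> \<bar>d2 f (a + \<zeta> *s b) (c *s b) (c *s b)\<bar> <= B"
 shows "2 * pi * f a - pi * B <= cint (%\<theta>. f (a + cis \<theta> *s b))"
proof -
 have a: "a \<in> S" using disc[of 0] by simp
 have si: "cintegrable h" if "continuous_on {0..2*pi} h" for h :: "real => real"
  unfolding set_integrable_def by (rule borel_integrable_compact[OF _ that]) simp
 have lin: "linear (fd f a)" by (rule linear_frechet_derivative[OF C2_differentiable[OF S f a]])
 have pt: "(f a - B / 2) + fd f a b * cos \<theta> + fd f a (cmi b) * sin \<theta> <= f (a + cis \<theta> *s b)" for \<theta>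
 proof -
  let ?u = "cis \<theta> *s b"
  have seg: "a + s *\<^sub>R ?u = a + (of_real s * cis \<theta>) *s b" for s by (simp add: scaleR_complex_vec)
  have sm: "cmod (of_real s * cis \<theta>) <= 1" if "0 <= s" "s <= 1" for s using that by (simp add: norm_mult)
  obtain \<xi> where \<xi>: "0 < \<xi>" "\<xi> < 1" "f (a + 1 *\<^sub>R ?u) = f a + 1 * fd f a ?u + 1\<^sup>2 / 2 * d2 f (a + \<xi> *\<^sub>R ?u) ?u ?u"
   by (rule C2_line_Taylor[OF S f, of 1 a ?u]) (use disc[OF sm] seg in auto)
  have "\<bar>d2 f (a + \<xi> *\<^sub>R ?u) ?u ?u\<bar> <= B" unfolding seg by (rule B[OF sm]) (use \<xi> in auto)
  moreover have "fd f a ?u = cos \<theta> * fd f a b + sin \<theta> * fd f a (cmi b)"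
   unfolding cis_cscalar by (simp only: linear_add[OF lin] linear_cmul[OF lin]) simp
  ultimately show ?thesis using \<xi>(3) by (simp add: mult.commute)
 qed
 have cf: "continuous_on {0..2*pi} (%\<theta>. f (a + cis \<theta> *s b))"
  by (rule continuous_on_compose2[OF C2_continuous[OF S f]]) (auto intro!: continuous_intros disc)
 have "2 * pi * (f a - B / 2) = cint (%\<theta>. (f a - B / 2) + fd f a b * cos \<theta> + fd f a (cmi b) * sin \<theta>)" by (simp only: cint_trig)
 also have "... <= cint (%\<theta>. f (a + cis \<theta> *s b))"
  unfolding cint_def by (rule set_integral_mono[OF si si[OF cf]]) (use pt in \<open>auto intro!: continuous_intros\<close>)
 finally show ?thesis by (simp add: right_diff_distrib)
qed

lemma C2_d2_bound:
 fixes f :: "complex^'n => real"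
 assumes S: "open S" and f: "Ck_on 2 S f" and K: "compact K" "K \<subseteq> S"
 obtains B where "B \<ge> 0" "!!z u. z \<in> K ==> \<bar>d2 f z u u\<bar> <= B * (norm u)\<^sup>2"
proof -
 have "bounded ((%(x, v). d2 f x v v) ` (K \<times> sphere 0 1))"
  by (intro compact_imp_bounded compact_continuous_image compact_Times K compact_sphere
    continuous_on_subset[OF C2_d2_continuous_joint[OF S f]]) (use K in auto)
 then obtain B where B: "!!z u. z \<in> K ==> norm u = 1 ==> \<bar>d2 f z u u\<bar> <= B" by (fastforce simp: bounded_iff)
 have "\<bar>d2 f z u u\<bar> <= \<bar>B\<bar> * (norm u)\<^sup>2" if z: "z \<in> K" for z u
 proof -
  have zS: "z \<in> S" using z K by auto
  have h: "d2 f z (c *\<^sub>R x) (c *\<^sub>R x) = c\<^sup>2 * d2 f z x x" for c x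
   using d2_bilinear[OF S f zS, of c x 0 x] by simp
  show ?thesis
  proof (cases "u = 0")
   case True then show ?thesis using h[of 0 u] by simp
  next
   case False
   define x where "x = (1 / norm u) *\<^sub>R u"
   have x: "norm x = 1" "u = norm u *\<^sub>R x" using False by (auto simp: x_def)
   have "\<bar>d2 f z u u\<bar> = (norm u)\<^sup>2 * \<bar>d2 f z x x\<bar>" by (subst (1 2) x(2)) (simp add: h abs_mult)
   also have "... <= (norm u)\<^sup>2 * \<bar>B\<bar>" using B[OF z x(1)] by (intro mult_left_mono) auto
   finally show ?thesis by (simp add: mult.commute)
  qed
 qed
 then show ?thesis using that[of "\<bar>B\<bar>"] by simp
qed

text \<open>The cut-off with its genuine pole. The parameter \<open>t\<close> will be the
  coefficient of the logarithmic singularity.\<close>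

definition cutpole :: "real => real => ereal" where
 "cutpole t b = (if b <= 0 then -\<infinity> else ereal (t * cutlog b))"

lemma cutlog_continuous: "continuous_on {0<..} cutlog"
proof -
 have "continuous_on {0<..} (%b::real. 2 * ln (min b 1) + 1 - (min b 1)\<^sup>2)" by (intro continuous_intros) auto
 then show ?thesis by (rule continuous_on_eq) (auto simp: cutlog_def min_def)
qed

text \<open>Continuity into the extended reals, with the pole included, settles upper semicontinuity
  of the potential and continuity on the quotient at once.\<close>

lemma cutpole_continuous:
 assumes t: "t > 0" shows "continuous_on {0..} (cutpole t)"
proof -
 have "(cutpole t \<longlongrightarrow> cutpole t b) (at b within {0..})" if b: "0 <= b" for b
 proof (cases "b = 0")
  case True
  have "(cutpole t \<longlongrightarrow> -\<infinity>) (at 0 within {0..})"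
  proof (rule tendsto_MInfty[THEN iffD2], intro allI)
   fix r
   have "eventually (%x. ln x < (r / t - 1) / 2) (at_right (0::real))"
    using ln_at_0 unfolding filterlim_at_bot_dense by blast
   then have "eventually (%x. ln x < (r / t - 1) / 2) (at 0 within {0::real..})"
    by (auto simp: eventually_at_filter elim!: eventually_mono)
   moreover have "eventually (%x. x \<in> {0..} \<and> x \<noteq> 0) (at 0 within {0::real..})" by (simp add: eventually_at_filter)
   moreover have "eventually (%x::real. x < 1) (at 0 within {0..})"
    by (rule order_tendstoD(2)[OF tendsto_ident_at]) simp
   ultimately show "eventually (%x. cutpole t x < ereal r) (at 0 within {0..})"
   proof eventually_elim
    case (elim x)
    have "2 * ln x < r / t - 1" using elim(1) by (simp only: less_divide_eq_numeral1 mult.commute)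
    then have "2 * ln x + 1 - x\<^sup>2 < r / t" using zero_le_power2[of x] by linarith
    then have "t * (2 * ln x + 1 - x\<^sup>2) < r" using t by (simp add: pos_less_divide_eq mult.commute)
    then show ?case using elim by (auto simp: cutpole_def cutlog_def)
   qed
  qed
  then show ?thesis using True by (simp add: cutpole_def)
 next
  case False
  then have b0: "b > 0" using b by simp
  have "isCont cutlog b" using cutlog_continuous b0 by (simp add: continuous_on_eq_continuous_at)
  then have "((%x. ereal (t * cutlog x)) \<longlongrightarrow> ereal (t * cutlog b)) (at b within {0..})"
   by (intro tendsto_intros tendsto_within_subset[OF isContD]) auto
  moreover have ev: "eventually (%x. ereal (t * cutlog x) = cutpole t x) (at b within {0..})"
   using order_tendstoD(1)[OF tendsto_ident_at b0, of "{0..}"] by eventually_elim (auto simp: cutpole_def)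
  ultimately have "(cutpole t \<longlongrightarrow> ereal (t * cutlog b)) (at b within {0..})" by (simp only: tendsto_cong[OF ev])
  then show ?thesis using b0 by (simp add: cutpole_def)
 qed
 then show ?thesis by (auto simp: continuous_on)
qed

section \<open>The distance to an orbit\<close>

locale discontinuous_group = bergman_domain \<Omega> for \<Omega> :: "(complex^'n) set" +
 fixes \<Gamma> :: "(complex^'n => complex^'n) set"
 assumes subgroup: "subgroup \<Gamma> (Iso \<Omega>)" and disc: "discontinuous \<Omega> \<Gamma>" and fpf: "fixed_point_free \<Omega> \<Gamma>"
begin

abbreviation "\<pi> \<equiv> covering_proj \<Omega> \<Gamma>"

lemma Iso_one: "\<one>\<^bsub>Iso \<Omega>\<^esub> = (\<lambda>z\<in>\<Omega>. z)" by (simp add: Iso_def BijGroup_def)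

lemma Iso_mult: "f \<in> Bij \<Omega> ==> g \<in> Bij \<Omega> ==> f \<otimes>\<^bsub>Iso \<Omega>\<^esub> g = compose \<Omega> f g"
 by (simp add: Iso_def BijGroup_def)

lemma Iso_carrier: "f \<in> carrier (Iso \<Omega>) \<longleftrightarrow> f \<in> Bij \<Omega> \<and> holo_map \<Omega> f \<and> holo_map \<Omega> (inv_into \<Omega> f)"
 by (simp add: Iso_def)

lemma \<Gamma>_carrier: "\<gamma> \<in> \<Gamma> ==> \<gamma> \<in> carrier (Iso \<Omega>)" using subgroup.subset[OF subgroup] by blast

lemma \<Gamma>_biholo:
 assumes "\<gamma> \<in> \<Gamma>" shows "biholo \<Omega> \<gamma> (inv_into \<Omega> \<gamma>)"
proof -
 have h: "\<gamma> \<in> Bij \<Omega>" "holo_map \<Omega> \<gamma>" "holo_map \<Omega> (inv_into \<Omega> \<gamma>)" using \<Gamma>_carrier[OF assms] by (auto simp: Iso_carrier)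
 then have b: "bij_betw \<gamma> \<Omega> \<Omega>" by (simp add: Bij_def)
 then have i: "inj_on \<gamma> \<Omega>" "\<gamma> ` \<Omega> = \<Omega>" by (auto simp: bij_betw_def)
 show ?thesis
 proof unfold_locales
  fix z assume z: "z \<in> \<Omega>"
  then have zi: "z \<in> \<gamma> ` \<Omega>" using i by simp
  show "\<gamma> z \<in> \<Omega>" using i(2) z by blast
  show "inv_into \<Omega> \<gamma> z \<in> \<Omega>" by (rule inv_into_into[OF zi])
  show "inv_into \<Omega> \<gamma> (\<gamma> z) = z" by (rule inv_into_f_f[OF i(1) z])
  show "\<gamma> (inv_into \<Omega> \<gamma> z) = z" by (rule f_inv_into_f[OF zi])
 qed (use h in auto)
qed

lemma \<Gamma>_in: "\<gamma> \<in> \<Gamma> ==> z \<in> \<Omega> ==> \<gamma> z \<in> \<Omega>" using biholo.gO[OF \<Gamma>_biholo] .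

lemma \<Gamma>_one: "(\<lambda>z\<in>\<Omega>. z) \<in> \<Gamma>" using subgroup.one_closed[OF subgroup] by (simp add: Iso_one)

lemma \<Gamma>_mult: "\<gamma> \<in> \<Gamma> ==> \<delta> \<in> \<Gamma> ==> compose \<Omega> \<gamma> \<delta> \<in> \<Gamma>"
 using subgroup.m_closed[OF subgroup, of \<gamma> \<delta>] \<Gamma>_carrier by (simp add: Iso_mult Iso_carrier)

text \<open>The inverse in \<open>Iso \<Omega>\<close> is a definite description among extensional
  maps; it is identified with the restriction of \<open>inv_into\<close>, because
  \<open>inv_into\<close> itself need not be extensional.\<close>

lemma \<Gamma>_inv:
 assumes \<gamma>: "\<gamma> \<in> \<Gamma>"
 obtains \<delta> where "\<delta> \<in> \<Gamma>" "!!z. z \<in> \<Omega> ==> \<delta> (\<gamma> z) = z" "!!z. z \<in> \<Omega> ==> \<gamma> (\<delta> z) = z"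
proof -
 interpret b: biholo \<Omega> \<gamma> "inv_into \<Omega> \<gamma>" by (rule \<Gamma>_biholo[OF \<gamma>])
 have B: "\<gamma> \<in> Bij \<Omega>" using \<Gamma>_carrier[OF \<gamma>] by (simp add: Iso_carrier)
 define y where "y = (\<lambda>z\<in>\<Omega>. inv_into \<Omega> \<gamma> z)"
 have yB: "y \<in> Bij \<Omega>" unfolding y_def by (rule restrict_inv_into_Bij[OF B])
 have y: "y z = inv_into \<Omega> \<gamma> z" if "z \<in> \<Omega>" for z using that by (simp add: y_def)
 have hy: "holo_map \<Omega> y"
  unfolding holo_map_def
 proof
  fix i
  show "holo_fun \<Omega> (%z. y z $ i)"
   by (rule holo_fun_cong[OF open_dom _ b.h[unfolded holo_map_def, rule_format, of i]]) (simp add: y)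
 qed
 have iy: "inv_into \<Omega> y z = \<gamma> z" if "z \<in> \<Omega>" for z
  by (rule inv_into_f_eq) (use yB that b.gO b.hg in \<open>auto simp: Bij_def bij_betw_def y\<close>)
 have hiy: "holo_map \<Omega> (inv_into \<Omega> y)"
  unfolding holo_map_def
 proof
  fix i
  show "holo_fun \<Omega> (%z. inv_into \<Omega> y z $ i)"
   by (rule holo_fun_cong[OF open_dom _ b.g[unfolded holo_map_def, rule_format, of i]]) (simp add: iy)
 qed
 have yc: "y \<in> carrier (Iso \<Omega>)" using yB hy hiy by (simp add: Iso_carrier)
 have "inv\<^bsub>Iso \<Omega>\<^esub> \<gamma> = y"
  unfolding m_inv_def
 proof (rule the_equality)
  show "y \<in> carrier (Iso \<Omega>) \<and> \<gamma> \<otimes>\<^bsub>Iso \<Omega>\<^esub> y = \<one>\<^bsub>Iso \<Omega>\<^esub> \<and> y \<otimes>\<^bsub>Iso \<Omega>\<^esub> \<gamma> = \<one>\<^bsub>Iso \<Omega>\<^esub>"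
   using yc b.gO b.gh b.hg by (auto simp: Iso_mult B yB Iso_one compose_def restrict_def y fun_eq_iff)
  fix u assume u: "u \<in> carrier (Iso \<Omega>) \<and> \<gamma> \<otimes>\<^bsub>Iso \<Omega>\<^esub> u = \<one>\<^bsub>Iso \<Omega>\<^esub> \<and> u \<otimes>\<^bsub>Iso \<Omega>\<^esub> \<gamma> = \<one>\<^bsub>Iso \<Omega>\<^esub>"
  then have uB: "u \<in> Bij \<Omega>" by (simp add: Iso_carrier)
  have uy: "u z = y z" if z: "z \<in> \<Omega>" for z
  proof -
   have "compose \<Omega> \<gamma> u z = (\<lambda>z\<in>\<Omega>. z) z" using u by (simp add: Iso_mult[OF B uB] Iso_one)
   then have "\<gamma> (u z) = z" using z by (simp add: compose_def)
   moreover have "u z \<in> \<Omega>" using uB z by (auto simp: Bij_def bij_betw_def)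
   ultimately show ?thesis using b.hg[of "u z"] y[OF z] by simp
  qed
  show "u = y" by (rule extensionalityI[of _ \<Omega>]) (use uB yB uy in \<open>auto simp: Bij_def\<close>)
 qed
 then have "y \<in> \<Gamma>" using subgroup.m_inv_closed[OF subgroup \<gamma>] by simp
 then show ?thesis by (rule that) (use y b.hg b.gh b.gO in auto)
qed

lemma \<pi>_set: "\<pi> z = {\<gamma> z | \<gamma>. \<gamma> \<in> \<Gamma>}" by (simp add: covering_proj_def orbit_def)

lemma \<pi>_I: "\<gamma> \<in> \<Gamma> ==> \<gamma> z \<in> \<pi> z"
 unfolding \<pi>_set by (intro CollectI exI[of _ \<gamma>] conjI refl)

lemma \<pi>_E:
 assumes "y \<in> \<pi> z" obtains \<gamma> where "\<gamma> \<in> \<Gamma>" "y = \<gamma> z"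
 using assms unfolding \<pi>_set by (elim CollectE exE conjE)

lemma \<pi>_self: "z \<in> \<Omega> ==> z \<in> \<pi> z"
 using \<pi>_I[OF \<Gamma>_one, of z] by simp

lemma \<pi>_sub:
 assumes z: "z \<in> \<Omega>" shows "\<pi> z \<subseteq> \<Omega>"
proof
 fix y assume "y \<in> \<pi> z"
 then show "y \<in> \<Omega>" by (rule \<pi>_E) (simp add: \<Gamma>_in z)
qed

lemma \<pi>_image:
 assumes z: "z \<in> \<Omega>" and \<gamma>: "\<gamma> \<in> \<Gamma>" and y: "y \<in> \<pi> z" shows "\<gamma> y \<in> \<pi> z"
proof -
 obtain \<delta> where \<delta>: "\<delta> \<in> \<Gamma>" "y = \<delta> z" using y by (rule \<pi>_E)
 then have "\<gamma> y = compose \<Omega> \<gamma> \<delta> z" using z by (simp add: compose_def)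
 then show ?thesis using \<pi>_I[OF \<Gamma>_mult[OF \<gamma> \<delta>(1)]] by simp
qed

lemma \<pi>_cong:
 assumes z: "z \<in> \<Omega>" and y: "y \<in> \<pi> z" shows "\<pi> y = \<pi> z"
proof -
 obtain \<gamma> where \<gamma>: "\<gamma> \<in> \<Gamma>" "y = \<gamma> z" using y by (rule \<pi>_E)
 obtain \<delta> where \<delta>: "\<delta> \<in> \<Gamma>" "!!z. z \<in> \<Omega> ==> \<delta> (\<gamma> z) = z" using \<Gamma>_inv[OF \<gamma>(1)] by metis
 have yO: "y \<in> \<Omega>" using y \<pi>_sub[OF z] by blast
 have zy: "z \<in> \<pi> y" using \<pi>_I[OF \<delta>(1), of y] \<delta>(2)[OF z] \<gamma>(2) by simp
 show ?thesis
 proof (intro equalityI subsetI)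
  fix u assume "u \<in> \<pi> y"
  then show "u \<in> \<pi> z" by (rule \<pi>_E) (simp add: \<pi>_image[OF z _ y])
 next
  fix u assume "u \<in> \<pi> z"
  then show "u \<in> \<pi> y" by (rule \<pi>_E) (simp add: \<pi>_image[OF yO _ zy])
 qed
qed

lemma orbit_discrete: "z \<in> \<Omega> ==> b \<in> \<Omega> ==> \<not> b islimpt \<pi> z"
 using disc unfolding discontinuous_def \<pi>_set by blast

lemma quotient_space_eq: "quotient_space \<Omega> \<Gamma> = \<pi> ` \<Omega>"
 by (auto simp: quotient_space_def orbits_def covering_proj_def)

lemma bd_\<Gamma>: "\<gamma> \<in> \<Gamma> ==> x \<in> \<Omega> ==> y \<in> \<Omega> ==> bd (\<gamma> x) (\<gamma> y) = bd x y"
 using biholo.bd_invariant[OF \<Gamma>_biholo] connected_dom by blast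

lemma \<Gamma>_fixed: "\<gamma> \<in> \<Gamma> ==> z \<in> \<Omega> ==> \<gamma> z = z ==> \<gamma> = \<one>\<^bsub>Iso \<Omega>\<^esub>"
 using fpf unfolding fixed_point_free_def by blast

lemma half_displacement_le:
 assumes "x \<in> \<Omega>" "\<gamma> \<in> \<Gamma>" "\<gamma> \<noteq> \<one>\<^bsub>Iso \<Omega>\<^esub>"
 shows "2 * half_displacement \<Omega> \<Gamma> x <= bd x (\<gamma> x)"
proof -
 have "(INF \<gamma>\<in>\<Gamma> - {\<one>\<^bsub>Iso \<Omega>\<^esub>}. bd x (\<gamma> x)) <= bd x (\<gamma> x)"
 proof (rule cINF_lower)
  show "bdd_below ((%\<gamma>. bd x (\<gamma> x)) ` (\<Gamma> - {\<one>\<^bsub>Iso \<Omega>\<^esub>}))"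
   unfolding bdd_below_def
  proof (intro exI ballI)
   fix r assume "r \<in> (%\<gamma>. bd x (\<gamma> x)) ` (\<Gamma> - {\<one>\<^bsub>Iso \<Omega>\<^esub>})"
   then show "0 <= r" by (rule imageE) (simp add: bd_nonneg \<Gamma>_in assms(1))
  qed
  show "\<gamma> \<in> \<Gamma> - {\<one>\<^bsub>Iso \<Omega>\<^esub>}" using assms by simp
 qed
 then show ?thesis by (simp add: half_displacement_def)
qed

text \<open>Discreteness keeps the other orbit points at a Euclidean distance from \<open>x\<close>,
  which the local lower bound turns into a uniform gap for the Bergman distance. Freeness ensures
  that every element other than the identity moves \<open>x\<close>.\<close>

lemma half_displacement_pos:
 assumes x: "x \<in> \<Omega>" and ne: "\<Gamma> - {\<one>\<^bsub>Iso \<Omega>\<^esub>} \<noteq> {}"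
 shows "0 < half_displacement \<Omega> \<Gamma> x"
proof -
 obtain e where "e > 0" and e': "!!y. y \<in> \<pi> x ==> \<not> (y \<noteq> x \<and> dist y x < e)"
  using orbit_discrete[OF x x] unfolding islimpt_approachable by blast
 have e: "e <= dist (\<gamma> x) x" if "\<gamma> \<in> \<Gamma>" "\<gamma> x \<noteq> x" for \<gamma>
  using e'[OF \<pi>_I[OF that(1)]] that(2) by simp
 obtain c r where cr: "c > 0" "r > 0" "!!y. y \<in> \<Omega> ==> c * min r (norm (y - x)) <= bd x y" using bd_local_lower[OF x] by metis
 note e0 = \<open>e > 0\<close>
 have "c * min r e <= (INF \<gamma>\<in>\<Gamma> - {\<one>\<^bsub>Iso \<Omega>\<^esub>}. bd x (\<gamma> x))"
 proof (rule cINF_greatest[OF ne])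
  fix \<gamma> assume "\<gamma> \<in> \<Gamma> - {\<one>\<^bsub>Iso \<Omega>\<^esub>}"
  then have \<gamma>: "\<gamma> \<in> \<Gamma>" "\<gamma> \<noteq> \<one>\<^bsub>Iso \<Omega>\<^esub>" by simp_all
  have "\<gamma> x \<noteq> x" using \<Gamma>_fixed[OF \<gamma>(1) x] \<gamma>(2) by (rule contrapos_nn[rotated])
  then have "e <= norm (\<gamma> x - x)" using e[OF \<gamma>(1)] by (simp add: dist_norm)
  then have "c * min r e <= c * min r (norm (\<gamma> x - x))" using cr by (intro mult_left_mono) auto
  also have "... <= bd x (\<gamma> x)" by (rule cr(3)[OF \<Gamma>_in[OF \<gamma>(1) x]])
  finally show "c * min r e <= bd x (\<gamma> x)" .
 qed
 moreover have "0 < c * min r e" using cr e0 by simp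
 ultimately show ?thesis by (simp add: half_displacement_def)
qed

text \<open>For the trivial group \<open>the_elem\<close> is a continuous inverse of the projection,
  so the domain would be compact as well as open, hence the whole space, although it is
  bounded.\<close>

lemma group_nontrivial:
 assumes comp: "compact_space (quot_topology \<Omega> \<Gamma>)" and ne: "\<Omega> \<noteq> {}"
 shows "\<Gamma> - {\<one>\<^bsub>Iso \<Omega>\<^esub>} \<noteq> {}"
proof
 assume "\<Gamma> - {\<one>\<^bsub>Iso \<Omega>\<^esub>} = {}"
 then have s: "\<pi> z = {z}" if "z \<in> \<Omega>" for z
 proof (intro equalityI subsetI)
  fix y assume "y \<in> \<pi> z"
  then obtain \<gamma> where "\<gamma> \<in> \<Gamma>" "y = \<gamma> z" by (rule \<pi>_E)
  then show "y \<in> {z}" using \<open>\<Gamma> - {\<one>\<^bsub>Iso \<Omega>\<^esub>} = {}\<close> that by (auto simp: Iso_one)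
 qed (use \<pi>_self[OF that] in simp)
 have "continuous_map (top_of_set \<Omega>) euclidean (the_elem \<circ> \<pi>)"
  by (rule continuous_map_eq[of _ _ id]) (use s in auto)
 then have c: "continuous_map (quot_topology \<Omega> \<Gamma>) euclidean the_elem"
  by (rule continuous_compose_quotient_map[OF quotient_map_covering_proj])
 have "topspace (quot_topology \<Omega> \<Gamma>) = \<pi> ` \<Omega>"
  using quotient_imp_surjective_map[OF quotient_map_covering_proj[of \<Omega> \<Gamma>]] by simp
 then have "compactin euclidean (the_elem ` \<pi> ` \<Omega>)"
  using image_compactin[OF _ c] comp unfolding compact_space_def by metis
 moreover have "the_elem ` \<pi> ` \<Omega> = \<Omega>" using s by force
 ultimately have "compact \<Omega>" by simp
 then have "\<Omega> = UNIV" using open_dom ne clopen[of \<Omega>] compact_imp_closed by blast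
 then show False using bounded_dom not_bounded_UNIV by metis
qed

text \<open>Stated for any \<open>f\<close> satisfying the triangle inequality, so that it covers
  both the distance to a point and the distance to an orbit.\<close>

lemma locally_Lipschitz:
 assumes f: "!!a b. a \<in> \<Omega> ==> b \<in> \<Omega> ==> f b <= f a + bd a b" and z: "z \<in> \<Omega>"
 obtains M r where "M > 0" "r > 0" "cball z r \<subseteq> \<Omega>" "!!u w. u \<in> cball z r ==> w \<in> cball z r ==> \<bar>f u - f w\<bar> <= M * norm (u - w)"
proof -
 obtain r where r: "r > 0" "cball z r \<subseteq> \<Omega>" using open_dom z open_contains_cball by blast
 obtain M where M: "M > 0" "!!z' w. closed_segment z' (z' + w) \<subseteq> cball z r ==> bd z' (z' + w) <= M * norm w"
  using bd_local_upper[OF compact_cball r(2)] by metis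
 have "f u - f w <= M * norm (u - w)" if "u \<in> cball z r" "w \<in> cball z r" for u w
 proof -
  have "closed_segment w (w + (u - w)) \<subseteq> cball z r" using that by (simp add: closed_segment_subset)
  then have "bd w u <= M * norm (u - w)" using M(2)[of w "u - w"] by simp
  moreover have "f u <= f w + bd w u" by (rule f) (use that r in auto)
  ultimately show ?thesis by simp
 qed
 then have "\<bar>f u - f w\<bar> <= M * norm (u - w)" if "u \<in> cball z r" "w \<in> cball z r" for u w
  using that norm_minus_commute[of u w] by (metis abs_le_iff minus_diff_eq)
 then show ?thesis using that[OF M(1) r] by blast
qed

lemma Lipschitz_continuous:
 assumes f: "!!a b. a \<in> \<Omega> ==> b \<in> \<Omega> ==> f b <= f a + bd a b"
 shows "continuous_on \<Omega> f"
proof (rule continuous_at_imp_continuous_on, rule ballI)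
 fix z assume z: "z \<in> \<Omega>"
 obtain M r where M: "M > 0" "r > 0" "cball z r \<subseteq> \<Omega>" "!!u w. u \<in> cball z r ==> w \<in> cball z r ==> \<bar>f u - f w\<bar> <= M * norm (u - w)"
  using locally_Lipschitz[OF f z] by blast
 have "((%u. f u - f z) \<longlongrightarrow> 0) (at z)"
 proof (rule Lim_null_comparison)
  have "eventually (%u. u \<in> ball z r) (at z)" using eventually_at_ball[OF M(2), of z UNIV] by simp
  then show "eventually (%u. norm (f u - f z) <= M * norm (u - z)) (at z)"
   by eventually_elim (use M in auto)
  have "((%u. M * norm (u - z)) \<longlongrightarrow> M * norm (z - z)) (at z)" by (intro tendsto_intros)
  then show "((%u. M * norm (u - z)) \<longlongrightarrow> 0) (at z)" by simp
 qed
 then show "isCont f z" unfolding isCont_def by (rule LIM_zero_cancel)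
qed

lemma bd_continuous: "y \<in> \<Omega> ==> continuous_on \<Omega> (bd y)"
 by (rule Lipschitz_continuous) (rule bd_triangle)

text \<open>A group element moves one of the two points to \<open>x\<close>; the other is then the
  image of \<open>x\<close> under an element different from the identity.\<close>

lemma orbit_separated:
 assumes x: "x \<in> \<Omega>" and y: "y \<in> \<pi> x" "y' \<in> \<pi> x" "y \<noteq> y'"
 shows "2 * half_displacement \<Omega> \<Gamma> x <= bd y y'"
proof -
 obtain \<gamma> \<gamma>' where \<gamma>: "\<gamma> \<in> \<Gamma>" "y = \<gamma> x" "\<gamma>' \<in> \<Gamma>" "y' = \<gamma>' x" using y by (elim \<pi>_E)
 obtain \<delta> where \<delta>: "\<delta> \<in> \<Gamma>" "!!z. z \<in> \<Omega> ==> \<delta> (\<gamma> z) = z" "!!z. z \<in> \<Omega> ==> \<gamma> (\<delta> z) = z" using \<Gamma>_inv[OF \<gamma>(1)] by metis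
 let ?c = "compose \<Omega> \<delta> \<gamma>'"
 have cx: "?c x = \<delta> y'" using x \<gamma> by (simp add: compose_def)
 have yO: "y \<in> \<Omega>" "y' \<in> \<Omega>" using y \<pi>_sub[OF x] by auto
 have "?c \<noteq> \<one>\<^bsub>Iso \<Omega>\<^esub>"
 proof
  assume "?c = \<one>\<^bsub>Iso \<Omega>\<^esub>"
  then have "\<delta> y' = x" using cx x by (simp add: Iso_one)
  then have "y' = y" using \<delta>(3)[OF yO(2)] \<gamma> by simp
  then show False using y by simp
 qed
 then have "2 * half_displacement \<Omega> \<Gamma> x <= bd x (?c x)"
  by (rule half_displacement_le[OF x \<Gamma>_mult[OF \<delta>(1) \<gamma>(3)]])
 also have "... = bd (\<delta> y) (\<delta> y')" using \<delta>(2)[OF x] \<gamma>(2) cx by simp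
 also have "... = bd y y'" by (rule bd_\<Gamma>[OF \<delta>(1) yO])
 finally show ?thesis .
qed

end

section \<open>The distance to the orbit of a fixed point\<close>

locale orbit_potential = discontinuous_group \<Omega> \<Gamma> for \<Omega> :: "(complex^'n) set" and \<Gamma> +
 fixes x :: "complex^'n"
 assumes x: "x \<in> \<Omega>" and hd_pos: "0 < half_displacement \<Omega> \<Gamma> x"
  and log_psh: "!!y. y \<in> \<Omega> ==> psh_on \<Omega> (%z. log0 (bergman_dist \<Omega> y z))"
begin

abbreviation "\<rho> \<equiv> half_displacement \<Omega> \<Gamma> x"

text \<open>Taking the whole orbit instead of the point \<open>x\<close> makes the function
  invariant under the group, so that it descends to the quotient.\<close>

definition dd :: "complex^'n => real" where "dd z = (INF y\<in>\<pi> x. bd y z)"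

lemma orbit_in: "y \<in> \<pi> x ==> y \<in> \<Omega>" using \<pi>_sub[OF x] by blast

lemma orbit_ne: "\<pi> x \<noteq> {}" using \<pi>_self[OF x] by blast

lemma dd_bdd: "z \<in> \<Omega> ==> bdd_below ((%y. bd y z) ` \<pi> x)"
 by (auto intro!: bdd_belowI[of _ 0] bd_nonneg orbit_in)

lemma dd_le: "z \<in> \<Omega> ==> y \<in> \<pi> x ==> dd z <= bd y z"
 unfolding dd_def by (rule cINF_lower[OF dd_bdd])

lemma dd_ge: "(!!y. y \<in> \<pi> x ==> c <= bd y z) ==> c <= dd z"
 unfolding dd_def by (rule cINF_greatest[OF orbit_ne])

lemma dd_nonneg: "z \<in> \<Omega> ==> 0 <= dd z"
 by (rule dd_ge) (rule bd_nonneg[OF orbit_in])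

lemma dd_less: "z \<in> \<Omega> ==> dd z < c ==> \<exists>y\<in>\<pi> x. bd y z < c"
 unfolding dd_def by (simp add: cINF_less_iff[OF orbit_ne dd_bdd])

lemma dd_triangle:
 assumes "a \<in> \<Omega>" "b \<in> \<Omega>" shows "dd b <= dd a + bd a b"
proof -
 have "dd b - bd a b <= dd a"
 proof (rule dd_ge)
  fix y assume y: "y \<in> \<pi> x"
  show "dd b - bd a b <= bd y a" using dd_le[OF assms(2) y] bd_triangle[OF orbit_in[OF y] assms] by linarith
 qed
 then show ?thesis by simp
qed

lemma dd_continuous: "continuous_on \<Omega> dd" by (rule Lipschitz_continuous[OF dd_triangle])

text \<open>Orbit points are at least twice \<rho> apart, so a point closer than \<rho> to one of
  them is farther than \<rho> from all others.\<close>

lemma dd_near: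
 assumes z: "z \<in> \<Omega>" and y: "y \<in> \<pi> x" and less: "bd y z < \<rho>"
 shows "dd z = bd y z"
proof (rule antisym[OF dd_le[OF z y] dd_ge])
 fix y' assume y': "y' \<in> \<pi> x"
 show "bd y z <= bd y' z"
 proof (cases "y' = y")
  case False
  have "2 * \<rho> <= bd y y'" by (rule orbit_separated[OF x y y']) (use False in auto)
  also have "... <= bd y z + bd z y'" by (rule bd_triangle[OF orbit_in[OF y] z orbit_in[OF y']])
  also have "bd z y' = bd y' z" by (rule bd_sym[OF z orbit_in[OF y']])
  finally show ?thesis using less by linarith
 qed simp
qed

lemma dd_eq_0: "z \<in> \<Omega> ==> dd z = 0 \<longleftrightarrow> z \<in> \<pi> x"
proof
 assume z: "z \<in> \<Omega>" "dd z = 0"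
 then obtain y where y: "y \<in> \<pi> x" "bd y z < \<rho>" using dd_less[OF z(1)] hd_pos by auto
 then have "bd y z = 0" using dd_near[OF z(1)] z(2) by simp
 then show "z \<in> \<pi> x" using bd_pos[OF orbit_in[OF y(1)] z(1)] y(1) by force
next
 assume z: "z \<in> \<Omega>" "z \<in> \<pi> x"
 then show "dd z = 0" using dd_le[OF z] dd_nonneg[OF z(1)] bd_self[OF z(1)] by simp
qed

lemma dd_pos: "z \<in> \<Omega> ==> z \<notin> \<pi> x ==> 0 < dd z"
 using dd_eq_0 dd_nonneg by (simp add: less_le)

lemma dd_invariant:
 assumes \<gamma>: "\<gamma> \<in> \<Gamma>" and z: "z \<in> \<Omega>" shows "dd (\<gamma> z) = dd z"
proof -
 have le: "dd z <= dd (\<gamma> z)" if \<gamma>: "\<gamma> \<in> \<Gamma>" and z: "z \<in> \<Omega>" for \<gamma> z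
 proof (rule dd_ge)
  fix y assume y: "y \<in> \<pi> x"
  obtain \<delta> where \<delta>: "\<delta> \<in> \<Gamma>" "!!z. z \<in> \<Omega> ==> \<delta> (\<gamma> z) = z" using \<Gamma>_inv[OF \<gamma>] by metis
  have "dd z <= bd (\<delta> y) z" by (rule dd_le[OF z \<pi>_image[OF x \<delta>(1) y]])
  also have "... = bd (\<delta> y) (\<delta> (\<gamma> z))" using \<delta>(2)[OF z] by simp
  also have "... = bd y (\<gamma> z)" by (rule bd_\<Gamma>[OF \<delta>(1) orbit_in[OF y] \<Gamma>_in[OF \<gamma> z]])
  finally show "dd z <= bd y (\<gamma> z)" .
 qed
 obtain \<delta> where \<delta>: "\<delta> \<in> \<Gamma>" "!!z. z \<in> \<Omega> ==> \<delta> (\<gamma> z) = z" using \<Gamma>_inv[OF \<gamma>] by metis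
 have "dd (\<gamma> z) <= dd (\<delta> (\<gamma> z))" by (rule le[OF \<delta>(1) \<Gamma>_in[OF \<gamma> z]])
 then show ?thesis using le[OF \<gamma> z] \<delta>(2)[OF z] by simp
qed

lemma lapl_logK: "z \<in> \<Omega> ==> lapl logK v z = 2 * E z v"
 by (simp add: lapl_def bergman_riemannian_d2)

lemma dd_segment:
 assumes "closed_segment z (z + w) \<subseteq> \<Omega>" "0 <= M" "!!y. y \<in> closed_segment z (z + w) ==> lapl logK w y <= 2 * M\<^sup>2"
 shows "\<bar>dd (z + w) - dd z\<bar> <= M"
proof -
 have O: "z \<in> \<Omega>" "z + w \<in> \<Omega>" using assms(1) by auto
 have "bd z (z + w) <= M"
 proof (rule bd_segment[OF assms(1) _ assms(2)])
  fix y assume y: "y \<in> closed_segment z (z + w)"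
  then have "y \<in> \<Omega>" using assms(1) by blast
  then show "E y w <= M\<^sup>2" using assms(3)[OF y] by (simp add: lapl_logK)
 qed
 then show ?thesis using dd_triangle[OF O] dd_triangle[OF O(2,1)] bd_sym[OF O] by linarith
qed

lemma orbit_countable: "countable {z \<in> \<Omega>. dd z = 0}"
proof -
 have "\<pi> x sparse_in \<Omega>"
  unfolding sparse_in_def using orbit_discrete[OF x] open_dom by blast
 then have "countable (\<Omega> \<inter> \<pi> x)" by (rule sparse_imp_countable[OF open_dom])
 moreover have "{z \<in> \<Omega>. dd z = 0} = \<Omega> \<inter> \<pi> x" using dd_eq_0 by blast
 ultimately show ?thesis by simp
qed

text \<open>Where \<open>dd\<close> is below \<rho> it is the distance to one orbit point, but that
  point might change along the disc. The disc is connected and the balls \<open>U y\<close> are open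
  and pairwise disjoint, so a single orbit point serves, and plurisubharmonicity of its log-distance
  applies.\<close>

lemma log_dd_circle_mean:
 assumes a: "0 < dd a" and disk: "!!\<zeta>. cmod \<zeta> <= 1 ==> a + \<zeta> *s b \<in> \<Omega> \<and> dd (a + \<zeta> *s b) < \<rho>"
 shows "cintegrable (%\<theta>. ln (dd (a + cis \<theta> *s b))) \<and>
    2 * pi * ln (dd a) <= cint (%\<theta>. ln (dd (a + cis \<theta> *s b))) \<and>
    (AE \<theta> in lborel. \<theta> \<in> {0..2*pi} \<longrightarrow> 0 < dd (a + cis \<theta> *s b))"
proof -
 define T where "T = (%\<zeta>. a + \<zeta> *s b) ` cball 0 1"
 have T: "z \<in> \<Omega>" "dd z < \<rho>" if "z \<in> T" for z using disk that by (auto simp: T_def)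
 have "connected T"
  unfolding T_def by (intro connected_continuous_image convex_connected convex_cball continuous_intros)
 have aT: "a \<in> T" unfolding T_def by (rule image_eqI[of _ _ 0]) auto
 define U where "U y = {z \<in> \<Omega>. bd y z < \<rho>}" for y
 have oU: "open (U y)" if "y \<in> \<pi> x" for y
  unfolding U_def using open_Collect_less_Int[OF bd_continuous[OF orbit_in[OF that]] continuous_on_const[of _ \<rho>]] open_dom
  by (metis open_Int)
 obtain y0 where y0: "y0 \<in> \<pi> x" "bd y0 a < \<rho>" using dd_less[OF T[OF aT]] by blast
 have disj: "y = y0" if "y \<in> \<pi> x" "z \<in> U y" "z \<in> U y0" for y z
 proof (rule ccontr)
  assume ne: "y \<noteq> y0"
  have z: "z \<in> \<Omega>" "bd y z < \<rho>" "bd y0 z < \<rho>" using that by (auto simp: U_def)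
  have "2 * \<rho> <= bd y y0" by (rule orbit_separated[OF x that(1) y0(1) ne])
  also have "... <= bd y z + bd z y0" by (rule bd_triangle[OF orbit_in[OF that(1)] z(1) orbit_in[OF y0(1)]])
  finally show False using z bd_sym[OF z(1) orbit_in[OF y0(1)]] by linarith
 qed
 have "U y0 \<inter> T = {} \<or> (\<Union>y\<in>\<pi> x - {y0}. U y) \<inter> T = {}"
 proof (rule connectedD[OF \<open>connected T\<close>])
  show "open (U y0)" by (rule oU[OF y0(1)])
  show "open (\<Union>y\<in>\<pi> x - {y0}. U y)" using oU by blast
  show "U y0 \<inter> (\<Union>y\<in>\<pi> x - {y0}. U y) \<inter> T = {}" using disj by blast
  show "T \<subseteq> U y0 \<union> (\<Union>y\<in>\<pi> x - {y0}. U y)"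
  proof
   fix z assume z: "z \<in> T"
   then obtain y where "y \<in> \<pi> x" "z \<in> U y" using dd_less[OF T[OF z]] T(1)[OF z] by (auto simp: U_def)
   then show "z \<in> U y0 \<union> (\<Union>y\<in>\<pi> x - {y0}. U y)" by (cases "y = y0") auto
  qed
 qed
 moreover have "a \<in> U y0 \<inter> T" using y0 T(1)[OF aT] aT by (simp add: U_def)
 ultimately have none: "(\<Union>y\<in>\<pi> x - {y0}. U y) \<inter> T = {}" by blast
 have dT: "bd y0 z < \<rho> \<and> dd z = bd y0 z" if z: "z \<in> T" for z
 proof -
  obtain y where y: "y \<in> \<pi> x" "bd y z < \<rho>" using dd_less[OF T[OF z]] by blast
  then have "y = y0" using none z T(1)[OF z] by (auto simp: U_def)
  then show ?thesis using y dd_near[OF T(1)[OF z] y] by simp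
 qed
 have circ: "a + cis \<theta> *s b \<in> T" for \<theta> unfolding T_def by (rule imageI) simp
 have y0O: "y0 \<in> \<Omega>" by (rule orbit_in[OF y0(1)])
 let ?g = "%\<theta>. bd y0 (a + cis \<theta> *s b)"
 have "log0 (bd y0 a) <= circle_mean (%\<theta>. log0 (?g \<theta>))"
  using log_psh[OF y0O] T(1)[OF aT] disk unfolding psh_on_def by blast
 moreover have "continuous_on UNIV ?g"
  by (rule continuous_on_compose2[OF bd_continuous[OF y0O]]) (use circ T in \<open>auto intro!: continuous_intros\<close>)
 moreover have "0 <= ?g \<theta>" "?g \<theta> <= \<rho>" for \<theta> using dT[OF circ[of \<theta>]] bd_nonneg[OF y0O T(1)[OF circ]] by auto
 moreover have "0 < bd y0 a" using a dT[OF aT] by simp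
 ultimately have "cintegrable (%\<theta>. ln (?g \<theta>))" "2 * pi * ln (bd y0 a) <= cint (%\<theta>. ln (?g \<theta>))"
  "AE \<theta> in lborel. \<theta> \<in> {0..2*pi} \<longrightarrow> 0 < ?g \<theta>"
  using log_circle_mean[of ?g \<rho> "bd y0 a"] by blast+
 then show ?thesis using dT[OF aT] dT[OF circ] by simp
qed

lemma cut_potential_dd: "0 < R ==> R < \<rho> ==> cut_potential \<Omega> logK dd R \<rho>"
 by unfold_locales
   (use open_dom logK_C2 dd_continuous dd_nonneg orbit_countable dd_segment log_dd_circle_mean lapl_logK E_nonneg in auto)

end

section \<open>The Seshadri number\<close>

lemma continuous_on_add_ereal_real:
 fixes f :: "'a::topological_space => ereal"
 assumes "continuous_on S f" "continuous_on S g"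
 shows "continuous_on S (%z. f z + ereal (g z))"
 using assms unfolding continuous_on by (auto intro!: tendsto_add_ereal_general1 tendsto_intros)

context discontinuous_group
begin

lemma complex_jacobian_compose:
 assumes \<gamma>: "\<gamma> \<in> \<Gamma>" and \<delta>: "\<delta> \<in> \<Gamma>" and z: "z \<in> \<Omega>"
 shows "complex_jacobian (compose \<Omega> \<delta> \<gamma>) z = complex_jacobian \<delta> (\<gamma> z) * complex_jacobian \<gamma> z"
proof -
 have h: "holo_map \<Omega> f" if "f \<in> \<Gamma>" for f using \<Gamma>_carrier[OF that] by (simp add: Iso_carrier)
 have gz: "\<gamma> z \<in> \<Omega>" by (rule \<Gamma>_in[OF \<gamma> z])
 let ?c = "compose \<Omega> \<delta> \<gamma>"
 have c: "holo_map \<Omega> ?c" by (rule h[OF \<Gamma>_mult[OF \<delta> \<gamma>]])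
 have "((%x. \<delta> (\<gamma> x)) has_derivative (%v. cjac \<delta> (\<gamma> z) *v (cjac \<gamma> z *v v))) (at z)"
  by (rule has_derivative_compose[OF holo_map_has_derivative[OF h[OF \<gamma>] z] holo_map_has_derivative[OF h[OF \<delta>] gz]])
 then have "(?c has_derivative (%v. cjac \<delta> (\<gamma> z) *v (cjac \<gamma> z *v v))) (at z)"
  by (rule has_derivative_transform_within_open[OF _ open_dom z]) (simp add: compose_def)
 from has_derivative_unique[OF holo_map_has_derivative[OF c z] this]
 have "cjac ?c z = cjac \<delta> (\<gamma> z) ** cjac \<gamma> z"
  by (subst matrix_eq) (simp add: matrix_vector_mul_assoc fun_eq_iff)
 then show ?thesis
  by (simp add: complex_jacobian_eq[OF c z] complex_jacobian_eq[OF h[OF \<gamma>] z] complex_jacobian_eq[OF h[OF \<delta>] gz] det_mul)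
qed

lemma complex_jacobian_one: "z \<in> \<Omega> ==> complex_jacobian (\<lambda>z\<in>\<Omega>. z) z = 1"
proof -
 assume z: "z \<in> \<Omega>"
 have "((\<lambda>z\<in>\<Omega>. z) has_derivative (%v. v)) (at z)"
  by (rule has_derivative_transform_within_open[OF has_derivative_ident open_dom z]) simp
 from has_derivative_fd[OF this] have "(\<chi> i j. fd (\<lambda>z\<in>\<Omega>. z) z (axis j 1) $ i) = (mat 1 :: complex^'n^'n)"
  by (auto simp: vec_eq_iff mat_def axis_def)
 then show ?thesis by (simp add: complex_jacobian_def)
qed

text \<open>Reindexing the orbit by composition with \<gamma>; the cocycle rule for Jacobians
  matches the second components.\<close>

lemma canonical_pt_\<Gamma>:
 assumes \<gamma>: "\<gamma> \<in> \<Gamma>" and z: "z \<in> \<Omega>"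
 shows "canonical_pt \<Gamma> (\<gamma> z) 1 = canonical_pt \<Gamma> z (complex_jacobian \<gamma> z)" and "complex_jacobian \<gamma> z \<noteq> 0"
proof -
 obtain \<gamma>' where \<gamma>': "\<gamma>' \<in> \<Gamma>" "!!z. z \<in> \<Omega> ==> \<gamma>' (\<gamma> z) = z" using \<Gamma>_inv[OF \<gamma>] by metis
 have gz: "\<gamma> z \<in> \<Omega>" by (rule \<Gamma>_in[OF \<gamma> z])
 have "compose \<Omega> \<gamma>' \<gamma> = (\<lambda>z\<in>\<Omega>. z)" using \<gamma>'(2) by (auto simp: compose_def restrict_def fun_eq_iff)
 then have J: "complex_jacobian \<gamma>' (\<gamma> z) * complex_jacobian \<gamma> z = 1"
  using complex_jacobian_compose[OF \<gamma> \<gamma>'(1) z] complex_jacobian_one[OF z] by simp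
 then show nz: "complex_jacobian \<gamma> z \<noteq> 0" by auto
 have nz': "complex_jacobian \<gamma>' (\<gamma> z) \<noteq> 0" using J by auto
 show "canonical_pt \<Gamma> (\<gamma> z) 1 = canonical_pt \<Gamma> z (complex_jacobian \<gamma> z)"
 proof (intro equalityI subsetI)
  fix p assume "p \<in> canonical_pt \<Gamma> (\<gamma> z) 1"
  then obtain \<delta> where \<delta>: "\<delta> \<in> \<Gamma>" "p = (\<delta> (\<gamma> z), 1 / complex_jacobian \<delta> (\<gamma> z))"
   unfolding canonical_pt_def by (elim CollectE exE conjE)
  let ?c = "compose \<Omega> \<delta> \<gamma>"
  have "p = (?c z, complex_jacobian \<gamma> z / complex_jacobian ?c z)"
   using \<delta>(2) z nz complex_jacobian_compose[OF \<gamma> \<delta>(1) z] by (simp add: compose_def)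
  then show "p \<in> canonical_pt \<Gamma> z (complex_jacobian \<gamma> z)"
   unfolding canonical_pt_def using \<Gamma>_mult[OF \<delta>(1) \<gamma>] by (intro CollectI exI[of _ ?c] conjI)
 next
  fix p assume "p \<in> canonical_pt \<Gamma> z (complex_jacobian \<gamma> z)"
  then obtain \<delta> where \<delta>: "\<delta> \<in> \<Gamma>" "p = (\<delta> z, complex_jacobian \<gamma> z / complex_jacobian \<delta> z)"
   unfolding canonical_pt_def by (elim CollectE exE conjE)
  let ?c = "compose \<Omega> \<delta> \<gamma>'"
  have cj: "complex_jacobian ?c (\<gamma> z) = complex_jacobian \<delta> z * complex_jacobian \<gamma>' (\<gamma> z)"
   using complex_jacobian_compose[OF \<gamma>'(1) \<delta>(1) gz] \<gamma>'(2)[OF z] by simp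
  have "complex_jacobian \<gamma> z = 1 / complex_jacobian \<gamma>' (\<gamma> z)" using J nz' by (simp add: field_simps)
  then have "complex_jacobian \<gamma> z / complex_jacobian \<delta> z = 1 / complex_jacobian ?c (\<gamma> z)"
   unfolding cj by simp
  then have "p = (?c (\<gamma> z), 1 / complex_jacobian ?c (\<gamma> z))" using \<delta>(2) gz \<gamma>'(2)[OF z] by (simp add: compose_def)
  then show "p \<in> canonical_pt \<Gamma> (\<gamma> z) 1"
   unfolding canonical_pt_def using \<Gamma>_mult[OF \<delta>(1) \<gamma>'(1)] by (intro CollectI exI[of _ ?c] conjI)
 qed
qed

text \<open>Both log K and the weight of any metric of the canonical bundle change by -log |J|^2
  under a group element, so their difference descends to the quotient. This is what allows an
  arbitrary metric instead of the one given by the kernel.\<close>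

lemma weight_invariant:
 assumes h: "smooth_hermitian_metric \<Omega> \<Gamma> h" and \<gamma>: "\<gamma> \<in> \<Gamma>" and z: "z \<in> \<Omega>"
 shows "logK (\<gamma> z) - metric_weight \<Gamma> h (\<gamma> z) = logK z - metric_weight \<Gamma> h z"
proof -
 let ?J = "complex_jacobian \<gamma> z"
 interpret b: biholo \<Omega> \<gamma> "inv_into \<Omega> \<gamma>" by (rule \<Gamma>_biholo[OF \<gamma>])
 have J: "det (cjac \<gamma> z) = ?J" by (rule complex_jacobian_eq[OF b.g z, symmetric])
 have p: "0 < h (canonical_pt \<Gamma> z 1)" using h z unfolding smooth_hermitian_metric_def by blast
 have "h (canonical_pt \<Gamma> (\<gamma> z) 1) = cmod ?J * h (canonical_pt \<Gamma> z 1)"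
  unfolding canonical_pt_\<Gamma>(1)[OF \<gamma> z] using h z unfolding smooth_hermitian_metric_def by blast
 then have "metric_weight \<Gamma> h (\<gamma> z) = metric_weight \<Gamma> h z - ln ((cmod ?J)\<^sup>2)"
  unfolding metric_weight_def using p canonical_pt_\<Gamma>(2)[OF \<gamma> z]
  by (simp add: power_mult_distrib ln_mult_pos)
 moreover have "logK z = ln ((cmod ?J)\<^sup>2) + logK (\<gamma> z)" using b.logK_transform[OF z] by (simp add: J)
 ultimately show ?thesis by simp
qed

end

section \<open>A function with a logarithmic pole on the quotient\<close>

locale seshadri_construction = orbit_potential \<Omega> \<Gamma> x for \<Omega> :: "(complex^'n) set" and \<Gamma> and x +
 fixes h :: "((complex^'n) \<times> complex) set => real" and R :: real
 assumes metric: "smooth_hermitian_metric \<Omega> \<Gamma> h" and R: "0 < R" "R < half_displacement \<Omega> \<Gamma> x"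
begin

sublocale cp: cut_potential \<Omega> logK dd R \<rho> by (rule cut_potential_dd[OF R])

abbreviation "w \<equiv> metric_weight \<Gamma> h"
abbreviation "t \<equiv> R\<^sup>2 / 2"

lemma t: "t > 0" using R by simp

text \<open>Subtracting the weight makes the function invariant, and the curvature form adds the
  weight back: the current in question is that of the cut-off plus log K.\<close>

definition \<Phi> :: "complex^'n => ereal" where "\<Phi> z = cutpole t (dd z / R) + ereal (logK z - w z)"

text \<open>The chosen point of the orbit is immaterial by invariance.\<close>

definition \<phi> :: "(complex^'n) set => ereal" where "\<phi> q = \<Phi> (SOME z. z \<in> q)"

lemma w_Ck: "Ck_on k \<Omega> w" using metric unfolding smooth_hermitian_metric_def smooth_on_def by blast

lemma w_continuous: "continuous_on \<Omega> w" by (rule C2_continuous[OF open_dom w_Ck])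

lemma logK_continuous: "continuous_on \<Omega> logK" by (rule C2_continuous[OF open_dom logK_C2])

lemma \<Phi>_off: "z \<in> \<Omega> ==> z \<notin> \<pi> x ==> \<Phi> z = ereal (t * cp.cl z + logK z - w z)"
 using dd_pos[of z] R by (simp add: \<Phi>_def cutpole_def cp.cl_def divide_le_0_iff)

lemma cutpole_dd_continuous: "continuous_on \<Omega> (%z. cutpole t (dd z / R))"
 by (rule continuous_on_compose2[OF cutpole_continuous[OF t]])
   (use R dd_nonneg in \<open>auto intro!: continuous_intros dd_continuous\<close>)

lemma \<Phi>_continuous: "continuous_on \<Omega> \<Phi>"
 unfolding \<Phi>_def
 by (intro continuous_on_add_ereal_real cutpole_dd_continuous continuous_intros logK_continuous w_continuous)

lemma \<phi>_\<pi>: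
 assumes z: "z \<in> \<Omega>" shows "\<phi> (\<pi> z) = \<Phi> z"
proof -
 have "(SOME y. y \<in> \<pi> z) \<in> \<pi> z" by (rule someI[of _ z]) (rule \<pi>_self[OF z])
 then obtain \<gamma> where \<gamma>: "\<gamma> \<in> \<Gamma>" "(SOME y. y \<in> \<pi> z) = \<gamma> z" by (rule \<pi>_E)
 show ?thesis
  unfolding \<phi>_def \<gamma>(2) \<Phi>_def dd_invariant[OF \<gamma>(1) z] weight_invariant[OF metric \<gamma>(1) z] ..
qed

lemma \<phi>_continuous: "continuous_map (quot_topology \<Omega> \<Gamma>) euclidean \<phi>"
proof (rule continuous_compose_quotient_map[OF quotient_map_covering_proj])
 show "continuous_map (top_of_set \<Omega>) euclidean (\<phi> \<circ> \<pi>)"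
  by (rule continuous_map_eq[of _ _ \<Phi>]) (use \<Phi>_continuous in \<open>auto simp: \<phi>_\<pi>\<close>)
qed

lemma \<phi>_finite: "q \<in> quotient_space \<Omega> \<Gamma> - {\<pi> x} ==> \<bar>\<phi> q\<bar> \<noteq> \<infinity>"
proof -
 assume "q \<in> quotient_space \<Omega> \<Gamma> - {\<pi> x}"
 then obtain z where z: "z \<in> \<Omega>" "q = \<pi> z" "\<pi> z \<noteq> \<pi> x" by (auto simp: quotient_space_eq)
 then have "z \<notin> \<pi> x" using \<pi>_cong[OF x] by blast
 then show ?thesis using z by (simp add: \<phi>_\<pi> \<Phi>_off)
qed

lemma \<phi>_current: "i_ddbar_plus_form_nonneg \<Omega> (%z. \<phi> (\<pi> z)) (i_curvature \<Gamma> h)"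
 unfolding i_ddbar_plus_form_nonneg_def
proof (intro allI impI)
 fix \<eta> v assume t\<eta>: "test_fun \<Omega> \<eta>" and \<eta>0: "\<forall>z. 0 <= \<eta> z"
 have \<eta>2: "Ck_on 2 UNIV \<eta>" using t\<eta> unfolding test_fun_def smooth_on_def by blast
 obtain C where C: "compact C" "C \<subseteq> \<Omega>" "!!z. z \<notin> C ==> \<eta> z = 0" using t\<eta> unfolding test_fun_def by blast
 have ie: "i_ddbar \<eta> z v (cmi v) = lapl \<eta> v z / 2" for z
  unfolding lapl_def by (rule i_ddbar_eq_d2[OF open_UNIV \<eta>2]) simp
 have iw: "i_curvature \<Gamma> h z v (cmi v) = lapl w v z / 2" if "z \<in> \<Omega>" for z
  unfolding lapl_def i_curvature_def by (rule i_ddbar_eq_d2[OF open_dom w_Ck that])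
 have "(LINT z:\<Omega>|lborel. real_of_ereal (\<phi> (\<pi> z)) * i_ddbar \<eta> z v (cmi v)) = (LINT z:\<Omega>|lborel. (t * cp.cl z + logK z - w z) * (lapl \<eta> v z / 2))"
  unfolding set_lebesgue_integral_def
 \<comment> \<open>On the orbit the real value assigned to -infinity and the default value of
   \<open>cutlog\<close> may differ, but the orbit is countable.\<close>
 proof (rule integral_discrete_difference[OF orbit_countable])
  fix z assume "z \<notin> {z \<in> \<Omega>. dd z = 0}"
  then show "indicator \<Omega> z *\<^sub>R (real_of_ereal (\<phi> (\<pi> z)) * i_ddbar \<eta> z v (cmi v)) = indicator \<Omega> z *\<^sub>R ((t * cp.cl z + logK z - w z) * (lapl \<eta> v z / 2))"
   by (cases "z \<in> \<Omega>") (auto simp: \<phi>_\<pi> \<Phi>_off dd_eq_0 ie)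
 qed auto
 moreover have "(LINT z:\<Omega>|lborel. \<eta> z * i_curvature \<Gamma> h z v (cmi v)) = (LINT z:\<Omega>|lborel. \<eta> z * (lapl w v z / 2))"
  by (rule set_lebesgue_integral_cong) (use open_dom iw in auto)
 ultimately show "0 <= (LINT z:\<Omega>|lborel. real_of_ereal (\<phi> (\<pi> z)) * i_ddbar \<eta> z v (cmi v)) + (LINT z:\<Omega>|lborel. \<eta> z * i_curvature \<Gamma> h z v (cmi v))"
  using cp.current_inequality[OF \<eta>2 _ C(3) w_Ck C(1,2), of v] \<eta>0 by simp
qed

text \<open>Near an orbit point the Bergman and Euclidean distances are comparable in both
  directions, so the function differs from t log |z - a|^2 by a bounded amount. The quotient then
  even has a limit.\<close>

lemma \<phi>_Liminf:
 assumes a: "a \<in> \<pi> x"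
 shows "Liminf (at a) (%z. \<phi> (\<pi> z) / ereal (ln ((norm (z - a))\<^sup>2))) = ereal t"
proof -
 have aO: "a \<in> \<Omega>" by (rule orbit_in[OF a])
 obtain c r0 where cr: "c > 0" "r0 > 0" "!!y. y \<in> \<Omega> ==> c * min r0 (norm (y - a)) <= bd a y" using bd_local_lower[OF aO] by metis
 obtain M r where M: "M > 0" "r > 0" "cball a r \<subseteq> \<Omega>" "!!u w. u \<in> cball a r ==> w \<in> cball a r ==> \<bar>bd a u - bd a w\<bar> <= M * norm (u - w)"
  using locally_Lipschitz[OF bd_triangle[OF aO] aO] by blast
 have "bounded ((%z. logK z - w z) ` cball a r)"
  by (intro compact_imp_bounded compact_continuous_image compact_cball continuous_intros
    continuous_on_subset[OF logK_continuous M(3)] continuous_on_subset[OF w_continuous M(3)])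
 then obtain G where "\<forall>z\<in>cball a r. \<bar>logK z - w z\<bar> <= G" by (auto simp: bounded_iff)
 then have G: "\<bar>logK z - w z\<bar> <= G" if "z \<in> cball a r" for z using that by blast
 \<comment> \<open>Small enough for the Lipschitz bound, for the lower bound of the distance, for
   the distance to stay below R, and for the logarithm to be negative.\<close>
 define s where "s = min (min r r0) (min (R / (2 * M)) (1/2))"
 have s: "s > 0" "s <= r" "s <= r0" "M * s < R" "s < 1"
 proof -
  show "s > 0" "s <= r" "s <= r0" "s < 1" using M cr R by (auto simp: s_def)
  have "M * s <= M * (R / (2 * M))" using M by (intro mult_left_mono) (auto simp: s_def)
  then show "M * s < R" using M R by simp
 qed
 \<comment> \<open>Collects the comparison constants of the two distances, the bounded part 1 -
   (d/R)^2 of the cut-off, and the bound for log K minus the weight.\<close>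
 define Bd where "Bd = t * (2 * (\<bar>ln (c / R)\<bar> + \<bar>ln (M / R)\<bar>) + 1) + \<bar>G\<bar>"
 define q where "q z = t * cp.cl z + logK z - w z" for z
 define lg where "lg z = ln ((norm (z - a))\<^sup>2)" for z
 have near: "z \<in> \<Omega> \<and> z \<notin> \<pi> x \<and> lg z < 0 \<and> \<bar>q z - t * lg z\<bar> <= Bd" if z: "z \<in> ball a s" "z \<noteq> a" for z
 proof -
  define n where "n = norm (z - a)"
  have n: "0 < n" "n < s" using z by (auto simp: n_def dist_norm norm_minus_commute)
  have zb: "z \<in> cball a r" using z s by auto
  then have zO: "z \<in> \<Omega>" using M(3) by blast
  have up: "bd a z <= M * n" using M(4)[OF zb, of a] M(2) bd_self[OF aO] by (simp add: n_def)
  also have "M * n <= M * s" using M n by simp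
  finally have small: "bd a z < R" using s by simp
  then have dz: "dd z = bd a z" using dd_near[OF zO a] R by simp
  have lo: "c * n <= dd z" using cr(3)[OF zO] n s by (simp add: n_def dz)
  have d0: "0 < dd z" using lo cr n by (smt (verit) mult_pos_pos)
  have zx: "z \<notin> \<pi> x" using d0 dd_eq_0[OF zO] by simp
  have cl: "cp.cl z = 2 * ln (dd z / R) + 1 - (dd z / R)\<^sup>2" using small dz R by (simp add: cp.cl_def cutlog_def)
  have sq: "0 <= 1 - (dd z / R)\<^sup>2" "1 - (dd z / R)\<^sup>2 <= 1"
   using d0 small dz R by (auto simp: power_le_one)
  have "ln (c / R * n) <= ln (dd z / R)" using lo cr R n d0 by (simp add: divide_right_mono)
  moreover have "ln (c / R * n) = ln (c / R) + ln n" by (rule ln_mult_pos) (use cr R n in auto)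
  ultimately have l1: "ln (c / R) + ln n <= ln (dd z / R)" by linarith
  have "ln (dd z / R) <= ln (M / R * n)" using up dz M R n d0 by (simp add: divide_right_mono)
  moreover have "ln (M / R * n) = ln (M / R) + ln n" by (rule ln_mult_pos) (use M R n in auto)
  ultimately have l2: "ln (dd z / R) <= ln (M / R) + ln n" by linarith
  have lg: "lg z = 2 * ln n" using n by (simp add: lg_def n_def ln_realpow)
  have aux: "\<bar>2 * l + 1 - y - 2 * k\<bar> <= 2 * (\<bar>p\<bar> + \<bar>m\<bar>) + 1"
   if "0 <= 1 - y" "1 - y <= 1" "p + k <= l" "l <= m + k" for l y k p m :: real
   using that by (smt (verit))
  have "\<bar>cp.cl z - lg z\<bar> <= 2 * (\<bar>ln (c / R)\<bar> + \<bar>ln (M / R)\<bar>) + 1"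
   unfolding cl lg by (rule aux[OF sq l1 l2])
  then have "t * \<bar>cp.cl z - lg z\<bar> <= t * (2 * (\<bar>ln (c / R)\<bar> + \<bar>ln (M / R)\<bar>) + 1)"
   using t by (intro mult_left_mono) auto
  moreover have "\<bar>t * cp.cl z - t * lg z\<bar> = t * \<bar>cp.cl z - lg z\<bar>" unfolding right_diff_distrib[symmetric] abs_mult using t by simp
  ultimately have "\<bar>q z - t * lg z\<bar> <= Bd" unfolding q_def Bd_def using G[OF zb] by linarith
  moreover have "lg z < 0" unfolding lg using n s by simp
  ultimately show ?thesis using zO zx by simp
 qed
 have ev: "eventually (%z. z \<in> ball a s \<and> z \<noteq> a) (at a)"
  using eventually_at_ball'[OF s(1), of a UNIV] by simp
 have "filterlim (%z. (norm (z - a))\<^sup>2) (at_right 0) (at a)"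
  unfolding filterlim_at
 proof
  have "((%z. (norm (z - a))\<^sup>2) \<longlongrightarrow> (norm (a - a))\<^sup>2) (at a)" by (intro tendsto_intros)
  then show "((%z. (norm (z - a))\<^sup>2) \<longlongrightarrow> 0) (at a)" by simp
  show "eventually (%z. (norm (z - a))\<^sup>2 \<in> {0<..} \<and> (norm (z - a))\<^sup>2 \<noteq> 0) (at a)"
   using ev by eventually_elim simp
 qed
 from filterlim_compose[OF ln_at_0 this] have "filterlim lg at_bot (at a)" unfolding lg_def .
 then have "filterlim lg at_infinity (at a)" by (rule filterlim_at_bot_imp_at_infinity)
 then have "((%z. Bd / lg z) \<longlongrightarrow> 0) (at a)" by (rule tendsto_divide_0[OF tendsto_const])
 then have b0: "((%z. \<bar>Bd / lg z\<bar>) \<longlongrightarrow> 0) (at a)" by (rule tendsto_rabs_zero)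
 have "((%z. q z / lg z - t) \<longlongrightarrow> 0) (at a)"
 proof (rule Lim_null_comparison[OF _ b0])
  show "eventually (%z. norm (q z / lg z - t) <= \<bar>Bd / lg z\<bar>) (at a)"
   using ev
  proof eventually_elim
   case (elim z)
   then have z: "lg z < 0" "\<bar>q z - t * lg z\<bar> <= Bd" using near by blast+
   have "q z / lg z - t = (q z - t * lg z) / lg z" using z(1) by (simp add: diff_divide_distrib)
   then have "\<bar>q z / lg z - t\<bar> = \<bar>q z - t * lg z\<bar> / \<bar>lg z\<bar>" by (simp add: abs_divide)
   also have "... <= \<bar>Bd\<bar> / \<bar>lg z\<bar>" using z(2) by (intro divide_right_mono) auto
   finally show ?case by (simp add: abs_divide)
  qed
 qed
 then have "((%z. q z / lg z) \<longlongrightarrow> t) (at a)" by (rule LIM_zero_cancel)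
 then have l: "((%z. ereal (q z / lg z)) \<longlongrightarrow> ereal t) (at a)" by (rule tendsto_ereal)
 have ev2: "eventually (%z. ereal (q z / lg z) = \<phi> (\<pi> z) / ereal (ln ((norm (z - a))\<^sup>2))) (at a)"
  using ev
 proof eventually_elim
  case (elim z)
  then have z: "z \<in> \<Omega>" "z \<notin> \<pi> x" "lg z < 0" using near by blast+
  then show ?case by (simp add: \<phi>_\<pi> \<Phi>_off q_def flip: lg_def)
 qed
 show ?thesis
  by (rule lim_imp_Liminf[OF trivial_limit_at]) (use l tendsto_cong[OF ev2] in blast)
qed

text \<open>\<open>psh_on\<close> tests all discs that fit into \<open>V\<close>, not just small
  ones. So the cut-off estimate is used with its uniform error, the squared increments are bounded
  directly by the Lipschitz constant, and every loss is a multiple of |b|^2, which a multiple of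
  |z|^2 compensates.\<close>

lemma \<Phi>_quasi_psh: "quasi_psh_on \<Omega> (%z. \<phi> (\<pi> z))"
 unfolding quasi_psh_on_def
proof
 fix a0 assume a0: "a0 \<in> \<Omega>"
 obtain M r where M: "M > 0" "r > 0" "cball a0 r \<subseteq> \<Omega>" "!!u w. u \<in> cball a0 r ==> w \<in> cball a0 r ==> \<bar>dd u - dd w\<bar> <= M * norm (u - w)"
  using locally_Lipschitz[OF dd_triangle a0] by blast
 obtain B where B: "B \<ge> 0" "!!z u. z \<in> cball a0 r ==> \<bar>d2 logK z u u\<bar> <= B * (norm u)\<^sup>2"
  using C2_d2_bound[OF open_dom logK_C2 compact_cball M(3)] by blast
 \<comment> \<open>A disc in \<open>V\<close> has |b| < 2s. The second bound then yields \<kappa> <=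
   1/2, and the third keeps \<open>dd\<close> below \<rho> on all of \<open>V\<close> as soon as it
   is below R at the centre of the disc.\<close>
 define s where "s = min r (min (R / (4 * M)) ((\<rho> - R) / (2 * M)))"
 have s: "s > 0" "s <= r" "4 * (M * s) <= R" "2 * (M * s) <= \<rho> - R"
 proof -
  show "s > 0" "s <= r" using M R by (auto simp: s_def)
  have "s <= R / (4 * M)" "s <= (\<rho> - R) / (2 * M)" by (auto simp: s_def)
  then show "4 * (M * s) <= R" "2 * (M * s) <= \<rho> - R" using M by (auto simp: field_simps)
 qed
 define V where "V = ball a0 s"
 have Vr: "V \<subseteq> cball a0 r" using s by (auto simp: V_def)
 have V\<Omega>: "V \<subseteq> \<Omega>" using Vr M by blast
 \<comment> \<open>the quadratic term absorbs the defects of \<open>cutlog\<close> and of \<open>logK\<close> on circles\<close>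
 define K where "K = (7 * M\<^sup>2 + B) / 2"
 define v where "v z = cutpole t (dd z / R) + ereal (logK z + K * (z \<bullet> z))" for z
 define f where "f z = (0 - w z) - K * (z \<bullet> z)" for z
 have "smooth_on V f"
  unfolding smooth_on_def f_def
  by (intro allI Ck_on_diff Ck_on_const Ck_on_square Ck_on_subset[OF w_Ck V\<Omega>]) (simp_all add: V_def)
 moreover have "\<forall>z\<in>V. \<phi> (\<pi> z) = v z + ereal (f z)"
  using V\<Omega> by (auto simp: \<phi>_\<pi> \<Phi>_def v_def f_def add.assoc)
 moreover have "psh_on V v"
  unfolding psh_on_def
 proof (intro conjI ballI allI impI)
  show "v z \<noteq> \<infinity>" for z by (simp add: v_def cutpole_def)
  have "continuous_on V v"
   unfolding v_def
   by (intro continuous_on_add_ereal_real continuous_on_subset[OF cutpole_dd_continuous V\<Omega>] continuous_intros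
     continuous_on_subset[OF logK_continuous V\<Omega>])
  from continuous_openin_preimage_gen[OF this open_lessThan]
  show "openin (top_of_set V) {z \<in> V. v z < c}" for c
   by (simp add: vimage_def Int_def)
 next
  fix a b assume a: "a \<in> V" and disk: "\<forall>\<zeta>. cmod \<zeta> <= 1 \<longrightarrow> a + \<zeta> *s b \<in> V"
  show "v a <= circle_mean (%\<theta>. v (a + cis \<theta> *s b))"
  proof (cases "a \<in> \<pi> x")
   case True
   then have "dd a = 0" using dd_eq_0 a V\<Omega> by blast
   then show ?thesis by (simp add: v_def cutpole_def)
  next
   case False
   have aO: "a \<in> \<Omega>" using a V\<Omega> by blast
   have da: "0 < dd a" by (rule dd_pos[OF aO False])
   have circ: "a + cis \<theta> *s b \<in> V" for \<theta> using disk by simp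
   have dlip: "\<bar>dd u - dd u'\<bar> <= M * norm (u - u')" if "u \<in> V" "u' \<in> V" for u u'
    by (rule M(4)) (use that Vr in auto)
   have nb: "norm b < 2 * s"
   proof -
    have "a + 1 *s b \<in> V" using disk by (metis norm_one order_refl)
    then have "dist a0 (a + b) < s" "dist a0 a < s" using a by (auto simp: V_def)
    then have "dist a (a + b) < s + s" using dist_triangle[of a "a + b" a0] by (simp add: dist_commute)
    then show ?thesis by (simp add: dist_norm)
   qed
   define \<kappa> where "\<kappa> = M * norm b / R"
   define g where "g \<theta> = dd (a + cis \<theta> *s b) / R" for \<theta>
   define a' where "a' = dd a / R"
   have "M * norm b <= M * (2 * s)" using M nb by simp
   then have "M * norm b <= R / 2" using s by linarith
   then have \<kappa>: "0 <= \<kappa>" "\<kappa> <= 1/2" using M R by (auto simp: \<kappa>_def field_simps)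
   have a': "0 < a'" using da R by (simp add: a'_def)
   have cg: "continuous_on UNIV g"
    unfolding g_def using R circ V\<Omega>
    by (intro continuous_intros continuous_on_compose2[OF dd_continuous]) auto
   have g0: "0 <= g \<theta>" for \<theta> unfolding g_def using dd_nonneg circ V\<Omega> R by (simp add: subset_iff)
   have gk: "\<bar>g \<theta> - a'\<bar> <= \<kappa>" for \<theta>
   proof -
    have "\<bar>dd (a + cis \<theta> *s b) - dd a\<bar> <= M * norm b" using dlip[OF circ[of \<theta>] a] by simp
    then have "\<bar>dd (a + cis \<theta> *s b) - dd a\<bar> / R <= \<kappa>" unfolding \<kappa>_def using R by (intro divide_right_mono) auto
    then show ?thesis using R by (simp add: g_def a'_def diff_divide_distrib[symmetric])
   qed
   have logs: "cintegrable (%\<theta>. ln (dd (a + cis \<theta> *s b)))"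
     "2 * pi * ln (dd a) <= cint (%\<theta>. ln (dd (a + cis \<theta> *s b)))"
     "AE \<theta> in lborel. \<theta> \<in> {0..2*pi} \<longrightarrow> 0 < dd (a + cis \<theta> *s b)" if "a' < 1"
   proof -
    have dR: "dd a < R" using that R by (simp add: a'_def)
    have "dd u < \<rho>" if u: "u \<in> V" for u
    proof -
     have "\<bar>dd u - dd a\<bar> <= M * norm (u - a)" by (rule dlip[OF u a])
     also have "norm (u - a) <= 2 * s"
      using u a dist_triangle[of u a a0] by (simp add: V_def dist_norm norm_minus_commute)
     finally have "\<bar>dd u - dd a\<bar> <= M * (2 * s)" using M by simp
     then show ?thesis using dR s(4) by linarith
    qed
    then have "a + \<zeta> *s b \<in> \<Omega> \<and> dd (a + \<zeta> *s b) < \<rho>" if "cmod \<zeta> <= 1" for \<zeta> using disk V\<Omega> that by blast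
    from log_dd_circle_mean[OF da this] show
     "cintegrable (%\<theta>. ln (dd (a + cis \<theta> *s b)))"
     "2 * pi * ln (dd a) <= cint (%\<theta>. ln (dd (a + cis \<theta> *s b)))"
     "AE \<theta> in lborel. \<theta> \<in> {0..2*pi} \<longrightarrow> 0 < dd (a + cis \<theta> *s b)" by blast+
   qed
   have ae: "AE \<theta> in lborel. \<theta> \<in> {0..2*pi} \<longrightarrow> 0 < g \<theta>"
   proof (cases "a' < 1")
    case True
    show ?thesis using logs(3)[OF True] by eventually_elim (use R in \<open>auto simp: g_def\<close>)
   next
    case False
    have "0 < g \<theta>" for \<theta> using gk[of \<theta>] \<kappa> False by linarith
    then show ?thesis by simp
   qed
   have lng: "cintegrable (%\<theta>. ln (g \<theta>)) \<and> 2 * pi * ln a' <= cint (%\<theta>. ln (g \<theta>))" if lt: "a' < 1"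
    unfolding g_def a'_def
    by (rule ln_quotient_circle_mean[OF _ R(1) da logs[OF lt]], rule continuous_on_compose2[OF dd_continuous])
      (use circ V\<Omega> in \<open>auto intro!: continuous_intros\<close>)
   have si: "cintegrable k" if "continuous_on {0..2*pi} k" for k :: "real => real"
    unfolding set_integrable_def by (rule borel_integrable_compact[OF _ that]) simp
   note cm = cutlog_circle_mean[OF a' \<kappa> cg g0 gk lng]
   have "cint (%\<theta>. (g \<theta> - a')\<^sup>2) <= cint (%\<theta>. \<kappa>\<^sup>2)"
    unfolding cint_def
   proof (rule set_integral_mono)
    show "(g \<theta> - a')\<^sup>2 <= \<kappa>\<^sup>2" for \<theta> using gk[of \<theta>] \<kappa> by (simp add: abs_le_square_iff[symmetric])
   qed (auto intro!: si continuous_intros continuous_on_subset[OF cg])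
   also have "cint (%\<theta>. \<kappa>\<^sup>2) = 2 * pi * \<kappa>\<^sup>2" using cint_trig[of "\<kappa>\<^sup>2" 0 0] by simp
   finally have k1: "cint (%\<theta>. (g \<theta> - a')\<^sup>2) <= 2 * pi * \<kappa>\<^sup>2" .
   have k2: "pi * cuterr a' \<kappa> <= pi * (5 * \<kappa>\<^sup>2)" using cuterr_bounds(2)[OF a' \<kappa>(1)] by simp
   \<comment> \<open>Of the 14, the squared increments account for 4 and the uniform bound of the
     cut-off error for 10.\<close>
   have "2 * pi * cutlog a' - 14 * (pi * \<kappa>\<^sup>2) <= cint (%\<theta>. cutlog (g \<theta>))" using cm(2) k1 k2 by linarith
   then have "t * (2 * pi * cutlog a' - 14 * (pi * \<kappa>\<^sup>2)) <= t * cint (%\<theta>. cutlog (g \<theta>))" using t by (intro mult_left_mono) auto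
   moreover have "t * (2 * pi * cutlog a' - 14 * (pi * \<kappa>\<^sup>2)) = 2 * pi * (t * cutlog a') - 7 * pi * M\<^sup>2 * (norm b)\<^sup>2"
    using R by (simp add: \<kappa>_def field_simps power_mult_distrib)
   ultimately have c1: "2 * pi * (t * cutlog a') - 7 * pi * M\<^sup>2 * (norm b)\<^sup>2 <= t * cint (%\<theta>. cutlog (g \<theta>))" by simp
   have c2: "2 * pi * logK a - pi * (B * (norm b)\<^sup>2) <= cint (%\<theta>. logK (a + cis \<theta> *s b))"
   proof (rule C2_circle_lower[OF open_dom logK_C2])
    show "a + \<zeta> *s b \<in> \<Omega>" if "cmod \<zeta> <= 1" for \<zeta> using disk V\<Omega> that by blast
    show "\<bar>d2 logK (a + \<zeta> *s b) (c *s b) (c *s b)\<bar> <= B * (norm b)\<^sup>2" if "cmod \<zeta> <= 1" "cmod c = 1" for \<zeta> c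
     using B(2)[of "a + \<zeta> *s b" "c *s b"] disk Vr that by auto
   qed
   let ?F = "%\<theta>. t * cutlog (g \<theta>) + (logK (a + cis \<theta> *s b) + K * (norm (a + cis \<theta> *s b))\<^sup>2)"
   have i1: "cintegrable (%\<theta>. t * cutlog (g \<theta>))" using cm(1) by simp
   have i2: "cintegrable (%\<theta>. logK (a + cis \<theta> *s b))"
    by (rule si, rule continuous_on_compose2[OF logK_continuous]) (use circ V\<Omega> in \<open>auto intro!: continuous_intros\<close>)
   have i3: "cintegrable (%\<theta>. K * (norm (a + cis \<theta> *s b))\<^sup>2)" by (intro si continuous_intros)
   have iF: "cintegrable ?F" by (intro set_integral_add(1) i1 i2 i3)
   have "cint ?F = cint (%\<theta>. t * cutlog (g \<theta>)) + (cint (%\<theta>. logK (a + cis \<theta> *s b)) + cint (%\<theta>. K * (norm (a + cis \<theta> *s b))\<^sup>2))"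
    unfolding cint_def using set_integral_add(2)[OF i1 set_integral_add(1)[OF i2 i3]] set_integral_add(2)[OF i2 i3] by simp
   also have "cint (%\<theta>. t * cutlog (g \<theta>)) = t * cint (%\<theta>. cutlog (g \<theta>))" by (simp add: cint_def)
   also have "cint (%\<theta>. K * (norm (a + cis \<theta> *s b))\<^sup>2) = K * (2 * pi * ((norm a)\<^sup>2 + (norm b)\<^sup>2))"
    unfolding cint_norm_square[symmetric] by (simp add: cint_def)
   finally have "2 * pi * (t * cutlog a' + (logK a + K * (norm a)\<^sup>2)) <= cint ?F"
    using c1 c2 by (simp add: K_def algebra_simps add_divide_distrib)
   then have le: "t * cutlog a' + (logK a + K * (norm a)\<^sup>2) <= cint ?F / (2 * pi)" by (simp add: field_simps)
   have "circle_mean (%\<theta>. v (a + cis \<theta> *s b)) = ereal (cint ?F / (2 * pi))"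
    by (rule circle_mean_eq[OF iF], use ae in eventually_elim)
      (auto simp: v_def cutpole_def g_def[symmetric] power2_norm_eq_inner[symmetric])
   moreover have "v a = ereal (t * cutlog a' + (logK a + K * (norm a)\<^sup>2))"
    using a' by (simp add: v_def cutpole_def a'_def[symmetric] power2_norm_eq_inner[symmetric])
   ultimately show ?thesis using le by simp
  qed
 qed
 moreover have "open V" "a0 \<in> V" using s by (auto simp: V_def)
 ultimately show "\<exists>V v f. open V \<and> a0 \<in> V \<and> V \<subseteq> \<Omega> \<and> psh_on V v \<and> smooth_on V f \<and> (\<forall>z\<in>V. \<phi> (\<pi> z) = v z + ereal (f z))"
  using V\<Omega> by blast
qed

lemma \<phi>_seshadri: "\<phi> \<in> seshadri_functions \<Omega> \<Gamma> h t (\<pi> x)"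
 unfolding seshadri_functions_def mem_Collect_eq
 by (intro conjI ballI \<Phi>_quasi_psh \<phi>_finite continuous_map_from_subtopology[OF \<phi>_continuous] \<phi>_Liminf \<phi>_current)

lemma seshadri_number_ge: "ereal t <= seshadri_number \<Omega> \<Gamma> h (\<pi> x)"
 unfolding seshadri_number_def by (rule SUP_upper) (use \<phi>_seshadri t in blast)

end

theorem proposition2p6:
  fixes \<Omega> :: "(complex^'n) set"
    and \<Gamma> :: "(complex^'n \<Rightarrow> complex^'n) set"
    and h :: "((complex^'n) \<times> complex) set \<Rightarrow> real"
  assumes "open \<Omega>" and "connected \<Omega>" and "\<Omega> \<noteq> {}" and "bounded \<Omega>"
    and "subgroup \<Gamma> (Iso \<Omega>)"
    and "discontinuous \<Omega> \<Gamma>"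
    and "fixed_point_free \<Omega> \<Gamma>"
    and "compact_space (quot_topology \<Omega> \<Gamma>)"
    and "smooth_hermitian_metric \<Omega> \<Gamma> h"
    and "\<And>x. x \<in> \<Omega> \<Longrightarrow> psh_on \<Omega> (\<lambda>z. log0 (bergman_dist \<Omega> x z))"
  shows "\<forall>x\<in>\<Omega>. seshadri_number \<Omega> \<Gamma> h (covering_proj \<Omega> \<Gamma> x)
                  \<ge> ereal ((half_displacement \<Omega> \<Gamma> x)\<^sup>2 / 2)"
proof
 fix x assume x: "x \<in> \<Omega>"
 interpret discontinuous_group \<Omega> \<Gamma>
  by (intro discontinuous_group.intro bergman_domain.intro domain.intro bergman_domain_axioms.intro
    discontinuous_group_axioms.intro assms)
 let ?\<rho> = "half_displacement \<Omega> \<Gamma> x"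
 have pos: "0 < ?\<rho>" by (rule half_displacement_pos[OF x group_nontrivial[OF assms(8,3)]])
 have le: "ereal (R\<^sup>2 / 2) <= seshadri_number \<Omega> \<Gamma> h (\<pi> x)" if "0 < R" "R < ?\<rho>" for R
 proof -
  interpret seshadri_construction \<Omega> \<Gamma> x h R by unfold_locales (use x pos assms(9,10) that in auto)
  show ?thesis by (rule seshadri_number_ge)
 qed
 \<comment> \<open>The construction needs R strictly below the half displacement; the bound with the
   half displacement itself is the limit as R increases to it.\<close>
 have "((%R. ereal (R\<^sup>2 / 2)) \<longlongrightarrow> ereal (?\<rho>\<^sup>2 / 2)) (at_left ?\<rho>)" by (intro tendsto_intros) simp
 moreover have "eventually (%R. ereal (R\<^sup>2 / 2) <= seshadri_number \<Omega> \<Gamma> h (\<pi> x)) (at_left ?\<rho>)"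
  using eventually_at_left_real[OF pos] by eventually_elim (use le in auto)
 ultimately show "seshadri_number \<Omega> \<Gamma> h (\<pi> x) \<ge> ereal (?\<rho>\<^sup>2 / 2)"
  by (rule tendsto_upperbound) simp
qed

end
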